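(* Let $R$ be the Baxter–Belavin elliptic $R$-matrix and $g\in\mathbb{C}$. Let $(x^*,p^* )$ be the point with $x_i^*=\frac in$, $p_i^*=0$, $i=1,\dots,n$. For $r=2,\dots,n$ let $\mathsf H_r^\vee=\mathrm{Res}^\vee(h_r(\lambda,y))=H_r+\hbar\,\mathsf A_r^\vee$, with $H_r$ a scalar quantum elliptic Calogero–Moser (eCM) Hamiltonian and $\mathsf A_r^\vee\in(A_\hbar\otimes\mathrm{End}\,U)*W^\vee$, and for $f\in\mathtt B_g$ let $\mathsf L_f^\vee=\mathrm{Res}^\vee(f(\lambda,y))$. Define $$\mathcal H_r^\vee=\eta_0(\mathsf A_r^\vee)\big|_{(x,p)=(x^*,p^* )}\ \ (r=2,\dots,n),\qquad \mathcal I_f^\vee=\eta_0(\mathsf L_f^\vee)\big|_{(x,p)=(x^*,p^* )}\ \ (f\in\mathtt B_g).$$ Then the elements $\mathcal H_r^\vee$, $r=2,\dots,n$, and $\mathcal I_f^\vee$ with $f\in\mathtt B_g$ form a commutative family of elements of $(\mathbb{C}(V^\vee)\otimes\mathrm{End}\,U)*W^\vee$, where $W^\vee=S_n^\vee$.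
   Context: Everything is over $\mathbb{C}$. $W=S_n$ acts on $V=\mathbb{C}^n$ (coordinates $x_1,\dots,x_n$) by permuting basis vectors, and on meromorphic functions by $(w.f)(v)=f(w^{-1}.v)$. $V^\vee\cong V$ is another copy of $V$ with coordinates $\lambda=(\lambda_1,\dots,\lambda_n)$, and $W^\vee=S_n^\vee=\{w^\vee\}$ a copy of $W$ acting on it. $\mathbb{C}(\cdot)$ denotes meromorphic functions. $U=U_1\otimes\cdots\otimes U_n$, $U_i\cong\mathbb{C}^d$, with $W$ permuting tensor factors; $s_{ij}$ is the transposition of $i,j$. Algebras. $A_\hbar$ is generated over $\mathbb{C}[[\hbar]]$ by meromorphic functions of $x$ and by commuting $\hat p_i=\hbar\,\partial/\partial x_i$ with $[\hat p_i,f]=\hbar\,\partial_if$; $A_0=\mathbb{C}(V)[p_1,\dots,p_n]$ is its commutative classical analogue; throughout, coefficients in the algebras $(A_\hbar\otimes\mathrm{End}\,U)*\cdots$ and $(A_0\otimes\mathrm{End}\,U)*\cdots$ are allowed to depend meromorphically also on $\lambda\in V^\vee$. The classical limit $\eta_0$ sends functions to themselves, $\hat p_i\mapsto p_i$, $\hbar\mapsto0$, and extends to matrix-valued elements and crossed products. There are two commuting group actions: $\widehat W=\{\widehat w\}\cong W$ acts by $\widehat w.(a\otimes b)=(w.a)\otimes(w\,b\,w^{-1})$ for $b\in\mathrm{End}\,U$, where $w.a$ permutes the $x_i$ and the momenta and does not affect $\lambda$; and $W^\vee$ acts by permuting $\lambda$ only, $w^\vee.f(x,\lambda)=f(x,w^{-1}.\lambda)$.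 One forms crossed products with $\widehat W$, with $W^\vee$, or with $\widehat W\times W^\vee$ (in which $\widehat w$ or $w^\vee$ passes through coefficients via its action). The linear map $\mathrm{Res}^\vee$ from the crossed product with $\widehat W\times W^\vee$ to that with $W^\vee$ is $$\mathrm{Res}^\vee:\ \sum_{w_1,w_2}a_{w_1w_2}\,\widehat w_1\otimes w_2^\vee\ \mapsto\ \sum_{w_1,w_2}a_{w_1w_2}\,(w_2w_1^{-1})^\vee .$$ $R$-matrix. For $\mathrm{Im}\,\tau>0$ let $\theta(z|\tau)$ be the odd Jacobi theta function and $\phi(z,\mu|\tau)=\frac{\theta'(0|\tau)\theta(z+\mu|\tau)}{\theta(z|\tau)\theta(\mu|\tau)}$. The Baxter–Belavin $R$-matrix is $R(z,\mu)=\sum R_{\alpha\beta,\gamma\delta}(z,\mu)\,e_{\alpha\beta}\otimes e_{\gamma\delta}\in\mathrm{End}(\mathbb{C}^d\otimes\mathbb{C}^d)$, the sum over $\alpha,\beta,\gamma,\delta\in\{1,\dots,d\}$ with $\alpha+\gamma\equiv\beta+\delta\pmod d$, where $$R_{\alpha\beta,\gamma\delta}(z,\mu)=\exp\Bigl(\tfrac{2\pi \mathrm i}{d}\bigl((\gamma-\beta)(\beta-\alpha)\tau+(\gamma-\beta)\mu+(\beta-\alpha)z\bigr)\Bigr)\,\phi\bigl(z+(\gamma-\beta)\tau,\mu+(\beta-\alpha)\tau\,|\,d\tau\bigr).$$ $R_{ij}(z,\mu)\in\mathrm{End}\,U$ acts as $R(z,\mu)$ on $U_i\otimes U_j$ and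 trivially on the other factors. $\wp$ is the Weierstrass function with periods $1,\tau$. Dunkl operators. $y_i=\hat p_i-g\sum_{j\ne i}R_{ij}(x_i-x_j,\lambda_i-\lambda_j)\,\widehat s_{ij}$. They commute pairwise and with functions of $\lambda$. For $W$-invariant $f(x,p)\in A_0^W$, $f(\lambda,y)$ denotes the result of substituting $x_i\mapsto\lambda_i$, $p_i\mapsto y_i$. eCM Hamiltonians. The classical ones $h_r(x,p)=\sigma_r(p)+\text{l.o.t.}$ ($\sigma_r$ elementary symmetric) are the standard Poisson-commuting integrals of $h_1^2-2h_2=\sum_ip_i^2-2g^2\sum_{i<j}\wp(x_i-x_j)$; explicitly, $h_r$ is the sum, over all choices of a set $M$ of $m\ge0$ pairwise disjoint pairs $\{i,j\}\subset\{1,\dots,n\}$ and a set $K$ of $r-2m$ indices disjoint from these pairs, of $\prod_{\{i,j\}\in M}g^2\wp(x_i-x_j)\prod_{k\in K}p_k$. They admit pairwise commuting quantum lifts $\widetilde H_1,\dots,\widetilde H_n\in A_\hbar^W$ (not depending on $\lambda$), $\eta_0(\widetilde H_r)=h_r$, with $\widetilde H_1=\sum\hat p_i$ and $\widetilde H_1^2-2\widetilde H_2=\sum_i\hat p_i^2-2g(g-\hbar)\sum_{i<j}\wp(x_i-x_j)$; a scalar quantum eCM Hamiltonian is an element of $\mathbb{C}[\widetilde H_1,\dots,\widetilde H_n]$. The decomposition of $\mathsf H_r^\vee$ in the claim exists for each $r$. Spherical Cherednik algebra. $\mathtt B_g\subset A_0^W$ is the classical rational spherical Cherednik algebra of $S_n$: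 in $A_0*W$ (with $W$ permuting $x_i$ and $p_i$) consider the subalgebra $\mathsf C_g$ generated by $W$, $x_1,\dots,x_n$ and the classical rational Dunkl operators $p_i-g\sum_{j\ne i}(x_i-x_j)^{-1}s_{ij}$; with $e_0=\frac1{n!}\sum_{w\in W}w$, $\mathtt B_g$ is the set of $f\in A_0^W$ such that $f e_0\in e_0\mathsf C_ge_0$. For instance, $\sum_ix_ip_i\in\mathtt B_g$. *)

theory Defs
  imports
    "HOL-Analysis.Analysis"
    "HOL-Computational_Algebra.Formal_Power_Series"
    "HOL-Library.Poly_Mapping"
    "HOL-Library.Function_Algebras"
    "HOL-Combinatorics.Perm"
begin

unbundle permutation_syntax

section \<open>Meromorphic functions of several complex variables\<close>

definition holo_on :: "(complex^'k \<Rightarrow> complex) \<Rightarrow> (complex^'k) set \<Rightarrow> bool" where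
  "holo_on f N \<longleftrightarrow> open N \<and>
     (\<forall>u\<in>N. \<exists>D. (f has_derivative D) (at u) \<and> (\<forall>c v. D (c *s v) = c * D v))"

definition nowhere_dense :: "'a::topological_space set \<Rightarrow> bool" where
  "nowhere_dense S \<longleftrightarrow> interior (closure S) = {}"

text \<open>
  A total function represents a meromorphic function if it is locally a quotient of holomorphic
  functions wherever the denominator does not vanish (its values elsewhere are irrelevant).
  Two such functions represent the same meromorphic function if they agree outside a nowhere
  dense set.
\<close>

definition mero :: "(complex^'k \<Rightarrow> complex) \<Rightarrow> bool" where
  "mero f \<longleftrightarrow> (\<forall>u. \<exists>N a b. u \<in> N \<and> holo_on a N \<and> holo_on b N \<and>
     interior {v\<in>N. b v = 0} = {} \<and> (\<forall>v\<in>N. b v \<noteq> 0 \<longrightarrow> f v = a v / b v))"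

definition mer_rel :: "(complex^'k \<Rightarrow> complex) \<Rightarrow> (complex^'k \<Rightarrow> complex) \<Rightarrow> bool" where
  "mer_rel f g \<longleftrightarrow> mero f \<and> mero g \<and> nowhere_dense {u. f u \<noteq> g u}"

lemma nowhere_dense_empty [simp]: "nowhere_dense {}"
  by (simp add: nowhere_dense_def)

lemma nowhere_dense_subset: "nowhere_dense T \<Longrightarrow> S \<subseteq> T \<Longrightarrow> nowhere_dense S"
  unfolding nowhere_dense_def by (metis closure_mono interior_mono subset_empty)

lemma nowhere_dense_Un: "nowhere_dense S \<Longrightarrow> nowhere_dense T \<Longrightarrow> nowhere_dense (S \<union> T)"
  unfolding nowhere_dense_def
  by (metis closed_closure closure_Un interior_closed_Un_empty_interior)

lemma holo_on_subset: "holo_on f N \<Longrightarrow> open M \<Longrightarrow> M \<subseteq> N \<Longrightarrow> holo_on f M"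
  unfolding holo_on_def by blast

lemma holo_on_const: "open N \<Longrightarrow> holo_on (\<lambda>_. c) N"
  unfolding holo_on_def by (auto intro!: exI[of _ "\<lambda>_. 0"])

lemma holo_on_add: "holo_on f N \<Longrightarrow> holo_on g N \<Longrightarrow> holo_on (\<lambda>u. f u + g u) N"
  unfolding holo_on_def
proof (safe, goal_cases)
  case (1 u)
  then obtain D E where "(f has_derivative D) (at u)" "\<forall>c v. D (c *s v) = c * D v"
    "(g has_derivative E) (at u)" "\<forall>c v. E (c *s v) = c * E v"
    by blast
  then show ?case
    by (intro exI[of _ "\<lambda>v. D v + E v"]) (auto intro: has_derivative_add simp: algebra_simps)
qed

lemma holo_on_mult: "holo_on f N \<Longrightarrow> holo_on g N \<Longrightarrow> holo_on (\<lambda>u. f u * g u) N"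
  unfolding holo_on_def
proof (safe, goal_cases)
  case (1 u)
  then obtain D E where "(f has_derivative D) (at u)" "\<forall>c v. D (c *s v) = c * D v"
    "(g has_derivative E) (at u)" "\<forall>c v. E (c *s v) = c * E v"
    by blast
  then show ?case
    by (intro exI[of _ "\<lambda>v. f u * E v + D v * g u"])
      (intro conjI has_derivative_mult, auto simp: algebra_simps)
qed

lemma holo_on_continuous: "holo_on f N \<Longrightarrow> continuous_on N f"
  unfolding holo_on_def
  by (meson continuous_at_imp_continuous_on has_derivative_continuous)

lemma zero_set_mult:
  assumes "holo_on b M" "holo_on b' N" "interior {v\<in>M. b v = 0} = {}" "interior {v\<in>N. b' v = 0} = {}"
  shows "interior {v\<in>M\<inter>N. b v * b' v = 0} = {}"
proof (rule ccontr)
  let ?W = "interior {v\<in>M\<inter>N. b v * b' v = 0}"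
  assume "?W \<noteq> {}"
  have sub: "?W \<subseteq> {v\<in>M\<inter>N. b v * b' v = 0}" by (rule interior_subset)
  have "continuous_on ?W b"
    using holo_on_continuous[OF assms(1)] sub by (elim continuous_on_subset) auto
  then have "open (?W \<inter> b -` (- {0}))"
    by (intro continuous_open_preimage) auto
  moreover have "?W \<inter> b -` (- {0}) = {v\<in>?W. b v \<noteq> 0}" by auto
  ultimately have op: "open {v\<in>?W. b v \<noteq> 0}" by simp
  have "{v\<in>?W. b v \<noteq> 0} \<noteq> {}"
  proof
    assume "{v\<in>?W. b v \<noteq> 0} = {}"
    then have "?W \<subseteq> {v\<in>M. b v = 0}" using sub by auto
    from interior_maximal[OF this open_interior] show False
      using assms(3) \<open>?W \<noteq> {}\<close> by simp
  qed
  moreover have "{v\<in>?W. b v \<noteq> 0} \<subseteq> {v\<in>N. b' v = 0}" using sub by auto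
  from interior_maximal[OF this op] have "{v\<in>?W. b v \<noteq> 0} = {}"
    using assms(4) by simp
  ultimately show False by contradiction
qed

lemma mero_const: "mero (\<lambda>_. c)"
  unfolding mero_def
  by (intro allI exI[of _ UNIV] exI[of _ "\<lambda>_. c"] exI[of _ "\<lambda>_. 1"]) (auto intro: holo_on_const)

lemma mero_arith:
  assumes "mero f" "mero g"
  shows mero_add: "mero (\<lambda>u. f u + g u)" and mero_mult: "mero (\<lambda>u. f u * g u)"
proof -
  have *: "(\<exists>L a b. u \<in> L \<and> holo_on a L \<and> holo_on b L \<and> interior {v\<in>L. b v = 0} = {} \<and>
       (\<forall>v\<in>L. b v \<noteq> 0 \<longrightarrow> f v + g v = a v / b v)) \<and>
     (\<exists>L a b. u \<in> L \<and> holo_on a L \<and> holo_on b L \<and> interior {v\<in>L. b v = 0} = {} \<and>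
       (\<forall>v\<in>L. b v \<noteq> 0 \<longrightarrow> f v * g v = a v / b v))" for u
  proof -
    obtain M a b where f: "u \<in> M" "holo_on a M" "holo_on b M" "interior {v\<in>M. b v = 0} = {}"
      "\<forall>v\<in>M. b v \<noteq> 0 \<longrightarrow> f v = a v / b v"
      using assms(1) unfolding mero_def by meson
    obtain N c d where g: "u \<in> N" "holo_on c N" "holo_on d N" "interior {v\<in>N. d v = 0} = {}"
      "\<forall>v\<in>N. d v \<noteq> 0 \<longrightarrow> g v = c v / d v"
      using assms(2) unfolding mero_def by meson
    have "open (M \<inter> N)" using f(2) g(2) by (auto simp: holo_on_def)
    then have h: "holo_on a (M \<inter> N)" "holo_on b (M \<inter> N)" "holo_on c (M \<inter> N)" "holo_on d (M \<inter> N)"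
      using f(2,3) g(2,3) by (meson holo_on_subset Int_lower1 Int_lower2)+
    note z = zero_set_mult[OF f(3) g(3) f(4) g(4)]
    have "\<forall>v\<in>M \<inter> N. b v * d v \<noteq> 0 \<longrightarrow> f v + g v = (a v * d v + c v * b v) / (b v * d v)"
      "\<forall>v\<in>M \<inter> N. b v * d v \<noteq> 0 \<longrightarrow> f v * g v = (a v * c v) / (b v * d v)"
      using f(5) g(5) by (simp_all add: add_frac_eq)
    moreover have "holo_on (\<lambda>v. a v * d v + c v * b v) (M \<inter> N)" "holo_on (\<lambda>v. b v * d v) (M \<inter> N)"
      "holo_on (\<lambda>v. a v * c v) (M \<inter> N)"
      by (intro holo_on_add holo_on_mult h)+
    moreover have "u \<in> M \<inter> N" using f(1) g(1) by simp
    ultimately show ?thesis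
      using z by meson
  qed
  show "mero (\<lambda>u. f u + g u)"
    unfolding mero_def by (rule allI) (rule *[THEN conjunct1])
  show "mero (\<lambda>u. f u * g u)"
    unfolding mero_def by (rule allI) (rule *[THEN conjunct2])
qed

lemma mero_uminus: "mero f \<Longrightarrow> mero (\<lambda>u. - f u)"
  using mero_mult[OF mero_const[of "-1"]] by simp

lemma part_equivp_mer_rel: "part_equivp mer_rel"
proof (rule part_equivpI)
  show "\<exists>f. mer_rel f f" by (rule exI[of _ "\<lambda>_. 0"]) (simp add: mer_rel_def mero_const)
  show "symp mer_rel"
  proof (rule sympI)
    fix f g assume "mer_rel f g"
    moreover have "{u. g u \<noteq> f u} = {u. f u \<noteq> g u}" by auto
    ultimately show "mer_rel g f" by (simp add: mer_rel_def)
  qed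
  show "transp mer_rel"
  proof (rule transpI)
    fix f g h assume a: "mer_rel f g" "mer_rel g h"
    have "nowhere_dense {u. f u \<noteq> h u}"
      by (rule nowhere_dense_subset[OF nowhere_dense_Un[of "{u. f u \<noteq> g u}" "{u. g u \<noteq> h u}"]])
        (use a in \<open>auto simp: mer_rel_def\<close>)
    then show "mer_rel f h" using a by (simp add: mer_rel_def)
  qed
qed

quotient_type 'k merfun = "complex^('k::finite) \<Rightarrow> complex" / partial: mer_rel
  morphisms rep_mer abs_mer
  by (rule part_equivp_mer_rel)

instantiation merfun :: (finite) comm_ring_1
begin

lift_definition zero_merfun :: "'a merfun" is "\<lambda>_. 0" by (simp add: mer_rel_def mero_const)

lift_definition one_merfun :: "'a merfun" is "\<lambda>_. 1" by (simp add: mer_rel_def mero_const)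

lift_definition plus_merfun :: "'a merfun \<Rightarrow> 'a merfun \<Rightarrow> 'a merfun" is "\<lambda>f g u. f u + g u"
proof -
  fix f f' g g' :: "complex^'a \<Rightarrow> complex"
  assume a: "mer_rel f f'" "mer_rel g g'"
  have "nowhere_dense {u. f u + g u \<noteq> f' u + g' u}"
    by (rule nowhere_dense_subset[OF nowhere_dense_Un[of "{u. f u \<noteq> f' u}" "{u. g u \<noteq> g' u}"]])
      (use a in \<open>auto simp: mer_rel_def\<close>)
  then show "mer_rel (\<lambda>u. f u + g u) (\<lambda>u. f' u + g' u)"
    using a by (simp add: mer_rel_def mero_add)
qed

lift_definition times_merfun :: "'a merfun \<Rightarrow> 'a merfun \<Rightarrow> 'a merfun" is "\<lambda>f g u. f u * g u"
proof -
  fix f f' g g' :: "complex^'a \<Rightarrow> complex"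
  assume a: "mer_rel f f'" "mer_rel g g'"
  have "nowhere_dense {u. f u * g u \<noteq> f' u * g' u}"
    by (rule nowhere_dense_subset[OF nowhere_dense_Un[of "{u. f u \<noteq> f' u}" "{u. g u \<noteq> g' u}"]])
      (use a in \<open>auto simp: mer_rel_def\<close>)
  then show "mer_rel (\<lambda>u. f u * g u) (\<lambda>u. f' u * g' u)"
    using a by (simp add: mer_rel_def mero_mult)
qed

lift_definition uminus_merfun :: "'a merfun \<Rightarrow> 'a merfun" is "\<lambda>f u. - f u"
  by (auto simp: mer_rel_def mero_uminus)

definition minus_merfun :: "'a merfun \<Rightarrow> 'a merfun \<Rightarrow> 'a merfun" where
  "minus_merfun f g = f + - g"

instance
proof
  fix f g h :: "'a merfun"
  show "f + g + h = f + (g + h)" by transfer (simp add: mer_rel_def mero_add add.assoc)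
  show "f + g = g + f" by transfer (simp add: mer_rel_def mero_add add.commute)
  show "0 + f = f" by transfer (simp add: mer_rel_def)
  show "- f + f = 0" by transfer (simp add: mer_rel_def mero_const)
  show "f - g = f + - g" by (rule minus_merfun_def)
  show "f * g * h = f * (g * h)" by transfer (simp add: mer_rel_def mero_mult mult.assoc)
  show "f * g = g * f" by transfer (simp add: mer_rel_def mero_mult mult.commute)
  show "1 * f = f" by transfer (simp add: mer_rel_def)
  show "(f + g) * h = f * h + g * h"
    by transfer (simp add: mer_rel_def mero_add mero_mult distrib_right)
  show "(0::'a merfun) \<noteq> 1" by transfer (simp add: mer_rel_def nowhere_dense_def)
qed

end

definition mconst :: "complex \<Rightarrow> ('k::finite) merfun" where
  "mconst c = abs_mer (\<lambda>_. c)"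

definition pderiv_mer :: "'k \<Rightarrow> 'k merfun \<Rightarrow> ('k::finite) merfun" where
  "pderiv_mer i F = abs_mer (\<lambda>u. deriv (\<lambda>t. rep_mer F (u + t *s axis i 1)) 0)"

text \<open>Substitution of variables $z_k \mapsto z_{\sigma(k)}$, used for injective $\sigma$ only.\<close>

definition reindex :: "('k \<Rightarrow> 'l) \<Rightarrow> ('k::finite) merfun \<Rightarrow> ('l::finite) merfun" where
  "reindex \<sigma> F = abs_mer (\<lambda>u. rep_mer F (\<chi> k. u $ \<sigma> k))"

definition regular_value :: "('k::finite) merfun \<Rightarrow> complex^'k \<Rightarrow> complex \<Rightarrow> bool" where
  "regular_value F u c \<longleftrightarrow> (\<exists>N a. u \<in> N \<and> holo_on a N \<and>
     nowhere_dense {v\<in>N. rep_mer F v \<noteq> a v} \<and> a u = c)"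

text \<open>
  Functions on $V \times V^\vee$ are functions on \<open>complex^('n + 'n)\<close>: the coordinates of $x$ are
  indexed by \<open>Inl i\<close>, those of $\lambda$ by \<open>Inr i\<close>.
\<close>

definition join :: "complex^'n \<Rightarrow> complex^'n \<Rightarrow> complex^('n + 'n)" where
  "join x l = (\<chi> k. case k of Inl i \<Rightarrow> x $ i | Inr i \<Rightarrow> l $ i)"

text \<open>The restriction to $x = x^*$ makes sense iff \<open>regular_along\<close> holds.\<close>

definition regular_along :: "complex^'n \<Rightarrow> ('n::finite + 'n) merfun \<Rightarrow> bool" where
  "regular_along xs F \<longleftrightarrow> nowhere_dense {l. \<nexists>c. regular_value F (join xs l) c}"

definition restrict_x :: "complex^'n \<Rightarrow> ('n::finite + 'n) merfun \<Rightarrow> 'n merfun" where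
  "restrict_x xs F = abs_mer (\<lambda>l. THE c. regular_value F (join xs l) c)"


section \<open>Generated subalgebras, matrices and crossed products\<close>

text \<open>
  In the algebras below, products are passed explicitly; sums are the type class ones.
  A group action on the coefficients of a crossed product is passed as \<open>act\<close>, and
  \<open>a :: 'n perm \<Rightarrow> 'r\<close> stands for the sum of the \<open>a w\<close> times \<open>w\<close>.  For finite \<open>'n\<close>,
  \<open>'n perm\<close> is the full symmetric group.  The class instance for functions also provides
  a pointwise product on \<open>'n perm \<Rightarrow> 'r\<close>, which is never used.
\<close>

inductive_set alg_gen :: "('r::plus \<Rightarrow> 'r \<Rightarrow> 'r) \<Rightarrow> 'r set \<Rightarrow> 'r set"
  for mul :: "'r \<Rightarrow> 'r \<Rightarrow> 'r" and G :: "'r set" where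
  gen: "a \<in> G \<Longrightarrow> a \<in> alg_gen mul G"
| add: "a \<in> alg_gen mul G \<Longrightarrow> b \<in> alg_gen mul G \<Longrightarrow> a + b \<in> alg_gen mul G"
| mul: "a \<in> alg_gen mul G \<Longrightarrow> b \<in> alg_gen mul G \<Longrightarrow> mul a b \<in> alg_gen mul G"

definition cross_mult ::
  "('r \<Rightarrow> 'r \<Rightarrow> 'r) \<Rightarrow> ('n perm \<Rightarrow> 'r \<Rightarrow> 'r) \<Rightarrow> ('n perm \<Rightarrow> 'r) \<Rightarrow> ('n perm \<Rightarrow> 'r)
    \<Rightarrow> 'n perm \<Rightarrow> 'r::comm_monoid_add" where
  "cross_mult mul act a b = (\<lambda>v. \<Sum>w\<in>UNIV. mul (a w) (act w (b (inverse w * v))))"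

definition delta :: "'n perm \<Rightarrow> 'r \<Rightarrow> 'n perm \<Rightarrow> 'r::zero" where
  "delta w a = (\<lambda>v. if v = w then a else 0)"

lemma finite_UNIV_perm: "finite (UNIV :: ('n::finite) perm set)"
  by (rule finite_imageD[of "Perm.apply"])
    (auto intro: inj_onI simp: perm_eq_iff)

text \<open>$U$ has the basis \<open>'n \<Rightarrow> 'd\<close>; elements of \<open>End U\<close> over any ring are matrices.\<close>

type_synonym ('n, 'd, 'r) umat = "('n \<Rightarrow> 'd) \<Rightarrow> ('n \<Rightarrow> 'd) \<Rightarrow> 'r"

definition umat_mult ::
  "('r \<Rightarrow> 'r \<Rightarrow> 'r) \<Rightarrow> ('n::finite, 'd::finite, 'r::comm_monoid_add) umat
    \<Rightarrow> ('n, 'd, 'r) umat \<Rightarrow> ('n, 'd, 'r) umat" where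
  "umat_mult mul A B = (\<lambda>I J. \<Sum>K\<in>UNIV. mul (A I K) (B K J))"

definition scal_mat :: "'r \<Rightarrow> ('n, 'd, 'r::zero) umat" where
  "scal_mat a = (\<lambda>I J. if I = J then a else 0)"

text \<open>$1$-based position in the linear order: identifies \<open>'n\<close> with $\{1,\dots,n\}$.\<close>

definition pos :: "'a::{finite,linorder} \<Rightarrow> nat" where
  "pos i = card {j. j \<le> i}"


section \<open>The classical and quantum algebras\<close>

text \<open>
  Both consist of polynomials in momenta.  Coefficients of quantum elements are formal power series
  in $\hbar$ (the series variable \<open>fps_X\<close>), written to the left of the momenta.  The product of
  quantum elements is \<open>star\<close>; the type class product is the commutative one.
\<close>

type_synonym ('n, 'c) mompoly = "('n \<Rightarrow>\<^sub>0 nat) \<Rightarrow>\<^sub>0 'c"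
type_synonym 'n cl = "('n, 'n merfun) mompoly"
type_synonym 'n cl2 = "('n, ('n + 'n) merfun) mompoly"
type_synonym 'n qu = "('n, ('n + 'n) merfun fps) mompoly"
type_synonym ('n, 'd) qu_W = "'n perm \<Rightarrow> ('n, 'd, 'n qu) umat"
  \<comment> \<open>crossed product with $W^\vee$\<close>
type_synonym ('n, 'd) qu_WW = "'n perm \<Rightarrow> 'n perm \<Rightarrow> ('n, 'd, 'n qu) umat"
  \<comment> \<open>crossed product with $\widehat W \times W^\vee$; the first argument is in $\widehat W$\<close>

definition coef :: "'c \<Rightarrow> ('n, 'c::zero) mompoly" where
  "coef c = Poly_Mapping.single 0 c"

definition mom :: "'n \<Rightarrow> ('n, 'c::zero_neq_one) mompoly" where
  "mom i = Poly_Mapping.single (Poly_Mapping.single i 1) 1"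

definition fps_coeffwise :: "('a \<Rightarrow> 'b) \<Rightarrow> 'a fps \<Rightarrow> 'b fps" where
  "fps_coeffwise f A = Abs_fps (\<lambda>k. f (fps_nth A k))"

definition pderivs_x ::
  "('n::{finite,linorder} \<Rightarrow>\<^sub>0 nat) \<Rightarrow> ('n + 'n) merfun \<Rightarrow> ('n + 'n) merfun" where
  "pderivs_x \<gamma> F =
     foldr (\<lambda>i. pderiv_mer (Inl i) ^^ Poly_Mapping.lookup \<gamma> i) (sorted_list_of_set UNIV) F"

text \<open>
  Leibniz rule: $\hat p^\alpha f =
    \sum_{\gamma\le\alpha} \binom{\alpha}{\gamma} \hbar^{|\gamma|} (\partial^\gamma f)\, \hat p^{\alpha-\gamma}$.
\<close>

definition star :: "('n::{finite,linorder}) qu \<Rightarrow> 'n qu \<Rightarrow> 'n qu" where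
  "star a b = (\<Sum>\<alpha>\<in>Poly_Mapping.keys a. \<Sum>\<beta>\<in>Poly_Mapping.keys b.
     \<Sum>\<gamma>\<in>{\<gamma>. \<forall>i. Poly_Mapping.lookup \<gamma> i \<le> Poly_Mapping.lookup \<alpha> i}.
       Poly_Mapping.single (\<alpha> - \<gamma> + \<beta>)
         (of_nat (\<Prod>i\<in>UNIV. Poly_Mapping.lookup \<alpha> i choose Poly_Mapping.lookup \<gamma> i)
           * fps_X ^ (\<Sum>i\<in>UNIV. Poly_Mapping.lookup \<gamma> i)
           * Poly_Mapping.lookup a \<alpha>
           * fps_coeffwise (pderivs_x \<gamma>) (Poly_Mapping.lookup b \<beta>)))"

text \<open>
  Since $(w.f)(v) = f(w^{-1}v)$ and $(w^{-1}v)_i = v_{w(i)}$, a permutation $w$ sends $x_i$ to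
  $x_{w(i)}$ and $p_i$ to $p_{w(i)}$.
\<close>

definition perm_mom :: "'n perm \<Rightarrow> ('n, 'c::zero) mompoly \<Rightarrow> ('n, 'c) mompoly" where
  "perm_mom w a = Poly_Mapping.map_key (Poly_Mapping.map_key (Perm.apply w)) a"

definition act_cl :: "'n perm \<Rightarrow> ('n::finite) cl \<Rightarrow> 'n cl" where
  "act_cl w a = Poly_Mapping.map (reindex (Perm.apply w)) (perm_mom w a)"

definition act_hat_qu :: "'n perm \<Rightarrow> ('n::finite) qu \<Rightarrow> 'n qu" where
  "act_hat_qu w a =
     Poly_Mapping.map (fps_coeffwise (reindex (map_sum (Perm.apply w) id))) (perm_mom w a)"

definition act_vee_qu :: "'n perm \<Rightarrow> ('n::finite) qu \<Rightarrow> 'n qu" where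
  "act_vee_qu w a = Poly_Mapping.map (fps_coeffwise (reindex (map_sum id (Perm.apply w)))) a"

text \<open>$w$ maps the basis vector $e_I$ of $U$ to $e_{I \circ w^{-1}}$, so
  $(w b w^{-1})_{I,J} = b_{I \circ w,\, J \circ w}$.\<close>

definition act_hat :: "'n perm \<Rightarrow> ('n::finite, 'd) qu_W \<Rightarrow> ('n, 'd) qu_W" where
  "act_hat w a = (\<lambda>v I J. act_hat_qu w (a v (I \<circ> Perm.apply w) (J \<circ> Perm.apply w)))"

definition act_vee ::
  "'n perm \<Rightarrow> ('n::finite, 'd, 'n qu) umat \<Rightarrow> ('n, 'd, 'n qu) umat" where
  "act_vee w A = (\<lambda>I J. act_vee_qu w (A I J))"

definition mult_W ::
  "('n::{finite,linorder}, 'd::finite) qu_W \<Rightarrow> ('n, 'd) qu_W \<Rightarrow> ('n, 'd) qu_W" where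
  "mult_W = cross_mult (umat_mult star) act_vee"

definition mult_WW ::
  "('n::{finite,linorder}, 'd::finite) qu_WW \<Rightarrow> ('n, 'd) qu_WW \<Rightarrow> ('n, 'd) qu_WW" where
  "mult_WW = cross_mult mult_W act_hat"

definition scalar_W :: "('n::finite) qu \<Rightarrow> ('n, 'd) qu_W" where
  "scalar_W a = delta 1 (scal_mat a)"

definition scalar_WW :: "('n::finite) qu \<Rightarrow> ('n, 'd) qu_WW" where
  "scalar_WW a = delta 1 (scalar_W a)"

text \<open>The subalgebra generated over $\mathbb{C}[[\hbar]]$ by the functions in $F$ and the
  $\hat p_i$.\<close>

definition A_hbar_over :: "('n::{finite,linorder} + 'n) merfun set \<Rightarrow> 'n qu set" where
  "A_hbar_over F = alg_gen star
     (range (\<lambda>c. coef (fps_coeffwise mconst c)) \<union> (\<lambda>f. coef (fps_const f)) ` F \<union> range mom)"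

definition A_hbar :: "('n::{finite,linorder}) qu set" where
  "A_hbar = A_hbar_over (range (reindex Inl))"

text \<open>With coefficients depending on $\lambda$ as well.\<close>

definition A_hbar_lam :: "('n::{finite,linorder}) qu set" where
  "A_hbar_lam = A_hbar_over UNIV"

definition A_hbar_End_W :: "('n::{finite,linorder}, 'd::finite) qu_W set" where
  "A_hbar_End_W = {a. \<forall>w I J. a w I J \<in> A_hbar_lam}"

definition hbar_W :: "('n::{finite,linorder}, 'd) qu_W \<Rightarrow> ('n, 'd) qu_W" where
  "hbar_W a = (\<lambda>w I J. star (coef fps_X) (a w I J))"

text \<open>$\mathrm{Res}^\vee$: the term $a\,\widehat w_1 \otimes w_2^\vee$ contributes to the
  coefficient of $v = w_2 w_1^{-1}$, i.e. $w_2 = v w_1$.\<close>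

definition Res_vee :: "('n::finite, 'd) qu_WW \<Rightarrow> ('n, 'd) qu_W" where
  "Res_vee a = (\<lambda>v. \<Sum>w\<in>UNIV. a w (v * w))"

definition eta0 :: "('n::finite) qu \<Rightarrow> 'n cl2" where
  "eta0 a = Poly_Mapping.map (\<lambda>c. fps_nth c 0) a"

definition cl_emb :: "('n::finite) cl \<Rightarrow> 'n cl2" where
  "cl_emb f = Poly_Mapping.map (reindex Inl) f"


section \<open>Elliptic functions and the Baxter--Belavin R-matrix\<close>

text \<open>Up to sign (which is irrelevant for \<open>phi\<close>), the odd Jacobi theta function.\<close>

definition jtheta :: "complex \<Rightarrow> complex \<Rightarrow> complex" where
  "jtheta z \<tau> = (\<Sum>\<^sub>\<infinity>k::int. exp (of_real pi * \<i> * \<tau> * (of_int k + 1/2)\<^sup>2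
                       + 2 * of_real pi * \<i> * (of_int k + 1/2) * (z + 1/2)))"

definition phi :: "complex \<Rightarrow> complex \<Rightarrow> complex \<Rightarrow> complex" where
  "phi z \<mu> \<tau> = deriv (\<lambda>t. jtheta t \<tau>) 0 * jtheta (z + \<mu>) \<tau> / (jtheta z \<tau> * jtheta \<mu> \<tau>)"

definition wp :: "complex \<Rightarrow> complex \<Rightarrow> complex" where
  "wp z \<tau> = 1 / z\<^sup>2 +
     (\<Sum>\<^sub>\<infinity>(m, k)\<in>UNIV - {(0::int, 0::int)}.
        1 / (z - (of_int m + of_int k * \<tau>))\<^sup>2 - 1 / (of_int m + of_int k * \<tau>)\<^sup>2)"

definition R_entry ::
  "complex \<Rightarrow> 'd::{finite,linorder} \<Rightarrow> 'd \<Rightarrow> 'd \<Rightarrow> 'd \<Rightarrow> complex \<Rightarrow> complex \<Rightarrow> complex" where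
  "R_entry \<tau> \<alpha> \<beta> \<gamma> \<delta> z \<mu> =
     (if (pos \<alpha> + pos \<gamma>) mod CARD('d) = (pos \<beta> + pos \<delta>) mod CARD('d) then
        let s = of_nat (pos \<gamma>) - of_nat (pos \<beta>); t = of_nat (pos \<beta>) - of_nat (pos \<alpha>);
            d = of_nat CARD('d)
        in exp (2 * of_real pi * \<i> / d * (s * t * \<tau> + s * \<mu> + t * z))
             * phi (z + s * \<tau>) (\<mu> + t * \<tau>) (d * \<tau>)
      else 0)"

text \<open>$R_{ij}(x_i - x_j, \lambda_i - \lambda_j)$, where $e_{\alpha\beta}$ has its entry in row
  $\alpha$ and column $\beta$.\<close>

definition R_mat ::
  "complex \<Rightarrow> 'n::finite \<Rightarrow> 'n \<Rightarrow> ('n, 'd::{finite,linorder}, ('n + 'n) merfun) umat" where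
  "R_mat \<tau> i j = (\<lambda>I J. if \<forall>k. k \<noteq> i \<and> k \<noteq> j \<longrightarrow> I k = J k
     then abs_mer (\<lambda>u. R_entry \<tau> (I i) (J i) (I j) (J j)
                         (u $ Inl i - u $ Inl j) (u $ Inr i - u $ Inr j))
     else 0)"


section \<open>Dunkl operators and Calogero--Moser Hamiltonians\<close>

definition dunkl ::
  "complex \<Rightarrow> complex \<Rightarrow> 'n::{finite,linorder} \<Rightarrow> ('n, 'd::{finite,linorder}) qu_WW" where
  "dunkl \<tau> g i = scalar_WW (mom i)
     - (\<Sum>j\<in>UNIV - {i}. delta \<langle>i \<leftrightarrow> j\<rangle> (delta 1
          (\<lambda>I J. coef (fps_const (mconst g * R_mat \<tau> i j I J)))))"

text \<open>$y^\alpha$; the order of the factors is immaterial as the $y_i$ commute.\<close>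

definition dunkl_monom ::
  "complex \<Rightarrow> complex \<Rightarrow> ('n::{finite,linorder} \<Rightarrow>\<^sub>0 nat) \<Rightarrow> ('n, 'd::{finite,linorder}) qu_WW" where
  "dunkl_monom \<tau> g \<alpha> =
     foldr (\<lambda>i. mult_WW (dunkl \<tau> g i) ^^ Poly_Mapping.lookup \<alpha> i)
       (sorted_list_of_set UNIV) (scalar_WW (coef 1))"

definition subst_dunkl ::
  "complex \<Rightarrow> complex \<Rightarrow> ('n::{finite,linorder}) cl \<Rightarrow> ('n, 'd::{finite,linorder}) qu_WW" where
  "subst_dunkl \<tau> g f = (\<Sum>\<alpha>\<in>Poly_Mapping.keys f.
     mult_WW (scalar_WW (coef (fps_const (reindex Inr (Poly_Mapping.lookup f \<alpha>)))))
       (dunkl_monom \<tau> g \<alpha>))"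

text \<open>Unordered pairs $\{i,j\}$ are represented by $(i,j)$ with $i<j$.\<close>

definition matchings :: "nat \<Rightarrow> (('n::{finite,linorder} \<times> 'n) set \<times> 'n set) set" where
  "matchings r = {(M, K). M \<subseteq> {(i, j). i < j} \<and>
     (\<forall>q\<in>M. \<forall>q'\<in>M. q \<noteq> q' \<longrightarrow> {fst q, snd q} \<inter> {fst q', snd q'} = {}) \<and>
     (\<forall>q\<in>M. fst q \<notin> K \<and> snd q \<notin> K) \<and> 2 * card M + card K = r}"

definition eCM_h :: "complex \<Rightarrow> complex \<Rightarrow> nat \<Rightarrow> ('n::{finite,linorder}) cl" where
  "eCM_h \<tau> g r = (\<Sum>(M, K)\<in>matchings r.
     (\<Prod>(i, j)\<in>M. coef (abs_mer (\<lambda>x. g\<^sup>2 * wp (x $ i - x $ j) \<tau>))) * (\<Prod>k\<in>K. mom k))"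

text \<open>\<open>Ht 1, \<dots>, Ht n\<close> are pairwise commuting quantum lifts of the classical Hamiltonians.\<close>

definition eCM_quantum_lifts ::
  "complex \<Rightarrow> complex \<Rightarrow> (nat \<Rightarrow> ('n::{finite,linorder}) qu) \<Rightarrow> bool" where
  "eCM_quantum_lifts \<tau> g Ht \<longleftrightarrow>
     (\<forall>r\<in>{1..CARD('n)}. Ht r \<in> A_hbar \<and> (\<forall>w. act_hat_qu w (Ht r) = Ht r)
        \<and> eta0 (Ht r) = cl_emb (eCM_h \<tau> g r)) \<and>
     (\<forall>r\<in>{1..CARD('n)}. \<forall>s\<in>{1..CARD('n)}. star (Ht r) (Ht s) = star (Ht s) (Ht r)) \<and>
     Ht 1 = (\<Sum>i\<in>UNIV. mom i) \<and>
     (2 \<le> CARD('n) \<longrightarrow>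
        star (Ht 1) (Ht 1) - (Ht 2 + Ht 2) =
          (\<Sum>i\<in>UNIV. star (mom i) (mom i))
          - (\<Sum>(i, j)\<in>{(i, j). i < j}.
               coef (fps_const (abs_mer (\<lambda>u. 2 * g * wp (u $ Inl i - u $ Inl j) \<tau>))
                       * (fps_const (mconst g) - fps_X))))"

definition scalar_eCM_hamiltonians :: "(nat \<Rightarrow> ('n::{finite,linorder}) qu) \<Rightarrow> 'n qu set" where
  "scalar_eCM_hamiltonians Ht =
     alg_gen star (range (\<lambda>c. coef (fps_const (mconst c))) \<union> Ht ` {1..CARD('n)})"


section \<open>The classical rational spherical Cherednik algebra\<close>

definition mult_cl_W ::
  "('n perm \<Rightarrow> ('n::finite) cl) \<Rightarrow> ('n perm \<Rightarrow> 'n cl) \<Rightarrow> 'n perm \<Rightarrow> 'n cl" where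
  "mult_cl_W = cross_mult (*) act_cl"

definition rational_dunkl :: "complex \<Rightarrow> 'n::finite \<Rightarrow> 'n perm \<Rightarrow> 'n cl" where
  "rational_dunkl g i = delta 1 (mom i)
     - (\<Sum>j\<in>UNIV - {i}. delta \<langle>i \<leftrightarrow> j\<rangle> (coef (abs_mer (\<lambda>x. g / (x $ i - x $ j)))))"

definition cherednik :: "complex \<Rightarrow> ('n perm \<Rightarrow> ('n::finite) cl) set" where
  "cherednik g = alg_gen mult_cl_W
     (range (\<lambda>c. delta 1 (coef (mconst c))) \<union> range (\<lambda>w. delta w 1)
      \<union> range (\<lambda>i. delta 1 (coef (abs_mer (\<lambda>x. x $ i)))) \<union> range (rational_dunkl g))"

definition e_sym :: "'n perm \<Rightarrow> ('n::finite) cl" where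
  "e_sym = (\<lambda>w. coef (mconst (1 / fact CARD('n))))"

definition spherical_cherednik :: "complex \<Rightarrow> ('n::finite) cl set" where
  "spherical_cherednik g = {f. (\<forall>w. act_cl w f = f) \<and>
     (\<exists>c\<in>cherednik g. mult_cl_W (delta 1 f) e_sym = mult_cl_W e_sym (mult_cl_W c e_sym))}"


section \<open>Classical limit and evaluation at a point of phase space\<close>

text \<open>Elements of $(\mathbb{C}(V^\vee) \otimes \mathrm{End}\,U) * W^\vee$.\<close>

type_synonym ('n, 'd) spin_W = "'n perm \<Rightarrow> ('n, 'd, 'n merfun) umat"

definition spin_mult ::
  "('n::finite, 'd::finite) spin_W \<Rightarrow> ('n, 'd) spin_W \<Rightarrow> ('n, 'd) spin_W" where
  "spin_mult = cross_mult (umat_mult (*)) (\<lambda>w A I J. reindex (Perm.apply w) (A I J))"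

definition eval_cl2 :: "complex^'n \<Rightarrow> complex^'n \<Rightarrow> ('n::finite) cl2 \<Rightarrow> 'n merfun" where
  "eval_cl2 xs ps a = (\<Sum>\<alpha>\<in>Poly_Mapping.keys a.
     mconst (\<Prod>i\<in>UNIV. (ps $ i) ^ Poly_Mapping.lookup \<alpha> i)
       * restrict_x xs (Poly_Mapping.lookup a \<alpha>))"

definition classical_value ::
  "complex^'n \<Rightarrow> complex^'n \<Rightarrow> ('n::finite, 'd) qu_W \<Rightarrow> ('n, 'd) spin_W" where
  "classical_value xs ps a = (\<lambda>w I J. eval_cl2 xs ps (eta0 (a w I J)))"

text \<open>The coefficients of $\eta_0(a)$ have no pole along $x = x^*$, so that
  \<open>classical_value\<close> at $x^*$ is meaningful.\<close>

definition classical_value_defined :: "complex^'n \<Rightarrow> ('n::finite, 'd) qu_W \<Rightarrow> bool" where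
  "classical_value_defined xs a \<longleftrightarrow>
     (\<forall>w I J \<alpha>. regular_along xs (Poly_Mapping.lookup (eta0 (a w I J)) \<alpha>))"

definition x_star :: "complex^('n::{finite,linorder})" where
  "x_star = (\<chi> i. of_nat (pos i) / of_nat CARD('n))"

end

theory Submission
  imports Defs "HOL-Complex_Analysis.Complex_Analysis"
begin

unbundle permutation_syntax

text \<open>
  By the Yang--Baxter equation the Dunkl operators commute (\<open>dunkl_commute\<close>), so the elements
  $f(\lambda,y)$ commute. For invariant $f$ they are fixed by the diagonal action of $W$, and on fixed
  elements $\mathrm{Res}^\vee$ is multiplicative (\<open>Res_vee_mult\<close>). Hence all $\mathsf L_f^\vee$ and all
  $H_r+\hbar\mathsf A_r^\vee$ commute with each other (\<open>Res_subst_commute\<close>).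

  The coefficient of $\hbar^2$ in $[H_r+\hbar\mathsf A_r^\vee, H_s+\hbar\mathsf A_s^\vee]=0$ shows that the
  commutator of the classical limits of $\mathsf A_r^\vee$ and $\mathsf A_s^\vee$ is a combination of Poisson
  brackets of these limits with the classical Hamiltonians; similarly for $\mathsf A_r^\vee$ and
  $\mathsf L_f^\vee$. At $(x^*,0)$ the brackets vanish. There the points $x_i^*$ form a regular polygon
  on a circle, and its rotations and reflections force the Hamiltonian vector field of every $H_r$
  to be a multiple of $\sum_i\partial/\partial x_i$ (\<open>equilibrium_hamiltonian\<close>). This field
  annihilates the other argument, because the sum of the Dunkl operators is the total momentum and
  so everything is invariant under translations (\<open>Res_subst_translation\<close>, \<open>bracket_vanishes\<close>).

  It remains to see that all functions can be restricted to $x = x^*$. The poles in $x$ of the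
  R-matrix lie on the diagonals modulo the lattice, since the zeros of theta are the lattice points
  (\<open>jtheta_zero_lattice\<close>); this settles $\mathrm{Res}^\vee(f(\lambda,y))$. The classical limit of
  $\mathsf A_r^\vee$ also contains the coefficient of $\hbar$ in $H_r$. The quantum lifts are given
  only through their classical limits and commutation relations, so its regularity has to be deduced:
  commuting with $\widetilde H_1^2-2\widetilde H_2$ makes it satisfy the equations of a Killing tensor
  modulo regular functions, hence sufficiently high derivatives in every direction are regular, and
  integrating them back along segments shows that it is regular itself (\<open>hamiltonian_good_1\<close>,
  \<open>regular_from_iterated_derivatives\<close>).
\<close>

section \<open>Holomorphic functions of several variables\<close>

text \<open>
  Every complex-linear total derivative is used through its directional derivatives, which are
  derivatives of a function of one complex variable; this gives access to the one-variable
  theory.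
\<close>

definition ddir :: "complex^'k => (complex^'k => complex) => complex^'k => complex" where
  "ddir v f u = deriv (\<lambda>t. f (u + t *s v)) 0"

lemma norm_smult_vec: "norm (t *s v) = norm t * norm (v :: complex^'k::finite)"
  unfolding norm_vec_def
  by (simp add: norm_mult L2_set_right_distrib)

lemma bounded_linear_smult_left: "bounded_linear (\<lambda>t. t *s (v :: complex^'k::finite))"
  by (rule bounded_linear_intro[of _ "norm v"])
    (simp_all add: vec_eq_iff norm_smult_vec algebra_simps)

lemma has_derivative_affine_line:
  "((\<lambda>t. u + t *s (v :: complex^'k::finite)) has_derivative (\<lambda>t. t *s v)) F"
  using has_derivative_add[OF has_derivative_const bounded_linear_imp_has_derivative[OF bounded_linear_smult_left]]
  by fastforce

lemma continuous_on_affine_line: "continuous_on A (\<lambda>t. u + t *s (v :: complex^'k::finite))"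
  by (intro continuous_intros linear_continuous_on bounded_linear_smult_left)

lemma field_derivative_along_line:
  fixes f :: "complex^'k::finite => complex"
  assumes "(f has_derivative D) (at (u + t *s v))" "\<forall>c v. D (c *s v) = c * D v"
  shows "((\<lambda>t. f (u + t *s v)) has_field_derivative D v) (at t)"
proof -
  have "((\<lambda>t. f (u + t *s v)) has_derivative (\<lambda>t. D (t *s v))) (at t)"
    using has_derivative_compose[OF has_derivative_affine_line assms(1)] .
  then show ?thesis
    using assms(2) by (simp add: has_field_derivative_def mult.commute[of _ "D v"])
qed

lemma ddir_eq:
  assumes "(f has_derivative D) (at u)" "\<forall>c v. D (c *s v) = c * D v"
  shows "ddir v f u = D v"
  unfolding ddir_def using field_derivative_along_line[of f D u 0 v] assms by (simp add: DERIV_imp_deriv)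

lemma holo_on_open: "holo_on f N ==> open N"
  by (simp add: holo_on_def)

lemma holo_on_has_derivative:
  assumes "holo_on f N" "u \<in> N"
  shows "(f has_derivative (\<lambda>v. ddir v f u)) (at u)" "ddir (c *s v) f u = c * ddir v f u"
    "ddir (v + w) f u = ddir v f u + ddir w f u"
proof -
  obtain D where D: "(f has_derivative D) (at u)" "\<forall>c v. D (c *s v) = c * D v"
    using assms unfolding holo_on_def by blast
  then have e: "(\<lambda>v. ddir v f u) = D" using ddir_eq by blast
  show "(f has_derivative (\<lambda>v. ddir v f u)) (at u)" "ddir (c *s v) f u = c * ddir v f u"
    using D e fun_cong[OF e] by simp_all
  show "ddir (v + w) f u = ddir v f u + ddir w f u"
    using has_derivative_linear[OF D(1)] fun_cong[OF e] by (simp add: linear_add)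
qed

lemma holo_on_iff_linear:
  assumes "open N" "\<And>u. u \<in> N ==> (f has_derivative (\<lambda>v. D u v)) (at u)"
    "\<And>u c v. u \<in> N ==> D u (c *s v) = c * D u v"
  shows "holo_on f N"
  using assms unfolding holo_on_def by blast

lemma open_line_preimage: "open N ==> open {t. u + t *s (v :: complex^'k::finite) \<in> N}"
  using continuous_open_preimage[OF continuous_on_affine_line, of UNIV N u v]
  by (simp add: vimage_def)

lemma holo_on_along_line:
  assumes "holo_on f N" "u + t *s v \<in> N"
  shows "((\<lambda>t. f (u + t *s v)) has_field_derivative ddir v f (u + t *s v)) (at t)"
  by (rule field_derivative_along_line)
    (use holo_on_has_derivative[OF assms] in auto)

lemma holo_on_along_line_holomorphic:
  assumes "holo_on f N" "\<And>t. t \<in> S ==> u + t *s v \<in> N"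
  shows "(\<lambda>t. f (u + t *s v)) holomorphic_on S"
  using holo_on_along_line[OF assms(1)] assms(2)
  by (intro holomorphic_onI) (meson field_differentiable_at_within field_differentiable_def)

text \<open>
  Cauchy's inequality for the restriction to the complex line through \<open>x\<close> in the
  direction \<open>h\<close>.
\<close>

lemma ddir_bound:
  assumes f: "holo_on f N" and sub: "cball x r \<subseteq> N" and r: "r > 0"
    and B: "\<And>y. y \<in> cball x r ==> norm (f y) \<le> B"
  shows "norm (ddir h f x) \<le> B / r * norm h"
proof (cases "h = 0")
  case True
  have "x \<in> N" using sub r by auto
  then have "ddir (0 *s h) f x = 0 * ddir h f x"
    using holo_on_has_derivative(2)[OF f] by blast
  then show ?thesis using True by simp
next
  case False
  define \<rho> where "\<rho> = r / norm h"
  have \<rho>: "\<rho> > 0" using False r by (simp add: \<rho>_def)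
  have inn: "x + t *s h \<in> cball x r" if "norm t \<le> \<rho>" for t
    using that False by (simp add: dist_norm norm_smult_vec \<rho>_def field_simps)
  have hol: "(\<lambda>t. f (x + t *s h)) holomorphic_on cball 0 \<rho>"
    by (rule holo_on_along_line_holomorphic[OF f]) (use inn sub in \<open>auto simp: dist_norm\<close>)
  have "norm ((deriv ^^ 1) (\<lambda>t. f (x + t *s h)) 0) \<le> fact 1 * B / \<rho> ^ 1"
    by (rule Cauchy_inequality)
      (use hol holomorphic_on_imp_continuous_on \<rho> inn in
        \<open>auto intro: holomorphic_on_subset B\<close>)
  then show ?thesis by (simp add: ddir_def \<rho>_def)
qed

lemma has_derivative_ddir_diff:
  assumes "holo_on f N" "holo_on g N" "u \<in> N"
  shows "ddir v (\<lambda>x. f x - g x) u = ddir v f u - ddir v g u"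
  by (rule ddir_eq[of _ "\<lambda>v. ddir v f u - ddir v g u"])
    (use holo_on_has_derivative[OF assms(1,3)] holo_on_has_derivative[OF assms(2,3)] in
      \<open>auto intro!: has_derivative_diff simp: algebra_simps\<close>)

lemma holo_on_diff: "holo_on f N ==> holo_on g N ==> holo_on (\<lambda>u. f u - g u) N"
  using holo_on_add[of f N "\<lambda>u. - 1 * g u"] holo_on_mult[OF holo_on_const[of N "-1"]]
  by (simp add: holo_on_open)

text \<open>
  By Cauchy's inequality the derivatives of the approximating functions form a uniform Cauchy
  sequence of linear maps, so differentiation commutes with the limit.
\<close>

lemma holo_uniform_limit:
  fixes g :: "complex^'k::finite => complex"
  assumes r: "r > 0" and f: "\<And>n. holo_on (f n) (ball u r)"
    and lim: "uniform_limit (ball u r) f g sequentially"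
  shows "holo_on g (ball u (r / 2))"
    and "x \<in> ball u (r / 2) ==> (\<lambda>n. ddir v (f n) x) \<longlonglongrightarrow> ddir v g x"
proof -
  let ?S = "ball u (r / 2)"
  have sub: "cball x (r / 4) \<subseteq> ball u r" if "x \<in> ?S" for x
  proof
    fix y assume "y \<in> cball x (r / 4)"
    then have "dist u y < r/2 + r/4" using that dist_triangle[of u y x] by auto
    then show "y \<in> ball u r" using r by auto
  qed
  have uc: "\<exists>N. \<forall>x\<in>ball u r. \<forall>m\<ge>N. \<forall>n\<ge>N. dist (f m x) (f n x) < e" if "e > 0" for e
  proof -
    obtain N where N: "\<forall>n\<ge>N. \<forall>x\<in>ball u r. dist (f n x) (g x) < e / 2"
      using uniform_limitD[OF lim, of "e / 2"] \<open>e > 0\<close> by (auto simp: eventually_sequentially)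
    then show ?thesis by (meson dist_triangle_half_l)
  qed
  have est: "\<exists>N. \<forall>m\<ge>N. \<forall>n\<ge>N. \<forall>x\<in>?S. \<forall>h. norm (ddir h (f m) x - ddir h (f n) x) \<le> e * norm h"
    if "e > 0" for e
  proof -
    have "e * r / 4 > 0" using that r by simp
    then obtain N where N: "\<forall>x\<in>ball u r. \<forall>m\<ge>N. \<forall>n\<ge>N. dist (f m x) (f n x) < e * r / 4"
      using uc by blast
    show ?thesis
    proof (intro exI allI impI ballI)
      fix m n x h assume mn: "N \<le> m" "N \<le> n" and x: "x \<in> ?S"
      have xu: "x \<in> ball u r" using x r by auto
      have "norm (ddir h (\<lambda>y. f m y - f n y) x) \<le> (e * r / 4) / (r / 4) * norm h"
        by (rule ddir_bound[OF holo_on_diff[OF f f] sub[OF x]])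
          (use r N mn sub[OF x] in \<open>force simp: dist_norm\<close>)+
      also have "\<dots> = e * norm h" using r by simp
      finally show "norm (ddir h (f m) x - ddir h (f n) x) \<le> e * norm h"
        by (simp add: has_derivative_ddir_diff[OF f f xu])
    qed
  qed
  define g' where "g' x h = lim (\<lambda>n. ddir h (f n) x)" for x h
  have g': "(\<lambda>n. ddir h (f n) x) \<longlonglongrightarrow> g' x h" if "x \<in> ?S" for x h
  proof -
    have "Cauchy (\<lambda>n. ddir h (f n) x)"
    proof (rule metric_CauchyI)
      fix e :: real assume "e > 0"
      define e' where "e' = e / (norm h + 1)"
      have e': "e' > 0" unfolding e'_def using \<open>e > 0\<close>
        by (intro divide_pos_pos) (auto intro: add_nonneg_pos)
      obtain N where N: "\<forall>m\<ge>N. \<forall>n\<ge>N. \<forall>x\<in>?S. \<forall>h. norm (ddir h (f m) x - ddir h (f n) x) \<le> e' * norm h"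
        using est[OF e'] by blast
      have "norm h + 1 \<noteq> 0" using norm_ge_zero[of h] by linarith
      then have "e' * (norm h + 1) = e" by (simp add: e'_def)
      moreover have "e' * norm h < e' * (norm h + 1)" using e' by simp
      ultimately have lt: "e' * norm h < e" by linarith
      show "\<exists>M. \<forall>m\<ge>M. \<forall>n\<ge>M. dist (ddir h (f m) x) (ddir h (f n) x) < e"
      proof (intro exI allI impI)
        fix m n assume "N \<le> m" "N \<le> n"
        then have "norm (ddir h (f m) x - ddir h (f n) x) \<le> e' * norm h" using N that by blast
        then show "dist (ddir h (f m) x) (ddir h (f n) x) < e" using lt by (simp add: dist_norm)
      qed
    qed
    then show ?thesis unfolding g'_def using Cauchy_convergent convergent_LIMSEQ_iff by blast
  qed
  have unif: "\<forall>\<^sub>F n in sequentially. \<forall>x\<in>?S. \<forall>h. norm (ddir h (f n) x - g' x h) \<le> e * norm h"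
    if "e > 0" for e
  proof -
    obtain N where N: "\<forall>m\<ge>N. \<forall>n\<ge>N. \<forall>x\<in>?S. \<forall>h. norm (ddir h (f m) x - ddir h (f n) x) \<le> e * norm h"
      using est[OF \<open>e > 0\<close>] by blast
    have "norm (ddir h (f n) x - g' x h) \<le> e * norm h" if "n \<ge> N" "x \<in> ?S" for n x h
    proof (rule tendsto_upperbound)
      show "(\<lambda>m. norm (ddir h (f n) x - ddir h (f m) x)) \<longlonglongrightarrow> norm (ddir h (f n) x - g' x h)"
        by (intro tendsto_intros g' that)
      show "\<forall>\<^sub>F m in sequentially. norm (ddir h (f n) x - ddir h (f m) x) \<le> e * norm h"
        using N that unfolding eventually_sequentially by blast
    qed simp
    then show ?thesis unfolding eventually_sequentially by blast
  qed
  have pt: "(\<lambda>n. f n x) \<longlonglongrightarrow> g x" if "x \<in> ?S" for x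
    by (rule tendsto_uniform_limitI[OF lim]) (use that r in auto)
  have "u \<in> ?S" using r by simp
  have "\<exists>g0. \<forall>x\<in>?S. (\<lambda>n. f n x) \<longlonglongrightarrow> g0 x \<and> (g0 has_derivative g' x) (at x within ?S)"
  proof (rule has_derivative_sequence[where f = f and f' = "\<lambda>n x h. ddir h (f n) x"])
    show "(\<lambda>n. f n u) \<longlonglongrightarrow> g u" by (rule pt) (rule \<open>u \<in> ?S\<close>)
    show "(f n has_derivative (\<lambda>h. ddir h (f n) x)) (at x within ?S)" if "x \<in> ?S" for n x
      using holo_on_has_derivative(1)[OF f, of x n] that r by (auto intro: has_derivative_at_withinI)
    show "convex ?S" by simp
    show "u \<in> ?S" by fact
    show "\<forall>\<^sub>F n in sequentially. \<forall>x\<in>?S. \<forall>h. norm (ddir h (f n) x - g' x h) \<le> e * norm h" if "e > 0" for e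
      by (rule unif[OF that])
  qed
  then obtain g0 where g0: "\<And>x. x \<in> ?S ==> (\<lambda>n. f n x) \<longlonglongrightarrow> g0 x"
    "\<And>x. x \<in> ?S ==> (g0 has_derivative g' x) (at x)"
    using at_within_open[OF _ open_ball, of _ u "r/2"] by metis
  have eq: "g0 x = g x" if "x \<in> ?S" for x
    using g0(1)[OF that] pt[OF that] LIMSEQ_unique by blast
  have der: "(g has_derivative g' x) (at x)" if "x \<in> ?S" for x
    by (rule has_derivative_transform_within_open[OF g0(2)[OF that] open_ball that eq])
  have lin: "\<forall>c v. g' x (c *s v) = c * g' x v" if "x \<in> ?S" for x
  proof (intro allI)
    fix c v
    have "(\<lambda>n. c * ddir v (f n) x) \<longlonglongrightarrow> c * g' x v" by (intro tendsto_intros g' that)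
    moreover have "(\<lambda>n. ddir (c *s v) (f n) x) = (\<lambda>n. c * ddir v (f n) x)"
      using holo_on_has_derivative(2)[OF f] that r by auto
    ultimately show "g' x (c *s v) = c * g' x v" using g'[OF that, of "c *s v"] LIMSEQ_unique by metis
  qed
  show "holo_on g ?S" by (rule holo_on_iff_linear[of _ _ g']) (use der lin in auto)
  show "(\<lambda>n. ddir v (f n) x) \<longlonglongrightarrow> ddir v g x" if "x \<in> ?S"
    using g'[OF that, of v] ddir_eq[OF der[OF that] lin[OF that]] by simp
qed

lemma holo_on_local:
  assumes "\<And>u. u \<in> N ==> \<exists>M. u \<in> M \<and> holo_on f M"
    and "open N"
  shows "holo_on f N"
  using assms unfolding holo_on_def by (metis)

lemma holo_on_translate:
  assumes "holo_on f N" "open M" "\<And>x. x \<in> M ==> x + w \<in> N"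
  shows "holo_on (\<lambda>x. f (x + w)) M"
proof (rule holo_on_iff_linear[OF assms(2), where D = "\<lambda>u v. ddir v f (u + w)"])
  fix u assume "u \<in> M"
  then have n: "u + w \<in> N" by (rule assms(3))
  have "((\<lambda>x. x + w) has_derivative (\<lambda>h. h)) (at u)" by (auto intro!: derivative_eq_intros)
  from has_derivative_compose[OF this holo_on_has_derivative(1)[OF assms(1) n]]
  show "((\<lambda>x. f (x + w)) has_derivative (\<lambda>v. ddir v f (u + w))) (at u)" .
  show "ddir (c *s v) f (u + w) = c * ddir v f (u + w)" for c v
    by (rule holo_on_has_derivative(2)[OF assms(1) n])
qed

lemma ddir_translate: "ddir v (\<lambda>x. f (x + w)) u = ddir v f (u + w)"
  unfolding ddir_def by (simp add: algebra_simps)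

text \<open>
  Along a complex line the second derivative is bounded on a compact set by Cauchy's inequality,
  which makes the convergence of the difference quotients uniform.
\<close>

lemma difference_quotient_uniform_limit:
  fixes f :: "complex^'k::finite => complex"
  assumes f: "holo_on f N" and u: "u \<in> N"
  shows "\<exists>r>0. ball u r \<subseteq> N \<and> (\<exists>e>0::real. (\<forall>n. \<forall>x\<in>ball u r. x + of_real (e / real (Suc n)) *s v \<in> N) \<and>
    uniform_limit (ball u r) (\<lambda>n x. (f (x + of_real (e / real (Suc n)) *s v) - f x) / of_real (e / real (Suc n)))
       (ddir v f) sequentially)"
proof -
  obtain R where R: "R > 0" "cball u R \<subseteq> N"
    using u holo_on_open[OF f] open_contains_cball by blast
  have "compact (f ` cball u R)"
    using R(2) holo_on_continuous[OF f] by (intro compact_continuous_image) (auto intro: continuous_on_subset)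
  then obtain M where M: "\<And>y. y \<in> cball u R ==> norm (f y) \<le> M"
    using compact_imp_bounded bounded_iff by (metis imageI)
  define r where "r = R / 2"
  define \<rho> where "\<rho> = r / (norm v + 1)"
  have nv: "norm v + 1 > 0" by (simp add: add_nonneg_pos)
  have r: "r > 0" using R by (simp add: r_def)
  have \<rho>: "\<rho> > 0" using r nv by (simp add: \<rho>_def)
  have inn: "x + t *s v \<in> cball u R" if "x \<in> ball u r" "norm t \<le> \<rho>" for x t
  proof -
    have "norm t * norm v \<le> \<rho> * (norm v + 1)" using that \<rho> by (intro mult_mono) auto
    also have "\<dots> = r" using nv by (simp add: \<rho>_def)
    finally have "norm (t *s v) \<le> r" by (simp add: norm_smult_vec)
    then have "dist u (x + t *s v) \<le> r + r"
      using that(1) norm_triangle_ineq4[of "u - x" "t *s v"] by (simp add: dist_norm algebra_simps)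
    then show ?thesis by (simp add: r_def)
  qed
  define e where "e = \<rho> / 2"
  have e: "e > 0" using \<rho> by (simp add: e_def)
  have en: "0 < e / real (Suc n)" "e / real (Suc n) \<le> \<rho> / 2" "e / real (Suc n) \<le> \<rho>" for n
  proof -
    have "e / real (Suc n) \<le> e / 1" using e by (intro divide_left_mono) auto
    moreover have "e / 1 = \<rho> / 2" by (simp add: e_def)
    moreover have "0 < e / real (Suc n)" using e by simp
    ultimately show "0 < e / real (Suc n)" "e / real (Suc n) \<le> \<rho> / 2" "e / real (Suc n) \<le> \<rho>"
      using \<rho> by linarith+
  qed
  define B where "B = 2 * M / (\<rho> / 2)^2"
  have key: "norm (f (x + t *s v) - f x - ddir v f x * t) \<le> B * norm t ^ 2"
    if x: "x \<in> ball u r" and t: "norm t \<le> \<rho> / 2" for x t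
  proof -
    define g where "g = (\<lambda>t. f (x + t *s v))"
    have hol: "g holomorphic_on cball 0 \<rho>"
      unfolding g_def
      by (rule holo_on_along_line_holomorphic[OF f]) (use inn[OF x] R(2) in \<open>auto simp: dist_norm\<close>)
    then have holb: "g holomorphic_on ball 0 \<rho>" using ball_subset_cball holomorphic_on_subset by blast
    have b2: "norm ((deriv ^^ 2) g w) \<le> B" if w: "w \<in> cball 0 (\<rho>/2)" for w
    proof -
      have sub: "cball w (\<rho>/2) \<subseteq> cball 0 \<rho>"
      proof
        fix y assume "y \<in> cball w (\<rho>/2)"
        then show "y \<in> cball 0 \<rho>" using w dist_triangle[of 0 y w] by auto
      qed
      have "norm ((deriv ^^ 2) g w) \<le> fact 2 * M / (\<rho> / 2) ^ 2"
      proof (rule Cauchy_inequality)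
        show "g holomorphic_on ball w (\<rho>/2)" "continuous_on (cball w (\<rho>/2)) g"
          using hol sub ball_subset_cball holomorphic_on_subset holomorphic_on_imp_continuous_on
          by (meson order_trans)+
        show "norm (g y) \<le> M" if "norm (w - y) = \<rho>/2" for y
        proof -
          have "y \<in> cball w (\<rho>/2)" using that by (simp add: dist_norm)
          then have "norm y \<le> \<rho>" using sub by auto
          then show ?thesis unfolding g_def using M inn[OF x] by blast
        qed
      qed (use \<rho> in simp)
      then show ?thesis by (simp add: B_def fact_2)
    qed
    have "norm ((deriv ^^ 0) g t - (\<Sum>i\<le>1. (deriv ^^ i) g 0 * (t - 0)^i / fact i)) \<le> B * norm (t - 0)^(Suc 1) / fact 1"
    proof (rule complex_Taylor[where S = "cball 0 (\<rho>/2)" and f = "\<lambda>i. (deriv ^^ i) g"])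
      show "((deriv ^^ i) g has_field_derivative (deriv ^^ Suc i) g y) (at y within cball 0 (\<rho>/2))"
        if "y \<in> cball 0 (\<rho>/2)" for i y
      proof -
        have "(deriv ^^ i) g holomorphic_on ball 0 \<rho>" by (rule holomorphic_higher_deriv[OF holb open_ball])
        then have "((deriv ^^ i) g has_field_derivative deriv ((deriv ^^ i) g) y) (at y)"
          using that \<rho> by (intro holomorphic_derivI) auto
        then show ?thesis by (simp add: has_field_derivative_at_within)
      qed
      show "norm ((deriv ^^ Suc 1) g y) \<le> B" if "y \<in> cball 0 (\<rho>/2)" for y
        using b2[OF that] by (simp add: numeral_2_eq_2)
      show "0 \<in> cball 0 (\<rho>/2)" "t \<in> cball 0 (\<rho>/2)" using t \<rho> by auto
    qed simp
    then show ?thesis by (simp add: g_def ddir_def power2_eq_square algebra_simps)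
  qed
  have ul: "uniform_limit (ball u r) (\<lambda>n x. (f (x + of_real (e / real (Suc n)) *s v) - f x) / of_real (e / real (Suc n)))
       (ddir v f) sequentially"
  proof (rule uniform_limitI)
    fix \<epsilon> :: real assume "\<epsilon> > 0"
    have "(\<lambda>n. B * (e / real (Suc n))) \<longlonglongrightarrow> B * 0"
      by (intro tendsto_intros) (rule LIMSEQ_Suc[OF lim_const_over_n])
    then have "\<forall>\<^sub>F n in sequentially. B * (e / real (Suc n)) < \<epsilon>"
      using order_tendstoD(2) \<open>\<epsilon> > 0\<close> by fastforce
    then show "\<forall>\<^sub>F n in sequentially. \<forall>x\<in>ball u r. dist ((f (x + of_real (e / real (Suc n)) *s v) - f x) / of_real (e / real (Suc n))) (ddir v f x) < \<epsilon>"
    proof eventually_elim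
      case (elim n)
      define t :: complex where "t = of_real (e / real (Suc n))"
      have nt: "norm t = e / real (Suc n)" unfolding t_def norm_of_real using en(1)[of n] by linarith
      have t0: "t \<noteq> 0" using en(1)[of n] nt by auto
      show ?case unfolding t_def[symmetric]
      proof
        fix x assume x: "x \<in> ball u r"
        have "(f (x + t *s v) - f x) / t - ddir v f x = (f (x + t *s v) - f x - ddir v f x * t) / t"
          using t0 by (simp add: field_simps)
        then have "norm ((f (x + t *s v) - f x) / t - ddir v f x) \<le> B * norm t ^ 2 / norm t"
          unfolding norm_divide
          using key[OF x, of t] nt en(2)[of n] by (metis divide_right_mono norm_ge_zero norm_divide)
        also have "\<dots> = B * norm t" using t0 by (simp add: power2_eq_square)
        also have "\<dots> < \<epsilon>" using elim nt by simp
        finally show "dist ((f (x + t *s v) - f x) / t) (ddir v f x) < \<epsilon>" by (simp add: dist_norm)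
      qed
    qed
  qed
  have "x + of_real (e / real (Suc n)) *s v \<in> N" if "x \<in> ball u r" for n x
  proof -
    have "norm (of_real (e / real (Suc n)) :: complex) \<le> \<rho>" unfolding norm_of_real using en[of n] by linarith
    then show ?thesis using inn[OF that] R(2) by blast
  qed
  moreover have "ball u r \<subseteq> N" using R r_def by (auto simp: subset_iff)
  ultimately show ?thesis using r e ul by blast
qed

lemma holo_difference_quotient:
  assumes f: "holo_on f N" and M: "open M" "M \<subseteq> N" "\<And>x. x \<in> M ==> x + w \<in> N"
  shows "holo_on (\<lambda>x. (f (x + w) - f x) / c) M"
    "x \<in> M ==> ddir v (\<lambda>x. (f (x + w) - f x) / c) x = (ddir v f (x + w) - ddir v f x) / c"
proof -
  have h: "holo_on (\<lambda>x. f (x + w)) M" "holo_on f M"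
    using holo_on_translate[OF f M(1,3)] holo_on_subset[OF f M(1,2)] by auto
  note m = holo_on_mult[OF holo_on_const[OF M(1), of "1/c"] holo_on_diff[OF h]]
  then show "holo_on (\<lambda>x. (f (x + w) - f x) / c) M" by simp
  show "ddir v (\<lambda>x. (f (x + w) - f x) / c) x = (ddir v f (x + w) - ddir v f x) / c" if "x \<in> M"
  proof -
    note d = holo_on_has_derivative[OF holo_on_diff[OF h] that]
    have "((\<lambda>x. (f (x + w) - f x) * (1 / c)) has_derivative (\<lambda>v. ddir v (\<lambda>x. f (x + w) - f x) x * (1/c))) (at x)"
      by (rule has_derivative_mult_left[OF d(1)])
    then have "ddir v (\<lambda>x. (f (x + w) - f x) * (1/c)) x = ddir v (\<lambda>x. f (x + w) - f x) x * (1/c)"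
      by (rule ddir_eq) (use d in auto)
    then show ?thesis
      using has_derivative_ddir_diff[OF h that, of v] by (simp add: ddir_translate)
  qed
qed

text \<open>
  The derivative is a locally uniform limit of difference quotients, and these are holomorphic.
\<close>

lemma holo_on_ddir:
  assumes f: "holo_on f N"
  shows "holo_on (ddir v f) N"
proof (rule holo_on_local[OF _ holo_on_open[OF f]])
  fix u assume u: "u \<in> N"
  obtain r e where r: "r > 0" "ball u r \<subseteq> N" "e > (0::real)"
    "\<And>n x. x \<in> ball u r ==> x + of_real (e / real (Suc n)) *s v \<in> N"
    "uniform_limit (ball u r) (\<lambda>n x. (f (x + of_real (e / real (Suc n)) *s v) - f x) / of_real (e / real (Suc n)))
       (ddir v f) sequentially"
    using difference_quotient_uniform_limit[OF f u, of v] by (elim exE conjE) blast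
  have "holo_on (ddir v f) (ball u (r / 2))"
    by (rule holo_uniform_limit(1)[OF r(1) _ r(5)])
      (rule holo_difference_quotient[OF f open_ball r(2) r(4)])
  then show "\<exists>M. u \<in> M \<and> holo_on (ddir v f) M"
    using r(1) by (intro exI[of _ "ball u (r/2)"]) auto
qed

lemma ddir_commute:
  assumes f: "holo_on f N" and u: "u \<in> N"
  shows "ddir v (ddir w f) u = ddir w (ddir v f) u"
proof -
  obtain r e where r: "r > 0" "ball u r \<subseteq> N" "e > (0::real)"
    "\<And>n x. x \<in> ball u r ==> x + of_real (e / real (Suc n)) *s v \<in> N"
    "uniform_limit (ball u r) (\<lambda>n x. (f (x + of_real (e / real (Suc n)) *s v) - f x) / of_real (e / real (Suc n)))
       (ddir v f) sequentially"
    using difference_quotient_uniform_limit[OF f u, of v] by (elim exE conjE) blast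
  let ?t = "\<lambda>n. complex_of_real (e / real (Suc n))"
  have l1: "(\<lambda>n. ddir w (\<lambda>x. (f (x + ?t n *s v) - f x) / ?t n) u) \<longlonglongrightarrow> ddir w (ddir v f) u"
  proof (rule holo_uniform_limit(2)[OF r(1) _ r(5)])
    show "holo_on (\<lambda>x. (f (x + ?t n *s v) - f x) / ?t n) (ball u r)" for n
      by (rule holo_difference_quotient(1)[OF f open_ball r(2) r(4)])
    show "u \<in> ball u (r / 2)" using r(1) by simp
  qed
  have e1: "ddir w (\<lambda>x. (f (x + ?t n *s v) - f x) / ?t n) u = (ddir w f (u + ?t n *s v) - ddir w f u) / ?t n" for n
    by (rule holo_difference_quotient(2)[OF f open_ball r(2) r(4)]) (use r(1) in auto)
  have "((\<lambda>t. ddir w f (u + t *s v)) has_field_derivative ddir v (ddir w f) u) (at 0)"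
    using holo_on_along_line[OF holo_on_ddir[OF f, of w], of u 0 v] u by simp
  then have l2: "((\<lambda>t. (ddir w f (u + t *s v) - ddir w f u) / t) \<longlongrightarrow> ddir v (ddir w f) u) (at 0)"
    by (simp add: has_field_derivative_iff)
  have "filterlim ?t (at 0) sequentially"
  proof (rule filterlim_atI)
    have "(\<lambda>n. e / real (Suc n)) \<longlonglongrightarrow> 0" by (rule LIMSEQ_Suc[OF lim_const_over_n])
    from tendsto_of_real[OF this, where 'a = complex] show "?t \<longlonglongrightarrow> 0" by (simp only: of_real_0)
    show "\<forall>\<^sub>F x in sequentially. ?t x \<noteq> 0" using r(3) by (simp del: of_nat_Suc)
  qed
  from filterlim_compose[OF l2 this] l1 show ?thesis
    unfolding e1 using LIMSEQ_unique by blast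
qed

section \<open>Derivatives of meromorphic functions\<close>

lemma nowhere_dense_local:
  assumes "\<And>u. \<exists>N. open N \<and> u \<in> N \<and> nowhere_dense (S \<inter> N)"
  shows "nowhere_dense S"
  unfolding nowhere_dense_def
proof (rule ccontr)
  let ?W = "interior (closure S)"
  assume "?W \<noteq> {}"
  then obtain u where u: "u \<in> ?W" by blast
  obtain N where N: "open N" "u \<in> N" "nowhere_dense (S \<inter> N)" using assms by blast
  have "?W \<inter> N \<subseteq> N \<inter> closure S" using interior_subset by blast
  also have "\<dots> \<subseteq> closure (S \<inter> N)" using open_Int_closure_subset[OF N(1), of S] by (simp add: Int_commute)
  finally have "?W \<inter> N \<subseteq> interior (closure (S \<inter> N))"
    by (rule interior_maximal) (simp add: N(1) open_Int)
  then show False using N(2,3) u by (auto simp: nowhere_dense_def)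
qed

lemma holo_on_open_nonzero:
  assumes "holo_on b N" shows "open {v\<in>N. b v \<noteq> 0}"
proof -
  have "open (N \<inter> b -` (- {0}))"
    by (rule continuous_open_preimage[OF holo_on_continuous[OF assms] holo_on_open[OF assms]]) auto
  moreover have "N \<inter> b -` (- {0}) = {v\<in>N. b v \<noteq> 0}" by auto
  ultimately show ?thesis by simp
qed

lemma nowhere_dense_zero_set:
  assumes b: "holo_on b N" and e: "interior {v\<in>N. b v = 0} = {}"
  shows "nowhere_dense {v\<in>N. b v = 0}"
  unfolding nowhere_dense_def
proof (rule ccontr)
  let ?Z = "{v\<in>N. b v = 0}"
  let ?W = "interior (closure ?Z)"
  assume "?W \<noteq> {}"
  then have "?W \<inter> closure ?Z \<noteq> {}" using interior_subset by blast
  then have ne: "?W \<inter> ?Z \<noteq> {}" using open_Int_closure_eq_empty[OF open_interior] by blast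
  from holo_on_open_nonzero[OF b] have "{v\<in>N. b v \<noteq> 0} \<inter> closure ?Z = {}"
    using open_Int_closure_eq_empty[of "{v\<in>N. b v \<noteq> 0}" ?Z] by blast
  then have "?W \<inter> N \<subseteq> ?Z" using interior_subset by blast
  from interior_maximal[OF this] holo_on_open[OF b] ne e show False by blast
qed

lemma nowhere_dense_vimage:
  assumes "continuous_on UNIV f" "\<And>W. open W ==> open (f ` W)" "nowhere_dense S"
  shows "nowhere_dense (f -` S)"
  unfolding nowhere_dense_def
proof (rule ccontr)
  let ?W = "interior (closure (f -` S))"
  assume ne: "?W \<noteq> {}"
  have "f ` ?W \<subseteq> f ` closure (f -` S)" using interior_subset by blast
  also have "\<dots> \<subseteq> closure S"
    by (rule image_closure_subset[OF continuous_on_subset[OF assms(1)]])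
      (use closure_subset in auto)
  finally have "f ` ?W \<subseteq> interior (closure S)"
    by (rule interior_maximal) (simp add: assms(2))
  then show False using ne assms(3) by (auto simp: nowhere_dense_def)
qed

lemma nowhere_dense_witness:
  assumes "nowhere_dense S" "open W" "W \<noteq> {}"
  shows "\<exists>u\<in>W. u \<notin> S"
proof (rule ccontr)
  assume "\<not> ?thesis"
  then have "W \<subseteq> closure S" using closure_subset by blast
  then have "W \<subseteq> interior (closure S)" using assms(2) by (rule interior_maximal)
  then show False using assms by (simp add: nowhere_dense_def)
qed

text \<open>
  This is how an equality of meromorphic functions, which holds only off a nowhere dense set,
  becomes an equality of values.
\<close>

lemma continuous_eq_off_nowhere_dense:
  fixes f g :: "'a::topological_space => complex"
  assumes "continuous_on N f" "continuous_on N g" "open N" "nowhere_dense S"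
    "\<And>u. u \<in> N ==> u \<notin> S ==> f u = g u" "v \<in> N"
  shows "f v = g v"
proof (rule ccontr)
  assume "f v \<noteq> g v"
  moreover have "open (N \<inter> (\<lambda>u. f u - g u) -` (- {0}))"
    by (intro continuous_open_preimage continuous_on_diff assms) auto
  ultimately obtain u where "u \<in> N \<inter> (\<lambda>u. f u - g u) -` (- {0})" "u \<notin> S"
    using nowhere_dense_witness[OF assms(4)] assms(6) by (metis (no_types, lifting) Compl_iff IntI empty_iff right_minus_eq singletonD vimageI2)
  then show False using assms(5) by auto
qed

definition holo_at :: "(complex^'k => complex) => complex^'k => bool" where
  "holo_at f u \<longleftrightarrow> (\<exists>N. u \<in> N \<and> holo_on f N)"

lemma holo_on_cong:
  assumes "holo_on f N" "\<And>u. u \<in> N ==> g u = f u"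
  shows "holo_on g N"
  unfolding holo_on_def
proof (intro conjI ballI)
  show "open N" using assms(1) by (rule holo_on_open)
  fix u assume u: "u \<in> N"
  then obtain D where D: "(f has_derivative D) (at u)" "\<forall>c v. D (c *s v) = c * D v"
    using assms(1) unfolding holo_on_def by blast
  have "(g has_derivative D) (at u)"
    by (rule has_derivative_transform_within_open[OF D(1) holo_on_open[OF assms(1)] u])
      (simp add: assms(2))
  then show "\<exists>D. (g has_derivative D) (at u) \<and> (\<forall>c v. D (c *s v) = c * D v)" using D(2) by blast
qed

lemma holo_on_divide:
  assumes a: "holo_on a N" and b: "holo_on b N" and n: "\<And>u. u \<in> N ==> b u \<noteq> 0"
  shows "holo_on (\<lambda>u. a u / b u) N"
proof -
  have "holo_on (\<lambda>u. inverse (b u)) N"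
  proof (rule holo_on_iff_linear[OF holo_on_open[OF b]])
    fix u assume u: "u \<in> N"
    show "((\<lambda>u. inverse (b u)) has_derivative (\<lambda>h. - (inverse (b u) * ddir h b u * inverse (b u)))) (at u)"
      by (rule Deriv.has_derivative_inverse[OF n[OF u] holo_on_has_derivative(1)[OF b u]])
    show "- (inverse (b u) * ddir (c *s v) b u * inverse (b u)) = c * - (inverse (b u) * ddir v b u * inverse (b u))" for c v
      by (simp add: holo_on_has_derivative(2)[OF b u])
  qed
  from holo_on_mult[OF a this] show ?thesis by (simp add: divide_inverse)
qed

text \<open>
  The poles and the arbitrary values of a representative all lie in the zero sets of local
  denominators.
\<close>

lemma nowhere_dense_not_holo:
  assumes "mero f" shows "nowhere_dense {u. \<not> holo_at f u}"
proof (rule nowhere_dense_local)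
  fix u
  obtain N a b where N: "u \<in> N" "holo_on a N" "holo_on b N" "interior {v\<in>N. b v = 0} = {}"
      "\<forall>v\<in>N. b v \<noteq> 0 \<longrightarrow> f v = a v / b v"
    using assms unfolding mero_def by meson
  let ?M = "{v\<in>N. b v \<noteq> 0}"
  have o: "open ?M" by (rule holo_on_open_nonzero[OF N(3)])
  have "holo_on (\<lambda>u. a u / b u) ?M"
    by (rule holo_on_divide) (use N o in \<open>auto intro: holo_on_subset\<close>)
  then have "holo_on f ?M" by (rule holo_on_cong) (use N(5) in auto)
  then have "holo_at f w" if "w \<in> N" "b w \<noteq> 0" for w
    unfolding holo_at_def using that by (intro exI[of _ ?M]) simp
  then have "{u. \<not> holo_at f u} \<inter> N \<subseteq> {v\<in>N. b v = 0}" by auto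
  then have "nowhere_dense ({u. \<not> holo_at f u} \<inter> N)"
    using nowhere_dense_subset[OF nowhere_dense_zero_set[OF N(3,4)]] by blast
  then show "\<exists>N. open N \<and> u \<in> N \<and> nowhere_dense ({u. \<not> holo_at f u} \<inter> N)"
    using N(1) holo_on_open[OF N(2)] by blast
qed

lemma ddir_cong:
  fixes f :: "complex^'k::finite => complex"
  assumes "open N" "u \<in> N" "\<And>x. x \<in> N ==> f x = g x"
  shows "ddir v f u = ddir v g u"
  unfolding ddir_def
proof (rule deriv_cong_ev)
  have "\<forall>\<^sub>F t in nhds 0. u + t *s v \<in> N"
    using eventually_nhds_in_open[OF open_line_preimage[OF assms(1), of u v], of 0] assms(2) by simp
  then show "\<forall>\<^sub>F t in nhds 0. f (u + t *s v) = g (u + t *s v)"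
    by eventually_elim (rule assms(3))
qed simp

lemma holo_at_has_derivative:
  assumes "holo_at f u"
  shows "(f has_derivative (\<lambda>v. ddir v f u)) (at u)" "ddir (c *s v) f u = c * ddir v f u"
    "ddir (v + w) f u = ddir v f u + ddir w f u" "ddir v (ddir w f) u = ddir w (ddir v f) u"
proof -
  obtain N where N: "u \<in> N" "holo_on f N" using assms unfolding holo_at_def by blast
  show "(f has_derivative (\<lambda>v. ddir v f u)) (at u)" "ddir (c *s v) f u = c * ddir v f u"
    "ddir (v + w) f u = ddir v f u + ddir w f u" "ddir v (ddir w f) u = ddir w (ddir v f) u"
    by (fact holo_on_has_derivative[OF N(2,1)] ddir_commute[OF N(2,1)])+
qed

lemma ddir_add:
  assumes "holo_at f u" "holo_at g u"
  shows "ddir v (\<lambda>x. f x + g x) u = ddir v f u + ddir v g u"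
  by (rule ddir_eq[of _ "\<lambda>v. ddir v f u + ddir v g u"])
    (use holo_at_has_derivative[OF assms(1)] holo_at_has_derivative[OF assms(2)] in
      \<open>auto intro!: has_derivative_add simp: algebra_simps\<close>)

lemma ddir_mult:
  assumes "holo_at f u" "holo_at g u"
  shows "ddir v (\<lambda>x. f x * g x) u = f u * ddir v g u + ddir v f u * g u"
  by (rule ddir_eq[OF has_derivative_mult[OF holo_at_has_derivative(1)[OF assms(1)] holo_at_has_derivative(1)[OF assms(2)]]])
    (simp add: holo_at_has_derivative(2)[OF assms(1)] holo_at_has_derivative(2)[OF assms(2)] algebra_simps)

lemma ddir_const [simp]: "ddir v (\<lambda>_. c) u = 0"
  by (simp add: ddir_def)

lemma ddir_divide:
  assumes "holo_at a u" "holo_at b u" "b u \<noteq> 0"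
  shows "ddir v (\<lambda>x. a x / b x) u = (ddir v a u * b u - a u * ddir v b u) / (b u * b u)"
proof (rule ddir_eq)
  show "((\<lambda>x. a x / b x) has_derivative (\<lambda>v. (ddir v a u * b u - a u * ddir v b u) / (b u * b u))) (at u)"
    by (rule has_derivative_divide'[OF holo_at_has_derivative(1)[OF assms(1)] holo_at_has_derivative(1)[OF assms(2)] assms(3)])
  show "\<forall>c v. (ddir (c *s v) a u * b u - a u * ddir (c *s v) b u) / (b u * b u) =
          c * ((ddir v a u * b u - a u * ddir v b u) / (b u * b u))"
    using holo_at_has_derivative(2)[OF assms(1)] holo_at_has_derivative(2)[OF assms(2)]
    by (simp add: algebra_simps)
qed

lemma mero_ddir:
  assumes "mero f" shows "mero (ddir v f)"
  unfolding mero_def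
proof
  fix u
  obtain N a b where N: "u \<in> N" "holo_on a N" "holo_on b N" "interior {v\<in>N. b v = 0} = {}"
      "\<forall>v\<in>N. b v \<noteq> 0 \<longrightarrow> f v = a v / b v"
    using assms unfolding mero_def by meson
  have "ddir v f w = (ddir v a w * b w - a w * ddir v b w) / (b w * b w)" if "w \<in> N" "b w \<noteq> 0" for w
  proof -
    have "ddir v f w = ddir v (\<lambda>x. a x / b x) w"
      by (rule ddir_cong[OF holo_on_open_nonzero[OF N(3)]]) (use N(5) that in auto)
    also have "\<dots> = (ddir v a w * b w - a w * ddir v b w) / (b w * b w)"
      by (rule ddir_divide) (use that N in \<open>auto simp: holo_at_def\<close>)
    finally show ?thesis .
  qed
  then show "\<exists>M a b. u \<in> M \<and> holo_on a M \<and> holo_on b M \<and> interior {v \<in> M. b v = 0} = {} \<and>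
     (\<forall>w\<in>M. b w \<noteq> 0 \<longrightarrow> ddir v f w = a w / b w)"
    using N by (intro exI[of _ N] exI[of _ "\<lambda>w. ddir v a w * b w - a w * ddir v b w"] exI[of _ "\<lambda>w. b w * b w"])
      (auto intro!: holo_on_diff holo_on_mult holo_on_ddir)
qed

lemma mero_rep: "mero (rep_mer F)"
  using Quotient3_rep_reflp[OF Quotient3_merfun, of F] by (simp add: mer_rel_def)

lemma abs_rep_mer: "abs_mer (rep_mer F) = F"
  by (rule Quotient3_abs_rep[OF Quotient3_merfun])

lemma merfun_cases:
  obtains f where "mero f" "F = abs_mer f"
  using mero_rep[of F] abs_rep_mer[of F] by fastforce

lemma mer_rel_refl: "mero f ==> mer_rel f f"
  by (simp add: mer_rel_def)

lemma rep_abs_mer: "mero f ==> nowhere_dense {u. rep_mer (abs_mer f) u \<noteq> f u}"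
  using Quotient3_rep_abs[OF Quotient3_merfun mer_rel_refl, of f] by (simp add: mer_rel_def)

lemma abs_mer_eqI:
  assumes "mero f" "mero g" "nowhere_dense S" "\<And>u. u \<notin> S ==> f u = g u"
  shows "abs_mer f = abs_mer g"
proof (rule Quotient3_rel_abs[OF Quotient3_merfun])
  show "mer_rel f g" unfolding mer_rel_def
    using assms nowhere_dense_subset[OF assms(3), of "{u. f u \<noteq> g u}"] by blast
qed

lemma abs_mer_add: "mero f ==> mero g ==> abs_mer f + abs_mer g = abs_mer (\<lambda>u. f u + g u)"
  by (rule plus_merfun.abs_eq) (simp_all add: mer_rel_def)

lemma abs_mer_mult: "mero f ==> mero g ==> abs_mer f * abs_mer g = abs_mer (\<lambda>u. f u * g u)"
  by (rule times_merfun.abs_eq) (simp_all add: mer_rel_def)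

lemma abs_mer_uminus: "mero f ==> - abs_mer f = abs_mer (\<lambda>u. - f u)"
  by (rule uminus_merfun.abs_eq) (simp_all add: mer_rel_def)

lemma mero_diff: "mero f ==> mero g ==> mero (\<lambda>u. f u - g u)"
  using mero_add[of f "\<lambda>u. - g u"] mero_uminus[of g] by simp

lemma mconst_0 [simp]: "mconst 0 = 0" by (simp add: mconst_def zero_merfun_def)
lemma mconst_1 [simp]: "mconst 1 = 1" by (simp add: mconst_def one_merfun_def)
lemma mconst_add: "mconst (a + b) = mconst a + mconst b"
  by (simp add: mconst_def abs_mer_add mero_const)
lemma mconst_mult: "mconst (a * b) = mconst a * mconst b"
  by (simp add: mconst_def abs_mer_mult mero_const)

text \<open>
  A directional derivative that need not be along a coordinate axis: directions such as
  $\sum_i\partial_i$ occur, and directional derivatives commute with substitutions of variables.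
\<close>

definition dmer :: "complex^'k => ('k::finite) merfun => 'k merfun" where
  "dmer v F = abs_mer (ddir v (rep_mer F))"

lemma pderiv_mer_dmer: "pderiv_mer i = dmer (axis i 1)"
proof
  fix F have "ddir (axis i 1) (rep_mer F) = (\<lambda>u. deriv (\<lambda>t. rep_mer F (u + t *s axis i 1)) 0)"
    by (rule ext) (simp add: ddir_def)
  then show "pderiv_mer i F = dmer (axis i 1) F" by (simp add: pderiv_mer_def dmer_def)
qed

lemma nowhere_dense_closure: "nowhere_dense S ==> nowhere_dense (closure S)"
  by (simp add: nowhere_dense_def)

lemma dmer_abs:
  assumes f: "mero f" shows "dmer v (abs_mer f) = abs_mer (ddir v f)"
  unfolding dmer_def
proof (rule abs_mer_eqI[OF mero_ddir[OF mero_rep] mero_ddir[OF f]])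
  show "nowhere_dense (closure {u. rep_mer (abs_mer f) u \<noteq> f u})"
    by (rule nowhere_dense_closure[OF rep_abs_mer[OF f]])
  fix u assume "u \<notin> closure {u. rep_mer (abs_mer f) u \<noteq> f u}"
  then show "ddir v (rep_mer (abs_mer f)) u = ddir v f u"
    by (intro ddir_cong[of "- closure {u. rep_mer (abs_mer f) u \<noteq> f u}"])
      (use closure_subset[of "{u. rep_mer (abs_mer f) u \<noteq> f u}"] in auto)
qed

lemma dmer_add: "dmer v (F + G) = dmer v F + dmer v G"
proof -
  obtain f where f: "mero f" "F = abs_mer f" by (rule merfun_cases)
  obtain g where g: "mero g" "G = abs_mer g" by (rule merfun_cases)
  have "abs_mer (ddir v (\<lambda>u. f u + g u)) = abs_mer (\<lambda>u. ddir v f u + ddir v g u)"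
    by (rule abs_mer_eqI[OF _ _ nowhere_dense_Un[OF nowhere_dense_not_holo[OF f(1)] nowhere_dense_not_holo[OF g(1)]]])
      (use f g in \<open>auto intro!: mero_add mero_ddir ddir_add\<close>)
  then show ?thesis using f g by (simp add: abs_mer_add mero_add dmer_abs mero_ddir)
qed

lemma dmer_mult: "dmer v (F * G) = F * dmer v G + dmer v F * G"
proof -
  obtain f where f: "mero f" "F = abs_mer f" by (rule merfun_cases)
  obtain g where g: "mero g" "G = abs_mer g" by (rule merfun_cases)
  have "abs_mer (ddir v (\<lambda>u. f u * g u)) = abs_mer (\<lambda>u. f u * ddir v g u + ddir v f u * g u)"
    by (rule abs_mer_eqI[OF _ _ nowhere_dense_Un[OF nowhere_dense_not_holo[OF f(1)] nowhere_dense_not_holo[OF g(1)]]])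
      (use f g in \<open>auto intro!: mero_add mero_mult mero_ddir ddir_mult\<close>)
  then show ?thesis using f g by (simp add: abs_mer_add abs_mer_mult mero_mult dmer_abs mero_ddir)
qed

lemma dmer_commute: "dmer v (dmer w F) = dmer w (dmer v F)"
proof -
  obtain f where f: "mero f" "F = abs_mer f" by (rule merfun_cases)
  have "abs_mer (ddir v (ddir w f)) = abs_mer (ddir w (ddir v f))"
    by (rule abs_mer_eqI[OF _ _ nowhere_dense_not_holo[OF f(1)]])
      (use f in \<open>auto intro!: mero_ddir holo_at_has_derivative(4)\<close>)
  then show ?thesis using f by (simp add: dmer_abs mero_ddir)
qed

lemma dmer_const [simp]: "dmer v (mconst c) = 0"
proof -
  have "ddir v (\<lambda>_. c) = (\<lambda>_. 0)" by (rule ext) simp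
  then show ?thesis by (simp add: mconst_def dmer_abs mero_const zero_merfun_def)
qed

lemma dmer_0 [simp]: "dmer v 0 = 0"
  using dmer_const[of v 0] by simp

lemma dmer_1 [simp]: "dmer v 1 = 0"
  using dmer_const[of v 1] by simp

lemma dmer_add_dir: "dmer (v + w) F = dmer v F + dmer w F"
proof -
  obtain f where f: "mero f" "F = abs_mer f" by (rule merfun_cases)
  have "abs_mer (ddir (v + w) f) = abs_mer (\<lambda>u. ddir v f u + ddir w f u)"
    by (rule abs_mer_eqI[OF _ _ nowhere_dense_not_holo[OF f(1)]])
      (use f in \<open>auto intro!: mero_ddir mero_add holo_at_has_derivative(3)\<close>)
  then show ?thesis using f by (simp add: dmer_abs mero_ddir abs_mer_add)
qed

lemma dmer_scale_dir: "dmer (c *s v) F = mconst c * dmer v F"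
proof -
  obtain f where f: "mero f" "F = abs_mer f" by (rule merfun_cases)
  have "abs_mer (ddir (c *s v) f) = abs_mer (\<lambda>u. c * ddir v f u)"
    by (rule abs_mer_eqI[OF _ _ nowhere_dense_not_holo[OF f(1)]])
      (use f in \<open>auto intro!: mero_ddir mero_mult mero_const holo_at_has_derivative(2)\<close>)
  then show ?thesis using f by (simp add: dmer_abs mero_ddir mconst_def abs_mer_mult mero_const)
qed

lemma dmer_zero_dir [simp]: "dmer 0 F = 0"
  using dmer_scale_dir[of 0 0 F] by simp

subsection \<open>Change of variables\<close>

text \<open>
  The map of points dual to the substitution \<open>reindex \<sigma>\<close> of variables.
\<close>

definition coords :: "('k => 'l) => complex^'l => complex^'k" where
  "coords \<sigma> u = (\<chi> k. u $ \<sigma> k)"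

lemma linear_coords: "linear (coords \<sigma>)"
  by (rule linearI) (simp_all add: coords_def vec_eq_iff)

lemma coords_simps [simp]: "coords \<sigma> (u + v) = coords \<sigma> u + coords \<sigma> v"
  "coords \<sigma> (c *s u) = c *s coords \<sigma> u" "coords \<sigma> u $ k = u $ \<sigma> k"
  by (simp_all add: coords_def vec_eq_iff)

lemma continuous_coords: "continuous_on A (coords (\<sigma> :: 'k::finite => 'l::finite))"
  by (rule linear_continuous_on) (simp add: linear_coords linear_conv_bounded_linear[symmetric])

lemma surj_coords: "inj \<sigma> ==> surj (coords \<sigma>)"
  unfolding surj_def
proof
  fix y assume "inj \<sigma>"
  then have "y = coords \<sigma> (\<chi> l. y $ inv \<sigma> l)" by (simp add: vec_eq_iff)
  then show "\<exists>x. y = coords \<sigma> x" ..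
qed

lemma open_coords_image: "inj (\<sigma> :: 'k::finite => 'l::finite) ==> open W ==> open (coords \<sigma> ` W)"
  using open_surjective_linear_image[OF _ linear_coords surj_coords] by blast

lemma open_coords_vimage: "open N ==> open (coords (\<sigma> :: 'k::finite => 'l::finite) -` N)"
  by (rule open_vimage[OF _ continuous_coords])

lemma holo_on_coords:
  assumes f: "holo_on f N" shows "holo_on (\<lambda>u. f (coords (\<sigma> :: 'k::finite => 'l::finite) u)) (coords \<sigma> -` N)"
proof (rule holo_on_iff_linear[where D = "\<lambda>u v. ddir (coords \<sigma> v) f (coords \<sigma> u)"])
  show "open (coords \<sigma> -` N)" by (rule open_coords_vimage[OF holo_on_open[OF f]])
  fix u assume "u \<in> coords \<sigma> -` N"
  then have n: "coords \<sigma> u \<in> N" by simp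
  have "(coords \<sigma> has_derivative coords \<sigma>) (at u)"
    by (simp add: linear_coords linear_imp_has_derivative)
  from has_derivative_compose[OF this holo_on_has_derivative(1)[OF f n]]
  show "((\<lambda>u. f (coords \<sigma> u)) has_derivative (\<lambda>v. ddir (coords \<sigma> v) f (coords \<sigma> u))) (at u)" .
  show "ddir (coords \<sigma> (c *s v)) f (coords \<sigma> u) = c * ddir (coords \<sigma> v) f (coords \<sigma> u)" for c v
    using holo_on_has_derivative(2)[OF f n] by simp
qed

lemma interior_coords:
  assumes "inj (\<sigma> :: 'k::finite => 'l::finite)" "interior Z = {}"
  shows "interior (coords \<sigma> -` Z) = {}"
proof (rule ccontr)
  assume ne: "interior (coords \<sigma> -` Z) \<noteq> {}"
  have "coords \<sigma> ` interior (coords \<sigma> -` Z) \<subseteq> interior Z"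
    by (rule interior_maximal[OF _ open_coords_image[OF assms(1) open_interior]])
      (use interior_subset in blast)
  then show False using ne assms(2) by auto
qed

lemma mero_coords:
  assumes "inj (\<sigma> :: 'k::finite => 'l::finite)" "mero f"
  shows "mero (\<lambda>u. f (coords \<sigma> u))"
  unfolding mero_def
proof
  fix u
  obtain N a b where N: "coords \<sigma> u \<in> N" "holo_on a N" "holo_on b N" "interior {v\<in>N. b v = 0} = {}"
      "\<forall>v\<in>N. b v \<noteq> 0 \<longrightarrow> f v = a v / b v"
    using assms(2) unfolding mero_def by meson
  have "{v \<in> coords \<sigma> -` N. b (coords \<sigma> v) = 0} = coords \<sigma> -` {v\<in>N. b v = 0}" by auto
  then show "\<exists>N a b. u \<in> N \<and> holo_on a N \<and> holo_on b N \<and> interior {v\<in>N. b v = 0} = {} \<and>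
     (\<forall>v\<in>N. b v \<noteq> 0 \<longrightarrow> f (coords \<sigma> v) = a v / b v)"
    using N interior_coords[OF assms(1) N(4)] holo_on_coords[OF N(2)] holo_on_coords[OF N(3)]
    by (intro exI[of _ "coords \<sigma> -` N"] exI[of _ "\<lambda>u. a (coords \<sigma> u)"] exI[of _ "\<lambda>u. b (coords \<sigma> u)"]) auto
qed

lemma nowhere_dense_coords:
  "inj (\<sigma> :: 'k::finite => 'l::finite) ==> nowhere_dense S ==> nowhere_dense (coords \<sigma> -` S)"
  by (rule nowhere_dense_vimage[OF continuous_coords open_coords_image])

lemma reindex_abs:
  assumes "inj (\<sigma> :: 'k::finite => 'l::finite)" "mero f"
  shows "reindex \<sigma> (abs_mer f) = abs_mer (\<lambda>u. f (coords \<sigma> u))"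
  unfolding reindex_def coords_def[symmetric]
  by (rule abs_mer_eqI[OF mero_coords[OF assms(1) mero_rep] mero_coords[OF assms]
        nowhere_dense_coords[OF assms(1) rep_abs_mer[OF assms(2)]]]) auto

context
  fixes \<sigma> :: "'k::finite => 'l::finite"
  assumes inj: "inj \<sigma>"
begin

lemma reindex_add: "reindex \<sigma> (F + G) = reindex \<sigma> F + reindex \<sigma> G"
  by (rule merfun_cases[of F], rule merfun_cases[of G])
    (simp add: abs_mer_add reindex_abs inj mero_add mero_coords)

lemma reindex_mult: "reindex \<sigma> (F * G) = reindex \<sigma> F * reindex \<sigma> G"
  by (rule merfun_cases[of F], rule merfun_cases[of G])
    (simp add: abs_mer_mult reindex_abs inj mero_mult mero_coords)

lemma reindex_mconst: "reindex \<sigma> (mconst c) = mconst c"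
  by (simp add: mconst_def reindex_abs inj mero_const)

lemma reindex_0: "reindex \<sigma> 0 = 0" using reindex_mconst[of 0] by simp
lemma reindex_1: "reindex \<sigma> 1 = 1" using reindex_mconst[of 1] by simp

lemma dmer_reindex: "dmer v (reindex \<sigma> F) = reindex \<sigma> (dmer (coords \<sigma> v) F)"
proof (rule merfun_cases[of F])
  fix f assume f: "mero f" "F = abs_mer f"
  have "ddir v (\<lambda>u. f (coords \<sigma> u)) = (\<lambda>u. ddir (coords \<sigma> v) f (coords \<sigma> u))"
    by (simp add: ddir_def fun_eq_iff)
  then show ?thesis using f by (simp add: reindex_abs inj dmer_abs mero_coords mero_ddir)
qed

end

lemma reindex_comp:
  assumes "inj (\<sigma> :: 'k::finite => 'l::finite)" "inj (\<sigma>' :: 'l => 'm::finite)"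
  shows "reindex \<sigma>' (reindex \<sigma> F) = reindex (\<sigma>' \<circ> \<sigma>) F"
proof (rule merfun_cases[of F])
  fix f assume f: "mero f" "F = abs_mer f"
  have "coords \<sigma> (coords \<sigma>' u) = coords (\<sigma>' \<circ> \<sigma>) u" for u by (simp add: vec_eq_iff)
  then show ?thesis using assms f by (simp add: reindex_abs mero_coords inj_compose)
qed

lemma reindex_id: "reindex id F = F"
proof (rule merfun_cases[of F])
  fix f assume f: "mero f" "F = abs_mer f"
  have "(\<lambda>u. f (coords id u)) = f" by (rule ext) (simp add: coords_def)
  then show ?thesis using f reindex_abs[of id f] by simp
qed

lemma coords_axis: "inj \<sigma> ==> coords \<sigma> (axis (\<sigma> k) c) = axis k c"
  by (auto simp: vec_eq_iff axis_def inj_eq)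

lemma coords_axis_notin: "l \<notin> range \<sigma> ==> coords \<sigma> (axis l c) = 0"
  by (auto simp: vec_eq_iff axis_def)

section \<open>Quantum polynomials in the momenta\<close>

abbreviation "lk \<equiv> Poly_Mapping.lookup"
abbreviation "sg \<equiv> Poly_Mapping.single"

lemma poly_mapping_additive_induct [case_names zero plus single]:
  fixes a :: "'k \<Rightarrow>\<^sub>0 'c::comm_monoid_add"
  assumes "P 0" "\<And>a b. P a ==> P b ==> P (a + b)" "\<And>k c. P (sg k c)"
  shows "P a"
proof -
  have "P (\<Sum>k\<in>A. sg k (lk a k))" if "finite A" for A
    using that by (induction A) (auto intro: assms)
  moreover have "(\<Sum>k\<in>Poly_Mapping.keys a. sg k (lk a k)) = a"
    by (rule poly_mapping_eqI) (auto simp: lookup_sum lookup_single when_def in_keys_iff)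
  ultimately show ?thesis by (metis finite_keys)
qed

lemma exponent_induct [case_names zero add]:
  fixes \<alpha> :: "'n::finite \<Rightarrow>\<^sub>0 nat"
  assumes "P 0" "\<And>\<alpha> i. P \<alpha> ==> P (\<alpha> + sg i 1)"
  shows "P \<alpha>"
proof (induction "\<Sum>i\<in>UNIV. lk \<alpha> i" arbitrary: \<alpha>)
  case 0
  then have "\<alpha> = 0" by (intro poly_mapping_eqI) simp
  then show ?case using assms(1) by simp
next
  case (Suc n)
  then obtain i where i: "lk \<alpha> i \<noteq> 0" by (metis Zero_not_Suc sum.neutral)
  define \<beta> where "\<beta> = \<alpha> - sg i 1"
  have \<alpha>: "\<alpha> = \<beta> + sg i 1"
    unfolding \<beta>_def using i by (intro poly_mapping_eqI) (auto simp: lookup_add lookup_minus lookup_single when_def)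
  have "(\<Sum>j\<in>UNIV. lk \<alpha> j) = (\<Sum>j\<in>UNIV. lk \<beta> j) + (\<Sum>j\<in>UNIV. if j = i then 1 else 0)"
    unfolding \<alpha> sum.distrib[symmetric] by (rule sum.cong) (auto simp: lookup_add lookup_single when_def)
  then have "(\<Sum>j\<in>UNIV. lk \<beta> j) = n" using Suc(2) by simp
  then have "P \<beta>" using Suc(1) by simp
  then show ?case unfolding \<alpha> by (rule assms(2))
qed

text \<open>
  Commuting operators may be applied in any order, so raising one exponent applies one more
  operator in front.
\<close>

lemma foldr_funpow_add_single:
  assumes comm: "\<And>i j x. T i (T j x) = T j (T i x)" and "distinct xs" "i \<in> set xs"
  shows "foldr (\<lambda>j. T j ^^ lk (\<gamma> + sg i (1::nat)) j) xs x = T i (foldr (\<lambda>j. T j ^^ lk \<gamma> j) xs x)"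
  using assms(2,3)
proof (induction xs)
  case (Cons j xs)
  have pw: "(T j ^^ m) (T i y) = T i ((T j ^^ m) y)" for m y
    by (induction m) (simp_all add: comm[of j i])
  show ?case
  proof (cases "j = i")
    case True
    have "foldr (\<lambda>j. T j ^^ lk (\<gamma> + sg i 1) j) xs x = foldr (\<lambda>j. T j ^^ lk \<gamma> j) xs x"
      using Cons.prems True by (intro foldr_cong) (auto simp: lookup_add lookup_single when_def)
    then show ?thesis by (simp add: True lookup_add)
  next
    case False
    then show ?thesis using Cons by (simp add: lookup_add lookup_single pw)
  qed
qed simp

lemma foldr_funpow_zero: "foldr (\<lambda>j. T j ^^ lk (0 :: 'n \<Rightarrow>\<^sub>0 nat) j) xs x = x"
  by (induction xs) simp_all

subsection \<open>Coefficients\<close>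

definition Df :: "'n => ('n::finite + 'n) merfun fps => ('n + 'n) merfun fps" where
  "Df i = fps_coeffwise (pderiv_mer (Inl i))"

lemma fps_coeffwise_nth [simp]: "fps_nth (fps_coeffwise f c) k = f (fps_nth c k)"
  by (simp add: fps_coeffwise_def)

lemma dmer_sum: "dmer v (sum f A) = (\<Sum>x\<in>A. dmer v (f x))"
  by (induction A rule: infinite_finite_induct) (simp_all add: dmer_add)

lemma Df_add: "Df i (a + b) = Df i a + Df i b"
  by (rule fps_ext) (simp add: Df_def pderiv_mer_dmer dmer_add)

lemma Df_0 [simp]: "Df i 0 = 0"
  by (rule fps_ext) (simp add: Df_def pderiv_mer_dmer)

lemma Df_1 [simp]: "Df i 1 = 0"
  by (rule fps_ext) (simp add: Df_def pderiv_mer_dmer)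

lemma Df_mult: "Df i (a * b) = a * Df i b + Df i a * b"
  by (rule fps_ext) (simp add: Df_def pderiv_mer_dmer fps_mult_nth dmer_sum dmer_mult sum.distrib)

lemma Df_X [simp]: "Df i fps_X = 0"
  by (rule fps_ext) (simp add: Df_def pderiv_mer_dmer fps_X_def)

lemma Df_commute: "Df i (Df j a) = Df j (Df i a)"
  by (rule fps_ext) (simp add: Df_def pderiv_mer_dmer dmer_commute)

lemma pderivs_x_0: "fps_coeffwise (pderivs_x 0) c = c"
  by (rule fps_ext) (simp only: fps_coeffwise_nth pderivs_x_def foldr_funpow_zero)

lemma pderivs_x_add:
  "fps_coeffwise (pderivs_x (\<gamma> + sg i 1)) c = fps_coeffwise (pderivs_x \<gamma>) (Df i c)"
proof (rule fps_ext)
  fix k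
  let ?T = "\<lambda>i. pderiv_mer (Inl i) :: ('a + 'a) merfun => _"
  have comm: "?T i (?T j x) = ?T j (?T i x)" for i j x by (simp add: pderiv_mer_dmer dmer_commute)
  have pw: "(?T j ^^ m) (?T i y) = ?T i ((?T j ^^ m) y)" for j m y
    by (induction m) (simp_all add: comm[of j i])
  have out: "foldr (\<lambda>j. ?T j ^^ lk \<gamma> j) xs (?T i y) = ?T i (foldr (\<lambda>j. ?T j ^^ lk \<gamma> j) xs y)" for xs y
    by (induction xs) (simp_all add: pw)
  show "fps_nth (fps_coeffwise (pderivs_x (\<gamma> + sg i 1)) c) k = fps_nth (fps_coeffwise (pderivs_x \<gamma>) (Df i c)) k"
    using foldr_funpow_add_single[of ?T "sorted_list_of_set UNIV" i \<gamma> "fps_nth c k"] comm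
    by (simp add: pderivs_x_def Df_def out)
qed

lemma pderivs_x_plus:
  "fps_coeffwise (pderivs_x \<gamma>) (c + d) = fps_coeffwise (pderivs_x \<gamma>) c + fps_coeffwise (pderivs_x \<gamma>) d"
  by (induction \<gamma> arbitrary: c d rule: exponent_induct)
    (simp_all only: pderivs_x_0 pderivs_x_add Df_add)

lemma pderivs_x_zero: "fps_coeffwise (pderivs_x \<gamma>) 0 = 0"
  by (induction \<gamma> rule: exponent_induct) (simp_all only: pderivs_x_0 pderivs_x_add Df_0)

definition Dq :: "'n => ('n::finite) qu => 'n qu" where
  "Dq i a = Poly_Mapping.map (Df i) a"

lemma lookup_map_zero: "f 0 = 0 ==> lk (Poly_Mapping.map f a) k = f (lk a k)"
  by (simp add: Poly_Mapping.map.rep_eq when_def)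

lemma lookup_Dq [simp]: "lk (Dq i a) k = Df i (lk a k)"
  by (simp add: Dq_def lookup_map_zero)

lemma Dq_add: "Dq i (a + b) = Dq i a + Dq i b"
  by (rule poly_mapping_eqI) (simp add: lookup_add Df_add)

lemma Dq_0 [simp]: "Dq i 0 = 0"
  by (rule poly_mapping_eqI) simp

lemma Dq_single: "Dq i (sg k c) = sg k (Df i c)"
  by (rule poly_mapping_eqI) (simp add: lookup_single when_def)

lemma Dq_single_mult: "Dq i (sg k c * b) = sg k c * Dq i b + sg k (Df i c) * b"
proof (induction b rule: poly_mapping_additive_induct)
  case (single l d)
  then show ?case by (simp add: mult_single Dq_single Df_mult single_add)
qed (simp_all add: Dq_add algebra_simps)

lemma Dq_mult: "Dq i (a * b) = a * Dq i b + Dq i a * b"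
proof (induction a rule: poly_mapping_additive_induct)
  case (single k c)
  show ?case by (simp only: Dq_single_mult Dq_single)
qed (simp_all add: Dq_add algebra_simps)

lemma Dq_commute: "Dq i (Dq j a) = Dq j (Dq i a)"
  by (rule poly_mapping_eqI) (simp add: Df_commute)

lemma Dq_mom [simp]: "Dq i (mom j) = 0"
  by (simp add: mom_def Dq_single)

lemma Dq_coef: "Dq i (coef c) = coef (Df i c)"
  by (simp add: coef_def Dq_single)

lemma coef_0 [simp]: "coef 0 = 0" by (simp add: coef_def)
lemma coef_1 [simp]: "coef (1::'c::comm_semiring_1) = 1" by (simp add: coef_def)
lemma coef_add: "coef (a + b) = coef a + coef (b::'c::comm_ring_1)" by (simp add: coef_def single_add)
lemma coef_mult: "coef (a * b) = coef a * coef (b::'c::comm_ring_1)" by (simp add: coef_def mult_single)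
lemma coef_uminus: "coef (- a) = - coef (a::'c::comm_ring_1)"
  by (rule poly_mapping_eqI) (simp add: coef_def lookup_single when_def)

text \<open>
  Left multiplication by $\hat p_i$ in normal ordering, by the Leibniz rule.
\<close>

definition pq :: "'n => ('n::finite) qu => 'n qu" where
  "pq i b = mom i * b + coef fps_X * Dq i b"

lemma Dq_pq: "Dq i (pq j b) = pq j (Dq i b)"
  by (simp add: pq_def Dq_add Dq_mult Dq_coef Dq_commute[of i j])

lemma pq_commute: "pq i (pq j b) = pq j (pq i b)"
  by (simp add: pq_def Dq_add Dq_mult Dq_coef Dq_commute[of i j] algebra_simps)

lemma pq_add: "pq i (a + b) = pq i a + pq i b"
  by (simp add: pq_def Dq_add algebra_simps)

subsection \<open>The star product\<close>

definition mbinom :: "('n::finite \<Rightarrow>\<^sub>0 nat) => ('n \<Rightarrow>\<^sub>0 nat) => nat" where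
  "mbinom \<alpha> \<gamma> = (\<Prod>i\<in>UNIV. lk \<alpha> i choose lk \<gamma> i)"

definition star_term :: "('n::{finite,linorder} \<Rightarrow>\<^sub>0 nat) => ('n + 'n) merfun fps => ('n \<Rightarrow>\<^sub>0 nat)
    => ('n + 'n) merfun fps => 'n qu" where
  "star_term \<alpha> c \<beta> d = (\<Sum>\<gamma>\<in>{\<gamma>. \<forall>i. lk \<gamma> i \<le> lk \<alpha> i}.
     sg (\<alpha> - \<gamma> + \<beta>) (of_nat (mbinom \<alpha> \<gamma>) * fps_X ^ (\<Sum>i\<in>UNIV. lk \<gamma> i) * c
       * fps_coeffwise (pderivs_x \<gamma>) d))"

lemma star_alt: "star a b = (\<Sum>\<alpha>\<in>Poly_Mapping.keys a. \<Sum>\<beta>\<in>Poly_Mapping.keys b.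
    star_term \<alpha> (lk a \<alpha>) \<beta> (lk b \<beta>))"
  by (simp add: star_def star_term_def mbinom_def)

lemma star_term_add_left: "star_term \<alpha> (c + c') \<beta> d = star_term \<alpha> c \<beta> d + star_term \<alpha> c' \<beta> d"
  by (simp add: star_term_def sum.distrib[symmetric] single_add[symmetric] algebra_simps)

lemma star_term_add_right: "star_term \<alpha> c \<beta> (d + d') = star_term \<alpha> c \<beta> d + star_term \<alpha> c \<beta> d'"
  by (simp add: star_term_def sum.distrib[symmetric] single_add[symmetric] algebra_simps pderivs_x_plus)

lemma star_term_0 [simp]: "star_term \<alpha> 0 \<beta> d = 0" "star_term \<alpha> c \<beta> 0 = 0"
  by (simp_all add: star_term_def pderivs_x_zero)

lemma star_superset:
  assumes "finite A" "Poly_Mapping.keys a \<subseteq> A" "finite B" "Poly_Mapping.keys b \<subseteq> B"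
  shows "star a b = (\<Sum>\<alpha>\<in>A. \<Sum>\<beta>\<in>B. star_term \<alpha> (lk a \<alpha>) \<beta> (lk b \<beta>))"
proof -
  have "star a b = (\<Sum>\<alpha>\<in>Poly_Mapping.keys a. \<Sum>\<beta>\<in>B. star_term \<alpha> (lk a \<alpha>) \<beta> (lk b \<beta>))"
    unfolding star_alt
    by (rule sum.cong[OF refl], rule sum.mono_neutral_left) (use assms in \<open>auto simp: in_keys_iff\<close>)
  also have "\<dots> = (\<Sum>\<alpha>\<in>A. \<Sum>\<beta>\<in>B. star_term \<alpha> (lk a \<alpha>) \<beta> (lk b \<beta>))"
    by (rule sum.mono_neutral_left) (use assms in \<open>auto simp: in_keys_iff\<close>)
  finally show ?thesis .
qed

lemma star_add_left: "star (a + a') b = star a b + star a' b"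
proof -
  let ?A = "Poly_Mapping.keys a \<union> Poly_Mapping.keys a'"
  have "Poly_Mapping.keys (a + a') \<subseteq> ?A" by (rule Poly_Mapping.keys_add)
  then show ?thesis
    using star_superset[of ?A a "Poly_Mapping.keys b" b] star_superset[of ?A a' "Poly_Mapping.keys b" b]
      star_superset[of ?A "a + a'" "Poly_Mapping.keys b" b]
    by (simp add: lookup_add star_term_add_left sum.distrib)
qed

lemma star_add_right: "star a (b + b') = star a b + star a b'"
proof -
  let ?B = "Poly_Mapping.keys b \<union> Poly_Mapping.keys b'"
  have "Poly_Mapping.keys (b + b') \<subseteq> ?B" by (rule Poly_Mapping.keys_add)
  then show ?thesis
    using star_superset[of "Poly_Mapping.keys a" a ?B b] star_superset[of "Poly_Mapping.keys a" a ?B b']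
      star_superset[of "Poly_Mapping.keys a" a ?B "b + b'"]
    by (simp add: lookup_add star_term_add_right sum.distrib)
qed

lemma star_0 [simp]: "star 0 b = 0" "star a 0 = 0"
  by (simp_all add: star_def)

lemma star_single: "star (sg \<alpha> c) (sg \<beta> d) = star_term \<alpha> c \<beta> d"
  using star_superset[of "{\<alpha>}" "sg \<alpha> c" "{\<beta>}" "sg \<beta> d"] by simp

lemma finite_exponents_le: "finite {\<gamma> :: 'n::finite \<Rightarrow>\<^sub>0 nat. \<forall>i. lk \<gamma> i \<le> lk \<alpha> i}"
proof (rule finite_imageD[of lk])
  have "lk ` {\<gamma> :: 'n \<Rightarrow>\<^sub>0 nat. \<forall>i. lk \<gamma> i \<le> lk \<alpha> i} \<subseteq> PiE UNIV (\<lambda>i. {..lk \<alpha> i})"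
    by (auto simp: PiE_iff)
  then show "finite (lk ` {\<gamma> :: 'n \<Rightarrow>\<^sub>0 nat. \<forall>i. lk \<gamma> i \<le> lk \<alpha> i})"
    by (rule finite_subset) (simp add: finite_PiE)
qed (rule inj_onI, simp add: lookup_inject)

lemma mbinom_eq_0: "\<not> (\<forall>k. lk \<gamma> k \<le> lk \<alpha> k) ==> mbinom \<alpha> \<gamma> = 0"
  unfolding mbinom_def by (auto simp: not_le intro!: prod_zero)

lemma mbinom_add_single:
  "mbinom (\<alpha> + sg i 1) \<gamma> = mbinom \<alpha> \<gamma> + (if lk \<gamma> i = 0 then 0 else mbinom \<alpha> (\<gamma> - sg i 1))"
proof -
  have s: "mbinom a c = (lk a i choose lk c i) * (\<Prod>k\<in>UNIV - {i}. lk a k choose lk c k)" for a c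
    unfolding mbinom_def by (rule prod.remove) simp_all
  have r: "(\<Prod>k\<in>UNIV - {i}. lk (\<alpha> + sg i 1) k choose lk \<gamma> k) = (\<Prod>k\<in>UNIV - {i}. lk \<alpha> k choose lk \<gamma> k)"
    "(\<Prod>k\<in>UNIV - {i}. lk \<alpha> k choose lk (\<gamma> - sg i 1) k) = (\<Prod>k\<in>UNIV - {i}. lk \<alpha> k choose lk \<gamma> k)"
    by (auto intro!: prod.cong simp: lookup_add lookup_minus lookup_single when_def)
  show ?thesis
    unfolding s[of "\<alpha> + sg i 1" \<gamma>] s[of \<alpha>] r
    by (cases "lk \<gamma> i") (simp_all add: lookup_add lookup_minus algebra_simps)
qed

text \<open>
  Pascal's rule for the exponent $\gamma$ that counts how often each derivative hits the right
  factor.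
\<close>

lemma star_term_add_single:
  "star_term (\<alpha> + sg i 1) c \<beta> d = star_term \<alpha> c (\<beta> + sg i 1) d + star_term \<alpha> c \<beta> (fps_X * Df i d)"
proof -
  let ?S = "\<lambda>\<alpha>. {\<gamma>. \<forall>k. lk \<gamma> k \<le> lk \<alpha> k}"
  let ?\<alpha> = "\<alpha> + sg i 1"
  let ?g = "\<lambda>\<gamma>. fps_X ^ (\<Sum>k\<in>UNIV. lk \<gamma> k) * c * fps_coeffwise (pderivs_x \<gamma>) d"
  have S: "?S \<alpha> \<subseteq> ?S ?\<alpha>" by (auto simp: lookup_add intro: trans_le_add1)
  have "star_term ?\<alpha> c \<beta> d =
      (\<Sum>\<gamma>\<in>?S ?\<alpha>. sg (?\<alpha> - \<gamma> + \<beta>) (of_nat (mbinom \<alpha> \<gamma>) * ?g \<gamma>)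
        + (if lk \<gamma> i = 0 then 0 else sg (?\<alpha> - \<gamma> + \<beta>) (of_nat (mbinom \<alpha> (\<gamma> - sg i 1)) * ?g \<gamma>)))"
    unfolding star_term_def
    unfolding mbinom_add_single by (rule sum.cong[OF refl]) (simp add: algebra_simps single_add)
  also have "\<dots> = (\<Sum>\<gamma>\<in>?S ?\<alpha>. sg (?\<alpha> - \<gamma> + \<beta>) (of_nat (mbinom \<alpha> \<gamma>) * ?g \<gamma>))
     + (\<Sum>\<gamma>\<in>?S ?\<alpha>. if lk \<gamma> i = 0 then 0 else sg (?\<alpha> - \<gamma> + \<beta>) (of_nat (mbinom \<alpha> (\<gamma> - sg i 1)) * ?g \<gamma>))"
    (is "_ = ?A + ?B") by (rule sum.distrib)
  also have "?A = (\<Sum>\<gamma>\<in>?S \<alpha>. sg (?\<alpha> - \<gamma> + \<beta>) (of_nat (mbinom \<alpha> \<gamma>) * ?g \<gamma>))"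
    by (rule sum.mono_neutral_right[OF finite_exponents_le S]) (auto simp: mbinom_eq_0)
  also have "\<dots> = star_term \<alpha> c (\<beta> + sg i 1) d"
    unfolding star_term_def
  proof (rule sum.cong[OF refl])
    fix \<gamma> assume g: "\<gamma> \<in> ?S \<alpha>"
    have "?\<alpha> - \<gamma> + \<beta> = \<alpha> - \<gamma> + (\<beta> + sg i 1)"
    proof (rule poly_mapping_eqI)
      fix k have "lk \<gamma> k \<le> lk \<alpha> k" using g by simp
      then show "lk (?\<alpha> - \<gamma> + \<beta>) k = lk (\<alpha> - \<gamma> + (\<beta> + sg i 1)) k"
        by (simp add: lookup_add lookup_minus)
    qed
    then show "sg (?\<alpha> - \<gamma> + \<beta>) (of_nat (mbinom \<alpha> \<gamma>) * ?g \<gamma>) =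
        sg (\<alpha> - \<gamma> + (\<beta> + sg i 1)) (of_nat (mbinom \<alpha> \<gamma>) * fps_X ^ (\<Sum>k\<in>UNIV. lk \<gamma> k) * c * fps_coeffwise (pderivs_x \<gamma>) d)"
      by (simp add: algebra_simps)
  qed
  also have "?B = (\<Sum>\<gamma>\<in>{\<gamma>\<in>?S ?\<alpha>. lk \<gamma> i \<noteq> 0}. sg (?\<alpha> - \<gamma> + \<beta>) (of_nat (mbinom \<alpha> (\<gamma> - sg i 1)) * ?g \<gamma>))"
    by (rule sum.mono_neutral_cong_right[OF finite_exponents_le]) auto
  also have "\<dots> = star_term \<alpha> c \<beta> (fps_X * Df i d)"
    unfolding star_term_def
  proof (rule sum.reindex_bij_witness[of _ "\<lambda>\<gamma>. \<gamma> + sg i 1" "\<lambda>\<gamma>. \<gamma> - sg i 1"])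
    fix \<gamma> assume "\<gamma> \<in> ?S \<alpha>"
    then show "\<gamma> + sg i 1 - sg i 1 = \<gamma>" "\<gamma> + sg i 1 \<in> {\<gamma>\<in>?S ?\<alpha>. lk \<gamma> i \<noteq> 0}"
      by (auto intro!: poly_mapping_eqI simp: lookup_add lookup_minus)
  next
    fix \<gamma> assume g: "\<gamma> \<in> {\<gamma>\<in>?S ?\<alpha>. lk \<gamma> i \<noteq> 0}"
    define \<delta> where "\<delta> = \<gamma> - sg i 1"
    have \<gamma>: "\<gamma> = \<delta> + sg i 1"
      unfolding \<delta>_def using g
      by (intro poly_mapping_eqI) (auto simp: lookup_add lookup_minus lookup_single when_def)
    show "\<gamma> - sg i 1 + sg i 1 = \<gamma>" using \<gamma> by (simp add: \<delta>_def)
    show "\<gamma> - sg i 1 \<in> ?S \<alpha>"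
      using g by (auto simp: lookup_add lookup_minus lookup_single when_def split: if_splits)
    have s: "(\<Sum>k\<in>UNIV. lk \<gamma> k) = Suc (\<Sum>k\<in>UNIV. lk \<delta> k)"
    proof -
      have "(\<Sum>k\<in>UNIV. lk \<gamma> k) = (\<Sum>k\<in>UNIV. lk \<delta> k) + (\<Sum>k\<in>UNIV. if k = i then 1 else 0)"
        unfolding \<gamma> sum.distrib[symmetric] by (rule sum.cong) (auto simp: lookup_add lookup_single when_def)
      then show ?thesis by simp
    qed
    have e: "?\<alpha> - \<gamma> = \<alpha> - \<delta>"
      unfolding \<gamma> by (rule poly_mapping_eqI) (simp add: lookup_add lookup_minus)
    have p: "fps_coeffwise (pderivs_x \<delta>) (fps_X * Df i d) = fps_X * fps_coeffwise (pderivs_x \<gamma>) d"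
    proof -
      have *: "fps_coeffwise (pderivs_x \<delta>) (fps_X * c) = fps_X * fps_coeffwise (pderivs_x \<delta>) c" for c :: "('a + 'a) merfun fps"
        by (induction \<delta> arbitrary: c rule: exponent_induct)
          (simp_all only: pderivs_x_0 pderivs_x_add Df_mult Df_X mult_zero_left add_0_right)
      show ?thesis unfolding \<gamma> pderivs_x_add by (rule *)
    qed
    show "sg (\<alpha> - (\<gamma> - sg i 1) + \<beta>)
          (of_nat (mbinom \<alpha> (\<gamma> - sg i 1)) * fps_X ^ (\<Sum>k\<in>UNIV. lk (\<gamma> - sg i 1) k) * c *
           fps_coeffwise (pderivs_x (\<gamma> - sg i 1)) (fps_X * Df i d)) =
         sg (?\<alpha> - \<gamma> + \<beta>) (of_nat (mbinom \<alpha> (\<gamma> - sg i 1)) * ?g \<gamma>)"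
      unfolding \<delta>_def[symmetric] e p s by (simp add: algebra_simps)
  qed
  finally show ?thesis .
qed

lemma star_single_0: "star (sg 0 c) b = coef c * b"
proof (induction b rule: poly_mapping_additive_induct)
  case (single \<beta> d)
  have "{\<gamma> :: 'a \<Rightarrow>\<^sub>0 nat. \<forall>i. lk \<gamma> i \<le> lk 0 i} = {0}"
    by (auto intro: poly_mapping_eqI)
  then show ?case
    by (simp add: star_single star_term_def mbinom_def pderivs_x_0 coef_def mult_single)
qed (simp_all add: star_add_right algebra_simps)

text \<open>
  The star product is determined by this recursion: a momentum at the right end of the left
  factor acts on the right factor by \<open>pq\<close>. All algebraic laws of the star product
  follow from it by induction, and the closed formula with binomial coefficients can be
  forgotten.
\<close>

lemma star_single_add: "star (sg (\<alpha> + sg i 1) c) b = star (sg \<alpha> c) (pq i b)"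
proof (induction b rule: poly_mapping_additive_induct)
  case (single \<beta> d)
  have "pq i (sg \<beta> d) = sg (\<beta> + sg i 1) d + sg \<beta> (fps_X * Df i d)"
    by (simp add: pq_def mom_def coef_def mult_single Dq_single add.commute)
  then show ?case by (simp add: star_add_right star_single star_term_add_single[unfolded One_nat_def])
qed (simp_all add: star_add_right pq_def Dq_add algebra_simps)

lemma star_induct [case_names plus zero scalar mom]:
  fixes a :: "('n::{finite,linorder}) qu"
  assumes "\<And>a b. P a ==> P b ==> P (a + b)" "P 0" "\<And>c. P (sg 0 c)"
    "\<And>\<alpha> i c. (\<And>c. P (sg \<alpha> c)) ==> P (sg (\<alpha> + sg i 1) c)"
  shows "P a"
proof (induction a rule: poly_mapping_additive_induct)
  case (single \<alpha> c)
  show ?case by (induction \<alpha> arbitrary: c rule: exponent_induct) (use assms in auto)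
qed (use assms in auto)

lemma star_coef: "star (coef c) b = coef c * b"
  unfolding coef_def[of c] star_single_0 by (simp add: coef_def)

lemma star_coef_mult: "star (coef c * a) b = coef c * star a b"
proof (induction a arbitrary: c b rule: star_induct)
  case (scalar d)
  then show ?case by (simp add: coef_def mult_single star_single_0[unfolded coef_def] mult.assoc[symmetric])
next
  case (mom \<alpha> i d)
  have "coef c * sg (\<alpha> + sg i 1) d = sg (\<alpha> + sg i 1) (c * d)" "coef c * sg \<alpha> d = sg \<alpha> (c * d)"
    by (simp_all add: coef_def mult_single)
  then show ?case using mom by (metis star_single_add)
qed (simp_all add: algebra_simps star_add_left)

lemma pq_star: "pq i (star (sg \<beta> d) c) = star (pq i (sg \<beta> d)) c"
proof (induction \<beta> arbitrary: c d rule: exponent_induct)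
  case zero
  have "pq i (sg 0 d) = sg (0 + sg i 1) d + coef (fps_X * Df i d)"
    by (simp add: pq_def mom_def coef_def mult_single Dq_single)
  then show ?case
    by (simp only: star_add_left star_single_add star_single_0 star_coef)
      (simp add: pq_def Dq_mult Dq_coef coef_mult algebra_simps)
next
  case (add \<beta> j)
  have e: "pq i (sg \<beta> d) = sg (\<beta> + sg i 1) d + sg \<beta> (fps_X * Df i d)" for \<beta>
    by (simp add: pq_def mom_def coef_def mult_single Dq_single add.commute)
  have "star (pq i (sg (\<beta> + sg j 1) d)) c = star (pq i (sg \<beta> d)) (pq j c)"
    unfolding e star_add_left
    by (metis (no_types, lifting) add.assoc add.commute pq_commute star_single_add)
  then show ?case by (simp only: star_single_add add)
qed

lemma pq_star': "pq i (star b c) = star (pq i b) c"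
  by (induction b rule: poly_mapping_additive_induct)
    (simp_all add: pq_star star_add_left pq_add, simp add: pq_def)

text \<open>
  Both sides are computed by the recursion for the left factor; the step is the fact that
  \<open>pq\<close> commutes with right multiplication.
\<close>

lemma star_assoc: "star (star a b) c = star a (star b c)"
proof (induction a arbitrary: b c rule: star_induct)
  case (mom \<alpha> i d)
  then show ?case by (simp only: star_single_add pq_star')
qed (simp_all add: star_add_left star_single_0 star_coef_mult)

lemma star_1_left [simp]: "star 1 a = a"
  using star_coef[of 1 a] by simp

lemma star_mom: "star (mom i) b = pq i b"
  using star_single_add[of 0 i 1 b] by (simp add: mom_def)

text \<open>
  No derivative hits a right factor with constant coefficients.
\<close>

lemma star_const_right:
  assumes "\<And>j. Dq j q = 0" shows "star a q = a * q"
  using assms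
proof (induction a arbitrary: q rule: star_induct)
  case (mom \<alpha> i c)
  have pq: "pq i q = mom i * q" using mom(2) by (simp add: pq_def)
  have "star (sg (\<alpha> + sg i 1) c) q = star (sg \<alpha> c) (mom i * q)" by (simp only: star_single_add pq)
  also have "\<dots> = sg \<alpha> c * (mom i * q)" by (rule mom(1)) (simp add: Dq_mult mom(2))
  also have "\<dots> = sg (\<alpha> + sg i 1) c * q" by (simp add: mom_def mult_single mult.assoc[symmetric])
  finally show ?case .
qed (simp_all add: star_add_left star_single_0 algebra_simps, simp add: coef_def)

lemma Dq_1 [simp]: "Dq j 1 = 0"
  using Dq_coef[of j 1] by simp

lemma star_1_right [simp]: "star a 1 = a"
  by (simp add: star_const_right)

lemma star_diff_left: "star (a - a') b = star a b - star a' b"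
  using star_add_left[of "a - a'" a' b] by simp
lemma star_diff_right: "star a (b - b') = star a b - star a b'"
  using star_add_right[of a "b - b'" b'] by simp

section \<open>Group actions and crossed products\<close>

text \<open>
  Both group actions on quantum elements are instances: $\widehat w$ moves $x$ and the momenta,
  $w^\vee$ moves only $\lambda$, so that there the momentum permutation is trivial.
\<close>

definition qact :: "('n::finite + 'n => 'n + 'n) => 'n perm => 'n qu => 'n qu" where
  "qact \<rho> w a = Poly_Mapping.map (fps_coeffwise (reindex \<rho>)) (perm_mom w a)"

definition pexp :: "'n perm => ('n \<Rightarrow>\<^sub>0 nat) => ('n \<Rightarrow>\<^sub>0 nat)" where
  "pexp w \<alpha> = Poly_Mapping.map_key (Perm.apply (inverse w)) \<alpha>"

lemma inj_perm: "inj (Perm.apply w)"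
  using bij_apply bij_is_inj by blast

lemma perm_cancel [simp]: "w \<langle>$\<rangle> (inverse w \<langle>$\<rangle> i) = i" "inverse w \<langle>$\<rangle> (w \<langle>$\<rangle> i) = i"
  by (simp_all add: apply_sequence)

lemma perm_mult_cancel: "inverse w * (w * v) = v" "w * (inverse w * v) = (v :: 'n perm)"
  by (simp_all add: mult.assoc[symmetric])

lemmas perm_group = perm.left_inverse perm.right_inverse perm_mult_cancel mult.assoc
  perm.inverse_distrib_swap mult_1_left mult_1_right perm.inverse_inverse

lemma lookup_map_key_perm [simp]: "lk (Poly_Mapping.map_key (Perm.apply w) \<alpha>) i = lk \<alpha> (w \<langle>$\<rangle> i)"
  by (simp add: map_key.rep_eq inj_perm)

lemma lookup_pexp [simp]: "lk (pexp w \<alpha>) i = lk \<alpha> (inverse w \<langle>$\<rangle> i)"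
  by (simp add: pexp_def)

lemma inj_map_key_perm: "inj (Poly_Mapping.map_key (Perm.apply (w :: 'n perm)) :: ('n \<Rightarrow>\<^sub>0 nat) => _)"
proof (rule injI, rule poly_mapping_eqI)
  fix \<alpha> \<beta> :: "'n \<Rightarrow>\<^sub>0 nat" and i
  assume "Poly_Mapping.map_key (Perm.apply w) \<alpha> = Poly_Mapping.map_key (Perm.apply w) \<beta>"
  then have "lk (Poly_Mapping.map_key (Perm.apply w) \<alpha>) (inverse w \<langle>$\<rangle> i) = lk (Poly_Mapping.map_key (Perm.apply w) \<beta>) (inverse w \<langle>$\<rangle> i)"
    by simp
  then show "lk \<alpha> i = lk \<beta> i" by simp
qed

lemma lookup_perm_mom [simp]: "lk (perm_mom w a) \<alpha> = lk a (Poly_Mapping.map_key (Perm.apply w) \<alpha>)"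
  by (simp add: perm_mom_def map_key.rep_eq inj_map_key_perm)

lemma map_key_pexp: "Poly_Mapping.map_key (Perm.apply w) (pexp w \<alpha>) = \<alpha>"
  by (rule poly_mapping_eqI) simp

lemma pexp_map_key: "pexp w (Poly_Mapping.map_key (Perm.apply w) \<alpha>) = \<alpha>"
  by (rule poly_mapping_eqI) simp

lemma pexp_add: "pexp w (\<alpha> + \<beta>) = pexp w \<alpha> + pexp w \<beta>"
  by (rule poly_mapping_eqI) (simp add: lookup_add)

lemma perm_eq_inverse_iff: "inverse w \<langle>$\<rangle> i = j \<longleftrightarrow> i = w \<langle>$\<rangle> j"
  using perm_cancel by metis

lemma pexp_single: "pexp w (sg i c) = sg (w \<langle>$\<rangle> i) c"
  by (rule poly_mapping_eqI) (auto simp: lookup_single when_def perm_eq_inverse_iff)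

lemma pexp_0 [simp]: "pexp w 0 = 0"
  by (rule poly_mapping_eqI) simp

text \<open>
  The substitution of variables moves $x_i$ exactly as the momenta are moved, so that $[\hat
  p_i,x_j]$ is preserved.
\<close>

locale qaction =
  fixes \<rho> :: "'n::{finite,linorder} + 'n => 'n + 'n" and w :: "'n perm"
  assumes inj: "inj \<rho>" and Inl: "\<rho> (Inl i) = Inl (w \<langle>$\<rangle> i)"
begin

abbreviation "cf \<equiv> fps_coeffwise (reindex \<rho>)"

lemma cf_add: "cf (a + b) = cf a + cf b"
  by (rule fps_ext) (simp add: reindex_add inj)

lemma cf_0: "cf 0 = 0"
  by (rule fps_ext) (simp add: reindex_0 inj)

lemma reindex_sum: "reindex \<rho> (sum f A) = (\<Sum>x\<in>A. reindex \<rho> (f x))"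
  by (induction A rule: infinite_finite_induct) (simp_all add: reindex_0 reindex_add inj)

lemma cf_mult: "cf (a * b) = cf a * cf b"
  by (rule fps_ext) (simp add: fps_mult_nth reindex_sum reindex_mult inj)

lemma cf_X: "cf fps_X = fps_X"
  by (rule fps_ext) (simp add: fps_X_def reindex_0 reindex_1 inj)

lemma cf_Df: "cf (Df i c) = Df (w \<langle>$\<rangle> i) (cf c)"
  by (rule fps_ext) (simp add: Df_def pderiv_mer_dmer dmer_reindex inj Inl[symmetric] coords_axis)

lemma lookup_qact [simp]: "lk (qact \<rho> w a) \<alpha> = cf (lk a (Poly_Mapping.map_key (Perm.apply w) \<alpha>))"
  by (simp add: qact_def lookup_map_zero cf_0)

lemma qact_add: "qact \<rho> w (a + b) = qact \<rho> w a + qact \<rho> w b"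
  by (rule poly_mapping_eqI) (simp add: lookup_add cf_add)

lemma qact_0: "qact \<rho> w 0 = 0"
  by (rule poly_mapping_eqI) (simp add: cf_0)

lemma qact_single: "qact \<rho> w (sg \<alpha> c) = sg (pexp w \<alpha>) (cf c)"
proof (rule poly_mapping_eqI)
  fix \<beta>
  have "Poly_Mapping.map_key (Perm.apply w) \<beta> = \<alpha> \<longleftrightarrow> \<beta> = pexp w \<alpha>"
    using map_key_pexp pexp_map_key by metis
  then show "lk (qact \<rho> w (sg \<alpha> c)) \<beta> = lk (sg (pexp w \<alpha>) (cf c)) \<beta>"
    by (auto simp: lookup_single when_def cf_0)
qed

lemma qact_coef: "qact \<rho> w (coef c) = coef (cf c)"
  by (simp add: coef_def qact_single)

lemma qact_mom: "qact \<rho> w (mom i) = mom (w \<langle>$\<rangle> i)"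
proof -
  have "cf 1 = 1" by (rule fps_ext) (simp add: reindex_0 reindex_1 inj)
  then show ?thesis by (simp add: mom_def qact_single pexp_single)
qed

lemma qact_single_mult: "qact \<rho> w (sg \<alpha> c * b) = qact \<rho> w (sg \<alpha> c) * qact \<rho> w b"
proof (induction b rule: poly_mapping_additive_induct)
  case (single \<beta> d)
  show ?case by (simp add: mult_single qact_single pexp_add cf_mult)
qed (simp_all add: qact_0 qact_add algebra_simps)

lemma qact_mult: "qact \<rho> w (a * b) = qact \<rho> w a * qact \<rho> w b"
proof (induction a rule: poly_mapping_additive_induct)
  case (single \<alpha> c)
  show ?case by (rule qact_single_mult)
qed (simp_all add: qact_0 qact_add algebra_simps)

lemma qact_Dq: "qact \<rho> w (Dq i a) = Dq (w \<langle>$\<rangle> i) (qact \<rho> w a)"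
  by (rule poly_mapping_eqI) (simp add: cf_Df)

lemma qact_pq: "qact \<rho> w (pq i a) = pq (w \<langle>$\<rangle> i) (qact \<rho> w a)"
  by (simp add: pq_def qact_add qact_mult qact_mom qact_coef cf_X qact_Dq)

lemma qact_star: "qact \<rho> w (star a b) = star (qact \<rho> w a) (qact \<rho> w b)"
proof (induction a arbitrary: b rule: star_induct)
  case (scalar c)
  show ?case by (simp add: star_single_0 qact_mult qact_coef qact_single)
next
  case (mom \<alpha> i c)
  have "qact \<rho> w (star (sg (\<alpha> + sg i 1) c) b) = star (sg (pexp w \<alpha>) (cf c)) (pq (w \<langle>$\<rangle> i) (qact \<rho> w b))"
    using mom by (simp only: star_single_add qact_single qact_pq)
  also have "\<dots> = star (qact \<rho> w (sg (\<alpha> + sg i 1) c)) (qact \<rho> w b)"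
    unfolding star_single_add[symmetric] qact_single pexp_add pexp_single ..
  finally show ?case .
qed (simp_all add: qact_0 qact_add star_add_left)

end

lemma qact_comp:
  assumes "qaction \<rho> w" "qaction \<rho>' w'"
  shows "qact \<rho> w (qact \<rho>' w' a) = qact (\<rho> \<circ> \<rho>') (w * w') a"
proof -
  interpret a: qaction \<rho> w by fact
  interpret b: qaction \<rho>' w' by fact
  interpret c: qaction "\<rho> \<circ> \<rho>'" "w * w'"
    by unfold_locales (simp_all add: a.inj b.inj inj_compose a.Inl b.Inl apply_times)
  show ?thesis
  proof (rule poly_mapping_eqI, rule fps_ext)
    fix \<alpha> :: "'a \<Rightarrow>\<^sub>0 nat" and k
    have "Poly_Mapping.map_key (Perm.apply w') (Poly_Mapping.map_key (Perm.apply w) \<alpha>) = Poly_Mapping.map_key (Perm.apply (w * w')) \<alpha>"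
      by (rule poly_mapping_eqI) (simp add: apply_sequence)
    then show "fps_nth (lk (qact \<rho> w (qact \<rho>' w' a)) \<alpha>) k = fps_nth (lk (qact (\<rho> \<circ> \<rho>') (w * w') a) \<alpha>) k"
      by (simp add: reindex_comp a.inj b.inj)
  qed
qed

lemma qact_id: "qact id 1 a = (a :: ('n::{finite,linorder}) qu)"
proof -
  interpret qaction "id :: 'n + 'n => _" 1 by unfold_locales simp_all
  have "Poly_Mapping.map_key (Perm.apply 1) \<alpha> = \<alpha>" for \<alpha> :: "'n \<Rightarrow>\<^sub>0 nat"
    by (rule poly_mapping_eqI) (simp only: lookup_map_key_perm, simp)
  then show ?thesis by (intro poly_mapping_eqI fps_ext) (simp add: reindex_id)
qed

lemma inj_map_sum: "inj f ==> inj g ==> inj (map_sum f g)"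
  by (rule sum.inj_map)

lemma qaction_hat: "qaction (map_sum (Perm.apply w) id) w"
  by unfold_locales (simp_all add: inj_map_sum inj_perm)

lemma qaction_vee: "qaction (map_sum id (Perm.apply w)) 1"
  by unfold_locales (simp_all add: inj_map_sum inj_perm)

lemma act_hat_qu_qact: "act_hat_qu w = qact (map_sum (Perm.apply w) id) w"
  by (simp add: fun_eq_iff act_hat_qu_def qact_def)

lemma act_vee_qu_qact: "act_vee_qu w = qact (map_sum id (Perm.apply w)) 1"
proof
  fix a :: "'a qu"
  have "perm_mom 1 a = a"
  proof (rule poly_mapping_eqI)
    fix \<alpha> :: "'a \<Rightarrow>\<^sub>0 nat"
    have "Poly_Mapping.map_key (Perm.apply 1) \<alpha> = \<alpha>" by (rule poly_mapping_eqI) (simp only: lookup_map_key_perm, simp)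
    then show "lk (perm_mom 1 a) \<alpha> = lk a \<alpha>" by simp
  qed
  then show "act_vee_qu w a = qact (map_sum id (Perm.apply w)) 1 a" by (simp add: act_vee_qu_def qact_def)
qed

subsection \<open>Crossed products\<close>

locale crossed =
  fixes mul :: "'r::ab_group_add => 'r => 'r" and act :: "'n::finite perm => 'r => 'r"
  assumes mul_assoc: "mul (mul a b) c = mul a (mul b c)"
    and mul_add_left: "mul (a + a') b = mul a b + mul a' b"
    and mul_add_right: "mul a (b + b') = mul a b + mul a b'"
    and act_add: "act w (a + b) = act w a + act w b"
    and act_mul: "act w (mul a b) = mul (act w a) (act w b)"
    and act_times: "act (v * w) a = act v (act w a)"
    and act_one: "act 1 a = a"
begin

lemma mul_0 [simp]: "mul 0 b = 0" "mul a 0 = 0"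
  using mul_add_left[of 0 0 b] mul_add_right[of a 0 0] by auto

lemma act_0 [simp]: "act w 0 = 0"
  using act_add[of w 0 0] by auto

lemma mul_sum_left: "mul (sum f A) b = (\<Sum>x\<in>A. mul (f x) b)"
  by (induction A rule: infinite_finite_induct) (simp_all add: mul_add_left)

lemma mul_sum_right: "mul b (sum f A) = (\<Sum>x\<in>A. mul b (f x))"
  by (induction A rule: infinite_finite_induct) (simp_all add: mul_add_right)

lemma act_sum: "act w (sum f A) = (\<Sum>x\<in>A. act w (f x))"
  by (induction A rule: infinite_finite_induct) (simp_all add: act_add)

abbreviation "cm \<equiv> cross_mult mul act"

lemma cross_add_left: "cm (a + a') b = cm a b + cm a' b"
  by (simp add: fun_eq_iff cross_mult_def mul_add_left sum.distrib)

lemma cross_add_right: "cm a (b + b') = cm a b + cm a b'"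
  by (simp add: fun_eq_iff cross_mult_def mul_add_right act_add sum.distrib)

lemma cross_assoc: "cm (cm a b) c = cm a (cm b c)"
proof
  fix v
  have "cm (cm a b) c v = (\<Sum>w\<in>UNIV. \<Sum>u\<in>UNIV. mul (a u) (mul (act u (b (inverse u * w))) (act w (c (inverse w * v)))))"
    by (simp add: cross_mult_def mul_sum_left mul_assoc)
  also have "\<dots> = (\<Sum>u\<in>UNIV. \<Sum>w\<in>UNIV. mul (a u) (mul (act u (b (inverse u * w))) (act w (c (inverse w * v)))))"
    by (rule sum.swap)
  also have "\<dots> = (\<Sum>u\<in>UNIV. \<Sum>w\<in>UNIV. mul (a u) (mul (act u (b w)) (act u (act w (c (inverse w * (inverse u * v)))))))"
  proof (rule sum.cong[OF refl])
    fix u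
    show "(\<Sum>w\<in>UNIV. mul (a u) (mul (act u (b (inverse u * w))) (act w (c (inverse w * v))))) =
      (\<Sum>w\<in>UNIV. mul (a u) (mul (act u (b w)) (act u (act w (c (inverse w * (inverse u * v)))))))"
      by (rule sum.reindex_bij_witness[of _ "\<lambda>w. u * w" "\<lambda>w. inverse u * w"])
        (simp_all add: act_times[symmetric] perm_group)
  qed
  also have "\<dots> = cm a (cm b c) v"
    by (simp add: cross_mult_def act_sum mul_sum_right act_mul)
  finally show "cm (cm a b) c v = cm a (cm b c) v" .
qed

lemma cross_delta: "cm (delta w a) (delta w' b) = delta (w * w') (mul a (act w b))"
proof
  fix v
  have "cm (delta w a) (delta w' b) v = (\<Sum>u\<in>UNIV. if u = w then mul a (act w (delta w' b (inverse w * v))) else 0)"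
    unfolding cross_mult_def by (rule sum.cong) (auto simp: delta_def)
  also have "\<dots> = mul a (act w (delta w' b (inverse w * v)))"
    by (simp add: finite_UNIV_perm)
  also have "\<dots> = delta (w * w') (mul a (act w b)) v"
  proof -
    have "inverse w * v = w' \<longleftrightarrow> v = w * w'" by (metis perm_mult_cancel)
    then show ?thesis by (simp add: delta_def)
  qed
  finally show "cm (delta w a) (delta w' b) v = delta (w * w') (mul a (act w b)) v" .
qed

lemma cross_delta_left: "cm (delta 1 a) b = (\<lambda>v. mul a (b v))"
proof
  fix v
  have "cm (delta 1 a) b v = (\<Sum>u\<in>(UNIV :: 'n perm set). if u = 1 then mul a (b v) else 0)"
    unfolding cross_mult_def by (rule sum.cong) (auto simp: delta_def act_one)
  then show "cm (delta 1 a) b v = mul a (b v)" by (simp add: finite_UNIV_perm)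
qed

lemma cross_delta_right: "cm b (delta 1 a) = (\<lambda>v. mul (b v) (act v a))"
proof
  fix v
  have "cm b (delta 1 a) v = (\<Sum>u\<in>UNIV. if u = v then mul (b v) (act v a) else 0)"
  proof -
    have "inverse u * v = 1 \<longleftrightarrow> u = v" for u
      by (metis perm_mult_cancel(2) mult_1_right perm.left_inverse)
    then show ?thesis unfolding cross_mult_def by (intro sum.cong) (auto simp: delta_def)
  qed
  then show "cm b (delta 1 a) v = mul (b v) (act v a)" by (simp add: finite_UNIV_perm)
qed

text \<open>
  A ring automorphism that intertwines the action with its conjugate extends to the crossed
  product by conjugating group elements. It makes the action of $\widehat W$ on the crossed
  product with $W^\vee$, and the diagonal action below, multiplicative.
\<close>

lemma cross_hom:
  assumes add: "\<And>a b. \<theta> (a + b) = \<theta> a + \<theta> b" and hom: "\<And>a b. \<theta> (mul a b) = mul (\<theta> a) (\<theta> b)"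
    and eq: "\<And>w a. \<theta> (act w a) = act (u * w * inverse u) (\<theta> a)"
  shows "(\<lambda>v. \<theta> (cm a b (inverse u * v * u))) =
    cm (\<lambda>v. \<theta> (a (inverse u * v * u))) (\<lambda>v. \<theta> (b (inverse u * v * u)))"
proof
  fix v
  have "\<theta> 0 = 0" using add[of 0 0] by simp
  then have sum: "\<theta> (sum f A) = (\<Sum>x\<in>A. \<theta> (f x))" for f :: "'n perm => 'r" and A
    by (induction A rule: infinite_finite_induct) (simp_all add: add)
  have "\<theta> (cm a b (inverse u * v * u)) =
     (\<Sum>w\<in>UNIV. mul (\<theta> (a w)) (act (u * w * inverse u) (\<theta> (b (inverse w * (inverse u * v * u))))))"
    by (simp add: cross_mult_def sum hom eq)
  also have "\<dots> = cm (\<lambda>v. \<theta> (a (inverse u * v * u))) (\<lambda>v. \<theta> (b (inverse u * v * u))) v"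
    unfolding cross_mult_def
    by (rule sum.reindex_bij_witness[of _ "\<lambda>w. inverse u * w * u" "\<lambda>w. u * w * inverse u"])
      (simp_all add: perm_group)
  finally show "\<theta> (cm a b (inverse u * v * u)) =
     cm (\<lambda>v. \<theta> (a (inverse u * v * u))) (\<lambda>v. \<theta> (b (inverse u * v * u))) v" .
qed

end

lemma umat_mult_assoc:
  assumes "\<And>a b c. mul (mul a b) c = mul a (mul b c)" "\<And>a b c. mul (a + b) c = mul a c + mul b (c::'r::ab_group_add)"
    "\<And>a b c. mul a (b + c) = mul a b + mul a c"
  shows "umat_mult mul (umat_mult mul A B) C = umat_mult mul A (umat_mult mul B (C :: ('n::finite, 'd::finite, 'r) umat))"
proof (intro ext)
  fix I J
  have z: "mul 0 c = 0" "mul c 0 = 0" for c using assms(2)[of 0 0 c] assms(3)[of c 0 0] by auto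
  have l: "mul (sum f X) c = (\<Sum>x\<in>X. mul (f x) c)" for f :: "('n => 'd) => 'r" and X c
    by (induction X rule: infinite_finite_induct) (simp_all add: assms(2) z)
  have r: "mul c (sum f X) = (\<Sum>x\<in>X. mul c (f x))" for f :: "('n => 'd) => 'r" and X c
    by (induction X rule: infinite_finite_induct) (simp_all add: assms(3) z)
  show "umat_mult mul (umat_mult mul A B) C I J = umat_mult mul A (umat_mult mul B C) I J"
    unfolding umat_mult_def l r assms(1) by (rule sum.swap)
qed

abbreviation "um \<equiv> umat_mult star"

text \<open>
  The action of $\widehat W$ on one matrix; conjugation by a permutation of tensor factors
  permutes the multi-indices.
\<close>

definition hatM :: "'n perm => ('n::finite, 'd, 'n qu) umat => ('n, 'd, 'n qu) umat" where
  "hatM w A = (\<lambda>I J. act_hat_qu w (A (I \<circ> Perm.apply w) (J \<circ> Perm.apply w)))"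

lemma act_hat_hatM: "act_hat w a = (\<lambda>v. hatM w (a v))"
  by (simp add: act_hat_def hatM_def)

lemma um_add_left: "um (A + A') B = um A B + um A' B"
  by (simp add: fun_eq_iff umat_mult_def star_add_left sum.distrib)

lemma um_add_right: "um A (B + B') = um A B + um A B'"
  by (simp add: fun_eq_iff umat_mult_def star_add_right sum.distrib)

lemma um_assoc: "um (um A B) C = um A (um B C)"
  by (rule umat_mult_assoc) (simp_all add: star_assoc star_add_left star_add_right)

lemma qact_sum: "qaction \<rho> w ==> qact \<rho> w (sum f A) = (\<Sum>x\<in>A. qact \<rho> w (f x))"
  by (induction A rule: infinite_finite_induct) (simp_all add: qaction.qact_0 qaction.qact_add)

lemma act_vee_add: "act_vee w (A + (B :: ('n::{finite,linorder}, 'd, 'n qu) umat)) = act_vee w A + act_vee w B"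
  by (simp add: fun_eq_iff act_vee_def act_vee_qu_qact qaction.qact_add[OF qaction_vee])

lemma act_vee_um: "act_vee w (um A B) = um (act_vee w A) (act_vee w B)"
  by (simp add: fun_eq_iff act_vee_def umat_mult_def act_vee_qu_qact qact_sum[OF qaction_vee]
      qaction.qact_star[OF qaction_vee])

lemma map_sum_id_comp: "map_sum id f \<circ> map_sum id g = map_sum id (f \<circ> g)"
  "map_sum f id \<circ> map_sum g id = map_sum (f \<circ> g) id"
  "map_sum f id \<circ> map_sum id g = map_sum f g" "map_sum id g \<circ> map_sum f id = map_sum f g"
  by (simp_all add: map_sum.comp)

lemma act_vee_times: "act_vee (v * w) (A :: ('n::{finite,linorder}, 'd, 'n qu) umat) = act_vee v (act_vee w A)"
  by (simp add: fun_eq_iff act_vee_def act_vee_qu_qact qact_comp[OF qaction_vee qaction_vee] map_sum_id_comp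
      apply_times)

lemma act_vee_one: "act_vee 1 A = (A :: ('n::{finite,linorder}, 'd, 'n qu) umat)"
  by (simp add: fun_eq_iff act_vee_def act_vee_qu_qact map_sum.id qact_id)

lemma hatM_add: "hatM w (A + (B :: ('n::{finite,linorder}, 'd, 'n qu) umat)) = hatM w A + hatM w B"
  by (simp add: fun_eq_iff hatM_def act_hat_qu_qact qaction.qact_add[OF qaction_hat])

lemma bij_comp_perm: "bij (\<lambda>I :: 'n => 'd. I \<circ> Perm.apply w)"
proof (rule bij_betw_byWitness[where f' = "\<lambda>I. I \<circ> Perm.apply (inverse w)"])
  show "\<forall>I\<in>UNIV. (I \<circ> Perm.apply w) \<circ> Perm.apply (inverse w) = I"
    "\<forall>I\<in>UNIV. (I \<circ> Perm.apply (inverse w)) \<circ> Perm.apply w = I"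
    by (simp_all add: fun_eq_iff)
qed simp_all

lemma hatM_um: "hatM w (um A B) = um (hatM w A) (hatM w B)"
proof (intro ext)
  fix I J
  have "hatM w (um A B) I J = (\<Sum>K\<in>UNIV. star (act_hat_qu w (A (I \<circ> Perm.apply w) K)) (act_hat_qu w (B K (J \<circ> Perm.apply w))))"
    by (simp add: hatM_def umat_mult_def act_hat_qu_qact qact_sum[OF qaction_hat] qaction.qact_star[OF qaction_hat])
  also have "\<dots> = um (hatM w A) (hatM w B) I J"
    unfolding umat_mult_def hatM_def
    by (rule sum.reindex_bij_betw[OF bij_comp_perm, symmetric])
  finally show "hatM w (um A B) I J = um (hatM w A) (hatM w B) I J" .
qed

lemma hatM_times: "hatM (v * w) (A :: ('n::{finite,linorder}, 'd, 'n qu) umat) = hatM v (hatM w A)"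
  by (simp add: fun_eq_iff hatM_def act_hat_qu_qact qact_comp[OF qaction_hat qaction_hat] map_sum_id_comp
      apply_times comp_assoc)

lemma hatM_one: "hatM 1 A = (A :: ('n::{finite,linorder}, 'd, 'n qu) umat)"
  by (simp add: fun_eq_iff hatM_def act_hat_qu_qact map_sum.id qact_id)

lemma hatM_act_vee: "hatM w (act_vee v (A :: ('n::{finite,linorder}, 'd, 'n qu) umat)) = act_vee v (hatM w A)"
  by (simp add: fun_eq_iff hatM_def act_vee_def act_hat_qu_qact act_vee_qu_qact
      qact_comp[OF qaction_hat qaction_vee] qact_comp[OF qaction_vee qaction_hat] map_sum_id_comp)

interpretation W: crossed "umat_mult star :: ('n::{finite,linorder}, 'd::finite, 'n qu) umat => _" act_vee
  by unfold_locales (simp_all only: um_add_left um_add_right um_assoc act_vee_add act_vee_um act_vee_times act_vee_one)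

lemma mult_W_add: "mult_W (a + a') b = mult_W a b + mult_W a' b" "mult_W a (b + b') = mult_W a b + mult_W a b'"
  by (simp_all only: mult_W_def W.cross_add_left W.cross_add_right)

lemma act_hat_mult_W: "act_hat w (mult_W a b) = mult_W (act_hat w a) (act_hat w b)"
proof -
  have i: "inverse 1 * v * 1 = v" "1 * v * inverse 1 = v" for v :: "'a perm"
    by (simp_all add: perm.inverse_neutral)
  show ?thesis
    using W.cross_hom[of "hatM w" 1 a b, OF hatM_add hatM_um]
    by (simp only: act_hat_hatM mult_W_def hatM_act_vee i)
qed

interpretation WW: crossed "mult_W :: ('n::{finite,linorder}, 'd::finite) qu_W => _" act_hat
proof unfold_locales
  fix a b c :: "('n::{finite,linorder}, 'd::finite) qu_W" and v w :: "'n perm"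
  show "mult_W (mult_W a b) c = mult_W a (mult_W b c)" by (simp only: mult_W_def W.cross_assoc)
  show "act_hat w (a + b) = act_hat w a + act_hat w b" by (simp add: act_hat_hatM hatM_add fun_eq_iff)
qed (simp_all only: mult_W_add act_hat_mult_W, simp_all only: act_hat_hatM hatM_times hatM_one)

lemma mult_W_assoc: "mult_W (mult_W a b) c = mult_W a (mult_W b c)"
  by (rule WW.mul_assoc)

lemma mult_WW_add: "mult_WW (a + a') b = mult_WW a b + mult_WW a' b" "mult_WW a (b + b') = mult_WW a b + mult_WW a b'"
  and mult_WW_assoc: "mult_WW (mult_WW a b) c = mult_WW a (mult_WW b c)"
  by (simp_all only: mult_WW_def WW.cross_add_left WW.cross_add_right WW.cross_assoc)

text \<open>
  An element concentrated at $\widehat w\otimes 1$; Dunkl operators are sums of these.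
\<close>

definition spread :: "'n perm => ('n, 'd, 'n qu) umat => ('n::finite, 'd) qu_WW" where
  "spread w A = delta w (delta 1 A)"

lemma act_hat_delta: "act_hat w (delta v A) = delta v (hatM w (A :: ('n::{finite,linorder}, 'd, 'n qu) umat))"
proof -
  have "hatM w 0 = 0" using hatM_add[of w 0 0] by simp
  then show ?thesis by (auto simp: act_hat_hatM delta_def fun_eq_iff zero_fun_def)
qed

lemma mult_WW_spread: "mult_WW (spread w A) (spread v B) = spread (w * v) (um A (hatM w B))"
  unfolding mult_WW_def spread_def WW.cross_delta act_hat_delta
  unfolding mult_W_def W.cross_delta act_vee_one mult_1_left ..

subsection \<open>The restriction map\<close>

lemma sum_fun_apply: "(\<Sum>a\<in>A. f a) x = (\<Sum>a\<in>A. f a x :: 'b::comm_monoid_add)"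
  by (induction A rule: infinite_finite_induct) (simp_all add: zero_fun_def)

text \<open>
  The diagonal action of $u$: conjugation by $\widehat u\,u^\vee$. On products whose right
  factor is invariant $\mathrm{Res}^\vee$ is multiplicative.
\<close>

definition diag_act :: "'n perm => ('n::finite, 'd) qu_WW => ('n, 'd) qu_WW" where
  "diag_act u X = (\<lambda>w v. act_vee u (hatM u (X (inverse u * w * u) (inverse u * v * u))))"

lemma diag_act_add: "diag_act u (X + (Y :: ('n::{finite,linorder}, 'd) qu_WW)) = diag_act u X + diag_act u Y"
  by (simp add: diag_act_def fun_eq_iff act_vee_add hatM_add)

lemma diag_act_mult: "diag_act u (mult_WW X Y) = mult_WW (diag_act u X) (diag_act u (Y :: ('n::{finite,linorder}, 'd::finite) qu_WW))"
proof -
  define \<theta> where "\<theta> a = (\<lambda>v. act_vee u (hatM u (a (inverse u * v * u))))" for a :: "('n, 'd) qu_W"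
  have 1: "\<theta> (a + b) = \<theta> a + \<theta> b" for a b
    by (simp add: \<theta>_def fun_eq_iff act_vee_add hatM_add)
  have 2: "\<theta> (mult_W a b) = mult_W (\<theta> a) (\<theta> b)" for a b
    unfolding \<theta>_def mult_W_def
    by (rule W.cross_hom)
      (simp_all only: act_vee_add hatM_add act_vee_um hatM_um hatM_act_vee act_vee_times[symmetric] perm_group)
  have 3: "\<theta> (act_hat w a) = act_hat (u * w * inverse u) (\<theta> a)" for w a
    unfolding \<theta>_def act_hat_hatM
    by (simp only: hatM_act_vee hatM_times[symmetric] perm_group)
  show ?thesis
    using WW.cross_hom[of \<theta> u X Y, OF 1 2 3] unfolding mult_WW_def diag_act_def \<theta>_def by (simp add: fun_eq_iff)
qed

text \<open>
  $\mathrm{Res}^\vee$ replaces $\widehat w_1$ by $(w_1^{-1})^\vee$ at the right end. In a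
  product $XY$ the factor $\widehat a$ of $X$ must first be moved past $Y$; the invariance of
  $Y$ under $\widehat a\,a^\vee$ says that passing $\widehat a$ has the same effect as passing
  $(a^{-1})^\vee$. After the substitution $b = ca$ both sides are the same triple sum.
\<close>

theorem Res_vee_mult:
  assumes inv: "\<And>u. diag_act u Y = Y"
  shows "Res_vee (mult_WW X Y) = mult_W (Res_vee X) (Res_vee (Y :: ('n::{finite,linorder}, 'd::finite) qu_WW))"
proof
  fix v
  have inv': "act_vee u (hatM u (Y w1 w2)) = Y (u * w1 * inverse u) (u * w2 * inverse u)" for u w1 w2
  proof -
    have "Y (u * w1 * inverse u) (u * w2 * inverse u) = diag_act u Y (u * w1 * inverse u) (u * w2 * inverse u)"
      by (simp add: inv)
    also have "\<dots> = act_vee u (hatM u (Y (inverse u * (u * w1 * inverse u) * u) (inverse u * (u * w2 * inverse u) * u)))"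
      by (simp add: diag_act_def)
    also have "\<dots> = act_vee u (hatM u (Y w1 w2))" by (simp only: perm_group)
    finally show ?thesis by simp
  qed
  have "Res_vee (mult_WW X Y) v = (\<Sum>w\<in>UNIV. \<Sum>a\<in>UNIV. \<Sum>b\<in>UNIV.
      um (X a b) (act_vee b (hatM a (Y (inverse a * w) (inverse b * (v * w))))))"
    by (simp add: Res_vee_def mult_WW_def cross_mult_def mult_W_def act_hat_hatM sum_fun_apply)
  also have "\<dots> = (\<Sum>a\<in>UNIV. \<Sum>w\<in>UNIV. \<Sum>b\<in>UNIV.
      um (X a b) (act_vee b (hatM a (Y (inverse a * w) (inverse b * (v * w))))))"
    by (rule sum.swap)
  also have "\<dots> = (\<Sum>a\<in>UNIV. \<Sum>b\<in>UNIV. \<Sum>w\<in>UNIV.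
      um (X a b) (act_vee b (hatM a (Y (inverse a * w) (inverse b * (v * w))))))"
    by (rule sum.cong[OF refl], rule sum.swap)
  also have "\<dots> = (\<Sum>a\<in>UNIV. \<Sum>c\<in>UNIV. \<Sum>w\<in>UNIV.
      um (X a (c * a)) (act_vee (c * a) (hatM a (Y (inverse a * w) (inverse (c * a) * (v * w))))))"
  proof (rule sum.cong[OF refl])
    fix a
    show "(\<Sum>b\<in>UNIV. \<Sum>w\<in>UNIV. um (X a b) (act_vee b (hatM a (Y (inverse a * w) (inverse b * (v * w)))))) =
      (\<Sum>c\<in>UNIV. \<Sum>w\<in>UNIV. um (X a (c * a)) (act_vee (c * a) (hatM a (Y (inverse a * w) (inverse (c * a) * (v * w))))))"
      by (rule sum.reindex_bij_witness[of _ "\<lambda>c. c * a" "\<lambda>b. b * inverse a"])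
        (simp_all only: perm_group UNIV_I)
  qed
  also have "\<dots> = (\<Sum>a\<in>UNIV. \<Sum>c\<in>UNIV. \<Sum>w\<in>UNIV.
      um (X a (c * a)) (act_vee c (Y (w * inverse a) (inverse c * (v * (w * inverse a))))))"
  proof (rule sum.cong[OF refl], rule sum.cong[OF refl], rule sum.cong[OF refl])
    fix a c w :: "'n perm"
    have e1: "a * (inverse a * w) * inverse a = w * inverse a"
      by (simp only: perm_group)
    have e2: "a * (inverse (c * a) * (v * w)) * inverse a = inverse c * (v * (w * inverse a))"
      by (simp only: perm_group)
    show "um (X a (c * a)) (act_vee (c * a) (hatM a (Y (inverse a * w) (inverse (c * a) * (v * w))))) =
      um (X a (c * a)) (act_vee c (Y (w * inverse a) (inverse c * (v * (w * inverse a)))))"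
      by (simp only: act_vee_times inv' e1 e2)
  qed
  also have "\<dots> = (\<Sum>a\<in>UNIV. \<Sum>c\<in>UNIV. \<Sum>w\<in>UNIV.
      um (X a (c * a)) (act_vee c (Y w (inverse c * (v * w)))))"
  proof (rule sum.cong[OF refl], rule sum.cong[OF refl])
    fix a c
    show "(\<Sum>w\<in>UNIV. um (X a (c * a)) (act_vee c (Y (w * inverse a) (inverse c * (v * (w * inverse a)))))) =
      (\<Sum>w\<in>UNIV. um (X a (c * a)) (act_vee c (Y w (inverse c * (v * w)))))"
      by (rule sum.reindex_bij_witness[of _ "\<lambda>w. w * a" "\<lambda>w. w * inverse a"])
        (simp_all only: perm_group UNIV_I)
  qed
  also have "\<dots> = (\<Sum>c\<in>UNIV. \<Sum>a\<in>UNIV. \<Sum>w\<in>UNIV.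
      um (X a (c * a)) (act_vee c (Y w (inverse c * (v * w)))))"
    by (rule sum.swap)
  also have "\<dots> = mult_W (Res_vee X) (Res_vee Y) v"
    unfolding mult_W_def cross_mult_def Res_vee_def W.mul_sum_left W.mul_sum_right W.act_sum mult.assoc
    by (rule sum.cong[OF refl], rule sum.swap)
  finally show "Res_vee (mult_WW X Y) v = mult_W (Res_vee X) (Res_vee Y) v" .
qed

section \<open>The Jacobi theta function\<close>

lemma summable_on_int:
  fixes g :: "int => real"
  assumes "\<And>k. g k \<ge> 0" "summable (\<lambda>n. g (int n))" "summable (\<lambda>n. g (- int n))"
  shows "g summable_on UNIV"
proof -
  have "g summable_on range int"
    using assms by (subst summable_on_reindex) (auto simp: inj_on_def summable_on_UNIV_nonneg_real_iff comp_def)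
  moreover have "g summable_on range (\<lambda>n. - int n)"
    using assms by (subst summable_on_reindex) (auto simp: inj_on_def summable_on_UNIV_nonneg_real_iff comp_def)
  moreover have "range int \<union> range (\<lambda>n. - int n) = UNIV"
  proof -
    have "k \<in> range int \<union> range (\<lambda>n. - int n)" for k by (cases k rule: int_cases2) auto
    then show ?thesis by blast
  qed
  ultimately show ?thesis by (metis summable_on_union)
qed

lemma product_summable:
  fixes f :: "'a => complex" and g :: "'b => complex"
  assumes f: "(\<lambda>x. norm (f x)) summable_on A" and g: "(\<lambda>x. norm (g x)) summable_on B"
  shows "(\<lambda>p. norm (f (fst p) * g (snd p))) summable_on A \<times> B"
    "(\<Sum>\<^sub>\<infinity>p\<in>A \<times> B. f (fst p) * g (snd p)) = infsum f A * infsum g B"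
proof -
  show s: "(\<lambda>p. norm (f (fst p) * g (snd p))) summable_on A \<times> B"
  proof (rule summable_on_SigmaI)
    show "((\<lambda>y. norm (f (fst (x, y)) * g (snd (x, y)))) has_sum norm (f x) * infsum (\<lambda>y. norm (g y)) B) B" for x
      using has_sum_cmult_right[OF has_sum_infsum[OF g], of "norm (f x)"] by (simp add: norm_mult)
    show "(\<lambda>x. norm (f x) * infsum (\<lambda>y. norm (g y)) B) summable_on A"
      by (rule summable_on_cmult_left[OF f])
  qed simp
  have "(\<Sum>\<^sub>\<infinity>p\<in>A \<times> B. f (fst p) * g (snd p)) = (\<Sum>\<^sub>\<infinity>x\<in>A. \<Sum>\<^sub>\<infinity>y\<in>B. f x * g y)"
    using infsum_Sigma_banach[OF abs_summable_summable[OF s]] by simp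
  also have "\<dots> = infsum f A * infsum g B"
    by (simp add: infsum_cmult_right' infsum_cmult_left')
  finally show "(\<Sum>\<^sub>\<infinity>p\<in>A \<times> B. f (fst p) * g (snd p)) = infsum f A * infsum g B" .
qed

lemma summable_exp_abs: "(\<lambda>k::int. exp (- \<bar>of_int k\<bar>) :: real) summable_on UNIV"
proof (rule summable_on_int)
  have "summable (\<lambda>n. exp (-1::real) ^ n)" by (rule summable_geometric) simp
  then show "summable (\<lambda>n. exp (- \<bar>real_of_int (int n)\<bar>))" "summable (\<lambda>n. exp (- \<bar>real_of_int (- int n)\<bar>))"
    by (simp_all add: exp_of_nat_mult[symmetric])
qed simp

context
  fixes \<tau> :: complex
  assumes \<tau>: "Im \<tau> > 0"
begin

definition E_term :: "complex => int => complex" where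
  "E_term x M = exp (of_real pi * \<i> * \<tau> * (of_int M)\<^sup>2 / 2 + 2 * of_real pi * \<i> * of_int M * x)"

text \<open>
  The summand of the theta series. In a product of two thetas at $x\pm y$ the indices $k,l$ are
  replaced by $k+l+1$ and $k-l$, which splits a term into \<open>E_term\<close> at $x$ and
  \<open>E_term\<close> at $y$; the two new indices have opposite parity.
\<close>

definition T_term :: "complex => int => complex" where
  "T_term z k = exp (of_real pi * \<i> * \<tau> * (of_int k + 1/2)\<^sup>2 + 2 * of_real pi * \<i> * (of_int k + 1/2) * (z + 1/2))"

lemma jtheta_T: "jtheta z \<tau> = infsum (T_term z) UNIV"
  unfolding jtheta_def by (rule infsum_cong) (simp add: T_term_def)

lemma gauss_bound:
  assumes a: "a > 0" and b: "\<bar>b\<bar> \<le> B"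
  shows "exp (- a * m\<^sup>2 + b * m) \<le> exp ((B + 1)\<^sup>2 / (4 * a)) * exp (- \<bar>m\<bar> :: real)"
proof -
  have "b * m \<le> B * \<bar>m\<bar>"
  proof -
    have "b * m \<le> \<bar>b\<bar> * \<bar>m\<bar>" by (metis abs_ge_self abs_mult)
    also have "\<dots> \<le> B * \<bar>m\<bar>" using b by (intro mult_right_mono) auto
    finally show ?thesis .
  qed
  moreover have "- a * m\<^sup>2 + (B + 1) * \<bar>m\<bar> \<le> (B + 1)\<^sup>2 / (4 * a)"
  proof -
    have m2: "m\<^sup>2 = \<bar>m\<bar>\<^sup>2" by simp
    have "0 \<le> (2 * a * \<bar>m\<bar> - (B + 1))\<^sup>2 / (4 * a)" using a by simp
    also have "(2 * a * \<bar>m\<bar> - (B + 1))\<^sup>2 = 4 * a * (a * \<bar>m\<bar>\<^sup>2 - (B + 1) * \<bar>m\<bar>) + (B + 1)\<^sup>2"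
      by (simp only: power2_eq_square) (simp add: algebra_simps)
    also have "\<dots> / (4 * a) = (a * \<bar>m\<bar>\<^sup>2 - (B + 1) * \<bar>m\<bar>) + (B + 1)\<^sup>2 / (4 * a)"
      using a by (simp add: add_divide_distrib)
    finally show ?thesis unfolding m2 by linarith
  qed
  ultimately have "- a * m\<^sup>2 + b * m \<le> (B + 1)\<^sup>2 / (4 * a) + - \<bar>m\<bar>" by (simp add: algebra_simps)
  then show ?thesis unfolding exp_add[symmetric] by simp
qed

lemma E_bound:
  assumes "\<bar>Im x\<bar> \<le> B"
  shows "norm (E_term x M) \<le> exp ((2 * pi * B + 1)\<^sup>2 / (4 * (pi * Im \<tau> / 2))) * exp (- \<bar>of_int M\<bar>)"
proof -
  have "norm (E_term x M) = exp (- (pi * Im \<tau> / 2) * (of_int M)\<^sup>2 + (- 2 * pi * Im x) * of_int M)"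
    by (simp add: E_term_def power2_eq_square algebra_simps)
  also have "\<dots> \<le> exp ((2 * pi * B + 1)\<^sup>2 / (4 * (pi * Im \<tau> / 2))) * exp (- \<bar>of_int M\<bar>)"
    by (rule gauss_bound) (use assms \<tau> in \<open>auto simp: abs_mult\<close>)
  finally show ?thesis .
qed

lemma E_summable: "(\<lambda>M. norm (E_term x M)) summable_on A"
proof -
  have "(\<lambda>M. norm (E_term x M)) summable_on UNIV"
    by (rule summable_on_comparison_test[OF summable_on_cmult_right[OF summable_exp_abs]])
      (use E_bound[of x "\<bar>Im x\<bar>"] in auto)
  then show ?thesis using summable_on_subset by (metis subset_UNIV)
qed

lemma T_bound:
  assumes "\<bar>Im z\<bar> \<le> B"
  shows "norm (T_term z k) \<le> exp ((2 * pi * B + 1)\<^sup>2 / (4 * (pi * Im \<tau>))) * exp 1 * exp (- \<bar>of_int k\<bar>)"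
proof -
  have "norm (T_term z k) = exp (- (pi * Im \<tau>) * (of_int k + 1/2)\<^sup>2 + (- 2 * pi * Im z) * (of_int k + 1/2))"
    by (simp add: T_term_def power2_eq_square algebra_simps)
  also have "\<dots> \<le> exp ((2 * pi * B + 1)\<^sup>2 / (4 * (pi * Im \<tau>))) * exp (- \<bar>of_int k + 1/2\<bar>)"
    by (rule gauss_bound) (use assms \<tau> in \<open>auto simp: abs_mult\<close>)
  also have "\<dots> \<le> exp ((2 * pi * B + 1)\<^sup>2 / (4 * (pi * Im \<tau>))) * (exp 1 * exp (- \<bar>of_int k\<bar>))"
    unfolding exp_add[symmetric] by simp
  finally show ?thesis by (simp add: mult.assoc)
qed

lemma T_summable: "(\<lambda>M. norm (T_term x M)) summable_on A"
proof -
  have "(\<lambda>M. norm (T_term x M)) summable_on UNIV"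
    by (rule summable_on_comparison_test[OF summable_on_cmult_right[OF summable_exp_abs]])
      (use T_bound[of x "\<bar>Im x\<bar>"] in auto)
  then show ?thesis using summable_on_subset by (metis subset_UNIV)
qed

lemma jtheta_entire: "(\<lambda>z. jtheta z \<tau>) holomorphic_on A"
proof -
  have "(\<lambda>z. jtheta z \<tau>) holomorphic_on ball z0 1" for z0
  proof -
    let ?B = "\<bar>Im z0\<bar> + 1"
    let ?M = "\<lambda>k::int. exp ((2 * pi * ?B + 1)\<^sup>2 / (4 * (pi * Im \<tau>))) * exp 1 * exp (- \<bar>of_int k\<bar>)"
    have ul: "uniform_limit (cball z0 1) (\<lambda>X z. \<Sum>k\<in>X. T_term z k) (\<lambda>z. \<Sum>\<^sub>\<infinity>k. T_term z k) (finite_subsets_at_top UNIV)"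
    proof (rule Weierstrass_m_test_general[where M = ?M])
      show "?M summable_on UNIV" by (rule summable_on_cmult_right[OF summable_exp_abs])
      fix k z assume "z \<in> cball z0 1"
      then have "\<bar>Im z - Im z0\<bar> \<le> 1"
        by (metis abs_Im_le_cmod dist_commute dist_norm mem_cball minus_complex.simps(2) order_trans)
      then have "\<bar>Im z\<bar> \<le> ?B" by linarith
      then show "norm (T_term z k) \<le> ?M k" by (rule T_bound)
    qed
    have "\<forall>\<^sub>F X in finite_subsets_at_top UNIV. continuous_on (cball z0 1) (\<lambda>z. \<Sum>k\<in>X. T_term z k) \<and>
        (\<lambda>z. \<Sum>k\<in>X. T_term z k) holomorphic_on ball z0 1"
      unfolding T_term_def by (intro always_eventually allI conjI continuous_intros holomorphic_intros)
    then show ?thesis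
      using holomorphic_uniform_limit[OF _ ul finite_subsets_at_top_neq_bot] unfolding jtheta_T by blast
  qed
  then have "(\<lambda>z. jtheta z \<tau>) field_differentiable at z0" for z0
    by (meson centre_in_ball holomorphic_on_imp_differentiable_at open_ball zero_less_one)
  then show ?thesis by (simp add: holomorphic_on_def field_differentiable_at_within)
qed

lemma exp_2pi_int: "exp (2 * of_real pi * \<i> * of_int k) = 1"
  using exp_integer_2pi[of "of_int k"] by (simp add: mult_ac)

lemma exp_pi_odd: "exp (of_real pi * \<i> * of_int (2 * k + 1)) = -1"
proof -
  have "exp (of_real pi * \<i> * of_int (2 * k + 1)) = exp (2 * of_real pi * \<i> * of_int k) * exp (of_real pi * \<i>)"
    unfolding exp_add[symmetric] by (simp add: algebra_simps)
  then show ?thesis by (simp add: exp_2pi_int exp_pi_i')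
qed

lemma T_term_odd: "T_term (- z) (- 1 - k) = - T_term z k"
proof -
  have "T_term (- z) (- 1 - k) = T_term z k * exp (of_real pi * \<i> * of_int (2 * (- 1 - k) + 1))"
    unfolding T_term_def exp_add[symmetric] by (simp add: field_simps power2_eq_square)
  then show ?thesis unfolding exp_pi_odd by simp
qed

lemma jtheta_odd: "jtheta (- z) \<tau> = - jtheta z \<tau>"
proof -
  have "bij (\<lambda>k::int. - 1 - k)" by (rule bij_betw_byWitness[of _ "\<lambda>k. - 1 - k"]) auto
  then have "infsum (T_term (- z)) UNIV = infsum (\<lambda>k. T_term (- z) (- 1 - k)) UNIV"
    using infsum_reindex_bij_betw[of "\<lambda>k. - 1 - k" UNIV UNIV "T_term (- z)"] by simp
  then show ?thesis by (simp add: jtheta_T T_term_odd infsum_uminus)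
qed

lemma jtheta_0 [simp]: "jtheta 0 \<tau> = 0"
  using jtheta_odd[of 0] by simp

lemma jtheta_plus_1: "jtheta (z + 1) \<tau> = - jtheta z \<tau>"
proof -
  have "T_term (z + 1) k = - T_term z k" for k
  proof -
    have "T_term (z + 1) k = T_term z k * exp (of_real pi * \<i> * of_int (2 * k + 1))"
      unfolding T_term_def exp_add[symmetric] by (simp add: field_simps power2_eq_square)
    then show ?thesis unfolding exp_pi_odd by simp
  qed
  then have "T_term (z + 1) = (\<lambda>k. - T_term z k)" by blast
  then show ?thesis by (simp add: jtheta_T infsum_uminus)
qed

lemma jtheta_plus_tau: "jtheta (z + \<tau>) \<tau> = - exp (- of_real pi * \<i> * \<tau> - 2 * of_real pi * \<i> * z) * jtheta z \<tau>"
proof -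
  have e: "T_term (z + \<tau>) k = - exp (- of_real pi * \<i> * \<tau> - 2 * of_real pi * \<i> * z) * T_term z (k + 1)" for k
  proof -
    have "T_term (z + \<tau>) k = exp (of_real pi * \<i> * of_int (2 * (-1) + 1)) * exp (- of_real pi * \<i> * \<tau> - 2 * of_real pi * \<i> * z) * T_term z (k + 1)"
      unfolding T_term_def exp_add[symmetric] by (simp add: field_simps power2_eq_square)
    then show ?thesis unfolding exp_pi_odd by simp
  qed
  have "bij (\<lambda>k::int. k + 1)" by (rule bij_betw_byWitness[of _ "\<lambda>k. k - 1"]) auto
  then have "infsum (\<lambda>k. T_term z (k + 1)) UNIV = infsum (T_term z) UNIV"
    using infsum_reindex_bij_betw[of "\<lambda>k. k + 1" UNIV UNIV "T_term z"] by simp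
  then show ?thesis unfolding jtheta_T e infsum_cmult_right' by simp
qed

definition A_sum :: "complex => complex" where "A_sum x = infsum (E_term x) {M. even M}"
definition B_sum :: "complex => complex" where "B_sum x = infsum (E_term x) {M. odd M}"

text \<open>
  Separating the two parity classes writes the product as a $2\times2$ minor in $x$ and $y$.
\<close>

lemma jtheta_product: "jtheta (x + y) \<tau> * jtheta (x - y) \<tau> = A_sum x * B_sum y - B_sum x * A_sum y"
proof -
  let ?O = "{p :: int \<times> int. odd (fst p + snd p)}"
  let ?h = "\<lambda>p :: int \<times> int. (fst p + snd p + 1, fst p - snd p)"
  let ?F = "\<lambda>p :: int \<times> int. (if even (fst p) then 1 else -1) * (E_term x (fst p) * E_term y (snd p))"
  have bij: "bij_betw ?h UNIV ?O"
  proof (rule bij_betw_byWitness[of _ "\<lambda>p. ((fst p + snd p - 1) div 2, (fst p - snd p - 1) div 2)"])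
    show "\<forall>p\<in>UNIV. ((fst (?h p) + snd (?h p) - 1) div 2, (fst (?h p) - snd (?h p) - 1) div 2) = p" by auto
    show "\<forall>p\<in>?O. ?h ((fst p + snd p - 1) div 2, (fst p - snd p - 1) div 2) = p"
    proof
      fix p :: "int \<times> int" assume "p \<in> ?O"
      then have "odd (fst p + snd p)" by simp
      then obtain c where "fst p + snd p = 2 * c + 1" by (rule oddE)
      then have e: "fst p + snd p - 1 = c * 2" "fst p - snd p - 1 = (c - snd p) * 2" "fst p = 2 * c + 1 - snd p" by simp_all
      have "(fst p + snd p - 1) div 2 = c" "(fst p - snd p - 1) div 2 = c - snd p"
        unfolding e(1,2) by simp_all
      then show "?h ((fst p + snd p - 1) div 2, (fst p - snd p - 1) div 2) = p"
        using e(3) by (simp add: prod_eq_iff del: div_add1_eq)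
    qed
  qed auto
  have t: "T_term (x + y) (fst p) * T_term (x - y) (snd p) = ?F (?h p)" for p :: "int \<times> int"
  proof -
    let ?M = "fst p + snd p + 1"
    have "T_term (x + y) (fst p) * T_term (x - y) (snd p) =
       exp (of_real pi * \<i> * of_int ?M) * (E_term x ?M * E_term y (fst p - snd p))"
      unfolding T_term_def E_term_def exp_add[symmetric]
      by (rule arg_cong[of _ _ exp]) (simp add: field_simps power2_eq_square)
    moreover have "exp (of_real pi * \<i> * of_int ?M) = (if even ?M then 1 else -1)"
    proof (cases "even ?M")
      case True
      then obtain c where "?M = 2 * c" by blast
      then have "of_real pi * \<i> * of_int ?M = 2 * of_real pi * \<i> * (of_int c :: complex)" by simp
      then show ?thesis using True by (simp only: exp_2pi_int) simp
    next
      case False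
      then obtain c where "?M = 2 * c + 1" by (rule oddE)
      then show ?thesis using False exp_pi_odd[of c] by simp
    qed
    ultimately show ?thesis by simp
  qed
  have nE: "(\<lambda>p. norm (E_term x (fst p) * E_term y (snd p))) summable_on X \<times> Y" for X Y
    by (rule product_summable[OF E_summable E_summable])
  have split: "?O = {M. even M} \<times> {M. odd M} \<union> {M. odd M} \<times> {M. even M}" by auto
  have s1: "?F summable_on {M. even M} \<times> {M. odd M}" "?F summable_on {M. odd M} \<times> {M. even M}"
  proof -
    have nF: "(\<lambda>p. norm (?F p)) = (\<lambda>p. norm (E_term x (fst p) * E_term y (snd p)))"
      by (rule ext) (simp add: norm_mult)
    show "?F summable_on {M. even M} \<times> {M. odd M}" "?F summable_on {M. odd M} \<times> {M. even M}"
      by (rule abs_summable_summable, simp only: nF, rule nE)+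
  qed
  have "jtheta (x + y) \<tau> * jtheta (x - y) \<tau> = (\<Sum>\<^sub>\<infinity>p\<in>UNIV \<times> UNIV. T_term (x + y) (fst p) * T_term (x - y) (snd p))"
    unfolding jtheta_T by (rule product_summable(2)[OF T_summable T_summable, symmetric])
  also have "\<dots> = infsum (\<lambda>p. ?F (?h p)) UNIV" unfolding t by simp
  also have "\<dots> = infsum ?F ?O" by (rule infsum_reindex_bij_betw[OF bij])
  also have "\<dots> = infsum ?F ({M. even M} \<times> {M. odd M}) + infsum ?F ({M. odd M} \<times> {M. even M})"
    unfolding split by (rule infsum_Un_disjoint[OF s1]) auto
  also have "infsum ?F ({M. even M} \<times> {M. odd M}) = infsum (\<lambda>p. E_term x (fst p) * E_term y (snd p)) ({M. even M} \<times> {M. odd M})"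
    by (rule infsum_cong) auto
  also have "\<dots> = A_sum x * B_sum y"
    unfolding A_sum_def B_sum_def by (rule product_summable(2)[OF E_summable E_summable])
  also have "infsum ?F ({M. odd M} \<times> {M. even M}) = infsum (\<lambda>p. - (E_term x (fst p) * E_term y (snd p))) ({M. odd M} \<times> {M. even M})"
    by (rule infsum_cong) auto
  also have "\<dots> = - (B_sum x * A_sum y)"
    unfolding A_sum_def B_sum_def infsum_uminus by (simp add: product_summable(2)[OF E_summable E_summable])
  finally show ?thesis by simp
qed

text \<open>
  The products are $2\times2$ minors of the matrix with rows $(A,B)$ at the four points, and the
  identity is the Pluecker relation between them.
\<close>

lemma jtheta_three_term:
  "jtheta (a + b) \<tau> * jtheta (a - b) \<tau> * (jtheta (c + e) \<tau> * jtheta (c - e) \<tau>)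
   - jtheta (a + c) \<tau> * jtheta (a - c) \<tau> * (jtheta (b + e) \<tau> * jtheta (b - e) \<tau>)
   + jtheta (a + e) \<tau> * jtheta (a - e) \<tau> * (jtheta (b + c) \<tau> * jtheta (b - c) \<tau>) = 0"
  unfolding jtheta_product by (simp add: algebra_simps)

subsection \<open>Zeros of theta\<close>

text \<open>
  If theta vanished, averaging over shifts of $z$ by $2^{-j}$ would isolate the terms whose
  index is divisible by $2^j$. As $j$ grows only the term of index zero survives, and it is an
  exponential.
\<close>

lemma jtheta_not_zero: "\<exists>z. jtheta z \<tau> \<noteq> 0"
proof (rule ccontr)
  assume "\<not> ?thesis"
  then have z: "infsum (T_term z) UNIV = 0" for z by (simp add: jtheta_T[symmetric])
  define S where "S j = {k::int. 2 ^ j dvd k}" for j :: nat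
  have S: "infsum (T_term z) (S j) = 0" for j z
  proof (induction j arbitrary: z)
    case 0
    then show ?case using z by (simp add: S_def)
  next
    case (Suc j)
    define c where "c = exp (of_real pi * \<i> / 2 ^ Suc j)"
    let ?s = "\<lambda>k. if k \<in> S (Suc j) then 1 else (-1 :: complex)"
    have e: "T_term (z + 1 / 2 ^ Suc j) k = c * (?s k * T_term z k)" if k: "k \<in> S j" for k
    proof -
      obtain m where m: "k = 2 ^ j * m" using k by (auto simp: S_def)
      have i: "k \<in> S (Suc j) \<longleftrightarrow> even m" by (simp add: S_def m mult.commute)
      have "T_term (z + 1 / 2 ^ Suc j) k = c * (exp (of_real pi * \<i> * of_int m) * T_term z k)"
        unfolding T_term_def c_def exp_add[symmetric] m by (simp add: field_simps power2_eq_square)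
      moreover have "exp (of_real pi * \<i> * of_int m) = (if even m then 1 else -1)"
      proof (cases "even m")
        case True
        then obtain n where "m = 2 * n" by blast
        then have "of_real pi * \<i> * of_int m = 2 * of_real pi * \<i> * (of_int n :: complex)" by simp
        then show ?thesis using True by (simp only: exp_2pi_int) simp
      next
        case False
        then obtain n where "m = 2 * n + 1" by (auto elim: oddE)
        then show ?thesis using False exp_pi_odd[of n] by simp
      qed
      ultimately show ?thesis using i by simp
    qed
    have sub: "S (Suc j) \<subseteq> S j" by (auto simp: S_def)
    have "0 = infsum (T_term (z + 1 / 2 ^ Suc j)) (S j)" by (simp add: Suc)
    also have "\<dots> = infsum (\<lambda>k. c * (?s k * T_term z k)) (S j)" by (rule infsum_cong) (rule e)
    also have "\<dots> = c * infsum (\<lambda>k. ?s k * T_term z k) (S j)" by (rule infsum_cmult_right')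
    finally have "infsum (\<lambda>k. ?s k * T_term z k) (S j) = 0" by (simp add: c_def)
    then have "0 = infsum (T_term z) (S j) + infsum (\<lambda>k. ?s k * T_term z k) (S j)" using Suc by simp
    also have "\<dots> = infsum (\<lambda>k. T_term z k + ?s k * T_term z k) (S j)"
    proof (rule infsum_add[symmetric])
      show "T_term z summable_on S j" by (rule abs_summable_summable[OF T_summable])
      show "(\<lambda>k. ?s k * T_term z k) summable_on S j"
      proof (rule abs_summable_summable)
        have "(\<lambda>k. norm (?s k * T_term z k)) = (\<lambda>k. norm (T_term z k))" by (rule ext) simp
        then show "(\<lambda>k. norm (?s k * T_term z k)) summable_on S j" using T_summable by simp
      qed
    qed
    also have "\<dots> = infsum (\<lambda>k. 2 * T_term z k) (S (Suc j))"
      by (rule infsum_cong_neutral) (use sub in auto)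
    finally show ?case by (simp add: infsum_cmult_right')
  qed
  define e where "e = norm (T_term 0 0)"
  have e: "e > 0" by (simp add: e_def T_term_def)
  obtain F where F: "finite F" and Fs: "norm (sum (\<lambda>k. norm (T_term 0 k)) F - infsum (\<lambda>k. norm (T_term 0 k)) UNIV) \<le> e / 2"
    using infsum_finite_approximation[OF T_summable[of 0 UNIV], of "e / 2"] e by (auto simp: dist_norm)
  obtain j where j: "\<forall>k\<in>F. \<bar>k\<bar> < 2 ^ j"
  proof -
    obtain n where n: "\<forall>k\<in>F. nat \<bar>k\<bar> \<le> n" using F finite_nat_set_iff_bounded_le[of "(\<lambda>k. nat \<bar>k\<bar>) ` F"] by auto
    have "\<bar>k\<bar> < 2 ^ n" if "k \<in> F" for k
    proof -
      have "\<bar>k\<bar> \<le> int n" using n that by auto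
      also have "int n < 2 ^ n" by (metis less_exp of_nat_less_iff of_nat_numeral of_nat_power)
      finally show ?thesis .
    qed
    then show ?thesis using that by blast
  qed
  let ?R = "S j - {0}"
  have disj: "?R \<inter> F = {}"
  proof (rule ccontr)
    assume "?R \<inter> F \<noteq> {}"
    then obtain k where k: "k \<in> F" "2 ^ j dvd k" "k \<noteq> 0" by (auto simp: S_def)
    then have "2 ^ j \<le> \<bar>k\<bar>" using zdvd_imp_le[of "2 ^ j" "\<bar>k\<bar>"] by simp
    then show False using j k by force
  qed
  have "infsum (T_term 0) (S j) = infsum (T_term 0) ({0} \<union> ?R)"
    by (rule arg_cong[of _ _ "infsum (T_term 0)"]) (auto simp: S_def)
  also have "\<dots> = T_term 0 0 + infsum (T_term 0) ?R"
    by (subst infsum_Un_disjoint) (auto intro!: abs_summable_summable T_summable)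
  finally have "norm (T_term 0 0) = norm (infsum (T_term 0) ?R)"
    using S[of 0 j] by (metis add_eq_0_iff norm_minus_cancel)
  also have "\<dots> \<le> infsum (\<lambda>k. norm (T_term 0 k)) ?R" by (rule norm_infsum_bound[OF T_summable])
  also have "\<dots> \<le> infsum (\<lambda>k. norm (T_term 0 k)) (- F)"
    by (rule infsum_mono_neutral) (use disj T_summable in auto)
  also have "\<dots> \<le> e / 2"
  proof -
    have "infsum (\<lambda>k. norm (T_term 0 k)) (F \<union> - F) = sum (\<lambda>k. norm (T_term 0 k)) F + infsum (\<lambda>k. norm (T_term 0 k)) (- F)"
      by (subst infsum_Un_disjoint) (use F T_summable in auto)
    then show ?thesis using Fs by simp
  qed
  finally show False using e by (simp add: e_def)
qed

lemma jtheta_nonzero_near: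
  assumes "open S" "S \<noteq> {}" shows "\<exists>z\<in>S. jtheta z \<tau> \<noteq> 0"
proof (rule ccontr)
  assume n: "\<not> ?thesis"
  obtain s where s: "s \<in> S" using assms by blast
  obtain z where z: "jtheta z \<tau> \<noteq> 0" using jtheta_not_zero by blast
  have "jtheta z \<tau> = 0"
    by (rule analytic_continuation_open[of S UNIV "\<lambda>z. jtheta z \<tau>" "\<lambda>_. 0"])
      (use assms n jtheta_entire in auto)
  then show False using z by simp
qed

lemma open_jtheta_nonzero: "open {z. jtheta z \<tau> \<noteq> 0}"
  by (rule open_Collect_neq[OF holomorphic_on_imp_continuous_on[OF jtheta_entire] continuous_on_const])

text \<open>
  At a zero $z_0$ one product in the three-term identity drops out, and the remaining two say
  that the logarithmic derivative of $\theta(w+z_0)/\theta(w)$ is constant.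
\<close>

lemma jtheta_shift_of_zero:
  assumes z0: "jtheta z0 \<tau> = 0"
  obtains C c where "C \<noteq> 0" "\<And>w. jtheta (w + z0) \<tau> = C * exp (c * w) * jtheta w \<tau>"
proof -
  let ?\<theta> = "\<lambda>z. jtheta z \<tau>"
  have der: "(?\<theta> has_field_derivative deriv ?\<theta> z) (at z)" for z
    using jtheta_entire[of UNIV] by (simp add: holomorphic_derivI[of _ UNIV])
  have rel: "?\<theta> (w1 + s) * ?\<theta> w1 * (?\<theta> (w2 + z0) * ?\<theta> (w2 + s - z0)) =
    ?\<theta> (w2 + s) * ?\<theta> w2 * (?\<theta> (w1 + z0) * ?\<theta> (w1 + s - z0))" for w1 w2 s
  proof -
    let ?x = "s / 2" let ?y = "z0 - s / 2" let ?u = "w1 + s / 2" let ?v = "w2 + s / 2"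
    have t: "?x + ?y = z0" "?x + ?u = w1 + s" "?x - ?u = - w1" "?y + ?v = w2 + z0" "?y - ?v = - (w2 + s - z0)"
      "?x + ?v = w2 + s" "?x - ?v = - w2" "?y + ?u = w1 + z0" "?y - ?u = - (w1 + s - z0)"
      by (simp_all add: field_simps)
    from jtheta_three_term[of ?x ?y ?u ?v] show ?thesis
      unfolding t jtheta_odd by (simp add: z0)
  qed
  obtain \<beta> where \<beta>: "?\<theta> \<beta> \<noteq> 0" "?\<theta> (\<beta> - z0) \<noteq> 0"
  proof -
    note open_jtheta_nonzero
    have "{z. ?\<theta> z \<noteq> 0} \<noteq> {}" using jtheta_not_zero by blast
    then have "open ((\<lambda>z. - z0 + z) ` {z. ?\<theta> z \<noteq> 0})" "(\<lambda>z. - z0 + z) ` {z. ?\<theta> z \<noteq> 0} \<noteq> {}"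
      by (auto simp only: image_is_empty intro: open_translation[OF open_jtheta_nonzero])
    then obtain w where "w \<in> (\<lambda>z. - z0 + z) ` {z. ?\<theta> z \<noteq> 0}" "?\<theta> w \<noteq> 0" using jtheta_nonzero_near by blast
    then show ?thesis using that[of "w + z0"] by auto
  qed
  let ?P = "\<lambda>w. ?\<theta> (w + z0)"
  define c where "c = deriv ?\<theta> \<beta> / ?\<theta> \<beta> - deriv ?\<theta> (\<beta> - z0) / ?\<theta> (\<beta> - z0)"
  have dP: "(?P has_field_derivative deriv ?\<theta> (w + z0)) (at w)" for w
    using der[of "w + z0"] unfolding DERIV_shift .
  have log: "deriv ?\<theta> (w + z0) * ?\<theta> w - ?P w * deriv ?\<theta> w = c * (?P w * ?\<theta> w)" for w
  proof -
    let ?L = "\<lambda>w1. ?P w * ?\<theta> (\<beta> - z0) * (?\<theta> w1 * ?\<theta> (w1 - w + \<beta>))"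
    let ?R = "\<lambda>w1. ?P w1 * ?\<theta> (w1 - w + \<beta> - z0) * (?\<theta> w * ?\<theta> \<beta>)"
    have "?L w1 = ?R w1" for w1
      using rel[of w1 "\<beta> - w" w] by (simp add: algebra_simps)
    then have eq: "?L = ?R" by blast
    have sh: "((\<lambda>w1. ?\<theta> (w1 - w + a)) has_field_derivative deriv ?\<theta> a) (at w)" for a
      using der[of a] DERIV_shift[of ?\<theta> "deriv ?\<theta> a" w "a - w"] by (simp add: algebra_simps)
    have 1: "(?L has_field_derivative ?P w * ?\<theta> (\<beta> - z0) * (deriv ?\<theta> w * ?\<theta> \<beta> + deriv ?\<theta> \<beta> * ?\<theta> w)) (at w)"
      by (rule DERIV_cmult) (rule derivative_eq_intros der sh refl | simp)+
    have 2: "(?R has_field_derivative (deriv ?\<theta> (w + z0) * ?\<theta> (\<beta> - z0) + deriv ?\<theta> (\<beta> - z0) * ?P w) * (?\<theta> w * ?\<theta> \<beta>)) (at w)"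
      using DERIV_cmult_right[OF DERIV_mult[OF dP[of w] sh[of "\<beta> - z0"]], of "?\<theta> w * ?\<theta> \<beta>"]
      by (simp add: algebra_simps)
    have "?P w * ?\<theta> (\<beta> - z0) * (deriv ?\<theta> w * ?\<theta> \<beta> + deriv ?\<theta> \<beta> * ?\<theta> w) =
      (deriv ?\<theta> (w + z0) * ?\<theta> (\<beta> - z0) + deriv ?\<theta> (\<beta> - z0) * ?P w) * (?\<theta> w * ?\<theta> \<beta>)"
      using DERIV_unique[OF 1 2[unfolded eq[symmetric]]] .
    then show ?thesis unfolding c_def using \<beta> by (simp add: field_simps)
  qed
  from open_jtheta_nonzero obtain r where r: "r > 0" "ball \<beta> r \<subseteq> {z. ?\<theta> z \<noteq> 0}" using \<beta>(1) by (metis mem_Collect_eq openE)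
  let ?Q = "\<lambda>w. ?P w * exp (- c * w) / ?\<theta> w"
  have "\<exists>C. \<forall>w\<in>ball \<beta> r. ?Q w = C"
  proof (rule has_field_derivative_zero_constant)
    fix w assume w: "w \<in> ball \<beta> r"
    then have nz: "?\<theta> w \<noteq> 0" using r by auto
    have "(?Q has_field_derivative ((deriv ?\<theta> (w + z0) * exp (- c * w) + (exp (- c * w) * (- c)) * ?P w) * ?\<theta> w - (?P w * exp (- c * w)) * deriv ?\<theta> w) / (?\<theta> w * ?\<theta> w)) (at w)"
    proof (rule DERIV_divide[OF _ der nz])
      have "((\<lambda>w. exp (- c * w)) has_field_derivative exp (- c * w) * (- c)) (at w)"
        by (auto intro!: derivative_eq_intros)
      from DERIV_mult[OF dP this]
      show "((\<lambda>w. ?P w * exp (- c * w)) has_field_derivative deriv ?\<theta> (w + z0) * exp (- c * w) + (exp (- c * w) * (- c)) * ?P w) (at w)" .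
    qed
    moreover have "(deriv ?\<theta> (w + z0) * exp (- c * w) + (exp (- c * w) * (- c)) * ?P w) * ?\<theta> w - (?P w * exp (- c * w)) * deriv ?\<theta> w = 0"
    proof -
      have "(deriv ?\<theta> (w + z0) * exp (- c * w) + (exp (- c * w) * (- c)) * ?P w) * ?\<theta> w - (?P w * exp (- c * w)) * deriv ?\<theta> w
        = exp (- c * w) * (deriv ?\<theta> (w + z0) * ?\<theta> w - ?P w * deriv ?\<theta> w - c * (?P w * ?\<theta> w))"
        by (simp add: algebra_simps)
      then show ?thesis using log[of w] by simp
    qed
    ultimately show "(?Q has_field_derivative 0) (at w within ball \<beta> r)"
      by (simp add: has_field_derivative_at_within)
  qed simp
  then obtain C where C: "\<And>w. w \<in> ball \<beta> r ==> ?Q w = C" by blast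
  have on_ball: "?P w = C * exp (c * w) * ?\<theta> w" if "w \<in> ball \<beta> r" for w
  proof -
    have nz: "?\<theta> w \<noteq> 0" using that r by auto
    have "exp (- c * w) * exp (c * w) = 1" by (simp add: exp_add[symmetric])
    moreover have "?P w * exp (- c * w) = C * ?\<theta> w" using C[OF that] nz by (simp add: divide_eq_eq)
    ultimately show ?thesis by (metis mult.assoc mult.commute mult.right_neutral)
  qed
  have all: "?P w = C * exp (c * w) * ?\<theta> w" for w
  proof (rule analytic_continuation_open[of "ball \<beta> r" UNIV ?P "\<lambda>w. C * exp (c * w) * ?\<theta> w"])
    show "?P holomorphic_on UNIV"
      unfolding holomorphic_on_def field_differentiable_def using dP by blast
  qed (use on_ball r jtheta_entire in \<open>auto intro!: holomorphic_intros\<close>)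
  moreover have "C \<noteq> 0"
  proof
    assume "C = 0"
    then have "?\<theta> w = 0" for w using all[of "w - z0"] by simp
    then show False using jtheta_not_zero by blast
  qed
  ultimately show ?thesis using that by blast
qed

text \<open>
  $\theta(w+z_0)$ is an exponential times $\theta(w)$; comparing the two sides under $w\mapsto
  w+1$ and $w\mapsto w+\tau$ determines $z_0$. This avoids counting zeros by a contour integral.
\<close>

theorem jtheta_zero_lattice:
  assumes z0: "jtheta z0 \<tau> = 0"
  shows "\<exists>m n. z0 = of_int m + of_int n * \<tau>"
proof -
  obtain C c where C: "C \<noteq> 0" and s: "\<And>w. jtheta (w + z0) \<tau> = C * exp (c * w) * jtheta w \<tau>"
    using jtheta_shift_of_zero[OF z0] by blast
  obtain w where w: "jtheta w \<tau> \<noteq> 0" using jtheta_not_zero by blast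
  have "jtheta (w + 1 + z0) \<tau> = - jtheta (w + z0) \<tau>" using jtheta_plus_1[of "w + z0"] by (simp add: algebra_simps)
  then have "C * exp (c * (w + 1)) * jtheta w \<tau> = C * exp (c * w) * jtheta w \<tau>"
    unfolding s jtheta_plus_1 by simp
  then have "exp c = 1" using C w by (simp add: exp_add distrib_left)
  then obtain k where "Re c = 0" "Im c = of_int (2 * k) * pi" unfolding exp_eq_1 by blast
  then have k: "c = of_int (2 * k) * of_real pi * \<i>" by (simp add: complex_eq_iff)
  have h: "jtheta (w + \<tau> + z0) \<tau> = - exp (- of_real pi * \<i> * \<tau> - 2 * of_real pi * \<i> * (w + z0)) * jtheta (w + z0) \<tau>"
    using jtheta_plus_tau[of "w + z0"] by (simp add: algebra_simps)
  have "exp (c * \<tau>) * exp (c * w) * exp (- of_real pi * \<i> * \<tau> - 2 * of_real pi * \<i> * w) =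
     exp (- 2 * of_real pi * \<i> * z0) * exp (c * w) * exp (- of_real pi * \<i> * \<tau> - 2 * of_real pi * \<i> * w)"
  proof -
    have e1: "exp (c * (w + \<tau>)) = exp (c * \<tau>) * exp (c * w)"
      by (simp add: exp_add[symmetric] algebra_simps)
    have e2: "exp (- of_real pi * \<i> * \<tau> - 2 * of_real pi * \<i> * (w + z0)) =
       exp (- 2 * of_real pi * \<i> * z0) * exp (- of_real pi * \<i> * \<tau> - 2 * of_real pi * \<i> * w)"
      by (simp add: exp_add[symmetric] algebra_simps)
    have "(C * jtheta w \<tau>) * (exp (c * \<tau>) * exp (c * w) * exp (- of_real pi * \<i> * \<tau> - 2 * of_real pi * \<i> * w)) =
      (C * jtheta w \<tau>) * (exp (- 2 * of_real pi * \<i> * z0) * exp (c * w) * exp (- of_real pi * \<i> * \<tau> - 2 * of_real pi * \<i> * w))"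
      using h unfolding s jtheta_plus_tau e1 e2 by (simp only: mult_ac mult_minus_left mult_minus_right minus_mult_left[symmetric] neg_equal_iff_equal)
    then show ?thesis using C w by simp
  qed
  then have "exp (c * \<tau>) = exp (- 2 * of_real pi * \<i> * z0)" by simp
  then obtain m :: int where "c * \<tau> = - 2 * of_real pi * \<i> * z0 + (of_int (2 * m) * of_real pi) * \<i>"
    unfolding exp_eq by auto
  then have "2 * of_real pi * \<i> * z0 = 2 * of_real pi * \<i> * (of_int m + of_int (- k) * \<tau>)"
    unfolding k by (simp add: algebra_simps)
  then have "z0 = of_int m + of_int (- k) * \<tau>" by simp
  then show ?thesis by blast
qed

end

section \<open>The Kronecker function and the Baxter--Belavin R-matrix\<close>

lemma phi_sym: "phi z \<mu> \<tau> = phi \<mu> z \<tau>"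
  by (simp add: phi_def add.commute mult.commute)

lemma phi_odd:
  assumes "Im \<tau> > 0" shows "phi (- z) (- \<mu>) \<tau> = - phi z \<mu> \<tau>"
proof -
  have "- z + - \<mu> = - (z + \<mu>)" by simp
  then show ?thesis unfolding phi_def by (simp only: jtheta_odd[OF assms]) simp
qed

lemma phi_shift:
  assumes "Im \<tau> > 0" shows "phi (z + \<tau>) \<mu> \<tau> = exp (- 2 * of_real pi * \<i> * \<mu>) * phi z \<mu> \<tau>"
proof -
  let ?E = "\<lambda>z. - exp (- of_real pi * \<i> * \<tau> - 2 * of_real pi * \<i> * z)"
  have e: "?E (z + \<mu>) = exp (- 2 * of_real pi * \<i> * \<mu>) * ?E z"
    by (simp add: exp_add[symmetric] algebra_simps)
  have "z + \<tau> + \<mu> = (z + \<mu>) + \<tau>" by simp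
  then have "phi (z + \<tau>) \<mu> \<tau> = deriv (\<lambda>t. jtheta t \<tau>) 0 * (exp (- 2 * of_real pi * \<i> * \<mu>) * ?E z * jtheta (z + \<mu>) \<tau>) /
      ((?E z * jtheta z \<tau>) * jtheta \<mu> \<tau>)"
    unfolding phi_def by (simp only: jtheta_plus_tau[OF assms] e)
  also have "\<dots> = exp (- 2 * of_real pi * \<i> * \<mu>) * phi z \<mu> \<tau>"
    unfolding phi_def by (simp add: divide_simps)
  finally show ?thesis .
qed

text \<open>
  Fay's identity: the three-term identity at half sums of the arguments, divided by six thetas.
\<close>

lemma phi_fay:
  assumes \<tau>: "Im \<tau> > 0"
    and nz: "jtheta X \<tau> \<noteq> 0" "jtheta Y \<tau> \<noteq> 0" "jtheta U \<tau> \<noteq> 0" "jtheta V \<tau> \<noteq> 0"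
      "jtheta (U + V) \<tau> \<noteq> 0" "jtheta (X - Y) \<tau> \<noteq> 0"
  shows "phi X U \<tau> * phi Y V \<tau> = phi X (U + V) \<tau> * phi (Y - X) V \<tau> + phi Y (U + V) \<tau> * phi (X - Y) U \<tau>"
proof -
  let ?T = "\<lambda>z. jtheta z \<tau>"
  let ?a = "(X + Y + U + V) / 2" let ?b = "(X + U - Y - V) / 2"
  let ?c = "(X + U + V - Y) / 2" let ?e = "(Y + U + V - X) / 2"
  have t: "?a + ?b = X + U" "?a - ?b = Y + V" "?c + ?e = U + V" "?c - ?e = X - Y"
    "?a + ?c = X + U + V" "?a - ?c = Y" "?b + ?e = U" "?b - ?e = - (Y - X + V)"
    "?a + ?e = Y + U + V" "?a - ?e = X" "?b + ?c = X - Y + U" "?b - ?c = - V"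
    by (simp_all add: field_simps)
  have W: "?T (X + U) * ?T (Y + V) * (?T (U + V) * ?T (X - Y)) + ?T (X + U + V) * ?T Y * (?T U * ?T (Y - X + V))
     - ?T (Y + U + V) * ?T X * (?T (X - Y + U) * ?T V) = 0"
    using jtheta_three_term[OF \<tau>, of ?a ?b ?c ?e] unfolding t jtheta_odd[OF \<tau>] by simp
  have o: "?T (Y - X) = - ?T (X - Y)" using jtheta_odd[OF \<tau>, of "X - Y"] by simp
  have W': "?T (X + U) * ?T (Y + V) * (?T (U + V) * ?T (X - Y)) =
     ?T (Y + (U + V)) * ?T X * (?T (X - Y + U) * ?T V) - ?T (X + (U + V)) * ?T Y * (?T U * ?T (Y - X + V))"
    using W by (simp add: add.assoc algebra_simps)
  define P where "P = ?T X * ?T Y * ?T U * ?T V * ?T (U + V) * ?T (X - Y)"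
  let ?D = "deriv ?T 0"
  have P: "P \<noteq> 0" using nz by (simp add: P_def)
  have 1: "phi X U \<tau> * phi Y V \<tau> = ?D\<^sup>2 * (?T (X + U) * ?T (Y + V) * (?T (U + V) * ?T (X - Y))) / P"
    unfolding phi_def P_def using nz by (simp add: field_simps power2_eq_square)
  have 2: "phi X (U + V) \<tau> * phi (Y - X) V \<tau> = - (?D\<^sup>2 * (?T (X + (U + V)) * ?T Y * (?T U * ?T (Y - X + V))) / P)"
    unfolding phi_def P_def o using nz by (simp add: field_simps power2_eq_square)
  have 3: "phi Y (U + V) \<tau> * phi (X - Y) U \<tau> = ?D\<^sup>2 * (?T (Y + (U + V)) * ?T X * (?T (X - Y + U) * ?T V)) / P"
    unfolding phi_def P_def using nz by (simp add: field_simps power2_eq_square)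
  show ?thesis unfolding 1 2 3 W' by (simp add: right_diff_distrib diff_divide_distrib)
qed

text \<open>
  The entries of the R-matrix for integers $s,t$ instead of index differences; it is periodic in
  $s$ and $t$ modulo $d$, which removes all case distinctions on residues.
\<close>

definition Phi_st :: "complex => nat => int => int => complex => complex => complex" where
  "Phi_st \<tau> d s t z \<mu> =
     exp (2 * of_real pi * \<i> / of_nat d * (of_int s * of_int t * \<tau> + of_int s * \<mu> + of_int t * z))
     * phi (z + of_int s * \<tau>) (\<mu> + of_int t * \<tau>) (of_nat d * \<tau>)"

context
  fixes \<tau> :: complex and d :: nat
  assumes \<tau>: "Im \<tau> > 0" and d: "d > 0"
begin

lemma Im_d: "Im (of_nat d * \<tau>) > 0"
  using \<tau> d by simp

lemma Phi_st_sym: "Phi_st \<tau> d s t z \<mu> = Phi_st \<tau> d t s \<mu> z"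
  unfolding Phi_st_def by (subst phi_sym) (simp add: algebra_simps)

lemma Phi_st_odd: "Phi_st \<tau> d (- s) (- t) (- z) (- \<mu>) = - Phi_st \<tau> d s t z \<mu>"
proof -
  have "- z + of_int (- s) * \<tau> = - (z + of_int s * \<tau>)" "- \<mu> + of_int (- t) * \<tau> = - (\<mu> + of_int t * \<tau>)"
    by simp_all
  then show ?thesis unfolding Phi_st_def by (simp only: phi_odd[OF Im_d]) simp
qed

lemma Phi_st_shift: "Phi_st \<tau> d (s + int d) t z \<mu> = Phi_st \<tau> d s t z \<mu>"
proof -
  have e: "z + of_int (s + int d) * \<tau> = (z + of_int s * \<tau>) + of_nat d * \<tau>" by (simp add: algebra_simps)
  have h: "exp (2 * of_real pi * \<i> / of_nat d * (of_int (s + int d) * of_int t * \<tau> + of_int (s + int d) * \<mu> + of_int t * z))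
     * exp (- 2 * of_real pi * \<i> * (\<mu> + of_int t * \<tau>)) =
     exp (2 * of_real pi * \<i> / of_nat d * (of_int s * of_int t * \<tau> + of_int s * \<mu> + of_int t * z))"
    unfolding exp_add[symmetric] using d by (intro arg_cong[of _ _ exp]) (simp add: field_simps)
  show ?thesis unfolding Phi_st_def e phi_shift[OF Im_d] mult.assoc[of "exp _" "exp _" "phi _ _ _", symmetric] h ..
qed

lemma Phi_st_shift_mult: "Phi_st \<tau> d (s + int d * k) t z \<mu> = Phi_st \<tau> d s t z \<mu>"
proof (induction k rule: int_induct[of _ 0])
  case (step1 i)
  have "s + int d * (i + 1) = (s + int d * i) + int d" by (simp add: algebra_simps)
  then show ?case using step1 Phi_st_shift by metis
next
  case (step2 i)
  have "s + int d * i = (s + int d * (i - 1)) + int d" by (simp add: algebra_simps)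
  then show ?case using step2 Phi_st_shift by metis
qed simp

lemma Phi_st_cong:
  assumes "int d dvd s - s'" "int d dvd t - t'"
  shows "Phi_st \<tau> d s t z \<mu> = Phi_st \<tau> d s' t' z \<mu>"
proof -
  obtain k l where "s - s' = int d * k" "t - t' = int d * l" using assms by (metis dvdE)
  then have kl: "s = s' + int d * k" "t = t' + int d * l" by simp_all
  show ?thesis unfolding kl Phi_st_shift_mult
    using Phi_st_sym Phi_st_shift_mult by metis
qed

abbreviation "td z \<equiv> jtheta z (of_nat d * \<tau>)"

lemma Phi_st_fay:
  assumes nz: "td (X + of_int s * \<tau>) \<noteq> 0" "td (Y + of_int s' * \<tau>) \<noteq> 0" "td (U + of_int t * \<tau>) \<noteq> 0"
      "td (V + of_int t' * \<tau>) \<noteq> 0" "td (U + V + of_int (t + t') * \<tau>) \<noteq> 0" "td (X - Y + of_int (s - s') * \<tau>) \<noteq> 0"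
  shows "Phi_st \<tau> d s t X U * Phi_st \<tau> d s' t' Y V =
    Phi_st \<tau> d s (t + t') X (U + V) * Phi_st \<tau> d (s' - s) t' (Y - X) V
    + Phi_st \<tau> d s' (t + t') Y (U + V) * Phi_st \<tau> d (s - s') t (X - Y) U"
proof -
  let ?X = "X + of_int s * \<tau>" and ?Y = "Y + of_int s' * \<tau>" and ?U = "U + of_int t * \<tau>" and ?V = "V + of_int t' * \<tau>"
  let ?e = "\<lambda>s t z \<mu>. exp (2 * of_real pi * \<i> / of_nat d * (of_int s * of_int t * \<tau> + of_int s * \<mu> + of_int t * z))"
  have r: "U + V + of_int (t + t') * \<tau> = ?U + ?V" "X - Y + of_int (s - s') * \<tau> = ?X - ?Y" "Y - X + of_int (s' - s) * \<tau> = ?Y - ?X"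
    by (simp_all add: algebra_simps)
  have f: "phi ?X ?U (of_nat d * \<tau>) * phi ?Y ?V (of_nat d * \<tau>) =
     phi ?X (?U + ?V) (of_nat d * \<tau>) * phi (?Y - ?X) ?V (of_nat d * \<tau>) + phi ?Y (?U + ?V) (of_nat d * \<tau>) * phi (?X - ?Y) ?U (of_nat d * \<tau>)"
    by (rule phi_fay[OF Im_d]) (fact nz[unfolded r])+
  have e1: "?e s (t + t') X (U + V) * ?e (s' - s) t' (Y - X) V = ?e s t X U * ?e s' t' Y V"
    unfolding exp_add[symmetric] by (rule arg_cong[of _ _ exp]) (simp add: algebra_simps)
  have e2: "?e s' (t + t') Y (U + V) * ?e (s - s') t (X - Y) U = ?e s t X U * ?e s' t' Y V"
    unfolding exp_add[symmetric] by (rule arg_cong[of _ _ exp]) (simp add: algebra_simps)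
  have "Phi_st \<tau> d s t X U * Phi_st \<tau> d s' t' Y V = (?e s t X U * ?e s' t' Y V) * (phi ?X ?U (of_nat d * \<tau>) * phi ?Y ?V (of_nat d * \<tau>))"
    unfolding Phi_st_def by (simp only: mult_ac)
  also have "\<dots> = (?e s (t + t') X (U + V) * ?e (s' - s) t' (Y - X) V) * (phi ?X (?U + ?V) (of_nat d * \<tau>) * phi (?Y - ?X) ?V (of_nat d * \<tau>))
     + (?e s' (t + t') Y (U + V) * ?e (s - s') t (X - Y) U) * (phi ?Y (?U + ?V) (of_nat d * \<tau>) * phi (?X - ?Y) ?U (of_nat d * \<tau>))"
    unfolding f e1 e2 by (rule distrib_left)
  finally show ?thesis unfolding Phi_st_def r by (simp only: mult_ac)
qed

end

subsection \<open>Meromorphy\<close>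

lemma holo_on_compose:
  assumes h: "h holomorphic_on S" "open S" and l: "holo_on l N" "\<And>u. u \<in> N ==> l u \<in> S"
  shows "holo_on (\<lambda>u. h (l u)) N"
proof (rule holo_on_iff_linear[OF holo_on_open[OF l(1)], where D = "\<lambda>u v. deriv h (l u) * ddir v l u"])
  fix u assume u: "u \<in> N"
  have "(h has_derivative (*) (deriv h (l u))) (at (l u))"
    using holomorphic_derivI[OF h(1,2) l(2)[OF u]] by (simp add: has_field_derivative_def)
  from has_derivative_compose[OF holo_on_has_derivative(1)[OF l(1) u] this]
  show "((\<lambda>u. h (l u)) has_derivative (\<lambda>v. deriv h (l u) * ddir v l u)) (at u)" .
  show "deriv h (l u) * ddir (c *s v) l u = c * (deriv h (l u) * ddir v l u)" for c v
    by (simp add: holo_on_has_derivative(2)[OF l(1) u])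
qed

lemma holo_on_coord: "open N ==> holo_on (\<lambda>u. u $ a) N"
  by (rule holo_on_iff_linear[where D = "\<lambda>u v. v $ a"])
    (auto intro!: bounded_linear_imp_has_derivative bounded_linear_vec_nth)

lemma holo_on_coord_diff: "open N ==> holo_on (\<lambda>u. u $ a - u $ b + c) N"
  by (intro holo_on_add holo_on_diff holo_on_coord holo_on_const)

lemma nowhere_dense_coord_diff:
  fixes a b :: "'k::finite"
  assumes "a \<noteq> b" "nowhere_dense Z"
  shows "nowhere_dense {u :: complex^'k. u $ a - u $ b + c \<in> Z}"
proof -
  let ?f = "\<lambda>u :: complex^'k. u $ a - u $ b"
  have lin: "linear ?f" by (rule linearI) (simp_all add: algebra_simps)
  have "surj ?f"
  proof -
    have "\<exists>x. y = ?f x" for y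
      using assms(1) by (intro exI[of _ "y *s axis a 1"]) (simp add: axis_def)
    then show ?thesis unfolding surj_def by simp
  qed
  then have op: "open (?f ` W)" if "open W" for W
    using open_surjective_linear_image[OF that lin] by blast
  have "nowhere_dense ((\<lambda>u :: complex^'k. c + (u $ a - u $ b)) -` Z)"
  proof (rule nowhere_dense_vimage[OF _ _ assms(2)])
    show "continuous_on UNIV (\<lambda>u :: complex^'k. c + (u $ a - u $ b))" by (intro continuous_intros)
    fix W :: "(complex^'k) set" assume "open W"
    then have "open ((\<lambda>z. c + z) ` (?f ` W))" by (intro open_translation op)
    then show "open ((\<lambda>u. c + (u $ a - u $ b)) ` W)" by (simp add: image_image)
  qed
  then show ?thesis by (simp add: vimage_def add.commute)
qed

lemma nowhere_dense_jtheta_zeros: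
  assumes "Im \<tau> > 0" shows "nowhere_dense {z. jtheta z \<tau> = 0}"
proof -
  have "closed {z. jtheta z \<tau> = 0}"
    by (rule closed_Collect_eq[OF holomorphic_on_imp_continuous_on[OF jtheta_entire[OF assms]] continuous_on_const])
  moreover have "interior {z. jtheta z \<tau> = 0} = {}"
    using jtheta_nonzero_near[OF assms open_interior, of "{z. jtheta z \<tau> = 0}"] interior_subset by blast
  ultimately show ?thesis by (simp add: nowhere_dense_def closure_closed)
qed

lemma nowhere_dense_interior: "nowhere_dense S ==> interior S = {}"
  unfolding nowhere_dense_def using interior_mono[OF closure_subset[of S]] by blast

lemma mero_quotient:
  assumes "holo_on a UNIV" "holo_on b UNIV" "nowhere_dense {u. b u = 0}"
  shows "mero (\<lambda>u. a u / b u)"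
  unfolding mero_def using assms nowhere_dense_interior[OF assms(3)] by (intro allI exI[of _ UNIV] exI[of _ a] exI[of _ b]) auto

definition R_num :: "complex => nat => int => int => 'n::finite => 'n => 'n => 'n => complex^('n + 'n) => complex" where
  "R_num \<tau> d s t i j a b u =
     exp (2 * of_real pi * \<i> / of_nat d * (of_int s * of_int t * \<tau> + of_int s * (u $ Inr a - u $ Inr b) + of_int t * (u $ Inl i - u $ Inl j)))
     * (deriv (\<lambda>t. jtheta t (of_nat d * \<tau>)) 0 *
       jtheta ((u $ Inl i - u $ Inl j + of_int s * \<tau>) + (u $ Inr a - u $ Inr b + of_int t * \<tau>)) (of_nat d * \<tau>))"

text \<open>
  The two theta factors depend on $x$ alone and on $\lambda$ alone, so that the poles in $x$ do
  not move with $\lambda$.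
\<close>

definition R_den :: "complex => nat => int => int => 'n::finite => 'n => 'n => 'n => complex^('n + 'n) => complex" where
  "R_den \<tau> d s t i j a b u = jtheta (u $ Inl i - u $ Inl j + of_int s * \<tau>) (of_nat d * \<tau>)
     * jtheta (u $ Inr a - u $ Inr b + of_int t * \<tau>) (of_nat d * \<tau>)"

lemma Phi_st_quotient:
  "Phi_st \<tau> d s t (u $ Inl i - u $ Inl j) (u $ Inr a - u $ Inr b) = R_num \<tau> d s t i j a b u / R_den \<tau> d s t i j a b u"
  by (simp add: Phi_st_def phi_def R_num_def R_den_def)

context
  fixes \<tau> :: complex and d :: nat
  assumes \<tau>: "Im \<tau> > 0" and d: "d > 0"
begin

lemma holo_theta: "holo_on l N ==> holo_on (\<lambda>u. jtheta (l u) (of_nat d * \<tau>)) N"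
  by (rule holo_on_compose[OF jtheta_entire[OF Im_d[OF \<tau> d], of UNIV]]) auto

lemma holo_R_num: "holo_on (R_num \<tau> d s t i j a b) UNIV"
proof -
  have "holo_on (\<lambda>u. exp (2 * of_real pi * \<i> / of_nat d * (of_int s * of_int t * \<tau> + of_int s * (u $ Inr a - u $ Inr b) + of_int t * (u $ Inl i - u $ Inl j)))) UNIV"
    by (rule holo_on_compose[OF holomorphic_on_exp open_UNIV _ UNIV_I])
      (intro holo_on_mult holo_on_add holo_on_diff holo_on_const holo_on_coord open_UNIV)
  then show ?thesis
    unfolding R_num_def[abs_def]
    by (intro holo_on_mult holo_on_const holo_theta holo_on_add holo_on_coord_diff) auto
qed

lemma holo_R_den: "holo_on (R_den \<tau> d s t i j a b) UNIV"
  unfolding R_den_def[abs_def] by (intro holo_on_mult holo_theta holo_on_coord_diff) auto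

lemma nowhere_dense_theta:
  "k \<noteq> l ==> nowhere_dense {u :: complex^'k::finite. jtheta (u $ k - u $ l + c) (of_nat d * \<tau>) = 0}"
  using nowhere_dense_coord_diff[OF _ nowhere_dense_jtheta_zeros[OF Im_d[OF \<tau> d]]] by simp

lemma nowhere_dense_R_den:
  assumes "i \<noteq> j" "a \<noteq> b"
  shows "nowhere_dense {u. R_den \<tau> d s t i j a b u = 0}"
proof -
  have "{u. R_den \<tau> d s t i j a b u = 0} \<subseteq> {u. jtheta (u $ Inl i - u $ Inl j + of_int s * \<tau>) (of_nat d * \<tau>) = 0}
      \<union> {u. jtheta (u $ Inr a - u $ Inr b + of_int t * \<tau>) (of_nat d * \<tau>) = 0}"
    by (auto simp: R_den_def)
  then show ?thesis
    by (rule nowhere_dense_subset[rotated]) (intro nowhere_dense_Un nowhere_dense_theta, use assms in auto)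
qed

definition F_mer :: "int => int => 'n::finite => 'n => 'n => 'n => ('n + 'n) merfun" where
  "F_mer s t i j a b = abs_mer (\<lambda>u. Phi_st \<tau> d s t (u $ Inl i - u $ Inl j) (u $ Inr a - u $ Inr b))"

lemma mero_Phi:
  fixes i j a b :: "'n::finite"
  assumes "i \<noteq> j" "a \<noteq> b"
  shows "mero (\<lambda>u. Phi_st \<tau> d s t (u $ Inl i - u $ Inl j) (u $ Inr a - u $ Inr b))"
  unfolding Phi_st_quotient by (rule mero_quotient[OF holo_R_num holo_R_den nowhere_dense_R_den[OF assms]])

lemma F_mer_cong: "int d dvd s - s' ==> int d dvd t - t' ==> F_mer s t i j a b = F_mer s' t' i j a b"
  unfolding F_mer_def using Phi_st_cong[OF \<tau> d] by presburger

lemma F_mer_skew: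
  assumes "i \<noteq> j" "a \<noteq> b" shows "F_mer (- s) (- t) j i b a = - F_mer s t i j a b"
proof -
  have "Phi_st \<tau> d (- s) (- t) (u $ Inl j - u $ Inl i) (u $ Inr b - u $ Inr a) =
     - Phi_st \<tau> d s t (u $ Inl i - u $ Inl j) (u $ Inr a - u $ Inr b)" for u :: "complex^('a + 'a)"
    using Phi_st_odd[OF \<tau> d, of s t "u $ Inl i - u $ Inl j" "u $ Inr a - u $ Inr b"] by simp
  then show ?thesis unfolding F_mer_def using mero_Phi[OF assms] by (simp add: abs_mer_uminus)
qed

lemma F_mer_fay:
  assumes "i \<noteq> j" "i \<noteq> k" "j \<noteq> k" "a \<noteq> b" "b \<noteq> c" "a \<noteq> c"
  shows "F_mer s t i j a b * F_mer s' t' i k b c =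
    F_mer s (t + t') i j a c * F_mer (s' - s) t' j k b c + F_mer s' (t + t') i k a c * F_mer (s - s') t k j a b"
proof -
  let ?f = "\<lambda>s t i j a b u. Phi_st \<tau> d s t (u $ Inl i - u $ Inl j) (u $ Inr a - u $ Inr b)"
  let ?Z = "\<lambda>k l c. {u :: complex^('a + 'a). jtheta (u $ k - u $ l + c) (of_nat d * \<tau>) = 0}"
  let ?S = "?Z (Inl i) (Inl j) (of_int s * \<tau>) \<union> ?Z (Inl i) (Inl k) (of_int s' * \<tau>) \<union> ?Z (Inr a) (Inr b) (of_int t * \<tau>)
    \<union> ?Z (Inr b) (Inr c) (of_int t' * \<tau>) \<union> ?Z (Inr a) (Inr c) (of_int (t + t') * \<tau>) \<union> ?Z (Inl k) (Inl j) (of_int (s - s') * \<tau>)"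
  have "abs_mer (\<lambda>u. ?f s t i j a b u * ?f s' t' i k b c u) =
    abs_mer (\<lambda>u. ?f s (t + t') i j a c u * ?f (s' - s) t' j k b c u + ?f s' (t + t') i k a c u * ?f (s - s') t k j a b u)"
  proof (rule abs_mer_eqI[where S = ?S])
    show "nowhere_dense ?S" by (intro nowhere_dense_Un nowhere_dense_theta) (use assms in auto)
    fix u assume u: "u \<notin> ?S"
    let ?X = "u $ Inl i - u $ Inl j" and ?Y = "u $ Inl i - u $ Inl k" and ?U = "u $ Inr a - u $ Inr b" and ?V = "u $ Inr b - u $ Inr c"
    have r: "?U + ?V = u $ Inr a - u $ Inr c" "?Y - ?X = u $ Inl j - u $ Inl k" "?X - ?Y = u $ Inl k - u $ Inl j" by simp_all
    show "?f s t i j a b u * ?f s' t' i k b c u =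
      ?f s (t + t') i j a c u * ?f (s' - s) t' j k b c u + ?f s' (t + t') i k a c u * ?f (s - s') t k j a b u"
      using Phi_st_fay[OF \<tau> d, of ?X s ?Y s' ?U t ?V t'] u unfolding r by simp
  qed (use assms in \<open>auto intro!: mero_mult mero_add mero_Phi\<close>)
  then show ?thesis unfolding F_mer_def using assms by (simp add: abs_mer_mult abs_mer_add mero_Phi mero_mult)
qed

end

section \<open>Dunkl operators\<close>

lemma pos_less: "i < j ==> pos i < pos (j :: 'a::{finite,linorder})"
proof -
  assume "i < j"
  then have "{k. k \<le> i} \<subseteq> {k. k \<le> j}" "j \<in> {k. k \<le> j} - {k. k \<le> i}" by auto
  then have "{k. k \<le> i} \<subset> {k. k \<le> j}" by blast
  then show ?thesis unfolding pos_def by (intro psubset_card_mono) simp_all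
qed

lemma inj_pos: "inj (pos :: 'a::{finite,linorder} => nat)"
  by (rule injI) (metis less_irrefl linorder_neqE pos_less)

lemma range_pos: "range (pos :: 'a::{finite,linorder} => nat) = {1..CARD('a)}"
proof (rule card_subset_eq)
  show "range (pos :: 'a => nat) \<subseteq> {1..CARD('a)}"
  proof (safe, simp)
    fix i :: 'a
    have "{i} \<subseteq> {j. j \<le> i}" by simp
    then have "card {i} \<le> card {j. j \<le> i}" by (intro card_mono) auto
    moreover have "card {j. j \<le> i} \<le> CARD('a)" by (intro card_mono) auto
    ultimately show "Suc 0 \<le> pos i \<and> pos i \<le> CARD('a)" by (simp add: pos_def)
  qed
  show "card (range (pos :: 'a => nat)) = card {1..CARD('a)}" by (simp add: card_image inj_pos)
qed simp

abbreviation ip :: "'a::{finite,linorder} => int" where "ip x \<equiv> int (pos x)"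

lemma pos_residue_unique:
  assumes "int CARD('a) dvd ip x - ip (y :: 'a::{finite,linorder})" shows "x = y"
proof -
  have r: "pos x \<in> {1..CARD('a)}" "pos y \<in> {1..CARD('a)}" unfolding range_pos[symmetric] by auto
  then have lt: "\<bar>ip x - ip y\<bar> < int CARD('a)" by auto
  have "ip x - ip y = 0"
  proof (rule ccontr)
    assume "ip x - ip y \<noteq> 0"
    from dvd_imp_le_int[OF this assms] show False using lt by linarith
  qed
  then have "pos x = pos y" by simp
  then show ?thesis by (rule injD[OF inj_pos])
qed

lemma pos_residue_exists: "\<exists>x :: 'a::{finite,linorder}. int CARD('a) dvd ip x - m"
proof -
  define k where "k = (m - 1) mod int CARD('a) + 1"
  have "0 \<le> (m - 1) mod int CARD('a)" "(m - 1) mod int CARD('a) < int CARD('a)" by simp_all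
  then have "1 \<le> k" "k \<le> int CARD('a)" unfolding k_def by linarith+
  then have "nat k \<in> {1..CARD('a)}" by (simp add: nat_le_iff le_nat_iff)
  then obtain x :: 'a where x: "pos x = nat k" unfolding range_pos[symmetric] by (metis imageE)
  have "k \<ge> 0" by (simp add: k_def)
  then have "ip x = k" using x by simp
  then have "ip x - m = - ((m - 1) - (m - 1) mod int CARD('a))" by (simp add: k_def)
  then have "int CARD('a) dvd ip x - m" by (metis dvd_minus_mod dvd_minus_iff)
  then show ?thesis ..
qed

lemma sum_eq_single: "finite A ==> a \<in> A ==> (\<And>x. x \<in> A ==> x \<noteq> a ==> f x = 0) ==> sum f A = (f a :: 'b::comm_monoid_add)"
  by (subst sum.remove[of A a]) (auto intro!: sum.neutral)

text \<open>
  The R-matrix with the $x$-indices $i,j$ and the spectral indices $a,b$ decoupled: moving group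
  elements past coefficients permutes the two kinds of variables independently.
\<close>

definition RR :: "complex => 'n::finite => 'n => 'n => 'n => ('n, 'd::{finite,linorder}, ('n + 'n) merfun) umat" where
  "RR \<tau> i j a b = (\<lambda>I J. if \<forall>k. k \<noteq> i \<and> k \<noteq> j \<longrightarrow> I k = J k
     then abs_mer (\<lambda>u. R_entry \<tau> (I i) (J i) (I j) (J j) (u $ Inl i - u $ Inl j) (u $ Inr a - u $ Inr b))
     else 0)"

lemma R_mat_RR: "R_mat \<tau> i j = RR \<tau> i j i j"
  by (simp add: R_mat_def RR_def)

lemma R_entry_Phi:
  "R_entry \<tau> (\<alpha> :: 'd::{finite,linorder}) \<beta> \<gamma> \<delta> z \<mu> =
    (if int CARD('d) dvd ip \<alpha> + ip \<gamma> - ip \<beta> - ip \<delta> then Phi_st \<tau> CARD('d) (ip \<gamma> - ip \<beta>) (ip \<beta> - ip \<alpha>) z \<mu> else 0)"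
proof -
  have "(pos \<alpha> + pos \<gamma>) mod CARD('d) = (pos \<beta> + pos \<delta>) mod CARD('d) \<longleftrightarrow>
    (ip \<alpha> + ip \<gamma>) mod int CARD('d) = (ip \<beta> + ip \<delta>) mod int CARD('d)"
    by (metis of_nat_add of_nat_eq_iff zmod_int)
  also have "\<dots> \<longleftrightarrow> int CARD('d) dvd (ip \<alpha> + ip \<gamma>) - (ip \<beta> + ip \<delta>)"
    by (rule mod_eq_dvd_iff)
  also have "(ip \<alpha> + ip \<gamma>) - (ip \<beta> + ip \<delta>) = ip \<alpha> + ip \<gamma> - ip \<beta> - ip \<delta>" by simp
  finally show ?thesis by (simp add: R_entry_def Phi_st_def Let_def)
qed

context
  fixes \<tau> :: complex
  assumes \<tau>: "Im \<tau> > 0"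
begin

lemma RR_F_mer:
  "RR \<tau> i j a b (I :: 'n => 'd) J = (if (\<forall>k. k \<noteq> i \<and> k \<noteq> j \<longrightarrow> I k = J k) \<and> int CARD('d) dvd ip (I i) + ip (I j) - ip (J i) - ip (J j)
     then F_mer \<tau> CARD('d::{finite,linorder}) (ip (I j) - ip (J i)) (ip (J i) - ip (I i)) (i :: 'n::finite) j a b else 0)"
proof -
  have d: "CARD('d) > 0" by simp
  show ?thesis unfolding RR_def R_entry_Phi F_mer_def[OF \<tau> d] by (auto simp: zero_merfun_def)
qed

lemma RR_skew:
  assumes "i \<noteq> j" "a \<noteq> b"
  shows "RR \<tau> j i b a I (J :: 'n::finite => 'd::{finite,linorder}) = - RR \<tau> i j a b I J"
proof -
  let ?d = "CARD('d)"
  have d: "?d > 0" by simp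
  have e: "(int ?d dvd ip (I j) + ip (I i) - ip (J j) - ip (J i)) = (int ?d dvd ip (I i) + ip (I j) - ip (J i) - ip (J j))"
    by (simp add: algebra_simps)
  have "F_mer \<tau> ?d (ip (I i) - ip (J j)) (ip (J j) - ip (I j)) j i b a = - F_mer \<tau> ?d (ip (I j) - ip (J i)) (ip (J i) - ip (I i)) i j a b"
    if "int ?d dvd ip (I i) + ip (I j) - ip (J i) - ip (J j)"
  proof -
    have "F_mer \<tau> ?d (ip (I i) - ip (J j)) (ip (J j) - ip (I j)) j i b a
       = F_mer \<tau> ?d (- (ip (I j) - ip (J i))) (- (ip (J i) - ip (I i))) j i b a"
      by (rule F_mer_cong[OF \<tau> d]) (use that dvd_minus_iff[of "int ?d" "ip (I i) + ip (I j) - ip (J i) - ip (J j)"] in \<open>simp_all add: algebra_simps\<close>)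
    then show ?thesis by (simp only: F_mer_skew[OF \<tau> d assms])
  qed
  then show ?thesis unfolding RR_F_mer e by auto
qed

text \<open>
  The selection rule for the indices leaves a single intermediate multi-index in the product of
  two R-matrices that share a tensor factor.
\<close>

lemma RR_product:
  fixes i j k :: "'n::finite" and I J :: "'n => 'd::{finite,linorder}"
  assumes ijk: "i \<noteq> j" "i \<noteq> k" "j \<noteq> k"
  shows "umat_mult (*) (RR \<tau> i j a b) (RR \<tau> i k a' b') I J =
    (if (\<forall>l. l \<noteq> i \<and> l \<noteq> j \<and> l \<noteq> k \<longrightarrow> I l = J l) \<and>
        int CARD('d) dvd ip (I i) + ip (I j) + ip (I k) - ip (J i) - ip (J j) - ip (J k)
     then F_mer \<tau> CARD('d) (ip (J j) - ip (I i)) (ip (I j) - ip (J j)) i j a b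
        * F_mer \<tau> CARD('d) (ip (I k) - ip (J i)) (ip (I k) - ip (J k)) i k a' b' else 0)"
proof -
  let ?d = "int CARD('d)"
  have d: "CARD('d) > 0" by simp
  obtain c :: 'd where c: "?d dvd ip c - (ip (I i) + ip (I j) - ip (J j))" using pos_residue_exists by blast
  define K where "K l = (if l = i then c else if l = k then I k else J l)" for l
  have K: "K i = c" "K j = J j" "K k = I k" "\<And>l. l \<noteq> i ==> l \<noteq> k ==> K l = J l"
    using ijk by (auto simp: K_def)
  have "umat_mult (*) (RR \<tau> i j a b) (RR \<tau> i k a' b') I J = RR \<tau> i j a b I K * RR \<tau> i k a' b' K J"
    unfolding umat_mult_def
  proof (rule sum_eq_single)
    fix L :: "'n => 'd" assume "L \<noteq> K"
    show "RR \<tau> i j a b I L * RR \<tau> i k a' b' L J = 0"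
    proof (rule ccontr)
      assume "RR \<tau> i j a b I L * RR \<tau> i k a' b' L J \<noteq> 0"
      then have nz: "RR \<tau> i j a b I L \<noteq> 0" "RR \<tau> i k a' b' L J \<noteq> 0" by auto
      have 1: "\<And>l. l \<noteq> i ==> l \<noteq> j ==> I l = L l" "?d dvd ip (I i) + ip (I j) - ip (L i) - ip (L j)"
        using nz(1) unfolding RR_F_mer by (auto split: if_splits)
      have 2: "\<And>l. l \<noteq> i ==> l \<noteq> k ==> L l = J l"
        using nz(2) unfolding RR_F_mer by (auto split: if_splits)
      have Lj: "L j = J j" and Lk: "L k = I k" using 1(1)[of k] 2[of j] ijk by auto
      have "?d dvd (ip c - (ip (I i) + ip (I j) - ip (J j))) + (ip (I i) + ip (I j) - ip (L i) - ip (L j))"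
        by (rule dvd_add[OF c 1(2)])
      then have "?d dvd ip c - ip (L i)" by (simp add: Lj)
      then have "L i = c" using pos_residue_unique by metis
      then have "L = K" using 2 Lk by (auto simp: K_def)
      then show False using \<open>L \<noteq> K\<close> by simp
    qed
  qed simp_all
  also have "\<dots> = (if (\<forall>l. l \<noteq> i \<and> l \<noteq> j \<and> l \<noteq> k \<longrightarrow> I l = J l) \<and>
        ?d dvd ip (I i) + ip (I j) + ip (I k) - ip (J i) - ip (J j) - ip (J k)
     then F_mer \<tau> CARD('d) (ip (J j) - ip (I i)) (ip (I j) - ip (J j)) i j a b
        * F_mer \<tau> CARD('d) (ip (I k) - ip (J i)) (ip (I k) - ip (J k)) i k a' b' else 0)"
  proof -
    have c': "?d dvd ip (I i) + ip (I j) - ip c - ip (J j)"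
      using c dvd_minus_iff[of ?d "ip c - (ip (I i) + ip (I j) - ip (J j))"] by (simp add: algebra_simps)
    have tot: "?d dvd ip c + ip (I k) - ip (J i) - ip (J k) \<longleftrightarrow>
       ?d dvd ip (I i) + ip (I j) + ip (I k) - ip (J i) - ip (J j) - ip (J k)"
      using dvd_add_right_iff[OF c', of "ip c + ip (I k) - ip (J i) - ip (J k)"] by (simp add: algebra_simps)
    have q1: "(\<forall>l. l \<noteq> i \<and> l \<noteq> j \<longrightarrow> I l = K l) \<longleftrightarrow> (\<forall>l. l \<noteq> i \<and> l \<noteq> j \<and> l \<noteq> k \<longrightarrow> I l = J l)"
      using K by metis
    have q2: "\<forall>l. l \<noteq> i \<and> l \<noteq> k \<longrightarrow> K l = J l" using K(4) by blast
    have f1: "F_mer \<tau> CARD('d) (ip (I j) - ip c) (ip c - ip (I i)) i j a b =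
       F_mer \<tau> CARD('d) (ip (J j) - ip (I i)) (ip (I j) - ip (J j)) i j a b"
      by (rule F_mer_cong[OF \<tau> d]) (use c c' in \<open>simp_all add: algebra_simps\<close>)
    have f2: "F_mer \<tau> CARD('d) (ip (I k) - ip (J i)) (ip (J i) - ip c) i k a' b' =
       F_mer \<tau> CARD('d) (ip (I k) - ip (J i)) (ip (I k) - ip (J k)) i k a' b'"
      if t: "?d dvd ip (I i) + ip (I j) + ip (I k) - ip (J i) - ip (J j) - ip (J k)"
    proof (rule F_mer_cong[OF \<tau> d])
      have "?d dvd - (ip c + ip (I k) - ip (J i) - ip (J k))" using t tot dvd_minus_iff by blast
      then show "?d dvd ip (J i) - ip c - (ip (I k) - ip (J k))" by (simp add: algebra_simps)
    qed simp
    show ?thesis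
      unfolding RR_F_mer K(1-3) q1 tot using c' q2 f1 f2 by auto
  qed
  finally show ?thesis .
qed

text \<open>
  The associative Yang--Baxter equation. Entrywise all three products survive for the same
  indices, and the identity is that of Fay.
\<close>

lemma RR_aybe:
  fixes i j k a b c :: "'n::finite"
  assumes "i \<noteq> j" "i \<noteq> k" "j \<noteq> k" "a \<noteq> b" "b \<noteq> c" "a \<noteq> c"
  shows "umat_mult (*) (RR \<tau> i j a b) (RR \<tau> i k b c) I J + umat_mult (*) (RR \<tau> i k a c) (RR \<tau> j k b a) I J
    = umat_mult (*) (RR \<tau> j k b c) (RR \<tau> i j a c) I (J :: 'n => 'd::{finite,linorder})"
proof -
  let ?d = "int CARD('d)"
  have d: "CARD('d) > 0" by simp
  have neg: "umat_mult (*) (RR \<tau> i k a c) (RR \<tau> j k b a) I J = umat_mult (*) (RR \<tau> k i c a) (RR \<tau> k j a b) I J"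
    "umat_mult (*) (RR \<tau> j k b c) (RR \<tau> i j a c) I J = - umat_mult (*) (RR \<tau> j k b c) (RR \<tau> j i c a) I J"
    unfolding umat_mult_def using assms by (simp_all add: RR_skew[of i k a c] RR_skew[of j k b a] RR_skew[of i j a c] sum_negf)
  have o: "(\<forall>l. l \<noteq> k \<and> l \<noteq> i \<and> l \<noteq> j \<longrightarrow> I l = J l) = (\<forall>l. l \<noteq> i \<and> l \<noteq> j \<and> l \<noteq> k \<longrightarrow> I l = J l)"
    "(\<forall>l. l \<noteq> j \<and> l \<noteq> k \<and> l \<noteq> i \<longrightarrow> I l = J l) = (\<forall>l. l \<noteq> i \<and> l \<noteq> j \<and> l \<noteq> k \<longrightarrow> I l = J l)" by auto
  have t: "ip (I k) + ip (I i) + ip (I j) - ip (J k) - ip (J i) - ip (J j) = ip (I i) + ip (I j) + ip (I k) - ip (J i) - ip (J j) - ip (J k)"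
    "ip (I j) + ip (I k) + ip (I i) - ip (J j) - ip (J k) - ip (J i) = ip (I i) + ip (I j) + ip (I k) - ip (J i) - ip (J j) - ip (J k)"
    by simp_all
  let ?F = "F_mer \<tau> CARD('d) :: int => int => 'n => 'n => 'n => 'n => ('n + 'n) merfun"
  have main: "?F (ip (J j) - ip (I i)) (ip (I j) - ip (J j)) i j a b * ?F (ip (I k) - ip (J i)) (ip (I k) - ip (J k)) i k b c
     + ?F (ip (J i) - ip (I k)) (ip (I i) - ip (J i)) k i c a * ?F (ip (I j) - ip (J k)) (ip (I j) - ip (J j)) k j a b
     = - (?F (ip (J k) - ip (I j)) (ip (I k) - ip (J k)) j k b c * ?F (ip (I i) - ip (J j)) (ip (I i) - ip (J i)) j i c a)"
    if T: "?d dvd ip (I i) + ip (I j) + ip (I k) - ip (J i) - ip (J j) - ip (J k)" (is "?d dvd ?tot")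
  proof -
    have T': "?d dvd - ?tot" using T dvd_minus_iff by blast
    let ?s = "ip (J j) - ip (I i)" and ?t = "ip (I j) - ip (J j)" and ?s' = "ip (I k) - ip (J i)" and ?t' = "ip (I k) - ip (J k)"
    have 1: "?F ?s (?t + ?t') i j a c = - ?F (ip (I i) - ip (J j)) (ip (I i) - ip (J i)) j i c a"
    proof -
      have "?F ?s (?t + ?t') i j a c = ?F (- (ip (I i) - ip (J j))) (- (ip (I i) - ip (J i))) i j a c"
        by (rule F_mer_cong[OF \<tau> d]) (use T in \<open>simp_all add: algebra_simps\<close>)
      also have "\<dots> = - ?F (ip (I i) - ip (J j)) (ip (I i) - ip (J i)) j i c a"
        by (rule F_mer_skew[OF \<tau> d]) (use assms in auto)
      finally show ?thesis .
    qed
    have 2: "?F (?s' - ?s) ?t' j k b c = ?F (ip (J k) - ip (I j)) (ip (I k) - ip (J k)) j k b c"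
      by (rule F_mer_cong[OF \<tau> d]) (use T in \<open>simp_all add: algebra_simps\<close>)
    have 3: "?F ?s' (?t + ?t') i k a c = - ?F (ip (J i) - ip (I k)) (ip (I i) - ip (J i)) k i c a"
    proof -
      have "?F ?s' (?t + ?t') i k a c = ?F (- (ip (J i) - ip (I k))) (- (ip (I i) - ip (J i))) i k a c"
        by (rule F_mer_cong[OF \<tau> d]) (use T in \<open>simp_all add: algebra_simps\<close>)
      also have "\<dots> = - ?F (ip (J i) - ip (I k)) (ip (I i) - ip (J i)) k i c a"
        by (rule F_mer_skew[OF \<tau> d]) (use assms in auto)
      finally show ?thesis .
    qed
    have 4: "?F (?s - ?s') ?t k j a b = ?F (ip (I j) - ip (J k)) (ip (I j) - ip (J j)) k j a b"
      by (rule F_mer_cong[OF \<tau> d]) (use T' in \<open>simp_all add: algebra_simps\<close>)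
    show ?thesis
      using F_mer_fay[OF \<tau> d assms, of ?s ?t ?s' ?t'] unfolding 1 2 3 4 by (simp add: algebra_simps)
  qed
  show ?thesis
    unfolding neg using assms RR_product[of i j k a b b c I J] RR_product[of k i j c a a b I J] RR_product[of j k i b c c a I J]
    unfolding o t using main by auto
qed

lemma RR_disjoint:
  fixes i j k l :: "'n::finite"
  assumes "i \<noteq> j" "i \<noteq> k" "i \<noteq> l" "j \<noteq> k" "j \<noteq> l" "k \<noteq> l"
  shows "umat_mult (*) (RR \<tau> i k a c) (RR \<tau> j l b e) I J = umat_mult (*) (RR \<tau> j l b e) (RR \<tau> i k a c) I (J :: 'n => 'd::{finite,linorder})"
proof -
  define K where "K m = (if m = i \<or> m = k then J m else I m)" for m
  define K' where "K' m = (if m = j \<or> m = l then J m else I m)" for m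
  have z: "\<forall>m. m \<noteq> p \<and> m \<noteq> q \<longrightarrow> I m = L m" if "RR \<tau> p q a c I L \<noteq> 0" for p q a c and I L :: "'n => 'd"
    using that unfolding RR_F_mer by (auto split: if_splits)
  show ?thesis
  proof (cases "\<forall>m. m \<noteq> i \<and> m \<noteq> k \<and> m \<noteq> j \<and> m \<noteq> l \<longrightarrow> I m = J m")
    case False
    then obtain m where m: "m \<noteq> i" "m \<noteq> k" "m \<noteq> j" "m \<noteq> l" "I m \<noteq> J m" by blast
    have "RR \<tau> i k a c I L * RR \<tau> j l b e L J = 0" "RR \<tau> j l b e I L * RR \<tau> i k a c L J = 0" for L
      using m by (cases "I m = L m"; auto simp: RR_def)+
    then show ?thesis unfolding umat_mult_def by simp
  next
    case True
    have 1: "umat_mult (*) (RR \<tau> i k a c) (RR \<tau> j l b e) I J = RR \<tau> i k a c I K * RR \<tau> j l b e K J"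
      unfolding umat_mult_def
    proof (rule sum_eq_single)
      fix L assume "L \<noteq> K"
      show "RR \<tau> i k a c I L * RR \<tau> j l b e L J = 0"
      proof (rule ccontr)
        assume "RR \<tau> i k a c I L * RR \<tau> j l b e L J \<noteq> 0"
        then have nz: "RR \<tau> i k a c I L \<noteq> 0" "RR \<tau> j l b e L J \<noteq> 0" by auto
        have "\<forall>m. m \<noteq> i \<and> m \<noteq> k \<longrightarrow> I m = L m" "\<forall>m. m \<noteq> j \<and> m \<noteq> l \<longrightarrow> L m = J m"
          using z[OF nz(1)] z[OF nz(2)] by simp_all
        then have "L = K" using assms by (auto simp: K_def)
        then show False using \<open>L \<noteq> K\<close> by simp
      qed
    qed simp_all
    have 2: "umat_mult (*) (RR \<tau> j l b e) (RR \<tau> i k a c) I J = RR \<tau> j l b e I K' * RR \<tau> i k a c K' J"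
      unfolding umat_mult_def
    proof (rule sum_eq_single)
      fix L assume "L \<noteq> K'"
      show "RR \<tau> j l b e I L * RR \<tau> i k a c L J = 0"
      proof (rule ccontr)
        assume "RR \<tau> j l b e I L * RR \<tau> i k a c L J \<noteq> 0"
        then have nz: "RR \<tau> j l b e I L \<noteq> 0" "RR \<tau> i k a c L J \<noteq> 0" by auto
        have "\<forall>m. m \<noteq> j \<and> m \<noteq> l \<longrightarrow> I m = L m" "\<forall>m. m \<noteq> i \<and> m \<noteq> k \<longrightarrow> L m = J m"
          using z[OF nz(1)] z[OF nz(2)] by simp_all
        then have "L = K'" using assms by (auto simp: K'_def)
        then show False using \<open>L \<noteq> K'\<close> by simp
      qed
    qed simp_all
    have "RR \<tau> i k a c I K = RR \<tau> i k a c K' J" "RR \<tau> j l b e K J = RR \<tau> j l b e I K'"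
      using assms True by (auto simp: RR_F_mer K_def K'_def)
    then show ?thesis unfolding 1 2 by (simp add: mult.commute)
  qed
qed

lemma RR_mero:
  fixes i j a b :: "'n::finite"
  assumes "i \<noteq> j" "a \<noteq> b"
  shows "mero (\<lambda>u. R_entry \<tau> (\<alpha> :: 'd::{finite,linorder}) \<beta> \<gamma> \<delta> (u $ Inl i - u $ Inl j) (u $ Inr a - u $ Inr b))"
proof -
  have d: "CARD('d) > 0" by simp
  show ?thesis
    unfolding R_entry_Phi using mero_Phi[OF \<tau> d assms, of "ip \<gamma> - ip \<beta>" "ip \<beta> - ip \<alpha>"] mero_const[of 0]
    by (cases "int CARD('d) dvd ip \<alpha> + ip \<gamma> - ip \<beta> - ip \<delta>") simp_all
qed

lemma RR_reindex:
  fixes i j a b :: "'n::finite"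
  assumes "i \<noteq> j" "a \<noteq> b"
  shows "reindex (map_sum (Perm.apply w) (Perm.apply v)) (RR \<tau> i j a b (I \<circ> Perm.apply w) (J \<circ> Perm.apply w))
    = RR \<tau> (w \<langle>$\<rangle> i) (w \<langle>$\<rangle> j) (v \<langle>$\<rangle> a) (v \<langle>$\<rangle> b) I (J :: 'n => 'd::{finite,linorder})"
proof -
  have inj: "inj (map_sum (Perm.apply w) (Perm.apply v))" by (intro inj_map_sum inj_perm)
  have "(\<forall>k. k \<noteq> i \<and> k \<noteq> j \<longrightarrow> I (w \<langle>$\<rangle> k) = J (w \<langle>$\<rangle> k)) \<longleftrightarrow> (\<forall>k. k \<noteq> w \<langle>$\<rangle> i \<and> k \<noteq> w \<langle>$\<rangle> j \<longrightarrow> I k = J k)"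
    by (metis perm_cancel)
  then show ?thesis
    using reindex_abs[OF inj RR_mero[OF assms]] reindex_0[OF inj] by (auto simp: RR_def)
qed

lemma RR_deriv:
  fixes i j a b :: "'n::finite"
  assumes "i \<noteq> j" "a \<noteq> b"
  shows "l \<noteq> i ==> l \<noteq> j ==> pderiv_mer (Inl l) (RR \<tau> i j a b I J) = 0"
    "pderiv_mer (Inl i) (RR \<tau> i j a b I J) + pderiv_mer (Inl j) (RR \<tau> i j a b I (J :: 'n => 'd::{finite,linorder})) = 0"
proof -
  have z: "dmer v (RR \<tau> i j a b I J) = 0" if v: "v $ Inl i = v $ Inl j" "v $ Inr a = 0" "v $ Inr b = 0" for v
  proof (cases "\<forall>k. k \<noteq> i \<and> k \<noteq> j \<longrightarrow> I k = J k")
    case True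
    let ?f = "\<lambda>u. R_entry \<tau> (I i) (J i) (I j) (J j) (u $ Inl i - u $ Inl j) (u $ Inr a - u $ Inr b)"
    have "ddir v ?f = (\<lambda>u. 0)" by (rule ext) (simp add: ddir_def v)
    then show ?thesis using True by (simp add: RR_def dmer_abs[OF RR_mero[OF assms]] zero_merfun_def)
  next
    case False
    then have "RR \<tau> i j a b I J = 0" unfolding RR_def by (rule if_not_P)
    then show ?thesis by simp
  qed
  show "pderiv_mer (Inl l) (RR \<tau> i j a b I J) = 0" if "l \<noteq> i" "l \<noteq> j"
    unfolding pderiv_mer_dmer by (rule z) (use that in \<open>auto simp: axis_def\<close>)
  show "pderiv_mer (Inl i) (RR \<tau> i j a b I J) + pderiv_mer (Inl j) (RR \<tau> i j a b I J) = 0"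
    unfolding pderiv_mer_dmer dmer_add_dir[symmetric] by (rule z) (use assms in \<open>auto simp: axis_def\<close>)
qed

end

definition cM :: "('n, 'd, ('n::finite + 'n) merfun) umat => ('n, 'd, 'n qu) umat" where
  "cM A = (\<lambda>I J. coef (fps_const (A I J)))"

lemma coef_fps_const_add: "coef (fps_const (a + b)) = coef (fps_const a) + coef (fps_const (b :: 'c::comm_ring_1))"
  by (simp add: fps_const_add[symmetric] coef_add del: fps_const_add)

lemma coef_fps_const_sum: "coef (fps_const (sum f A)) = (\<Sum>x\<in>A. coef (fps_const (f x :: 'c::comm_ring_1)))"
  by (induction A rule: infinite_finite_induct) (simp_all add: coef_fps_const_add del: fps_const_add)

lemma um_cM: "um (cM A) (cM B) = cM (umat_mult (*) A (B :: ('n::{finite,linorder}, 'd::finite, _) umat))"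
  by (intro ext) (simp add: umat_mult_def cM_def star_coef coef_mult[symmetric] coef_fps_const_sum)

text \<open>
  The exchange term $g R_{ij}\widehat s_{ij}$ of a Dunkl operator.
\<close>

definition TT :: "complex => complex => 'n::{finite,linorder} => 'n => ('n, 'd::{finite,linorder}) qu_WW" where
  "TT \<tau> g i j = spread \<langle>i \<leftrightarrow> j\<rangle> (cM (\<lambda>I J. mconst g * RR \<tau> i j i j I J))"

text \<open>
  The momentum term of a Dunkl operator.
\<close>

definition PP :: "'n::{finite,linorder} => ('n, 'd::{finite,linorder}) qu_WW" where
  "PP i = spread 1 (scal_mat (mom i))"

lemma dunkl_PP_TT: "dunkl \<tau> g i = PP i - (\<Sum>j\<in>UNIV - {i}. TT \<tau> g i j)"
  by (simp add: dunkl_def PP_def TT_def scalar_WW_def scalar_W_def spread_def cM_def R_mat_RR)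

definition commutator :: "('n::{finite,linorder}, 'd::finite) qu_WW => ('n, 'd) qu_WW => ('n, 'd) qu_WW" where
  "commutator X Y = mult_WW X Y - mult_WW Y X"

lemma mult_WW_zero [simp]: "mult_WW 0 X = 0" "mult_WW X 0 = 0"
  using mult_WW_add(1)[of 0 0 X] mult_WW_add(2)[of X 0 0] by auto

lemma mult_WW_uminus: "mult_WW (- X) Y = - mult_WW X Y" "mult_WW X (- Y) = - mult_WW X Y"
  using mult_WW_add(1)[of X "- X" Y] mult_WW_add(2)[of X Y "- Y"] by (simp_all add: add_eq_0_iff)

lemma mult_WW_sum: "mult_WW (sum f A) Y = (\<Sum>x\<in>A. mult_WW (f x) Y)" "mult_WW Y (sum f A) = (\<Sum>x\<in>A. mult_WW Y (f x))"
  by (induction A rule: infinite_finite_induct;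
    simp only: sum.infinite sum.empty sum.insert mult_WW_zero mult_WW_add not_False_eq_True)+

lemma commutator_add: "commutator (X + X') Y = commutator X Y + commutator X' Y"
  "commutator Y (X + X') = commutator Y X + commutator Y X'"
  by (simp_all add: commutator_def mult_WW_add)

lemma commutator_uminus: "commutator (- X) Y = - commutator X Y" "commutator X (- Y) = - commutator X Y"
  by (simp_all add: commutator_def mult_WW_uminus)

lemma commutator_diff: "commutator (X - X') Y = commutator X Y - commutator X' Y"
  "commutator Y (X - X') = commutator Y X - commutator Y X'"
  using commutator_add(1)[of X "- X'" Y] commutator_add(2)[of Y X "- X'"] by (simp_all add: commutator_uminus)

lemma commutator_sum: "commutator (sum f A) Y = (\<Sum>x\<in>A. commutator (f x) Y)"
  "commutator Y (sum f A) = (\<Sum>x\<in>A. commutator Y (f x))"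
  by (simp_all add: commutator_def mult_WW_sum sum_subtractf)

lemma commutator_self [simp]: "commutator X X = 0"
  by (simp add: commutator_def)

lemma commutator_swap: "commutator X Y = - commutator Y X"
  by (simp add: commutator_def)

lemma spread_add: "spread w (A + B) = spread w A + spread w B"
  by (auto simp: spread_def delta_def fun_eq_iff)

lemma spread_uminus: "spread w (- A) = - spread w A"
  by (auto simp: spread_def delta_def fun_eq_iff)

lemma um_scal_left: "um (scal_mat a) A = (\<lambda>I J. star a (A I J))"
  unfolding umat_mult_def scal_mat_def
proof (intro ext)
  fix I J
  show "(\<Sum>K\<in>UNIV. star (if I = K then a else 0) (A K J)) = star a (A I J)"
    by (subst sum_eq_single[of UNIV I]) auto
qed

lemma um_scal_right: "um A (scal_mat a) = (\<lambda>I J. star (A I J) a)"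
  unfolding umat_mult_def scal_mat_def
proof (intro ext)
  fix I J
  show "(\<Sum>K\<in>UNIV. star (A I K) (if K = J then a else 0)) = star (A I J) a"
    by (subst sum_eq_single[of UNIV J]) auto
qed

lemma hatM_scal: "hatM w (scal_mat a) = scal_mat (act_hat_qu w (a :: ('n::{finite,linorder}) qu))"
proof (intro ext)
  fix I J :: "'n => 'd"
  have "I \<circ> Perm.apply w = J \<circ> Perm.apply w \<longleftrightarrow> I = J"
    by (metis bij_comp_perm bij_is_inj injD)
  then show "hatM w (scal_mat a) I J = scal_mat (act_hat_qu w a) I J"
    by (simp add: hatM_def scal_mat_def act_hat_qu_qact qaction.qact_0[OF qaction_hat])
qed

lemma act_vee_scal: "act_vee w (scal_mat a) = scal_mat (act_vee_qu w (a :: ('n::{finite,linorder}) qu))"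
  by (intro ext) (simp add: act_vee_def scal_mat_def act_vee_qu_qact qaction.qact_0[OF qaction_vee])

lemma act_hat_qu_mom: "act_hat_qu w (mom i) = mom (w \<langle>$\<rangle> (i :: 'n::{finite,linorder}))"
  by (simp add: act_hat_qu_qact qaction.qact_mom[OF qaction_hat])

lemma act_vee_qu_mom: "act_vee_qu w (mom i) = mom (i :: 'n::{finite,linorder})"
  by (simp add: act_vee_qu_qact qaction.qact_mom[OF qaction_vee])

lemma fps_coeffwise_const: "f 0 = 0 ==> fps_coeffwise f (fps_const c) = fps_const (f c)"
  by (rule fps_ext) simp

lemma act_hat_qu_const: "act_hat_qu w (coef (fps_const c)) = coef (fps_const (reindex (map_sum (Perm.apply w) id) (c :: ('n::{finite,linorder} + 'n) merfun)))"
  by (simp add: act_hat_qu_qact qaction.qact_coef[OF qaction_hat] fps_coeffwise_const reindex_0 inj_map_sum inj_perm)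

lemma act_vee_qu_const: "act_vee_qu w (coef (fps_const c)) = coef (fps_const (reindex (map_sum id (Perm.apply w)) (c :: ('n::{finite,linorder} + 'n) merfun)))"
  by (simp add: act_vee_qu_qact qaction.qact_coef[OF qaction_vee] fps_coeffwise_const reindex_0 inj_map_sum inj_perm)

context
  fixes \<tau> g :: complex
  assumes \<tau>: "Im \<tau> > 0"
begin

abbreviation gR :: "'n::{finite,linorder} => 'n => 'n => 'n => ('n, 'd::{finite,linorder}, ('n + 'n) merfun) umat" where
  "gR i j a b \<equiv> (\<lambda>I J. mconst g * RR \<tau> i j a b I J)"

lemma hatM_gR:
  fixes i j a b :: "'n::{finite,linorder}"
  assumes "i \<noteq> j" "a \<noteq> b"
  shows "hatM w (cM (gR i j a b)) = cM (gR (w \<langle>$\<rangle> i) (w \<langle>$\<rangle> j) a b :: ('n, 'd::{finite,linorder}, _) umat)"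
proof (intro ext)
  fix I J :: "'n => 'd"
  show "hatM w (cM (gR i j a b)) I J = cM (gR (w \<langle>$\<rangle> i) (w \<langle>$\<rangle> j) a b) I J"
    using RR_reindex[OF \<tau> assms, of w 1 I J]
    by (simp add: hatM_def cM_def act_hat_qu_const reindex_mult reindex_mconst inj_map_sum inj_perm id_def)
qed

lemma act_vee_gR:
  fixes i j a b :: "'n::{finite,linorder}"
  assumes "i \<noteq> j" "a \<noteq> b"
  shows "act_vee w (cM (gR i j a b)) = cM (gR i j (w \<langle>$\<rangle> a) (w \<langle>$\<rangle> b) :: ('n, 'd::{finite,linorder}, _) umat)"
proof (intro ext)
  fix I J :: "'n => 'd"
  have "I \<circ> (\<lambda>x. x) = I" "J \<circ> (\<lambda>x. x) = J" by auto
  then show "act_vee w (cM (gR i j a b)) I J = cM (gR i j (w \<langle>$\<rangle> a) (w \<langle>$\<rangle> b)) I J"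
    using RR_reindex[OF \<tau> assms, of 1 w I J]
    by (simp add: act_vee_def cM_def act_vee_qu_const reindex_mult reindex_mconst inj_map_sum inj_perm id_def)
qed

lemma um_gR: "umat_mult (*) (gR i j a b) (gR k l c e) I J = mconst (g * g) * umat_mult (*) (RR \<tau> i j a b) (RR \<tau> k l c e) I J"
  by (simp add: umat_mult_def sum_distrib_left mconst_mult mult_ac)

text \<open>
  The skew symmetry $R_{ij}(z,\mu) = -R_{ji}(-z,-\mu)$; it also makes the exchange terms cancel
  in the sum of all Dunkl operators.
\<close>

lemma TT_skew:
  assumes "i \<noteq> j" shows "TT \<tau> g j i = - (TT \<tau> g i j :: ('n::{finite,linorder}, 'd::{finite,linorder}) qu_WW)"
proof -
  have "cM (gR j i j i) = - cM (gR i j i j :: ('n, 'd, _) umat)"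
  proof (intro ext)
    fix I J :: "'n => 'd"
    show "cM (gR j i j i) I J = (- cM (gR i j i j)) I J"
      using RR_skew[OF \<tau> assms assms, of I J] by (simp add: cM_def coef_uminus[symmetric])
  qed
  moreover have "\<langle>j \<leftrightarrow> i\<rangle> = \<langle>i \<leftrightarrow> j\<rangle>" by (rule swap_sym)
  ultimately show ?thesis by (simp add: TT_def spread_uminus)
qed

lemma PP_commute: "commutator (PP i) (PP j) = (0 :: ('n::{finite,linorder}, 'd::{finite,linorder}) qu_WW)"
proof -
  have "(\<lambda>I J. star (mom i) (scal_mat (mom j) I J)) = (\<lambda>I (J :: 'n => 'd). star (mom j) (scal_mat (mom i) I J))"
    by (intro ext) (simp add: scal_mat_def star_mom pq_def mult.commute)
  then show ?thesis
    by (simp add: commutator_def PP_def mult_WW_spread hatM_one um_scal_left)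
qed

lemma Df_gR:
  fixes i j a b :: "'n::{finite,linorder}"
  assumes "i \<noteq> j" "a \<noteq> b"
  shows "l \<noteq> i ==> l \<noteq> j ==> Df l (fps_const (gR i j a b I J)) = 0"
    "Df i (fps_const (gR i j a b I J)) + Df j (fps_const (gR i j a b I (J :: 'n => 'd::{finite,linorder}))) = 0"
proof -
  have e: "Df l (fps_const (gR i j a b I J)) = fps_const (mconst g * pderiv_mer (Inl l) (RR \<tau> i j a b I J))" for l
    by (simp add: Df_def fps_coeffwise_const pderiv_mer_dmer dmer_mult)
  show "l \<noteq> i ==> l \<noteq> j ==> Df l (fps_const (gR i j a b I J)) = 0"
    unfolding e by (simp add: RR_deriv[OF \<tau> assms])
  show "Df i (fps_const (gR i j a b I J)) + Df j (fps_const (gR i j a b I J)) = 0"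
    unfolding e by (simp add: distrib_left[symmetric] RR_deriv[OF \<tau> assms])
qed

lemma PP_TT_mult:
  "mult_WW (PP l) (TT \<tau> g i j) = spread \<langle>i \<leftrightarrow> j\<rangle> (\<lambda>I J. mom l * cM (gR i j i j) I J + coef fps_X * Dq l (cM (gR i j i j) I J))"
  "mult_WW (TT \<tau> g i j) (PP l) = spread \<langle>i \<leftrightarrow> j\<rangle> (\<lambda>I J. mom (\<langle>i \<leftrightarrow> j\<rangle> \<langle>$\<rangle> l) * cM (gR i j i j) I (J :: 'n::{finite,linorder} => 'd::{finite,linorder}))"
  unfolding PP_def TT_def mult_WW_spread hatM_one hatM_scal act_hat_qu_mom um_scal_left um_scal_right star_mom
  by (simp_all add: pq_def cM_def star_coef mult.commute)

lemma commutator_PP_TT_disjoint: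
  assumes "l \<noteq> i" "l \<noteq> j" "i \<noteq> j"
  shows "commutator (PP l) (TT \<tau> g i (j :: 'n::{finite,linorder})) = 0"
proof -
  have "\<langle>i \<leftrightarrow> j\<rangle> \<langle>$\<rangle> l = l" using assms by simp
  then show ?thesis
    unfolding commutator_def PP_TT_mult
    by (simp add: cM_def Dq_coef Df_gR(1)[OF assms(3) assms(3) assms(1,2)])
qed

text \<open>
  The R-matrix depends on the difference $x_i - x_j$ only, so $\hat p_i+\hat p_j$ passes through
  it.
\<close>

lemma commutator_PP_TT:
  assumes "i \<noteq> j"
  shows "commutator (PP i) (TT \<tau> g j i) + commutator (TT \<tau> g i j) (PP (j :: 'n::{finite,linorder})) = (0 :: ('n, 'd::{finite,linorder}) qu_WW)"
proof -
  have s: "\<langle>i \<leftrightarrow> j\<rangle> \<langle>$\<rangle> i = j" "\<langle>i \<leftrightarrow> j\<rangle> \<langle>$\<rangle> j = i" by simp_all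
  have D: "Dq i (cM (gR i j i j) I J) = - Dq j (cM (gR i j i j) I (J :: 'n => 'd))" for I J
    using Df_gR(2)[OF assms assms, of I J]
    by (simp add: cM_def Dq_coef coef_uminus[symmetric] add_eq_0_iff2 add_eq_0_iff)
  have "commutator (PP i) (TT \<tau> g j i) + commutator (TT \<tau> g i j) (PP j) =
     mult_WW (TT \<tau> g i j) (PP i) - mult_WW (PP i) (TT \<tau> g i j) + (mult_WW (TT \<tau> g i j) (PP j) - mult_WW (PP j) (TT \<tau> g i j) :: ('n, 'd) qu_WW)"
    unfolding TT_skew[OF assms] commutator_def by (simp add: mult_WW_uminus)
  also have "\<dots> = 0"
    unfolding PP_TT_mult s
    by (auto simp: fun_eq_iff spread_def delta_def D algebra_simps)
  finally show ?thesis .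
qed

lemma TT_mult:
  assumes "i \<noteq> j" "k \<noteq> l"
  shows "mult_WW (TT \<tau> g i j) (TT \<tau> g k l) = spread (\<langle>i \<leftrightarrow> j\<rangle> * \<langle>k \<leftrightarrow> l\<rangle>)
    (cM (\<lambda>I J. mconst (g * g) * umat_mult (*) (RR \<tau> i j i j) (RR \<tau> (\<langle>i \<leftrightarrow> j\<rangle> \<langle>$\<rangle> k) (\<langle>i \<leftrightarrow> j\<rangle> \<langle>$\<rangle> l) k l) I (J :: 'n::{finite,linorder} => 'd::{finite,linorder})))"
  unfolding TT_def mult_WW_spread hatM_gR[OF assms(2,2)] um_cM um_gR ..

lemma commutator_TT_disjoint:
  assumes "i \<noteq> j" "i \<noteq> k" "i \<noteq> l" "j \<noteq> k" "j \<noteq> l" "k \<noteq> l"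
  shows "commutator (TT \<tau> g i k) (TT \<tau> g j l) = (0 :: ('n::{finite,linorder}, 'd::{finite,linorder}) qu_WW)"
proof -
  have s: "\<langle>i \<leftrightarrow> k\<rangle> \<langle>$\<rangle> j = j" "\<langle>i \<leftrightarrow> k\<rangle> \<langle>$\<rangle> l = l" "\<langle>j \<leftrightarrow> l\<rangle> \<langle>$\<rangle> i = i" "\<langle>j \<leftrightarrow> l\<rangle> \<langle>$\<rangle> k = k" using assms by simp_all
  have p: "\<langle>i \<leftrightarrow> k\<rangle> * \<langle>j \<leftrightarrow> l\<rangle> = \<langle>j \<leftrightarrow> l\<rangle> * \<langle>i \<leftrightarrow> k\<rangle>"
    using assms by (intro perm_eqI) (auto simp: apply_times swap.rep_eq Transposition.transpose_def)
  show ?thesis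
    unfolding commutator_def TT_mult[OF assms(2) assms(5)] TT_mult[OF assms(5) assms(2)] s p RR_disjoint[OF \<tau> assms]
    by simp
qed

text \<open>
  Moving the transpositions to the right turns the three products into the three terms of the
  associative Yang--Baxter equation.
\<close>

lemma TT_triple:
  assumes "i \<noteq> j" "i \<noteq> k" "j \<noteq> k"
  shows "mult_WW (TT \<tau> g i j) (TT \<tau> g j k) + mult_WW (TT \<tau> g i k) (TT \<tau> g j i)
    = (mult_WW (TT \<tau> g j k) (TT \<tau> g i k) :: ('n::{finite,linorder}, 'd::{finite,linorder}) qu_WW)"
proof -
  have s: "\<langle>i \<leftrightarrow> j\<rangle> \<langle>$\<rangle> j = i" "\<langle>i \<leftrightarrow> j\<rangle> \<langle>$\<rangle> k = k" "\<langle>i \<leftrightarrow> k\<rangle> \<langle>$\<rangle> j = j" "\<langle>i \<leftrightarrow> k\<rangle> \<langle>$\<rangle> i = k"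
    "\<langle>j \<leftrightarrow> k\<rangle> \<langle>$\<rangle> i = i" "\<langle>j \<leftrightarrow> k\<rangle> \<langle>$\<rangle> k = j" using assms by simp_all
  have p: "\<langle>i \<leftrightarrow> k\<rangle> * \<langle>j \<leftrightarrow> i\<rangle> = \<langle>i \<leftrightarrow> j\<rangle> * \<langle>j \<leftrightarrow> k\<rangle>" "\<langle>j \<leftrightarrow> k\<rangle> * \<langle>i \<leftrightarrow> k\<rangle> = \<langle>i \<leftrightarrow> j\<rangle> * \<langle>j \<leftrightarrow> k\<rangle>"
    using assms by (intro perm_eqI; auto simp: apply_times swap.rep_eq Transposition.transpose_def)+
  have "mconst (g * g) * umat_mult (*) (RR \<tau> i j i j) (RR \<tau> i k j k) I J + mconst (g * g) * umat_mult (*) (RR \<tau> i k i k) (RR \<tau> j k j i) I J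
     = mconst (g * g) * umat_mult (*) (RR \<tau> j k j k) (RR \<tau> i j i k) I J" for I J :: "'n => 'd"
    unfolding distrib_left[symmetric] RR_aybe[OF \<tau> assms(1-3) assms(1,3,2)] ..
  then have "cM (\<lambda>I J. mconst (g * g) * umat_mult (*) (RR \<tau> i j i j) (RR \<tau> i k j k) I J) + cM (\<lambda>I J. mconst (g * g) * umat_mult (*) (RR \<tau> i k i k) (RR \<tau> j k j i) I J)
     = cM (\<lambda>I J. mconst (g * g) * umat_mult (*) (RR \<tau> j k j k) (RR \<tau> i j i k) I (J :: 'n => 'd))"
    by (intro ext) (simp add: cM_def coef_fps_const_add[symmetric] del: fps_const_add)
  moreover have "j \<noteq> i" using assms by simp
  ultimately show ?thesis
    unfolding TT_mult[OF assms(1,3)] TT_mult[OF assms(2) \<open>j \<noteq> i\<close>] TT_mult[OF assms(3,2)] s p spread_add[symmetric] by simp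
qed

text \<open>
  Terms with disjoint indices commute; those with three distinct indices cancel by the
  Yang--Baxter equation, applied once as it stands and once with two indices exchanged.
\<close>

theorem dunkl_commute: "commutator (dunkl \<tau> g i) (dunkl \<tau> g j) = (0 :: ('n::{finite,linorder}, 'd::{finite,linorder}) qu_WW)"
proof (cases "i = j")
  case False
  let ?P = "PP :: 'n => ('n, 'd) qu_WW" and ?T = "TT \<tau> g :: 'n => 'n => ('n, 'd) qu_WW"
  let ?S = "UNIV - {i, j}"
  have s1: "(\<Sum>k\<in>UNIV - {i}. f k) = f j + (\<Sum>k\<in>?S. f k)" "(\<Sum>k\<in>UNIV - {j}. f k) = f i + (\<Sum>k\<in>?S. f k)" for f :: "'n => ('n, 'd) qu_WW"
  proof -
    have "UNIV - {i} - {j} = ?S" "UNIV - {j} - {i} = ?S" by auto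
    then show "(\<Sum>k\<in>UNIV - {i}. f k) = f j + (\<Sum>k\<in>?S. f k)" "(\<Sum>k\<in>UNIV - {j}. f k) = f i + (\<Sum>k\<in>?S. f k)"
      using False sum.remove[of "UNIV - {i}" j f] sum.remove[of "UNIV - {j}" i f] by simp_all
  qed
  have a: "commutator (?P i) (?P j) = 0" by (rule PP_commute)
  have b: "(\<Sum>l\<in>?S. commutator (?P i) (?T j l)) = 0"
    by (rule sum.neutral) (use False in \<open>auto intro!: commutator_PP_TT_disjoint\<close>)
  have c: "(\<Sum>k\<in>?S. commutator (?T i k) (?P j)) = 0"
  proof (rule sum.neutral, rule)
    fix k assume "k \<in> ?S"
    then have "commutator (?P j) (?T i k) = 0" using False by (intro commutator_PP_TT_disjoint) auto
    then show "commutator (?T i k) (?P j) = 0" using commutator_swap[of "?T i k" "?P j"] by simp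
  qed
  have d: "(\<Sum>l\<in>?S. commutator (?T i k) (?T j l)) = commutator (?T i k) (?T j k)" if "k \<in> ?S" for k
  proof (rule sum_eq_single)
    fix l assume "l \<in> ?S" "l \<noteq> k"
    then show "commutator (?T i k) (?T j l) = 0" using that False by (intro commutator_TT_disjoint) auto
  qed (use that in simp_all)
  have e: "commutator (?T i j) (?T j k) + commutator (?T i k) (?T j i) + commutator (?T i k) (?T j k) = 0" if "k \<in> ?S" for k
  proof -
    have "i \<noteq> k" "j \<noteq> k" "j \<noteq> i" using that False by auto
    then show ?thesis
      using TT_triple[OF False \<open>i \<noteq> k\<close> \<open>j \<noteq> k\<close>, where 'd = 'd] TT_triple[OF \<open>j \<noteq> i\<close> \<open>j \<noteq> k\<close> \<open>i \<noteq> k\<close>, where 'd = 'd]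
      unfolding commutator_def by (simp add: algebra_simps)
  qed
  have f: "commutator (?T i j) (?T j i) = 0"
    using TT_skew[OF False, where 'd = 'd] by (simp add: commutator_uminus)
  have "commutator (dunkl \<tau> g i) (dunkl \<tau> g j) =
      commutator (?P i) (?P j) - (\<Sum>l\<in>UNIV - {j}. commutator (?P i) (?T j l)) - (\<Sum>k\<in>UNIV - {i}. commutator (?T i k) (?P j))
      + (\<Sum>k\<in>UNIV - {i}. \<Sum>l\<in>UNIV - {j}. commutator (?T i k) (?T j l))"
  proof -
    let ?A = "\<Sum>k\<in>UNIV - {i}. ?T i k" and ?B = "\<Sum>l\<in>UNIV - {j}. ?T j l"
    have "commutator (?P i - ?A) (?P j - ?B) = commutator (?P i) (?P j) - commutator (?P i) ?B - commutator ?A (?P j) + commutator ?A ?B"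
      unfolding commutator_diff by (simp only: algebra_simps)
    then show ?thesis unfolding dunkl_PP_TT commutator_sum(1) unfolding commutator_sum(2) .
  qed
  also have "\<dots> = (\<Sum>k\<in>?S. commutator (?T i j) (?T j k)) + (\<Sum>k\<in>?S. commutator (?T i k) (?T j i)) + (\<Sum>k\<in>?S. commutator (?T i k) (?T j k))
      - (commutator (?P i) (?T j i) + commutator (?T i j) (?P j))"
    unfolding s1 a b c f sum.distrib
    by (simp only: d cong: sum.cong) (simp only: add_0_left add_0_right diff_0 minus_add_distrib diff_conv_add_uminus ac_simps)
  also have "\<dots> = (\<Sum>k\<in>?S. commutator (?T i j) (?T j k) + commutator (?T i k) (?T j i) + commutator (?T i k) (?T j k))"
    unfolding commutator_PP_TT[OF False] sum.distrib by (simp only: diff_zero)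
  also have "\<dots> = 0" by (rule sum.neutral) (use e in blast)
  finally show ?thesis .
qed simp

end

section \<open>Substituting Dunkl operators into invariant functions\<close>

definition lam_WW :: "('n::{finite,linorder}) merfun => ('n, 'd) qu_WW" where
  "lam_WW F = scalar_WW (coef (fps_const (reindex Inr F)))"

lemma scalar_WW_spread: "scalar_WW a = spread 1 (scal_mat a)"
  by (simp add: scalar_WW_def scalar_W_def spread_def)

lemma mult_W_scalar_left: "mult_W (scalar_W a) X = (\<lambda>w I J. star a (X w I J))"
  by (simp add: mult_W_def scalar_W_def W.cross_delta_left um_scal_left)

lemma mult_W_scalar_right: "mult_W X (scalar_W a) = (\<lambda>w I J. star (X w I J) (act_vee_qu w a))"
  by (simp add: mult_W_def scalar_W_def W.cross_delta_right act_vee_scal um_scal_right)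

lemma mult_WW_scalar_left: "mult_WW (scalar_WW a) X = (\<lambda>w v I J. star a (X w v I J))"
  by (simp add: mult_WW_def scalar_WW_def WW.cross_delta_left mult_W_scalar_left)

lemma act_qu_1: "act_hat_qu w 1 = (1 :: ('n::{finite,linorder}) qu)" "act_vee_qu w 1 = (1 :: ('n::{finite,linorder}) qu)"
  using act_hat_qu_const[of w 1] act_vee_qu_const[of w 1] by (simp_all add: reindex_1 inj_map_sum inj_perm)

lemma mult_WW_one:
  fixes X :: "('n::{finite,linorder}, 'd::finite) qu_WW"
  shows "mult_WW (scalar_WW 1) X = X" "mult_WW X (scalar_WW 1) = X"
proof -
  show "mult_WW (scalar_WW 1) X = X" by (simp add: mult_WW_scalar_left)
  have 1: "act_hat v (scalar_W 1 :: ('n, 'd) qu_W) = scalar_W 1" for v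
    by (simp add: scalar_W_def act_hat_delta hatM_scal act_qu_1)
  show "mult_WW X (scalar_WW 1) = X"
    by (simp add: mult_WW_def scalar_WW_def WW.cross_delta_right 1 mult_W_scalar_right act_qu_1)
qed

lemma reindex_Inr_hat: "reindex (map_sum (Perm.apply w) id) (reindex Inr F) = reindex Inr (F :: ('n::finite) merfun)"
  by (subst reindex_comp) (auto simp: inj_map_sum inj_perm comp_def)

lemma reindex_Inr_vee: "reindex (map_sum id (Perm.apply w)) (reindex Inr F) = reindex Inr (reindex (Perm.apply w) (F :: ('n::finite) merfun))"
  by (subst (1 2) reindex_comp) (auto simp: inj_map_sum inj_perm comp_def)

lemma Df_Inr: "Df i (fps_const (reindex Inr F)) = 0"
proof -
  have "dmer (axis (Inl i) 1) (reindex Inr F) = 0"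
    by (simp add: dmer_reindex coords_axis_notin image_iff reindex_0)
  then show ?thesis by (simp add: Df_def pderiv_mer_dmer fps_coeffwise_const)
qed

text \<open>
  $\widehat W$ and the momenta do not act on $\lambda$.
\<close>

lemma commutator_lam_spread: "commutator (lam_WW F) (spread w A) = 0"
proof -
  have "Dq j (coef (fps_const (reindex Inr F))) = 0" for j by (simp add: Dq_coef Df_Inr)
  then have r: "star a (coef (fps_const (reindex Inr F))) = a * coef (fps_const (reindex Inr F))" for a
    by (rule star_const_right)
  show ?thesis
    unfolding commutator_def lam_WW_def scalar_WW_spread mult_WW_spread hatM_one hatM_scal act_hat_qu_const
      reindex_Inr_hat um_scal_left um_scal_right star_coef r
    by (simp add: mult.commute)
qed

lemma commutator_lam_dunkl: "commutator (lam_WW F) (dunkl \<tau> g i) = 0"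
  unfolding dunkl_PP_TT commutator_diff commutator_sum PP_def TT_def commutator_lam_spread by simp

lemma commutator_lam_lam: "commutator (lam_WW F) (lam_WW G) = 0"
  unfolding lam_WW_def[of G] scalar_WW_spread by (rule commutator_lam_spread)

lemma commutator_mult:
  assumes "commutator X Z = 0" "commutator Y Z = 0" shows "commutator (mult_WW X Y) Z = 0"
proof -
  have "mult_WW X Z = mult_WW Z X" "mult_WW Y Z = mult_WW Z Y" using assms by (simp_all add: commutator_def)
  then have "mult_WW (mult_WW X Y) Z = mult_WW Z (mult_WW X Y)" by (metis mult_WW_assoc)
  then show ?thesis by (simp add: commutator_def)
qed

lemma commutator_one: "commutator (scalar_WW (coef 1)) X = 0"
  by (simp add: commutator_def mult_WW_one)

context
  fixes \<tau> g :: complex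
  assumes \<tau>: "Im \<tau> > 0"
begin

lemma dunkl_monom_0: "dunkl_monom \<tau> g 0 = scalar_WW (coef 1)"
  by (simp only: dunkl_monom_def foldr_funpow_zero)

lemma dunkl_monom_add:
  "dunkl_monom \<tau> g (\<alpha> + sg i 1) = mult_WW (dunkl \<tau> g i) (dunkl_monom \<tau> g \<alpha> :: ('n::{finite,linorder}, 'd::{finite,linorder}) qu_WW)"
proof -
  have c: "mult_WW (dunkl \<tau> g i) (mult_WW (dunkl \<tau> g j) x) = mult_WW (dunkl \<tau> g j) (mult_WW (dunkl \<tau> g i) x)"
    for i j :: 'n and x :: "('n, 'd) qu_WW"
  proof -
    have "mult_WW (dunkl \<tau> g i) (dunkl \<tau> g j) = (mult_WW (dunkl \<tau> g j) (dunkl \<tau> g i) :: ('n, 'd) qu_WW)"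
      using dunkl_commute[OF \<tau>, of g i j, where 'd = 'd] by (simp add: commutator_def)
    then show ?thesis by (metis mult_WW_assoc)
  qed
  show ?thesis unfolding dunkl_monom_def
    by (rule foldr_funpow_add_single[where T = "\<lambda>i. mult_WW (dunkl \<tau> g i)", OF c]) simp_all
qed

lemma commutator_monom:
  assumes "\<And>i. commutator (dunkl \<tau> g i) Z = 0"
  shows "commutator (dunkl_monom \<tau> g \<alpha>) (Z :: ('n::{finite,linorder}, 'd::{finite,linorder}) qu_WW) = 0"
proof (induction \<alpha> rule: exponent_induct)
  case zero
  show ?case by (simp only: dunkl_monom_0 commutator_one)
next
  case (add \<alpha> i)
  show ?case unfolding dunkl_monom_add by (rule commutator_mult[OF assms add])
qed

lemma subst_dunkl_alt: "subst_dunkl \<tau> g f = (\<Sum>\<alpha>\<in>Poly_Mapping.keys f. mult_WW (lam_WW (lk f \<alpha>)) (dunkl_monom \<tau> g \<alpha>))"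
  by (simp add: subst_dunkl_def lam_WW_def)

lemma commutator_subst:
  assumes "\<And>i. commutator (dunkl \<tau> g i) Z = 0" "\<And>F. commutator (lam_WW F) Z = 0"
  shows "commutator (subst_dunkl \<tau> g f) (Z :: ('n::{finite,linorder}, 'd::{finite,linorder}) qu_WW) = 0"
  unfolding subst_dunkl_alt commutator_sum
  by (rule sum.neutral) (intro ballI commutator_mult commutator_monom assms)

lemma commutator_subst_dunkl: "commutator (subst_dunkl \<tau> g f) (dunkl \<tau> g i :: ('n::{finite,linorder}, 'd::{finite,linorder}) qu_WW) = 0"
  by (rule commutator_subst) (rule dunkl_commute[OF \<tau>], rule commutator_lam_dunkl)

lemma commutator_subst_subst:
  "commutator (subst_dunkl \<tau> g f) (subst_dunkl \<tau> g f' :: ('n::{finite,linorder}, 'd::{finite,linorder}) qu_WW) = 0"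
proof (rule commutator_subst)
  show "commutator (dunkl \<tau> g i) (subst_dunkl \<tau> g f' :: ('n, 'd) qu_WW) = 0" for i
    using commutator_subst_dunkl[of f' i, where 'd = 'd] commutator_swap[of "dunkl \<tau> g i" "subst_dunkl \<tau> g f' :: ('n, 'd) qu_WW"] by simp
  show "commutator (lam_WW F) (subst_dunkl \<tau> g f' :: ('n, 'd) qu_WW) = 0" for F
  proof -
    have "commutator (subst_dunkl \<tau> g f' :: ('n, 'd) qu_WW) (lam_WW F) = 0"
    proof (rule commutator_subst)
      show "commutator (dunkl \<tau> g i) (lam_WW F :: ('n, 'd) qu_WW) = 0" for i
      proof -
        have "commutator (lam_WW F :: ('n, 'd) qu_WW) (dunkl \<tau> g i) = 0" by (rule commutator_lam_dunkl)
        then show ?thesis using commutator_swap[of "dunkl \<tau> g i" "lam_WW F :: ('n, 'd) qu_WW"] by simp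
      qed
    qed (rule commutator_lam_lam)
    then show ?thesis using commutator_swap[of "lam_WW F" "subst_dunkl \<tau> g f' :: ('n, 'd) qu_WW"] by simp
  qed
qed

subsection \<open>Equivariance\<close>

lemma diag_act_spread: "diag_act u (spread w A) = spread (u * w * inverse u) (act_vee u (hatM u (A :: ('n::{finite,linorder}, 'd, 'n qu) umat)))"
proof (intro ext)
  fix w1 w2 I J
  have z: "act_vee u (hatM u (0 :: ('n, 'd, 'n qu) umat)) = 0"
    using act_vee_add[of u 0 0] hatM_add[of u "0 :: ('n, 'd, 'n qu) umat" 0] by simp
  have e: "inverse u * w1 * u = w \<longleftrightarrow> w1 = u * w * inverse u" "inverse u * w2 * u = 1 \<longleftrightarrow> w2 = 1"
    by (metis perm_group)+
  show "diag_act u (spread w A) w1 w2 I J = spread (u * w * inverse u) (act_vee u (hatM u A)) w1 w2 I J"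
    using z by (auto simp: diag_act_def spread_def delta_def e)
qed

lemma diag_act_scalar: "diag_act u (scalar_WW a) = scalar_WW (act_vee_qu u (act_hat_qu u (a :: ('n::{finite,linorder}) qu)))"
  by (simp add: scalar_WW_spread diag_act_spread hatM_scal act_vee_scal)

lemma diag_act_lam: "diag_act u (lam_WW F) = lam_WW (reindex (Perm.apply u) (F :: ('n::{finite,linorder}) merfun))"
  by (simp add: lam_WW_def diag_act_scalar act_hat_qu_const act_vee_qu_const reindex_Inr_hat reindex_Inr_vee)

lemma diag_act_zero [simp]: "diag_act u 0 = (0 :: ('n::{finite,linorder}, 'd) qu_WW)"
  using diag_act_add[of u 0 "0 :: ('n, 'd) qu_WW"] by simp

lemma diag_act_sum: "diag_act u (sum f A) = (\<Sum>x\<in>A. diag_act u (f x :: ('n::{finite,linorder}, 'd) qu_WW))"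
  by (induction A rule: infinite_finite_induct)
    (simp_all only: sum.infinite sum.empty sum.insert diag_act_zero diag_act_add not_False_eq_True)

lemma diag_act_diff: "diag_act u (X - Y) = diag_act u X - diag_act u (Y :: ('n::{finite,linorder}, 'd) qu_WW)"
  using diag_act_add[of u "X - Y" Y] by (simp add: algebra_simps)

lemma perm_conj_swap: "u * \<langle>i \<leftrightarrow> j\<rangle> * inverse u = \<langle>u \<langle>$\<rangle> i \<leftrightarrow> u \<langle>$\<rangle> j\<rangle>"
proof (rule perm_eqI)
  fix a
  show "(u * \<langle>i \<leftrightarrow> j\<rangle> * inverse u) \<langle>$\<rangle> a = \<langle>u \<langle>$\<rangle> i \<leftrightarrow> u \<langle>$\<rangle> j\<rangle> \<langle>$\<rangle> a"
    by (auto simp: apply_times swap.rep_eq Transposition.transpose_def perm_eq_inverse_iff)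
qed

lemma diag_act_TT:
  assumes "i \<noteq> j"
  shows "diag_act u (TT \<tau> g i j) = (TT \<tau> g (u \<langle>$\<rangle> i) (u \<langle>$\<rangle> j) :: ('n::{finite,linorder}, 'd::{finite,linorder}) qu_WW)"
proof -
  have "u \<langle>$\<rangle> i \<noteq> u \<langle>$\<rangle> j" using assms by (metis perm_cancel(2))
  then show ?thesis
    unfolding TT_def diag_act_spread perm_conj_swap hatM_gR[OF \<tau> assms assms]
    by (simp add: act_vee_gR[OF \<tau>] assms)
qed

text \<open>
  Dunkl operators are permuted by the diagonal action because $x$, $\lambda$ and the tensor
  factors are permuted simultaneously.
\<close>

lemma diag_act_dunkl: "diag_act u (dunkl \<tau> g i) = (dunkl \<tau> g (u \<langle>$\<rangle> i) :: ('n::{finite,linorder}, 'd::{finite,linorder}) qu_WW)"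
proof -
  have "diag_act u (PP i :: ('n, 'd) qu_WW) = PP (u \<langle>$\<rangle> i)"
    unfolding PP_def scalar_WW_spread[symmetric] diag_act_scalar act_hat_qu_mom act_vee_qu_mom ..
  moreover have "(\<Sum>j\<in>UNIV - {i}. diag_act u (TT \<tau> g i j :: ('n, 'd) qu_WW)) = (\<Sum>j\<in>UNIV - {u \<langle>$\<rangle> i}. TT \<tau> g (u \<langle>$\<rangle> i) j)"
    by (rule sum.reindex_bij_witness[of _ "Perm.apply (inverse u)" "Perm.apply u"])
      (auto simp: diag_act_TT perm_eq_inverse_iff dest: arg_cong[of _ _ "Perm.apply (inverse u)"])
  ultimately show ?thesis unfolding dunkl_PP_TT diag_act_diff diag_act_sum by simp
qed

lemma diag_act_monom: "diag_act u (dunkl_monom \<tau> g \<alpha>) = (dunkl_monom \<tau> g (pexp u \<alpha>) :: ('n::{finite,linorder}, 'd::{finite,linorder}) qu_WW)"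
proof (induction \<alpha> rule: exponent_induct)
  case zero
  show ?case by (simp add: dunkl_monom_0 diag_act_scalar act_qu_1)
next
  case (add \<alpha> i)
  then show ?case by (simp only: dunkl_monom_add diag_act_mult diag_act_dunkl pexp_add pexp_single)
qed

lemma lookup_act_cl: "lk (act_cl w f) \<alpha> = reindex (Perm.apply w) (lk f (Poly_Mapping.map_key (Perm.apply w) \<alpha>))"
  by (simp add: act_cl_def lookup_map_zero reindex_0 inj_perm)

lemma diag_act_subst:
  assumes inv: "\<And>w. act_cl w f = f"
  shows "diag_act u (subst_dunkl \<tau> g f) = (subst_dunkl \<tau> g f :: ('n::{finite,linorder}, 'd::{finite,linorder}) qu_WW)"
proof -
  have c: "reindex (Perm.apply u) (lk f \<alpha>) = lk f (pexp u \<alpha>)" for u \<alpha>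
    using lookup_act_cl[of u f "pexp u \<alpha>"] by (simp add: inv map_key_pexp)
  have k: "pexp u \<alpha> \<in> Poly_Mapping.keys f" if "\<alpha> \<in> Poly_Mapping.keys f" for u \<alpha>
  proof (rule ccontr)
    assume "pexp u \<alpha> \<notin> Poly_Mapping.keys f"
    then have "reindex (Perm.apply u) (lk f \<alpha>) = 0" by (simp add: c in_keys_iff)
    moreover have "reindex (Perm.apply (inverse u)) (reindex (Perm.apply u) (lk f \<alpha>)) = lk f \<alpha>"
    proof -
      have "Perm.apply (inverse u) \<circ> Perm.apply u = id" by (simp add: apply_times[symmetric])
      then show ?thesis by (simp add: reindex_comp inj_perm reindex_id)
    qed
    ultimately have "lk f \<alpha> = 0" by (metis inj_perm reindex_0)
    then show False using that by (simp add: in_keys_iff)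
  qed
  have p: "pexp u (pexp v \<alpha>) = pexp (u * v) \<alpha>" for u v \<alpha>
    by (rule poly_mapping_eqI) (simp add: apply_sequence)
  have p1: "pexp 1 \<alpha> = \<alpha>" for \<alpha> :: "'n \<Rightarrow>\<^sub>0 nat"
  proof (rule poly_mapping_eqI)
    fix i have "inverse 1 = (1 :: 'n perm)" by (rule perm.inverse_neutral)
    then show "lk (pexp 1 \<alpha>) i = lk \<alpha> i" by simp
  qed
  have "diag_act u (subst_dunkl \<tau> g f) = (\<Sum>\<alpha>\<in>Poly_Mapping.keys f. mult_WW (lam_WW (lk f (pexp u \<alpha>))) (dunkl_monom \<tau> g (pexp u \<alpha>)) :: ('n, 'd) qu_WW)"
    unfolding subst_dunkl_alt diag_act_sum by (simp only: diag_act_mult diag_act_lam diag_act_monom c)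
  also have "\<dots> = subst_dunkl \<tau> g f"
    unfolding subst_dunkl_alt
    by (rule sum.reindex_bij_witness[of _ "pexp (inverse u)" "pexp u"]) (simp_all only: k p perm_group p1)
  finally show ?thesis .
qed

text \<open>
  Substitutions of commuting elements commute; invariance of $f$ makes them invariant under the
  diagonal action, so that $\mathrm{Res}^\vee$ preserves the relation.
\<close>

theorem Res_subst_commute:
  assumes "\<And>w. act_cl w f = f" "\<And>w. act_cl w f' = f'"
  shows "mult_W (Res_vee (subst_dunkl \<tau> g f)) (Res_vee (subst_dunkl \<tau> g f')) =
    (mult_W (Res_vee (subst_dunkl \<tau> g f')) (Res_vee (subst_dunkl \<tau> g f)) :: ('n::{finite,linorder}, 'd::{finite,linorder}) qu_W)"
proof -
  have "mult_WW (subst_dunkl \<tau> g f) (subst_dunkl \<tau> g f') = (mult_WW (subst_dunkl \<tau> g f') (subst_dunkl \<tau> g f) :: ('n, 'd) qu_WW)"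
    using commutator_subst_subst[of f f', where 'd = 'd] by (simp add: commutator_def)
  then show ?thesis
    by (metis Res_vee_mult diag_act_subst[OF assms(1)] diag_act_subst[OF assms(2)])
qed

text \<open>
  The exchange terms cancel in pairs by skew symmetry.
\<close>

lemma sum_dunkl: "(\<Sum>i\<in>UNIV. dunkl \<tau> g i) = (scalar_WW (\<Sum>i\<in>UNIV. mom i) :: ('n::{finite,linorder}, 'd::{finite,linorder}) qu_WW)"
proof -
  let ?T = "TT \<tau> g :: 'n => 'n => ('n, 'd) qu_WW"
  have "(\<Sum>i\<in>UNIV. \<Sum>j\<in>UNIV - {i}. ?T i j) = (\<Sum>p\<in>Sigma UNIV (\<lambda>i. UNIV - {i}). ?T (fst p) (snd p))"
    by (subst sum.Sigma) (auto simp: case_prod_beta)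
  also have "Sigma UNIV (\<lambda>i. UNIV - {i}) = {p. fst p < snd p} \<union> {p :: 'n \<times> 'n. snd p < fst p}" by auto
  also have "(\<Sum>p\<in>{p. fst p < snd p} \<union> {p :: 'n \<times> 'n. snd p < fst p}. ?T (fst p) (snd p)) =
     (\<Sum>p\<in>{p. fst p < snd p}. ?T (fst p) (snd p)) + (\<Sum>p\<in>{p :: 'n \<times> 'n. snd p < fst p}. ?T (fst p) (snd p))"
    by (rule sum.union_disjoint) auto
  also have "(\<Sum>p\<in>{p :: 'n \<times> 'n. snd p < fst p}. ?T (fst p) (snd p)) = (\<Sum>p\<in>{p. fst p < snd p}. - ?T (fst p) (snd p))"
  proof (rule sum.reindex_bij_witness[of _ prod.swap prod.swap])
    fix p :: "'n \<times> 'n" assume "p \<in> {p. snd p < fst p}"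
    then show "- ?T (fst (prod.swap p)) (snd (prod.swap p)) = ?T (fst p) (snd p)"
      using TT_skew[OF \<tau>, of "snd p" "fst p" g, where 'd = 'd] by auto
  qed auto
  finally have z: "(\<Sum>i\<in>UNIV. \<Sum>j\<in>UNIV - {i}. ?T i j) = 0" by (simp only: sum_negf right_minus)
  have s: "(\<Sum>i\<in>A. PP i) = (scalar_WW (\<Sum>i\<in>A. mom i) :: ('n, 'd) qu_WW)" if "finite A" for A
    using that
  proof (induction A)
    case empty
    show ?case by (auto simp: scalar_WW_def scalar_W_def delta_def scal_mat_def fun_eq_iff)
  next
    case (insert i A)
    have "scalar_WW (mom i + (\<Sum>i\<in>A. mom i)) = PP i + (scalar_WW (\<Sum>i\<in>A. mom i) :: ('n, 'd) qu_WW)"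
      by (auto simp: scalar_WW_spread PP_def spread_def delta_def scal_mat_def fun_eq_iff)
    then show ?case using insert by simp
  qed
  show ?thesis unfolding dunkl_PP_TT sum_subtractf z by (simp add: s)
qed

lemma Res_scalar: "Res_vee (scalar_WW a) = scalar_W a"
proof
  fix v
  have "Res_vee (scalar_WW a) v = (scalar_WW a 1 (v * 1) :: ('a, 'b, 'a qu) umat)"
    unfolding Res_vee_def by (rule sum_eq_single) (auto simp: finite_UNIV_perm scalar_WW_def delta_def)
  then show "Res_vee (scalar_WW a) v = (scalar_W a v :: ('a, 'b, 'a qu) umat)" by (simp add: scalar_WW_def delta_def)
qed

text \<open>
  The sum of all Dunkl operators is the total momentum. This expresses that the substituted
  elements are invariant under simultaneous translation of $x$.
\<close>

theorem Res_subst_translation: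
  assumes inv: "\<And>w. act_cl w f = f"
  shows "mult_W (scalar_W (\<Sum>i\<in>UNIV. mom i)) (Res_vee (subst_dunkl \<tau> g f)) =
    (mult_W (Res_vee (subst_dunkl \<tau> g f)) (scalar_W (\<Sum>i\<in>UNIV. mom i)) :: ('n::{finite,linorder}, 'd::{finite,linorder}) qu_W)"
proof -
  let ?Y = "scalar_WW (\<Sum>i\<in>UNIV. mom i) :: ('n, 'd) qu_WW" and ?X = "subst_dunkl \<tau> g f :: ('n, 'd) qu_WW"
  have "commutator ?X ?Y = 0"
    unfolding sum_dunkl[symmetric] commutator_sum by (simp add: commutator_subst_dunkl)
  then have c: "mult_WW ?X ?Y = mult_WW ?Y ?X" by (simp add: commutator_def)
  have "(\<Sum>i\<in>UNIV. dunkl \<tau> g (u \<langle>$\<rangle> i)) = (\<Sum>i\<in>UNIV. dunkl \<tau> g i :: ('n, 'd) qu_WW)" for u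
    by (rule sum.reindex_bij_betw) (rule bij_apply)
  then have "diag_act u ?Y = ?Y" for u
    unfolding sum_dunkl[symmetric] diag_act_sum diag_act_dunkl .
  then have "mult_W (Res_vee ?X) (Res_vee ?Y) = mult_W (Res_vee ?Y) (Res_vee ?X)"
    using c by (metis Res_vee_mult diag_act_subst[OF inv])
  then show ?thesis unfolding Res_scalar by simp
qed

end

section \<open>The Weierstrass function\<close>

context
  fixes \<tau> :: complex
  assumes \<tau>: "Im \<tau> > 0"
begin

definition om :: "int \<times> int => complex" where "om p = of_int (fst p) + of_int (snd p) * \<tau>"

definition wp_term :: "complex => int \<times> int => complex" where
  "wp_term z p = 1 / (z - om p)\<^sup>2 - 1 / (om p)\<^sup>2"

lemma wp_alt: "wp z \<tau> = 1 / z\<^sup>2 + infsum (wp_term z) (UNIV - {(0, 0)})"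
  unfolding wp_def by (intro arg_cong2[of _ _ _ _ "(+)"] refl infsum_cong) (auto simp: wp_term_def om_def)

definition om_const :: real where "om_const = 1 + cmod \<tau> / Im \<tau> + 1 / Im \<tau>"

lemma om_const_pos: "om_const > 0"
  using \<tau> by (simp add: om_const_def add_pos_nonneg)

lemma om_lower: "\<bar>of_int (fst p)\<bar> + \<bar>of_int (snd p)\<bar> \<le> om_const * cmod (om p)"
proof -
  have k: "\<bar>of_int (snd p)\<bar> * Im \<tau> \<le> cmod (om p)"
    using abs_Im_le_cmod[of "om p"] \<tau> by (simp add: om_def abs_mult)
  then have k': "\<bar>of_int (snd p)\<bar> \<le> cmod (om p) / Im \<tau>" using \<tau> by (simp add: field_simps)
  have "\<bar>of_int (fst p)\<bar> = cmod (om p - of_int (snd p) * \<tau>)" by (simp add: om_def norm_of_int)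
  also have "\<dots> \<le> cmod (om p) + \<bar>of_int (snd p)\<bar> * cmod \<tau>"
    using norm_triangle_ineq4[of "om p" "of_int (snd p) * \<tau>"] by (simp add: norm_mult)
  also have "\<bar>of_int (snd p)\<bar> * cmod \<tau> \<le> cmod (om p) / Im \<tau> * cmod \<tau>"
    by (rule mult_right_mono[OF k']) simp
  finally have "\<bar>of_int (fst p)\<bar> \<le> cmod (om p) + cmod (om p) / Im \<tau> * cmod \<tau>" by simp
  moreover have "om_const * cmod (om p) = cmod (om p) + cmod (om p) / Im \<tau> * cmod \<tau> + cmod (om p) / Im \<tau>"
    by (simp add: om_const_def distrib_right)
  ultimately show ?thesis using k' by linarith
qed

lemma om_eq_0: "om p = 0 \<longleftrightarrow> p = (0, 0)"
  using om_lower[of p] by (auto simp: om_def prod_eq_iff)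

lemma finite_om_ball: "finite {p. cmod (om p) < R}"
proof (rule finite_subset)
  let ?N = "\<lceil>om_const * R\<rceil>"
  show "{p. cmod (om p) < R} \<subseteq> {- ?N..?N} \<times> {- ?N..?N}"
  proof
    fix p assume "p \<in> {p. cmod (om p) < R}"
    then have "om_const * cmod (om p) \<le> om_const * R" using om_const_pos by simp
    then have "\<bar>of_int (fst p)\<bar> + \<bar>of_int (snd p)\<bar> \<le> om_const * R" using om_lower[of p] by linarith
    then have "\<bar>fst p\<bar> + \<bar>snd p\<bar> \<le> ?N" by linarith
    then show "p \<in> {- ?N..?N} \<times> {- ?N..?N}" by (cases p) auto
  qed
qed simp

text \<open>
  A summable majorant in each coordinate: $|\omega|^{-3}$ is bounded, up to a constant, by the
  product of two factors with exponent $3/2$.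
\<close>

definition dec :: "int => real" where "dec m = (1 + \<bar>of_int m\<bar>) powr (- 3 / 2)"

lemma dec_summable: "dec summable_on UNIV"
proof (rule summable_on_int)
  have "summable (\<lambda>n. real (Suc n) powr (- 3 / 2))"
    unfolding summable_Suc_iff[of "\<lambda>n. real n powr (- 3 / 2)"] by (simp add: summable_real_powr_iff)
  then show "summable (\<lambda>n. dec (int n))" "summable (\<lambda>n. dec (- int n))"
    by (simp_all add: dec_def)
qed (simp add: dec_def)

lemma dec_nonneg [simp]: "0 \<le> dec m" by (simp add: dec_def)

lemma dec_product_summable: "(\<lambda>p. dec (fst p) * dec (snd p)) summable_on A"
proof -
  have "(\<lambda>x. norm (complex_of_real (dec x))) summable_on UNIV" using dec_summable by simp
  from product_summable(1)[OF this this]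
  have "(\<lambda>p. dec (fst p) * dec (snd p)) summable_on UNIV" by (simp add: norm_mult)
  then show ?thesis using summable_on_subset subset_UNIV by metis
qed

lemma powr_square_three_halves:
  assumes "x > 0" shows "(x\<^sup>2) powr (3/2) = (x::real) ^ 3"
proof -
  have "(x\<^sup>2) powr (3/2) = (x powr 2) powr (3/2)" using assms by (simp add: powr_numeral)
  also have "\<dots> = x powr (2 * (3/2))" by (rule powr_powr)
  also have "\<dots> = x powr 3" by simp
  also have "\<dots> = x ^ 3" using assms by (simp add: powr_numeral)
  finally show ?thesis .
qed

lemma om_cube_bound:
  assumes "p \<noteq> (0, 0)" shows "1 / cmod (om p) ^ 3 \<le> 8 * om_const ^ 3 * (dec (fst p) * dec (snd p))"
proof -
  let ?m = "\<bar>real_of_int (fst p)\<bar>" and ?k = "\<bar>real_of_int (snd p)\<bar>"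
  have N: "?m + ?k \<ge> 1"
  proof -
    have "\<bar>fst p\<bar> + \<bar>snd p\<bar> \<ge> 1" using assms by (cases p) auto
    then have "real_of_int (\<bar>fst p\<bar> + \<bar>snd p\<bar>) \<ge> 1" by linarith
    then show ?thesis by simp
  qed
  have "(1 + ?m) * (1 + ?k) \<le> (2 * (?m + ?k)) * (2 * (?m + ?k))"
    using N by (intro mult_mono) auto
  then have "((1 + ?m) * (1 + ?k)) powr (3/2) \<le> ((2 * (?m + ?k))\<^sup>2) powr (3/2)"
    by (intro powr_mono2) (auto simp: power2_eq_square)
  also have "\<dots> = (2 * (?m + ?k)) ^ 3"
    by (rule powr_square_three_halves) (use N in simp)
  also have "\<dots> \<le> (2 * (om_const * cmod (om p))) ^ 3"
    using om_lower[of p] by (intro power_mono) auto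
  finally have le: "((1 + ?m) * (1 + ?k)) powr (3/2) \<le> 8 * om_const ^ 3 * cmod (om p) ^ 3"
    by (simp add: power_mult_distrib)
  have pos: "((1 + ?m) * (1 + ?k)) powr (3/2) > 0" "cmod (om p) ^ 3 > 0"
    using assms om_eq_0[of p] by (auto simp: add_pos_nonneg)
  have "dec (fst p) * dec (snd p) = 1 / ((1 + ?m) * (1 + ?k)) powr (3/2)"
    by (simp add: dec_def powr_mult[symmetric] powr_minus_divide)
  moreover have "1 / X \<le> K * (1 / P)" if "P > 0" "X > 0" "P \<le> K * X" for P X K :: real
    using that by (simp add: field_simps)
  ultimately show ?thesis using pos le by metis
qed

lemma wp_term_bound:
  assumes R: "cmod z \<le> R" "2 * R \<le> cmod (om p)" and p: "p \<noteq> (0, 0)"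
  shows "cmod (wp_term z p) \<le> (10 * R * (8 * om_const ^ 3)) * (dec (fst p) * dec (snd p))"
proof -
  let ?w = "om p"
  have w: "?w \<noteq> 0" using p by (simp add: om_eq_0)
  have R0: "R \<ge> 0" using R(1) norm_ge_zero order_trans by blast
  have d: "cmod (z - ?w) \<ge> cmod ?w / 2"
    using norm_triangle_ineq3[of z ?w] R by linarith
  then have zw: "z - ?w \<noteq> 0" using w by (metis norm_zero half_gt_zero_iff not_le zero_less_norm_iff)
  have "wp_term z p = z * (2 * ?w - z) / ((z - ?w)\<^sup>2 * ?w\<^sup>2)"
    unfolding wp_term_def using w zw by (simp add: diff_frac_eq) (simp add: power2_eq_square algebra_simps)
  then have "cmod (wp_term z p) = cmod z * cmod (2 * ?w - z) / (cmod (z - ?w) ^ 2 * cmod ?w ^ 2)"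
    by (simp add: norm_divide norm_mult norm_power)
  also have "\<dots> \<le> R * (5 / 2 * cmod ?w) / ((cmod ?w / 2) ^ 2 * cmod ?w ^ 2)"
  proof (rule frac_le)
    show "0 \<le> R * (5 / 2 * cmod ?w)" using R0 by simp
    have "cmod (2 * ?w - z) \<le> 5 / 2 * cmod ?w"
      using norm_triangle_ineq4[of "2 * ?w" z] R by (simp add: norm_mult)
    then show "cmod z * cmod (2 * ?w - z) \<le> R * (5 / 2 * cmod ?w)"
      using R(1) R0 by (intro mult_mono) auto
    show "0 < (cmod ?w / 2)\<^sup>2 * (cmod ?w)\<^sup>2" using w by simp
    show "(cmod ?w / 2)\<^sup>2 * (cmod ?w)\<^sup>2 \<le> (cmod (z - ?w))\<^sup>2 * (cmod ?w)\<^sup>2"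
      using d by (intro mult_right_mono power_mono) auto
  qed
  also have "\<dots> = 10 * R * (1 / cmod ?w ^ 3)"
    using w by (simp add: field_simps power2_eq_square power3_eq_cube)
  also have "\<dots> \<le> 10 * R * (8 * om_const ^ 3 * (dec (fst p) * dec (snd p)))"
    using R0 by (intro mult_left_mono om_cube_bound p) auto
  finally show ?thesis by (simp only: mult.assoc)
qed

text \<open>
  The finitely many lattice points whose terms can have poles in the disc of radius $R$.
\<close>

definition near :: "real => (int \<times> int) set" where "near R = {p. cmod (om p) < 2 * R} - {(0, 0)}"

lemma finite_near: "finite (near R)"
  unfolding near_def using finite_om_ball by simp

lemma wp_summable_far:
  assumes "cmod z \<le> R" shows "(\<lambda>p. norm (wp_term z p)) summable_on (UNIV - {(0, 0)} - near R)"
proof (rule summable_on_comparison_test[OF summable_on_cmult_right[OF dec_product_summable]])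
  fix p assume "p \<in> UNIV - {(0, 0)} - near R"
  then show "norm (wp_term z p) \<le> (10 * R * (8 * om_const ^ 3)) * (dec (fst p) * dec (snd p))"
    by (intro wp_term_bound[OF assms]) (auto simp: near_def)
qed simp

lemma wp_summable: "(\<lambda>p. norm (wp_term z p)) summable_on (UNIV - {(0, 0)})"
proof -
  have "(\<lambda>p. norm (wp_term z p)) summable_on (UNIV - {(0, 0)} - near (cmod z)) \<union> near (cmod z)"
    by (rule summable_on_union[OF wp_summable_far]) (simp_all add: finite_near)
  moreover have "(UNIV - {(0, 0)} - near (cmod z)) \<union> near (cmod z) = UNIV - {(0, 0)}"
    by (auto simp: near_def)
  ultimately show ?thesis by simp
qed

definition wp_far :: "real => complex => complex" where
  "wp_far R z = infsum (wp_term z) (UNIV - {(0, 0)} - near R)"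

lemma wp_split: "wp z \<tau> = 1 / z\<^sup>2 + (\<Sum>p\<in>near R. wp_term z p) + wp_far R z"
proof -
  have e: "UNIV - {(0, 0)} = near R \<union> (UNIV - {(0, 0)} - near R)" by (auto simp: near_def)
  have "infsum (wp_term z) (UNIV - {(0, 0)}) = infsum (wp_term z) (near R) + infsum (wp_term z) (UNIV - {(0, 0)} - near R)"
    by (subst e, rule infsum_Un_disjoint)
      (auto intro!: abs_summable_summable summable_on_subset[OF wp_summable] simp: near_def)
  then show ?thesis by (simp add: wp_alt wp_far_def finite_near)
qed

lemma wp_far_holomorphic: "wp_far R holomorphic_on ball 0 R"
proof (cases "R > 0")
  case True
  let ?A = "UNIV - {(0, 0)} - near R"
  let ?M = "\<lambda>p. (10 * R * (8 * om_const ^ 3)) * (dec (fst p) * dec (snd p))"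
  have ul: "uniform_limit (cball 0 R) (\<lambda>X z. \<Sum>p\<in>X. wp_term z p) (\<lambda>z. \<Sum>\<^sub>\<infinity>p\<in>?A. wp_term z p) (finite_subsets_at_top ?A)"
  proof (rule Weierstrass_m_test_general[where M = ?M])
    show "?M summable_on ?A" by (rule summable_on_cmult_right[OF dec_product_summable])
    show "norm (wp_term z p) \<le> ?M p" if "p \<in> ?A" "z \<in> cball 0 R" for p z
      by (rule wp_term_bound) (use that in \<open>auto simp: near_def\<close>)
  qed
  have nz: "z - om p \<noteq> 0" if "p \<in> ?A" "z \<in> cball 0 R" for z :: complex and p
  proof
    assume "z - om p = 0"
    then have "z = om p" by simp
    then show False using that True by (auto simp: near_def)
  qed
  have "\<forall>\<^sub>F X in finite_subsets_at_top ?A. continuous_on (cball 0 R) (\<lambda>z. \<Sum>p\<in>X. wp_term z p) \<and>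
      (\<lambda>z. \<Sum>p\<in>X. wp_term z p) holomorphic_on ball 0 R"
  proof (rule eventually_finite_subsets_at_top_weakI)
    fix X assume X: "finite X" "X \<subseteq> ?A"
    have t: "wp_term z = wp_term z" for z ..
    have "(\<lambda>z. \<Sum>p\<in>X. wp_term z p) holomorphic_on cball 0 R"
      unfolding wp_term_def
    proof (intro holomorphic_on_sum holomorphic_on_diff holomorphic_on_divide holomorphic_on_const holomorphic_on_power
        holomorphic_on_ident)
      fix p and z :: complex assume "p \<in> X" "z \<in> cball 0 R"
      then show "(z - om p)\<^sup>2 \<noteq> 0" using nz[where p = p and z = z] X by auto
      show "(om p)\<^sup>2 \<noteq> 0" using \<open>p \<in> X\<close> X by (auto simp: om_eq_0)
    qed
    then show "continuous_on (cball 0 R) (\<lambda>z. \<Sum>p\<in>X. wp_term z p) \<and> (\<lambda>z. \<Sum>p\<in>X. wp_term z p) holomorphic_on ball 0 R"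
      using holomorphic_on_imp_continuous_on holomorphic_on_subset ball_subset_cball by blast
  qed
  then show ?thesis
    using holomorphic_uniform_limit[OF _ ul finite_subsets_at_top_neq_bot] unfolding wp_far_def[abs_def] by blast
next
  case False
  then have "ball 0 R = ({} :: complex set)" by simp
  then show ?thesis by (simp only: holomorphic_on_empty)
qed

definition Lat :: "complex set" where "Lat = range om"

lemma wp_holomorphic:
  assumes "z \<notin> Lat" shows "\<exists>S. open S \<and> z \<in> S \<and> (\<lambda>z. wp z \<tau>) holomorphic_on S"
proof -
  define R where "R = cmod z + 1"
  let ?S = "ball 0 R - insert 0 (om ` near R)"
  have "open ?S" by (intro open_Diff open_ball finite_imp_closed) (simp add: finite_near)
  moreover have "z \<in> ?S"
  proof -
    have "om (0, 0) = 0" by (simp add: om_def)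
    then have "0 \<in> Lat" unfolding Lat_def by (metis rangeI)
    then show ?thesis using assms by (auto simp: R_def Lat_def)
  qed
  moreover have "(\<lambda>z. wp z \<tau>) holomorphic_on ?S"
    unfolding wp_split[of _ R] wp_term_def
    by (intro holomorphic_on_sum holomorphic_on_diff holomorphic_on_add holomorphic_on_divide holomorphic_on_const
        holomorphic_on_power holomorphic_on_ident holomorphic_on_subset[OF wp_far_holomorphic])
      (auto simp: near_def om_eq_0)
  ultimately show ?thesis by blast
qed

lemma wp_even: "wp (- z) \<tau> = wp z \<tau>"
proof -
  have om: "om (- fst p, - snd p) = - om p" for p by (simp add: om_def)
  have "bij_betw (\<lambda>p :: int \<times> int. (- fst p, - snd p)) (UNIV - {(0, 0)}) (UNIV - {(0, 0)})"
    by (rule bij_betw_byWitness[of _ "\<lambda>p. (- fst p, - snd p)"]) auto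
  from infsum_reindex_bij_betw[OF this, of "wp_term (- z)"]
  have "infsum (wp_term (- z)) (UNIV - {(0, 0)}) = infsum (\<lambda>p. wp_term (- z) (- fst p, - snd p)) (UNIV - {(0, 0)})" by simp
  also have "\<dots> = infsum (wp_term z) (UNIV - {(0, 0)})"
    by (rule infsum_cong) (simp add: wp_term_def om power2_commute)
  finally show ?thesis by (simp add: wp_alt)
qed

lemma inverse_square_summable: "(\<lambda>m::int. norm (1 / ((z :: complex) - of_int m)\<^sup>2)) summable_on UNIV"
proof -
  define N where "N = \<lceil>2 * cmod z + 1\<rceil>"
  have b: "norm (1 / (z - of_int m)\<^sup>2) \<le> 16 * dec m" if m: "m \<notin> {- N..N}" for m
  proof -
    have "N < \<bar>m\<bar>" using m by auto
    then have "2 * cmod z + 1 \<le> \<bar>real_of_int m\<bar>" unfolding N_def by linarith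
    moreover have "cmod (z - of_int m) \<ge> \<bar>real_of_int m\<bar> - cmod z"
      using norm_triangle_ineq3[of z "of_int m"] by simp
    moreover have "x / 4 \<le> y" if "2 * c + 1 \<le> a" "a - c \<le> y" "0 \<le> c" "x = 1 + a" for x y a c :: real
      using that by linarith
    ultimately have "(1 + \<bar>real_of_int m\<bar>) / 4 \<le> cmod (z - of_int m)"
      using norm_ge_zero[of z] by blast
    then have "((1 + \<bar>real_of_int m\<bar>) / 4)\<^sup>2 \<le> (cmod (z - of_int m))\<^sup>2" by (intro power_mono) auto
    then have "norm (1 / (z - of_int m)\<^sup>2) \<le> 1 / ((1 + \<bar>real_of_int m\<bar>) / 4)\<^sup>2"
      unfolding norm_divide norm_power norm_one by (intro frac_le) auto
    also have "\<dots> = 16 * (1 + \<bar>real_of_int m\<bar>) powr (- 2)"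
      by (simp add: powr_minus_divide powr_numeral power_divide)
    also have "\<dots> \<le> 16 * dec m"
      unfolding dec_def by (intro mult_left_mono powr_mono) auto
    finally show ?thesis .
  qed
  have "(\<lambda>m::int. norm (1 / (z - of_int m)\<^sup>2)) summable_on (UNIV - {- N..N})"
    by (rule summable_on_comparison_test[OF summable_on_cmult_right[OF summable_on_subset[OF dec_summable]]])
      (use b in auto)
  then have "(\<lambda>m::int. norm (1 / (z - of_int m)\<^sup>2)) summable_on (UNIV - {- N..N}) \<union> {- N..N}"
    by (rule summable_on_union) simp
  then show ?thesis by (simp add: Un_absorb1)
qed

text \<open>
  The difference of the two series is a double series that telescopes along the period $1$.
\<close>

lemma wp_plus_1: "wp (z + 1) \<tau> = wp z \<tau>"
proof -
  let ?u = "\<lambda>p. 1 / (z - om p)\<^sup>2"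
  let ?f = "\<lambda>p :: int \<times> int. ?u (fst p - 1, snd p) - ?u p"
  have om1: "om (fst p - 1, snd p) = om p - 1" for p by (simp add: om_def)
  have f: "?f p = wp_term (z + 1) p - wp_term z p" for p
    by (simp add: wp_term_def om1 algebra_simps)
  have s: "wp_term w summable_on (UNIV - {(0, 0)})" for w by (rule abs_summable_summable[OF wp_summable])
  have nws: "(\<lambda>p. - wp_term w p) summable_on (UNIV - {(0, 0)})" for w
    using s[of w] by (simp add: summable_on_uminus)
  have f': "?f = (\<lambda>p. wp_term (z + 1) p + - wp_term z p)"
  proof (rule ext)
    fix p show "?f p = wp_term (z + 1) p + - wp_term z p" using f[of p] by simp
  qed
  have fs: "?f summable_on (UNIV - {(0, 0)})"
    unfolding f' by (intro summable_on_add nws s)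
  have "wp (z + 1) \<tau> - wp z \<tau> = ?f (0, 0) + infsum ?f (UNIV - {(0, 0)})"
  proof -
    have "infsum ?f (UNIV - {(0, 0)}) = infsum (wp_term (z + 1)) (UNIV - {(0, 0)}) - infsum (wp_term z) (UNIV - {(0, 0)})"
      unfolding f' by (subst infsum_add[OF s nws]) (simp add: infsum_uminus)
    then show ?thesis by (simp add: wp_alt om_def)
  qed
  also have "\<dots> = infsum ?f UNIV"
  proof -
    have "infsum ?f (insert (0, 0) (UNIV - {(0, 0)})) = ?f (0, 0) + infsum ?f (UNIV - {(0, 0)})"
      by (rule infsum_insert[OF fs]) simp
    then show ?thesis by (simp only: insert_Diff_single insert_UNIV)
  qed
  also have "\<dots> = infsum (\<lambda>q. ?f (prod.swap q)) UNIV"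
    by (rule infsum_reindex_bij_betw[symmetric]) (simp add: bij_swap)
  also have "\<dots> = (\<Sum>\<^sub>\<infinity>k. \<Sum>\<^sub>\<infinity>m. ?f (m, k))"
  proof -
    have "?f summable_on insert (0, 0) (UNIV - {(0, 0)})" using fs by (simp only: summable_on_insert_iff)
    then have "?f summable_on UNIV" by (simp only: insert_Diff_single insert_UNIV)
    then have "(\<lambda>q. ?f (prod.swap q)) summable_on UNIV"
      using summable_on_reindex_bij_betw[OF bij_swap, of ?f] by simp
    then have "(\<lambda>q. ?f (prod.swap q)) summable_on (UNIV \<times> UNIV)" by simp
    from infsum_Sigma_banach[OF this] show ?thesis by simp
  qed
  also have "\<dots> = 0"
  proof -
    have "(\<Sum>\<^sub>\<infinity>m. ?f (m, k)) = 0" for k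
    proof -
      let ?v = "\<lambda>m::int. 1 / ((z - of_int k * \<tau>) - of_int m)\<^sup>2"
      have v: "?v summable_on UNIV" by (rule abs_summable_summable[OF inverse_square_summable])
      have nv: "(\<lambda>m. - ?v m) summable_on UNIV" using v by (simp only: summable_on_uminus)
      have bij: "bij (\<lambda>m::int. m - 1)" by (rule bij_betw_byWitness[of _ "\<lambda>m. m + 1"]) auto
      have v1: "(\<lambda>m. ?v (m - 1)) summable_on UNIV" using summable_on_reindex_bij_betw[OF bij, of ?v] v by simp
      have "(\<Sum>\<^sub>\<infinity>m. ?f (m, k)) = (\<Sum>\<^sub>\<infinity>m. ?v (m - 1) + - ?v m)"
        by (rule infsum_cong) (simp add: om_def algebra_simps)
      also have "\<dots> = (\<Sum>\<^sub>\<infinity>m. ?v (m - 1)) - infsum ?v UNIV"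
        by (subst infsum_add[OF v1 nv]) (simp add: infsum_uminus)
      also have "(\<Sum>\<^sub>\<infinity>m. ?v (m - 1)) = infsum ?v UNIV"
        using infsum_reindex_bij_betw[OF bij, of ?v] by simp
      finally show ?thesis by simp
    qed
    then show ?thesis by simp
  qed
  finally show ?thesis by simp
qed

lemma wp_plus_int: "wp (z + of_int n) \<tau> = wp z \<tau>"
proof (induction n rule: int_induct[of _ 0])
  case (step1 i)
  then show ?case using wp_plus_1[of "z + of_int i"] by (simp add: add.assoc)
next
  case (step2 i)
  then show ?case using wp_plus_1[of "z + of_int (i - 1)"] by (simp add: algebra_simps)
qed simp

lemma mero_sum: "finite A ==> (\<And>x. x \<in> A ==> mero (f x)) ==> mero (\<lambda>u. \<Sum>x\<in>A. f x u)"
  by (induction A rule: finite_induct) (auto intro!: mero_const mero_add)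

lemma mero_wp:
  assumes "a \<noteq> b" shows "mero (\<lambda>u :: complex^'k::finite. wp (u $ a - u $ b) \<tau>)"
  unfolding mero_def
proof
  fix u0 :: "complex^'k"
  let ?l = "\<lambda>u :: complex^'k. u $ a - u $ b"
  define R where "R = cmod (?l u0) + 1"
  let ?F = "\<lambda>u. 1 / (?l u)\<^sup>2 + (\<Sum>p\<in>near R. wp_term (?l u) p)"
  have inv: "mero (\<lambda>u. 1 / (?l u + c)\<^sup>2)" for c
  proof (rule mero_quotient)
    show "holo_on (\<lambda>u. (?l u + c)\<^sup>2) UNIV"
      unfolding power2_eq_square by (intro holo_on_mult holo_on_coord_diff open_UNIV)
    have "nowhere_dense {u :: complex^'k. ?l u + c \<in> {0}}"
      by (rule nowhere_dense_coord_diff[OF assms]) (simp add: nowhere_dense_def)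
    then show "nowhere_dense {u :: complex^'k. (?l u + c)\<^sup>2 = 0}" by simp
  qed (rule holo_on_const, simp)
  have "mero ?F"
    unfolding wp_term_def
    by (intro mero_add mero_sum finite_near mero_diff mero_const) (use inv[of 0] inv[of "- om _"] in simp_all)
  then obtain N A B where N: "u0 \<in> N" "holo_on A N" "holo_on B N" "interior {v\<in>N. B v = 0} = {}"
      "\<forall>v\<in>N. B v \<noteq> 0 \<longrightarrow> ?F v = A v / B v"
    unfolding mero_def by meson
  let ?M = "{u. ?l u \<in> ball 0 R}"
  have hl: "holo_on ?l UNIV" by (intro holo_on_diff holo_on_coord open_UNIV)
  have oM: "open ?M"
    using continuous_open_preimage[OF holo_on_continuous[OF hl] open_UNIV open_ball[of 0 R]] by (simp add: vimage_def)
  have far: "holo_on (\<lambda>u. wp_far R (?l u)) ?M"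
    by (rule holo_on_compose[OF wp_far_holomorphic open_ball holo_on_subset[OF hl oM]]) auto
  let ?N = "N \<inter> ?M"
  have oN: "open ?N" using oM holo_on_open[OF N(2)] by blast
  have h: "holo_on A ?N" "holo_on B ?N" "holo_on (\<lambda>u. wp_far R (?l u)) ?N"
    using N(2,3) far oN by (auto intro: holo_on_subset)
  have 1: "u0 \<in> ?N" using N(1) by (simp add: R_def)
  have 2: "holo_on (\<lambda>u. A u + B u * wp_far R (?l u)) ?N" by (intro holo_on_add holo_on_mult h)
  have 3: "interior {v\<in>?N. B v = 0} = {}"
    using interior_mono[of "{v\<in>?N. B v = 0}" "{v\<in>N. B v = 0}"] N(4) by auto
  have 4: "\<forall>v\<in>?N. B v \<noteq> 0 \<longrightarrow> wp (?l v) \<tau> = (A v + B v * wp_far R (?l v)) / B v"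
  proof (intro ballI impI)
    fix v assume v: "v \<in> ?N" "B v \<noteq> 0"
    then have "wp (?l v) \<tau> = A v / B v + wp_far R (?l v)" using N(5) wp_split[of "?l v" R] by auto
    then show "wp (?l v) \<tau> = (A v + B v * wp_far R (?l v)) / B v" using v(2) by (simp add: field_simps)
  qed
  show "\<exists>N A B. u0 \<in> N \<and> holo_on A N \<and> holo_on B N \<and> interior {v\<in>N. B v = 0} = {} \<and>
     (\<forall>v\<in>N. B v \<noteq> 0 \<longrightarrow> wp (?l v) \<tau> = A v / B v)"
    using 1 2 h(2) 3 4 by (intro exI conjI)
qed

end

section \<open>Restriction of meromorphic functions to a slice\<close>

text \<open>
  A local presentation of a meromorphic function as a quotient of holomorphic functions,
  insensitive to the choice of representative.
\<close>

definition rat :: "('k::finite) merfun => (complex^'k) set => (complex^'k => complex) => (complex^'k => complex) => bool" where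
  "rat F N a b \<longleftrightarrow> holo_on a N \<and> holo_on b N \<and> interior {v\<in>N. b v = 0} = {} \<and>
     nowhere_dense {v\<in>N. b v \<noteq> 0 \<and> rep_mer F v \<noteq> a v / b v}"

lemma rat_mono:
  assumes "rat F N a b" "open M" "M \<subseteq> N" shows "rat F M a b"
proof -
  have "interior {v\<in>M. b v = 0} \<subseteq> interior {v\<in>N. b v = 0}"
    by (rule interior_mono) (use assms(3) in auto)
  moreover have "nowhere_dense {v\<in>M. b v \<noteq> 0 \<and> rep_mer F v \<noteq> a v / b v}"
    by (rule nowhere_dense_subset[of "{v\<in>N. b v \<noteq> 0 \<and> rep_mer F v \<noteq> a v / b v}"])
      (use assms in \<open>auto simp: rat_def\<close>)
  ultimately show ?thesis using assms holo_on_subset unfolding rat_def by blast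
qed

lemma rep_add: "nowhere_dense {u. rep_mer (F + G) u \<noteq> rep_mer F u + rep_mer G u}"
  using rep_abs_mer[OF mero_add[OF mero_rep[of F] mero_rep[of G]]]
  by (simp add: abs_mer_add[OF mero_rep mero_rep, symmetric] abs_rep_mer)

lemma rep_mult: "nowhere_dense {u. rep_mer (F * G) u \<noteq> rep_mer F u * rep_mer G u}"
  using rep_abs_mer[OF mero_mult[OF mero_rep[of F] mero_rep[of G]]]
  by (simp add: abs_mer_mult[OF mero_rep mero_rep, symmetric] abs_rep_mer)

lemma rat_arith:
  assumes F: "rat F N a b" and G: "rat G N c d"
  shows rat_add: "rat (F + G) N (\<lambda>v. a v * d v + c v * b v) (\<lambda>v. b v * d v)"
    and rat_mult: "rat (F * G) N (\<lambda>v. a v * c v) (\<lambda>v. b v * d v)"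
proof -
  have h: "holo_on a N" "holo_on b N" "holo_on c N" "holo_on d N" using F G by (auto simp: rat_def)
  have z: "interior {v\<in>N. b v * d v = 0} = {}"
    using zero_set_mult[OF h(2,4)] F G by (simp add: rat_def)
  let ?S = "{v\<in>N. b v \<noteq> 0 \<and> rep_mer F v \<noteq> a v / b v} \<union> {v\<in>N. d v \<noteq> 0 \<and> rep_mer G v \<noteq> c v / d v}"
  have S: "nowhere_dense ?S" using F G by (auto simp: rat_def intro: nowhere_dense_Un)
  have "nowhere_dense {v\<in>N. b v * d v \<noteq> 0 \<and> rep_mer (F + G) v \<noteq> (a v * d v + c v * b v) / (b v * d v)}"
    by (rule nowhere_dense_subset[OF nowhere_dense_Un[OF S rep_add[of F G]]]) (auto simp: add_frac_eq)
  moreover have "nowhere_dense {v\<in>N. b v * d v \<noteq> 0 \<and> rep_mer (F * G) v \<noteq> (a v * c v) / (b v * d v)}"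
    by (rule nowhere_dense_subset[OF nowhere_dense_Un[OF S rep_mult[of F G]]]) auto
  ultimately show "rat (F + G) N (\<lambda>v. a v * d v + c v * b v) (\<lambda>v. b v * d v)"
    "rat (F * G) N (\<lambda>v. a v * c v) (\<lambda>v. b v * d v)"
    using h z by (auto simp: rat_def intro!: holo_on_add holo_on_mult)
qed

lemma rat_abs:
  assumes "mero f" "holo_on a N" "holo_on b N" "interior {v\<in>N. b v = 0} = {}"
    "\<And>v. v \<in> N ==> b v \<noteq> 0 ==> f v = a v / b v"
  shows "rat (abs_mer f) N a b"
proof -
  have "{v\<in>N. b v \<noteq> 0 \<and> rep_mer (abs_mer f) v \<noteq> a v / b v} \<subseteq> {u. rep_mer (abs_mer f) u \<noteq> f u}"
    using assms(5) by auto
  from nowhere_dense_subset[OF rep_abs_mer[OF assms(1)] this] show ?thesis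
    unfolding rat_def using assms(2-4) by blast
qed

lemma rat_exists: "\<exists>N a b. u \<in> N \<and> rat F N a b"
proof -
  obtain N a b where N: "u \<in> N" "holo_on a N" "holo_on b N" "interior {v\<in>N. b v = 0} = {}"
      "\<forall>v\<in>N. b v \<noteq> 0 \<longrightarrow> rep_mer F v = a v / b v"
    using mero_rep[of F] unfolding mero_def by meson
  have "rat (abs_mer (rep_mer F)) N a b" by (rule rat_abs[OF mero_rep N(2-4)]) (use N(5) in blast)
  then show ?thesis using N(1) unfolding abs_rep_mer by blast
qed

lemma rat_dmer:
  assumes F: "rat F N a b"
  shows "rat (dmer v F) N (\<lambda>u. ddir v a u * b u - a u * ddir v b u) (\<lambda>u. b u * b u)"
proof -
  have h: "holo_on a N" "holo_on b N" "interior {v\<in>N. b v = 0} = {}" using F by (auto simp: rat_def)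
  let ?S = "{v\<in>N. b v \<noteq> 0 \<and> rep_mer F v \<noteq> a v / b v}"
  have S: "nowhere_dense ?S" using F by (simp add: rat_def)
  have r: "nowhere_dense {u. rep_mer (dmer v F) u \<noteq> ddir v (rep_mer F) u}"
    unfolding dmer_def by (rule rep_abs_mer[OF mero_ddir[OF mero_rep]])
  have e: "ddir v (rep_mer F) u = (ddir v a u * b u - a u * ddir v b u) / (b u * b u)"
    if u: "u \<in> N" "b u \<noteq> 0" "u \<notin> closure ?S" for u
  proof -
    let ?M = "{v\<in>N. b v \<noteq> 0} - closure ?S"
    have "open ?M" using holo_on_open_nonzero[OF h(2)] by (intro open_Diff) auto
    moreover have "u \<in> ?M" using u by simp
    moreover have "rep_mer F x = a x / b x" if "x \<in> ?M" for x using that closure_subset[of ?S] by auto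
    ultimately have "ddir v (rep_mer F) u = ddir v (\<lambda>x. a x / b x) u" by (rule ddir_cong)
    also have "\<dots> = (ddir v a u * b u - a u * ddir v b u) / (b u * b u)"
      by (rule ddir_divide) (use u h in \<open>auto simp: holo_at_def\<close>)
    finally show ?thesis .
  qed
  have "nowhere_dense {u\<in>N. b u * b u \<noteq> 0 \<and> rep_mer (dmer v F) u \<noteq> (ddir v a u * b u - a u * ddir v b u) / (b u * b u)}"
    by (rule nowhere_dense_subset[OF nowhere_dense_Un[OF r nowhere_dense_closure[OF S]]]) (use e in auto)
  then show ?thesis using h by (auto simp: rat_def intro!: holo_on_diff holo_on_mult holo_on_ddir)
qed

lemma rat_reindex:
  assumes s: "inj (\<sigma> :: 'k::finite => 'l::finite)" and F: "rat F N a b"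
  shows "rat (reindex \<sigma> F) (coords \<sigma> -` N) (\<lambda>u. a (coords \<sigma> u)) (\<lambda>u. b (coords \<sigma> u))"
proof -
  have h: "holo_on a N" "holo_on b N" "interior {v\<in>N. b v = 0} = {}" using F by (auto simp: rat_def)
  have r: "nowhere_dense {u. rep_mer (reindex \<sigma> F) u \<noteq> rep_mer F (coords \<sigma> u)}"
  proof -
    have "reindex \<sigma> F = abs_mer (\<lambda>u. rep_mer F (coords \<sigma> u))"
      using reindex_abs[OF s mero_rep[of F]] by (simp add: abs_rep_mer)
    then show ?thesis using rep_abs_mer[OF mero_coords[OF s mero_rep[of F]]] by simp
  qed
  have "nowhere_dense (coords \<sigma> -` {v\<in>N. b v \<noteq> 0 \<and> rep_mer F v \<noteq> a v / b v})"
    using F by (intro nowhere_dense_coords[OF s]) (simp add: rat_def)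
  from nowhere_dense_Un[OF r this]
  have "nowhere_dense {v \<in> coords \<sigma> -` N. b (coords \<sigma> v) \<noteq> 0 \<and> rep_mer (reindex \<sigma> F) v \<noteq> a (coords \<sigma> v) / b (coords \<sigma> v)}"
    by (rule nowhere_dense_subset) auto
  moreover have "interior {v \<in> coords \<sigma> -` N. b (coords \<sigma> v) = 0} = {}"
    using interior_coords[OF s h(3)] by (simp add: vimage_def)
  ultimately show ?thesis using h by (simp add: rat_def holo_on_coords)
qed

subsection \<open>Regular values\<close>

lemma regular_value_unique:
  assumes "regular_value F u c" "regular_value F u c'" shows "c = c'"
proof -
  obtain N a where N: "u \<in> N" "holo_on a N" "nowhere_dense {v\<in>N. rep_mer F v \<noteq> a v}" "a u = c"
    using assms(1) by (auto simp: regular_value_def)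
  obtain N' a' where N': "u \<in> N'" "holo_on a' N'" "nowhere_dense {v\<in>N'. rep_mer F v \<noteq> a' v}" "a' u = c'"
    using assms(2) by (auto simp: regular_value_def)
  have "a u = a' u"
    by (rule continuous_eq_off_nowhere_dense[where N = "N \<inter> N'", OF _ _ _ nowhere_dense_Un[OF N(3) N'(3)]])
      (use N N' holo_on_open in \<open>auto intro!: open_Int continuous_on_subset[OF holo_on_continuous]\<close>)
  then show ?thesis using N N' by simp
qed

lemma regular_valueI: "u \<in> N ==> holo_on a N ==> nowhere_dense {v\<in>N. rep_mer F v \<noteq> a v} ==> a u = c ==> regular_value F u c"
  unfolding regular_value_def by blast

lemma regular_value_arith:
  assumes "regular_value F u c" "regular_value G u d"
  shows "regular_value (F + G) u (c + d)" "regular_value (F * G) u (c * d)"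
proof -
  obtain N a where N: "u \<in> N" "holo_on a N" "nowhere_dense {v\<in>N. rep_mer F v \<noteq> a v}" "a u = c"
    using assms(1) by (auto simp: regular_value_def)
  obtain N' a' where N': "u \<in> N'" "holo_on a' N'" "nowhere_dense {v\<in>N'. rep_mer G v \<noteq> a' v}" "a' u = d"
    using assms(2) by (auto simp: regular_value_def)
  have o: "open (N \<inter> N')" using N N' holo_on_open by blast
  have h: "holo_on a (N \<inter> N')" "holo_on a' (N \<inter> N')" using N N' o by (auto intro: holo_on_subset)
  note S = nowhere_dense_Un[OF N(3) N'(3)]
  show "regular_value (F + G) u (c + d)"
    by (rule regular_valueI[OF _ holo_on_add[OF h] nowhere_dense_subset[OF nowhere_dense_Un[OF S rep_add[of F G]]]])
      (use N N' in auto)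
  show "regular_value (F * G) u (c * d)"
    by (rule regular_valueI[OF _ holo_on_mult[OF h] nowhere_dense_subset[OF nowhere_dense_Un[OF S rep_mult[of F G]]]])
      (use N N' in auto)
qed

lemma regular_value_mconst: "regular_value (mconst c) u c"
  unfolding mconst_def
  by (rule regular_valueI[of _ UNIV "\<lambda>_. c"]) (use rep_abs_mer[OF mero_const[of c]] in \<open>auto intro: holo_on_const\<close>)

lemma regular_value_rat:
  assumes F: "rat F N a b" and u: "u \<in> N" "b u \<noteq> 0" shows "regular_value F u (a u / b u)"
proof (rule regular_valueI[of _ "{v\<in>N. b v \<noteq> 0}" "\<lambda>v. a v / b v"])
  have h: "holo_on a N" "holo_on b N" using F by (auto simp: rat_def)
  have o: "open {v\<in>N. b v \<noteq> 0}" by (rule holo_on_open_nonzero[OF h(2)])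
  show "holo_on (\<lambda>v. a v / b v) {v\<in>N. b v \<noteq> 0}"
    by (rule holo_on_divide) (use h o in \<open>auto intro: holo_on_subset\<close>)
  have "{v \<in> {v\<in>N. b v \<noteq> 0}. rep_mer F v \<noteq> a v / b v} = {v\<in>N. b v \<noteq> 0 \<and> rep_mer F v \<noteq> a v / b v}" by auto
  then show "nowhere_dense {v \<in> {v\<in>N. b v \<noteq> 0}. rep_mer F v \<noteq> a v / b v}" using F by (simp add: rat_def)
qed (use u in auto)

lemma regular_value_abs:
  assumes "mero f" "holo_at f u" shows "regular_value (abs_mer f) u (f u)"
proof -
  obtain N where "u \<in> N" "holo_on f N" using assms(2) by (auto simp: holo_at_def)
  then show ?thesis
    by (intro regular_valueI[of u N f]) (auto intro: nowhere_dense_subset[OF rep_abs_mer[OF assms(1)]])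
qed

subsection \<open>Functions that restrict to a slice $x = \mathrm{const}$\<close>

lemma linear_join: "linear (join (0 :: complex^'n::finite))"
  by (rule linearI) (auto simp: join_def vec_eq_iff split: sum.split)

lemma join_split: "join x l = join x 0 + join 0 l"
  by (auto simp: join_def vec_eq_iff split: sum.split)

lemma join_nth [simp]: "join x l $ Inl i = x $ i" "join x l $ Inr i = l $ i"
  by (simp_all add: join_def)

lemma has_derivative_join: "(join x has_derivative join 0) (at l)"
proof -
  have "((\<lambda>l. join x 0 + join 0 l) has_derivative (\<lambda>h. 0 + join 0 h)) (at l)"
    by (intro has_derivative_add has_derivative_const linear_imp_has_derivative linear_join)
  then show ?thesis by (simp add: join_split[of x, symmetric])
qed

lemma open_slice: "open N ==> open {l. join x l \<in> N}"
proof -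
  assume "open N"
  have "continuous_on UNIV (join x)"
    by (intro continuous_at_imp_continuous_on ballI has_derivative_continuous[OF has_derivative_join])
  from open_vimage[OF \<open>open N\<close> this] show ?thesis by (simp add: vimage_def)
qed

lemma holo_on_slice:
  assumes f: "holo_on f N" shows "holo_on (\<lambda>l. f (join x l)) {l. join x l \<in> N}"
proof (rule holo_on_iff_linear[OF open_slice[OF holo_on_open[OF f]], where D = "\<lambda>l v. ddir (join 0 v) f (join x l)"])
  fix l assume "l \<in> {l. join x l \<in> N}"
  then have l: "join x l \<in> N" by simp
  show "((\<lambda>l. f (join x l)) has_derivative (\<lambda>v. ddir (join 0 v) f (join x l))) (at l)"
    by (rule has_derivative_compose[OF has_derivative_join holo_on_has_derivative(1)[OF f l]])
  have "join 0 (c *s v) = c *s join 0 v" for c and v :: "complex^'a" by (auto simp: join_def vec_eq_iff split: sum.split)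
  then show "ddir (join 0 (c *s v)) f (join x l) = c * ddir (join 0 v) f (join x l)" for c v
    using holo_on_has_derivative(2)[OF f l] by simp
qed

text \<open>
  The denominator of some local presentation does not vanish identically on the slice through
  $x$. Regularity at single points would not do: the poles in $\lambda$ of the R-matrix meet the
  slice.
\<close>

definition slice_ok :: "complex^'n => complex^'n => ('n::finite + 'n) merfun => bool" where
  "slice_ok x l F \<longleftrightarrow> (\<exists>N a b. join x l \<in> N \<and> rat F N a b \<and> interior {l'. join x l' \<in> N \<and> b (join x l') = 0} = {})"

lemma slice_okI: "join x l \<in> N ==> rat F N a b ==> interior {l'. join x l' \<in> N \<and> b (join x l') = 0} = {} ==> slice_ok x l F"
  unfolding slice_ok_def by blast

lemma slice_ok_arith:
  assumes "slice_ok x l F" "slice_ok x l G"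
  shows "slice_ok x l (F + G)" "slice_ok x l (F * G)"
proof -
  obtain N a b where N: "join x l \<in> N" "rat F N a b" "interior {l'. join x l' \<in> N \<and> b (join x l') = 0} = {}"
    using assms(1) by (auto simp: slice_ok_def)
  obtain M c d where M: "join x l \<in> M" "rat G M c d" "interior {l'. join x l' \<in> M \<and> d (join x l') = 0} = {}"
    using assms(2) by (auto simp: slice_ok_def)
  have h: "holo_on b N" "holo_on d M" using N M by (auto simp: rat_def)
  have o: "open (N \<inter> M)" using h holo_on_open by blast
  have F: "rat F (N \<inter> M) a b" and G: "rat G (N \<inter> M) c d" using N M o rat_mono by blast+
  have "interior {l' \<in> {l. join x l \<in> N} \<inter> {l. join x l \<in> M}. b (join x l') * d (join x l') = 0} = {}"
    by (rule zero_set_mult[OF holo_on_slice[OF h(1)] holo_on_slice[OF h(2)]]) (use N M in auto)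
  then have z: "interior {l'. join x l' \<in> N \<inter> M \<and> b (join x l') * d (join x l') = 0} = {}" by (simp add: conj_assoc)
  show "slice_ok x l (F + G)" by (rule slice_okI[OF _ rat_add[OF F G]]) (use N M z in auto)
  show "slice_ok x l (F * G)" by (rule slice_okI[OF _ rat_mult[OF F G]]) (use N M z in auto)
qed

lemma slice_ok_dmer: "slice_ok x l F ==> slice_ok x l (dmer v F)"
  unfolding slice_ok_def
proof (elim exE conjE)
  fix N a b assume N: "join x l \<in> N" "rat F N a b" "interior {l'. join x l' \<in> N \<and> b (join x l') = 0} = {}"
  then show "\<exists>N a b. join x l \<in> N \<and> rat (dmer v F) N a b \<and> interior {l'. join x l' \<in> N \<and> b (join x l') = 0} = {}"
    using rat_dmer[OF N(2), of v]
    by (intro exI[of _ N] exI[of _ "\<lambda>u. ddir v a u * b u - a u * ddir v b u"] exI[of _ "\<lambda>u. b u * b u"]) simp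
qed

lemma slice_ok_holo:
  assumes "mero f" "holo_at f (join x l)" shows "slice_ok x l (abs_mer f)"
proof -
  obtain N where N: "join x l \<in> N" "holo_on f N" using assms(2) by (auto simp: holo_at_def)
  show ?thesis
    by (rule slice_okI[OF N(1) rat_abs[of f f N "\<lambda>_. 1"]])
      (use N assms holo_on_open in \<open>auto intro: holo_on_const\<close>)
qed

lemma slice_ok_mconst: "slice_ok x l (mconst c)"
  unfolding mconst_def by (rule slice_ok_holo[OF mero_const]) (auto simp: holo_at_def intro: holo_on_const)

lemma coords_hat_join: "coords (map_sum \<sigma> id) (join x l) = join (coords \<sigma> x) l"
  by (auto simp: vec_eq_iff join_def split: sum.split)

lemma coords_vee_join: "coords (map_sum id \<sigma>) (join x l) = join x (coords \<sigma> l)"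
  by (auto simp: vec_eq_iff join_def split: sum.split)

lemma slice_ok_hat:
  assumes "slice_ok (coords \<sigma> x) l F" "inj (\<sigma> :: 'n::finite => 'n)" shows "slice_ok x l (reindex (map_sum \<sigma> id) F)"
proof -
  obtain N a b where N: "join (coords \<sigma> x) l \<in> N" "rat F N a b" "interior {l'. join (coords \<sigma> x) l' \<in> N \<and> b (join (coords \<sigma> x) l') = 0} = {}"
    using assms(1) by (auto simp: slice_ok_def)
  show ?thesis
    by (rule slice_okI[OF _ rat_reindex[OF _ N(2)]]) (use N assms in \<open>auto simp: coords_hat_join inj_map_sum\<close>)
qed

lemma slice_ok_vee:
  assumes "slice_ok x (coords \<sigma> l) F" "inj (\<sigma> :: 'n::finite => 'n)" shows "slice_ok x l (reindex (map_sum id \<sigma>) F)"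
proof -
  obtain N a b where N: "join x (coords \<sigma> l) \<in> N" "rat F N a b" "interior {l'. join x l' \<in> N \<and> b (join x l') = 0} = {}"
    using assms(1) by (auto simp: slice_ok_def)
  have "{l'. join x l' \<in> coords (map_sum id \<sigma>) -` N \<and> b (coords (map_sum id \<sigma>) (join x l')) = 0} = coords \<sigma> -` {l'. join x l' \<in> N \<and> b (join x l') = 0}"
    by (auto simp: coords_vee_join)
  then have "interior {l'. join x l' \<in> coords (map_sum id \<sigma>) -` N \<and> b (coords (map_sum id \<sigma>) (join x l')) = 0} = {}"
    using interior_coords[OF assms(2) N(3)] by simp
  then show ?thesis
    by (intro slice_okI[OF _ rat_reindex[OF _ N(2)]]) (use N assms in \<open>auto simp: coords_vee_join inj_map_sum\<close>)
qed

lemma coords_Inr_join: "coords Inr (join x l) = l" "coords Inl (join x l) = x"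
  by (simp_all add: vec_eq_iff)

lemma slice_ok_Inr: "slice_ok x l (reindex Inr F)"
proof -
  obtain N a b where N: "l \<in> N" "rat F N a b" using rat_exists[of l F] by blast
  show ?thesis
    by (rule slice_okI[OF _ rat_reindex[OF _ N(2)]]) (use N in \<open>auto simp: coords_Inr_join rat_def\<close>)
qed

lemma slice_ok_Inl:
  assumes "regular_value F x c" shows "slice_ok x l (reindex Inl F)"
proof -
  obtain N a where N: "x \<in> N" "holo_on a N" "nowhere_dense {v\<in>N. rep_mer F v \<noteq> a v}"
    using assms by (auto simp: regular_value_def)
  then have "rat F N a (\<lambda>_. 1)" using holo_on_open by (auto simp: rat_def intro: holo_on_const)
  then show ?thesis
    by (intro slice_okI[OF _ rat_reindex]) (use N in \<open>auto simp: coords_Inr_join\<close>)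
qed

text \<open>
  For functions of $x$ alone restrictability is regularity: at some $\lambda$ on the slice the
  denominator is nonzero, and the function does not depend on $\lambda$.
\<close>

lemma slice_ok_Inl_iff:
  assumes "slice_ok x l (reindex Inl F)" shows "\<exists>c. regular_value F x c"
proof -
  obtain N a b where N: "join x l \<in> N" "rat (reindex Inl F) N a b" "interior {l'. join x l' \<in> N \<and> b (join x l') = 0} = {}"
    using assms by (auto simp: slice_ok_def)
  have o: "open {l'. join x l' \<in> N}" using N(2) holo_on_open open_slice unfolding rat_def by blast
  obtain l' where l': "join x l' \<in> N" "b (join x l') \<noteq> 0"
  proof -
    have "\<not> {l'. join x l' \<in> N} \<subseteq> {l'. join x l' \<in> N \<and> b (join x l') = 0}"
      using interior_maximal[OF _ o] N(1,3) by blast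
    then show ?thesis using that by blast
  qed
  obtain M c where M: "join x l' \<in> M" "holo_on c M" "nowhere_dense {v\<in>M. rep_mer (reindex Inl F) v \<noteq> c v}"
    using regular_value_rat[OF N(2) l'] by (auto simp: regular_value_def)
  have r: "nowhere_dense {u :: complex^('a + 'a). rep_mer (reindex Inl F) u \<noteq> rep_mer F (coords Inl u)}"
  proof -
    have i: "inj (Inl :: 'a => 'a + 'a)" by simp
    have "reindex (Inl :: 'a => 'a + 'a) F = abs_mer (\<lambda>u. rep_mer F (coords Inl u))"
      using reindex_abs[OF i mero_rep[of F]] by (simp add: abs_rep_mer)
    then show ?thesis using rep_abs_mer[OF mero_coords[OF i mero_rep[of F]]] by simp
  qed
  let ?S = "{v\<in>M. rep_mer (reindex Inl F) v \<noteq> c v} \<union> {u. rep_mer (reindex Inl F) u \<noteq> rep_mer F (coords Inl u)} \<union> coords Inl -` {u. \<not> holo_at (rep_mer F) u}"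
  have S: "nowhere_dense ?S"
    by (intro nowhere_dense_Un M(3) r nowhere_dense_coords[OF inj_Inl] nowhere_dense_not_holo mero_rep)
  obtain e where e: "e > 0" "ball (join x l') e \<subseteq> M"
    using M(1) holo_on_open[OF M(2)] open_contains_ball by blast
  \<comment> \<open>the function does not depend on the second group of variables\<close>
  define g where "g y = c (join y l')" for y
  have dj: "((\<lambda>y. join y l') has_derivative (\<lambda>h. join h 0)) (at y)" for y
  proof -
    have "linear (\<lambda>h :: complex^'a. join h 0)" by (rule linearI) (auto simp: join_def vec_eq_iff split: sum.split)
    then have "((\<lambda>y. join y 0 + join 0 l') has_derivative (\<lambda>h. join h 0 + 0)) (at y)"
      by (intro has_derivative_add has_derivative_const linear_imp_has_derivative)
    moreover have "join y 0 + join 0 l' = join y l'" for y by (auto simp: join_def vec_eq_iff split: sum.split)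
    ultimately show ?thesis by simp
  qed
  let ?Y = "{y. join y l' \<in> ball (join x l') e}"
  have oY: "open ?Y"
  proof -
    have "continuous_on UNIV (\<lambda>y. join y l')"
      by (intro continuous_at_imp_continuous_on ballI has_derivative_continuous[OF dj])
    from open_vimage[OF open_ball this] show ?thesis by (simp add: vimage_def)
  qed
  have hg: "holo_on g ?Y"
  proof (rule holo_on_iff_linear[OF oY, where D = "\<lambda>y v. ddir (join v 0) c (join y l')"])
    fix y assume "y \<in> ?Y"
    then have y: "join y l' \<in> M" using e by auto
    show "(g has_derivative (\<lambda>v. ddir (join v 0) c (join y l'))) (at y)"
      unfolding g_def[abs_def] by (rule has_derivative_compose[OF dj holo_on_has_derivative(1)[OF M(2) y]])
    have "join (k *s v) 0 = k *s join v 0" for k and v :: "complex^'a" by (auto simp: join_def vec_eq_iff split: sum.split)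
    then show "ddir (join (k *s v) 0) c (join y l') = k * ddir (join v 0) c (join y l')" for k v
      using holo_on_has_derivative(2)[OF M(2) y] by simp
  qed
  have eq: "rep_mer F y = g y" if y: "y \<in> ?Y" "holo_at (rep_mer F) y" for y
  proof -
    obtain P where P: "y \<in> P" "holo_on (rep_mer F) P" using y(2) by (auto simp: holo_at_def)
    let ?B = "M \<inter> coords Inl -` P"
    have oB: "open ?B" using holo_on_open[OF M(2)] open_coords_vimage[OF holo_on_open[OF P(2)]] by blast
    have "rep_mer F (coords Inl (join y l')) = c (join y l')"
    proof (rule continuous_eq_off_nowhere_dense[OF _ _ oB S])
      show "continuous_on ?B (\<lambda>u. rep_mer F (coords Inl u))"
        by (rule continuous_on_subset[OF holo_on_continuous[OF holo_on_coords[OF P(2)]]]) simp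
      show "continuous_on ?B c" by (rule continuous_on_subset[OF holo_on_continuous[OF M(2)]]) simp
      show "join y l' \<in> ?B" using y P e by (auto simp: coords_Inr_join)
    qed auto
    then show ?thesis by (simp add: coords_Inr_join g_def)
  qed
  have "regular_value F x (g x)"
    by (rule regular_valueI[OF _ hg nowhere_dense_subset[OF nowhere_dense_not_holo[OF mero_rep[of F]]]])
      (use e eq in auto)
  then show ?thesis ..
qed

lemma slice_ok_regular:
  assumes "slice_ok x l F"
  shows "\<exists>M A B. l \<in> M \<and> holo_on A M \<and> holo_on B M \<and> interior {l'\<in>M. B l' = 0} = {} \<and>
    (\<forall>l'\<in>M. B l' \<noteq> 0 \<longrightarrow> regular_value F (join x l') (A l' / B l'))"
proof -
  obtain N a b where N: "join x l \<in> N" "rat F N a b" "interior {l'. join x l' \<in> N \<and> b (join x l') = 0} = {}"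
    using assms(1) by (auto simp: slice_ok_def)
  have h: "holo_on a N" "holo_on b N" using N by (auto simp: rat_def)
  show ?thesis
    by (intro exI[of _ "{l'. join x l' \<in> N}"] exI[of _ "\<lambda>l'. a (join x l')"] exI[of _ "\<lambda>l'. b (join x l')"] conjI
          holo_on_slice[OF h(1)] holo_on_slice[OF h(2)])
      (use N regular_value_rat[OF N(2)] in auto)
qed

context
  fixes x :: "complex^'n::finite"
begin

definition slice_val :: "('n + 'n) merfun => complex^'n => complex" where
  "slice_val F l = (THE c. regular_value F (join x l) c)"

lemma slice_val_eq: "regular_value F (join x l) c ==> slice_val F l = c"
  unfolding slice_val_def using regular_value_unique by (intro the_equality) auto

text \<open>
  On the slice the quotient of the restricted numerator and denominator is the regular value
  wherever the denominator is nonzero.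
\<close>

lemma slice_val_props:
  assumes "\<And>l. slice_ok x l F"
  shows "mero (slice_val F)" "nowhere_dense {l. \<nexists>c. regular_value F (join x l) c}"
proof -
  show "mero (slice_val F)" unfolding mero_def
  proof
    fix l
    obtain M A B where M: "l \<in> M" "holo_on A M" "holo_on B M" "interior {l'\<in>M. B l' = 0} = {}"
      "\<forall>l'\<in>M. B l' \<noteq> 0 \<longrightarrow> regular_value F (join x l') (A l' / B l')"
      using slice_ok_regular[OF assms[of l]] by meson
    then show "\<exists>N a b. l \<in> N \<and> holo_on a N \<and> holo_on b N \<and> interior {v \<in> N. b v = 0} = {} \<and> (\<forall>v\<in>N. b v \<noteq> 0 \<longrightarrow> slice_val F v = a v / b v)"
      by (intro exI[of _ M] exI[of _ A] exI[of _ B]) (auto intro: slice_val_eq)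
  qed
  show "nowhere_dense {l. \<nexists>c. regular_value F (join x l) c}"
  proof (rule nowhere_dense_local)
    fix l
    obtain M A B where M: "l \<in> M" "holo_on A M" "holo_on B M" "interior {l'\<in>M. B l' = 0} = {}"
      "\<forall>l'\<in>M. B l' \<noteq> 0 \<longrightarrow> regular_value F (join x l') (A l' / B l')"
      using slice_ok_regular[OF assms[of l]] by meson
    have "nowhere_dense ({l. \<nexists>c. regular_value F (join x l) c} \<inter> M)"
      by (rule nowhere_dense_subset[OF nowhere_dense_zero_set[OF M(3,4)]]) (use M(5) in blast)
    then show "\<exists>N. open N \<and> l \<in> N \<and> nowhere_dense ({l. \<nexists>c. regular_value F (join x l) c} \<inter> N)"
      using M(1) holo_on_open[OF M(2)] by blast
  qed
qed

lemma restrict_slice_val: "restrict_x x F = abs_mer (slice_val F)"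
  by (simp add: restrict_x_def slice_val_def[abs_def])

lemma restrict_arith:
  assumes F: "\<And>l. slice_ok x l F" and G: "\<And>l. slice_ok x l G"
  shows "restrict_x x (F + G) = restrict_x x F + restrict_x x G"
    "restrict_x x (F * G) = restrict_x x F * restrict_x x G"
proof -
  note S = nowhere_dense_Un[OF slice_val_props(2)[OF F] slice_val_props(2)[OF G]]
  note m = slice_val_props(1)[OF F] slice_val_props(1)[OF G]
  show "restrict_x x (F + G) = restrict_x x F + restrict_x x G"
    unfolding restrict_slice_val abs_mer_add[OF m]
  proof (rule abs_mer_eqI[OF slice_val_props(1)[OF slice_ok_arith(1)[OF F G]] mero_add[OF m] S])
    fix l assume "l \<notin> {l. \<nexists>c. regular_value F (join x l) c} \<union> {l. \<nexists>c. regular_value G (join x l) c}"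
    then obtain c d where cd: "regular_value F (join x l) c" "regular_value G (join x l) d" by blast
    show "slice_val (F + G) l = slice_val F l + slice_val G l"
      using slice_val_eq[OF regular_value_arith(1)[OF cd]] slice_val_eq[OF cd(1)] slice_val_eq[OF cd(2)] by simp
  qed
  show "restrict_x x (F * G) = restrict_x x F * restrict_x x G"
    unfolding restrict_slice_val abs_mer_mult[OF m]
  proof (rule abs_mer_eqI[OF slice_val_props(1)[OF slice_ok_arith(2)[OF F G]] mero_mult[OF m] S])
    fix l assume "l \<notin> {l. \<nexists>c. regular_value F (join x l) c} \<union> {l. \<nexists>c. regular_value G (join x l) c}"
    then obtain c d where cd: "regular_value F (join x l) c" "regular_value G (join x l) d" by blast
    show "slice_val (F * G) l = slice_val F l * slice_val G l"
      using slice_val_eq[OF regular_value_arith(2)[OF cd]] slice_val_eq[OF cd(1)] slice_val_eq[OF cd(2)] by simp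
  qed
qed

lemma restrict_mconst: "restrict_x x (mconst c) = mconst c"
proof -
  have "slice_val (mconst c) = (\<lambda>_. c)" using slice_val_eq[OF regular_value_mconst[of c]] by (rule ext)
  then show ?thesis unfolding restrict_slice_val by (simp only: mconst_def)
qed

lemma restrict_Inl: "regular_value F x c ==> restrict_x x (reindex Inl F) = mconst c"
proof -
  assume "regular_value F x c"
  then obtain N a where N: "x \<in> N" "holo_on a N" "nowhere_dense {v\<in>N. rep_mer F v \<noteq> a v}" "a x = c"
    by (auto simp: regular_value_def)
  then have "rat F N a (\<lambda>_. 1)" using holo_on_open by (auto simp: rat_def intro: holo_on_const)
  then have r: "rat (reindex Inl F) (coords Inl -` N) (\<lambda>u. a (coords Inl u)) (\<lambda>u. 1)" by (rule rat_reindex[OF inj_Inl])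
  have "regular_value (reindex Inl F) (join x l) c" for l
    using regular_value_rat[OF r, of "join x l"] N by (simp add: coords_Inr_join)
  then have "slice_val (reindex Inl F) = (\<lambda>_. c)" using slice_val_eq by blast
  then show ?thesis by (simp add: restrict_slice_val mconst_def)
qed

lemma restrict_vee:
  assumes F: "\<And>l. slice_ok x l F" and s: "inj (\<sigma> :: 'n => 'n)"
  shows "restrict_x x (reindex (map_sum id \<sigma>) F) = reindex \<sigma> (restrict_x x F)"
  unfolding restrict_slice_val reindex_abs[OF s slice_val_props(1)[OF F]]
proof (rule abs_mer_eqI[OF _ mero_coords[OF s slice_val_props(1)[OF F]] nowhere_dense_coords[OF s slice_val_props(2)[OF F]]])
  show "mero (slice_val (reindex (map_sum id \<sigma>) F))"
    by (rule slice_val_props(1)[OF slice_ok_vee[OF F s]])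
  fix l assume "l \<notin> coords \<sigma> -` {l. \<nexists>c. regular_value F (join x l) c}"
  then obtain c where c: "regular_value F (join x (coords \<sigma> l)) c" by auto
  then obtain N a where N: "join x (coords \<sigma> l) \<in> N" "holo_on a N" "nowhere_dense {v\<in>N. rep_mer F v \<noteq> a v}" "a (join x (coords \<sigma> l)) = c"
    by (auto simp: regular_value_def)
  then have "rat F N a (\<lambda>_. 1)" using holo_on_open by (auto simp: rat_def intro: holo_on_const)
  then have r: "rat (reindex (map_sum id \<sigma>) F) (coords (map_sum id \<sigma>) -` N) (\<lambda>u. a (coords (map_sum id \<sigma>) u)) (\<lambda>u. 1)"
    by (rule rat_reindex[rotated]) (simp add: inj_map_sum s)
  have "regular_value (reindex (map_sum id \<sigma>) F) (join x l) c"
    using regular_value_rat[OF r, of "join x l"] N by (simp add: coords_vee_join)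
  then show "slice_val (reindex (map_sum id \<sigma>) F) l = slice_val F (coords \<sigma> l)"
    using slice_val_eq c by metis
qed

end

subsection \<open>Functions with poles only on the diagonals\<close>

lemma Lat_jtheta:
  assumes \<tau>: "Im \<tau> > 0" shows "Lat \<tau> = {z. jtheta z \<tau> = 0}"
proof -
  have z: "jtheta 0 \<tau> = 0" using jtheta_odd[OF \<tau>, of 0] by simp
  have p: "jtheta (w + of_int m) \<tau> = 0 \<longleftrightarrow> jtheta w \<tau> = 0" for w m
  proof (induction m rule: int_induct[of _ 0])
    case (step1 i)
    then show ?case using jtheta_plus_1[OF \<tau>, of "w + of_int i"] by (simp add: add.assoc)
  next
    case (step2 i)
    then show ?case using jtheta_plus_1[OF \<tau>, of "w + of_int (i - 1)"] by (simp add: algebra_simps)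
  qed simp
  have q: "jtheta (w + of_int m * \<tau>) \<tau> = 0 \<longleftrightarrow> jtheta w \<tau> = 0" for w m
  proof (induction m rule: int_induct[of _ 0])
    case (step1 i)
    then show ?case using jtheta_plus_tau[OF \<tau>, of "w + of_int i * \<tau>"] by (simp add: algebra_simps)
  next
    case (step2 i)
    then show ?case using jtheta_plus_tau[OF \<tau>, of "w + of_int (i - 1) * \<tau>"] by (simp add: algebra_simps)
  qed simp
  have "jtheta (om \<tau> x) \<tau> = 0" for x
    unfolding om_def[OF \<tau>] using q[of "of_int (fst x)" "snd x"] p[of 0 "fst x"] z by simp
  moreover have "w \<in> Lat \<tau>" if w: "jtheta w \<tau> = 0" for w
  proof -
    obtain m k where "w = of_int m + of_int k * \<tau>" using jtheta_zero_lattice[OF \<tau> w] by blast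
    then have "w = om \<tau> (m, k)" by (simp add: om_def[OF \<tau>])
    then show ?thesis unfolding Lat_def[OF \<tau>] by blast
  qed
  ultimately show ?thesis unfolding Lat_def[OF \<tau>] by auto
qed

text \<open>
  The points where no R-matrix and no potential of the Hamiltonians has a pole in $x$.
\<close>

definition Dset :: "complex => (complex^'n) set" where
  "Dset \<tau> = {x. \<forall>i j. i \<noteq> j \<longrightarrow> x $ i - x $ j \<notin> Lat \<tau>}"

lemma open_Dset:
  assumes \<tau>: "Im \<tau> > 0" shows "open (Dset \<tau> :: (complex^'n::finite) set)"
proof -
  have c: "continuous_on UNIV (\<lambda>z. jtheta z \<tau>)"
    using jtheta_entire[OF \<tau>, of UNIV] holomorphic_on_imp_continuous_on by blast
  have "Dset \<tau> = (\<Inter>i::'n. \<Inter>j\<in>UNIV - {i}. {x. jtheta (x $ i - x $ j) \<tau> \<noteq> 0})"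
    by (auto simp: Dset_def Lat_jtheta[OF \<tau>])
  moreover have "open {x :: complex^'n. jtheta (x $ i - x $ j) \<tau> \<noteq> 0}" for i j
  proof -
    have "continuous_on UNIV (\<lambda>x :: complex^'n. jtheta (x $ i - x $ j) \<tau>)"
      by (rule continuous_on_compose2[OF c]) (auto intro!: continuous_intros)
    then have "open ((\<lambda>x :: complex^'n. jtheta (x $ i - x $ j) \<tau>) -` (- {0}))" by (intro open_vimage) auto
    moreover have "(\<lambda>x :: complex^'n. jtheta (x $ i - x $ j) \<tau>) -` (- {0}) = {x. jtheta (x $ i - x $ j) \<tau> \<noteq> 0}" by auto
    ultimately show ?thesis by simp
  qed
  ultimately show ?thesis by (simp add: open_INT)
qed

lemma Dset_perm: "x \<in> Dset \<tau> ==> coords (Perm.apply w) x \<in> Dset \<tau>"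
  by (auto simp: Dset_def dest: injD[OF inj_perm])

lemma x_star_Dset:
  assumes \<tau>: "Im \<tau> > 0" shows "x_star \<in> (Dset \<tau> :: (complex^'n::{finite,linorder}) set)"
proof -
  define y :: "complex^('n::{finite,linorder})" where "y = x_star"
  have False if ij: "i \<noteq> j" and L: "y $ i - y $ j \<in> Lat \<tau>" for i j
  proof -
    obtain m k where mk: "y $ i - y $ j = of_int m + of_int k * \<tau>"
      using L by (auto simp: Lat_def[OF \<tau>] om_def[OF \<tau>])
    have n: "CARD('n) > 0" by simp
    have e: "y $ i - y $ j = of_real ((real (pos i) - real (pos j)) / real CARD('n))"
      by (simp add: y_def x_star_def diff_divide_distrib)
    have "of_int k * Im \<tau> = 0" using arg_cong[OF mk, of Im] unfolding e by simp
    then have k: "k = 0" using \<tau> by simp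
    have "(real (pos i) - real (pos j)) / real CARD('n) = of_int m" using arg_cong[OF mk, of Re] k unfolding e by simp
    then have "real_of_int (ip i - ip j) = real_of_int (m * int CARD('n))" using n by (simp add: field_simps)
    then have "ip i - ip j = m * int CARD('n)" by linarith
    then have "int CARD('n) dvd ip i - ip j" by simp
    then show False using pos_residue_unique ij by blast
  qed
  then show ?thesis unfolding Dset_def y_def by blast
qed

text \<open>
  Restrictability is required at all points of \<open>Dset\<close> and not only at
  \<open>x_star\<close>: this makes the condition invariant under permutations of $x$, and the
  integration along segments needs a neighbourhood.
\<close>

definition good :: "complex => ('n::finite + 'n) merfun => bool" where
  "good \<tau> F \<longleftrightarrow> (\<forall>x\<in>Dset \<tau>. \<forall>l. slice_ok x l F)"

lemma good_add: "good \<tau> F ==> good \<tau> G ==> good \<tau> (F + G)"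
  and good_mult: "good \<tau> F ==> good \<tau> G ==> good \<tau> (F * G)"
  by (auto simp: good_def intro: slice_ok_arith)

lemma good_mconst [simp]: "good \<tau> (mconst c)" by (simp add: good_def slice_ok_mconst)

lemma good_0 [simp]: "good \<tau> 0" and good_1 [simp]: "good \<tau> 1"
  using good_mconst[of \<tau> 0] good_mconst[of \<tau> 1] by simp_all

lemma mconst_uminus: "mconst (- c) = - mconst c"
  using mconst_add[of c "- c"] by (simp add: eq_neg_iff_add_eq_0 add.commute)

lemma good_uminus: "good \<tau> F ==> good \<tau> (- F)"
  using good_mult[OF good_mconst[of \<tau> "- 1"], of F] by (simp add: mconst_uminus)

lemma good_diff: "good \<tau> F ==> good \<tau> G ==> good \<tau> (F - G)"
  using good_add[OF _ good_uminus, of \<tau> F G] by simp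

lemma good_sum: "(\<And>a. a \<in> A ==> good \<tau> (f a)) ==> good \<tau> (sum f A)"
  by (induction A rule: infinite_finite_induct) (auto intro: good_add)

lemma good_dmer: "good \<tau> F ==> good \<tau> (dmer v F)"
  by (simp add: good_def slice_ok_dmer)

lemma good_hat: "good \<tau> F ==> good \<tau> (reindex (map_sum (Perm.apply w) id) F)"
  unfolding good_def by (intro ballI allI slice_ok_hat inj_perm) (simp add: Dset_perm)

lemma good_vee: "good \<tau> F ==> good \<tau> (reindex (map_sum id (Perm.apply w)) F)"
  unfolding good_def by (intro ballI allI slice_ok_vee inj_perm) simp

lemma good_Inr [simp]: "good \<tau> (reindex Inr F)"
  by (simp add: good_def slice_ok_Inr)

lemma good_InlI: "(\<And>x. x \<in> Dset \<tau> ==> \<exists>c. regular_value F x c) ==> good \<tau> (reindex Inl F)"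
  unfolding good_def using slice_ok_Inl by blast

lemma good_InlD: "good \<tau> (reindex Inl F) ==> x \<in> Dset \<tau> ==> \<exists>c. regular_value F x c"
  unfolding good_def using slice_ok_Inl_iff[of x 0 F] by blast

text \<open>
  The theta factor in $x$ can vanish only if $x_i-x_j$ is a lattice point, and the theta factor
  in $\lambda$ vanishes on a nowhere dense set.
\<close>

lemma good_RR:
  fixes i j a b :: "'n::finite" and I J :: "'n => 'd::{finite,linorder}"
  assumes \<tau>: "Im \<tau> > 0" and ij: "i \<noteq> j" "a \<noteq> b"
  shows "good \<tau> (RR \<tau> i j a b I J)"
proof -
  let ?d = "CARD('d)"
  have d: "?d > 0" by simp
  have "slice_ok x l (F_mer \<tau> ?d s t i j a b)" if x: "x \<in> Dset \<tau>" for x l s t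
  proof (rule slice_okI[where N = UNIV and a = "R_num \<tau> ?d s t i j a b" and b = "R_den \<tau> ?d s t i j a b"])
    note nd = nowhere_dense_R_den[OF \<tau> d ij, of s t]
    show "rat (F_mer \<tau> ?d s t i j a b) UNIV (R_num \<tau> ?d s t i j a b) (R_den \<tau> ?d s t i j a b)"
      unfolding F_mer_def[OF \<tau> d]
      by (rule rat_abs[OF mero_Phi[OF \<tau> d ij] holo_R_num[OF \<tau> d] holo_R_den[OF \<tau> d]])
        (use nowhere_dense_interior[OF nd] Phi_st_quotient in simp_all)
    have nz: "jtheta (x $ i - x $ j + of_int s * \<tau>) (of_nat ?d * \<tau>) \<noteq> 0"
    proof
      assume "jtheta (x $ i - x $ j + of_int s * \<tau>) (of_nat ?d * \<tau>) = 0"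
      then obtain m k where "x $ i - x $ j + of_int s * \<tau> = of_int m + of_int k * (of_nat ?d * \<tau>)"
        using jtheta_zero_lattice[OF Im_d[OF \<tau> d]] by blast
      then have "x $ i - x $ j = om \<tau> (m, k * int ?d - s)" by (simp add: om_def[OF \<tau>] algebra_simps)
      then have "x $ i - x $ j \<in> Lat \<tau>" unfolding Lat_def[OF \<tau>] by blast
      then show False using x ij by (simp add: Dset_def)
    qed
    have "{l'. join x l' \<in> UNIV \<and> R_den \<tau> ?d s t i j a b (join x l') = 0} = {l'. jtheta (l' $ a - l' $ b + of_int t * \<tau>) (of_nat ?d * \<tau>) = 0}"
      using nz by (simp add: R_den_def)
    then show "interior {l'. join x l' \<in> UNIV \<and> R_den \<tau> ?d s t i j a b (join x l') = 0} = {}"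
      using nowhere_dense_interior[OF nowhere_dense_theta[OF \<tau> d ij(2)]] by simp
  qed simp
  then have "good \<tau> (F_mer \<tau> ?d s t i j a b)" for s t by (simp add: good_def)
  then show ?thesis unfolding RR_F_mer[OF \<tau>] by simp
qed

lemma holo_at_wp:
  fixes u :: "complex^'k::finite"
  assumes \<tau>: "Im \<tau> > 0" and x: "u $ a - u $ b \<notin> Lat \<tau>"
  shows "holo_at (\<lambda>u :: complex^'k. wp (u $ a - u $ b) \<tau>) u"
proof -
  obtain S where S: "open S" "u $ a - u $ b \<in> S" "(\<lambda>z. wp z \<tau>) holomorphic_on S"
    using wp_holomorphic[OF \<tau> x] by blast
  let ?N = "(\<lambda>u :: complex^'k. u $ a - u $ b) -` S"
  have o: "open ?N" by (rule open_vimage[OF S(1)]) (intro continuous_intros)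
  have "holo_on (\<lambda>u. u $ a - u $ b) ?N" using holo_on_coord_diff[OF o, of a b 0] by simp
  then have "holo_on (\<lambda>u :: complex^'k. wp (u $ a - u $ b) \<tau>) ?N"
    by (rule holo_on_compose[OF S(3,1)]) simp
  then show ?thesis unfolding holo_at_def using S(2) by (intro exI[of _ ?N]) simp
qed

lemma good_wp:
  assumes \<tau>: "Im \<tau> > 0" and ij: "i \<noteq> j"
  shows "good \<tau> (abs_mer (\<lambda>u. c * wp (u $ Inl i - u $ Inl j) \<tau>) :: ('n::finite + 'n) merfun)"
proof -
  have m: "mero (\<lambda>u :: complex^('n + 'n). wp (u $ Inl i - u $ Inl j) \<tau>)" using ij by (intro mero_wp[OF \<tau>]) simp
  have "good \<tau> (abs_mer (\<lambda>u. wp (u $ Inl i - u $ Inl j) \<tau>) :: ('n + 'n) merfun)"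
    unfolding good_def using ij by (intro ballI allI slice_ok_holo[OF m] holo_at_wp[OF \<tau>]) (simp add: Dset_def)
  from good_mult[OF good_mconst[of \<tau> c] this] show ?thesis
    unfolding mconst_def abs_mer_mult[OF mero_const m] .
qed

section \<open>Regularity of the substituted Dunkl operators\<close>

definition goodf :: "complex => ('n::finite + 'n) merfun fps => bool" where
  "goodf \<tau> c \<longleftrightarrow> (\<forall>k. good \<tau> (fps_nth c k))"

lemma goodf_add: "goodf \<tau> c ==> goodf \<tau> d ==> goodf \<tau> (c + d)"
  by (simp add: goodf_def good_add)

lemma goodf_mult: "goodf \<tau> c ==> goodf \<tau> d ==> goodf \<tau> (c * d)"
  by (auto simp: goodf_def fps_mult_nth intro!: good_sum good_mult)

lemma goodf_const: "good \<tau> F ==> goodf \<tau> (fps_const F)"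
  by (simp add: goodf_def)

lemma goodf_0 [simp]: "goodf \<tau> 0" and goodf_1 [simp]: "goodf \<tau> 1" and goodf_X [simp]: "goodf \<tau> fps_X"
  by (simp_all add: goodf_def fps_X_def)

lemma goodf_power: "goodf \<tau> c ==> goodf \<tau> (c ^ k)"
  by (induction k) (auto intro: goodf_mult)

lemma goodf_of_nat: "goodf \<tau> (of_nat k)"
  by (induction k) (auto intro: goodf_add)

lemma goodf_pderivs_x: "goodf \<tau> c ==> goodf \<tau> (fps_coeffwise (pderivs_x \<gamma>) c)"
proof (induction \<gamma> arbitrary: c rule: exponent_induct)
  case zero
  then show ?case by (simp only: pderivs_x_0)
next
  case (add \<gamma> i)
  have "goodf \<tau> (Df i c)" using add.prems by (simp add: goodf_def Df_def pderiv_mer_dmer good_dmer)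
  then show ?case unfolding pderivs_x_add by (rule add.IH)
qed

definition Good :: "complex => ('n::finite) qu => bool" where
  "Good \<tau> q \<longleftrightarrow> (\<forall>\<alpha>. goodf \<tau> (lk q \<alpha>))"

lemma Good_add: "Good \<tau> a ==> Good \<tau> b ==> Good \<tau> (a + b)"
  by (simp add: Good_def lookup_add goodf_add)

lemma Good_0 [simp]: "Good \<tau> 0" by (simp add: Good_def)

lemma Good_single: "goodf \<tau> c ==> Good \<tau> (sg \<alpha> c)"
  by (simp add: Good_def lookup_single when_def)

lemma Good_coef: "goodf \<tau> c ==> Good \<tau> (coef c)"
  unfolding coef_def by (rule Good_single)

lemma Good_mom [simp]: "Good \<tau> (mom i)"
  unfolding mom_def by (rule Good_single) simp

lemma Good_sum: "(\<And>a. a \<in> A ==> Good \<tau> (f a)) ==> Good \<tau> (sum f A)"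
  by (induction A rule: infinite_finite_induct) (auto intro: Good_add)

lemma Good_star:
  assumes "Good \<tau> a" "Good \<tau> b" shows "Good \<tau> (star a b)"
  unfolding star_def
  by (intro Good_sum Good_single goodf_mult goodf_of_nat goodf_power goodf_X goodf_pderivs_x)
    (use assms in \<open>simp_all add: Good_def\<close>)

lemma Good_uminus: "Good \<tau> a ==> Good \<tau> (- a)"
  by (simp add: Good_def goodf_def good_uminus)

lemma Good_diff: "Good \<tau> a ==> Good \<tau> b ==> Good \<tau> (a - b)"
  using Good_add[OF _ Good_uminus, of \<tau> a b] by simp

lemma Good_hat: "Good \<tau> a ==> Good \<tau> (act_hat_qu w (a :: ('n::{finite,linorder}) qu))"
  unfolding act_hat_qu_qact
  by (simp add: Good_def goodf_def qaction.lookup_qact[OF qaction_hat] good_hat)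

lemma Good_vee: "Good \<tau> a ==> Good \<tau> (act_vee_qu w (a :: ('n::{finite,linorder}) qu))"
  unfolding act_vee_qu_qact
  by (simp add: Good_def goodf_def qaction.lookup_qact[OF qaction_vee] good_vee)

definition Good_W :: "complex => ('n::finite, 'd) qu_W => bool" where
  "Good_W \<tau> X \<longleftrightarrow> (\<forall>w I J. Good \<tau> (X w I J))"

lemma Good_W_mult:
  assumes "Good_W \<tau> X" "Good_W \<tau> (Y :: ('n::{finite,linorder}, 'd::finite) qu_W)" shows "Good_W \<tau> (mult_W X Y)"
  unfolding Good_W_def mult_W_def cross_mult_def sum_fun_apply umat_mult_def act_vee_def
  by (intro allI Good_sum Good_star Good_vee) (use assms in \<open>simp_all add: Good_W_def\<close>)

definition Good_WW :: "complex => ('n::finite, 'd) qu_WW => bool" where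
  "Good_WW \<tau> X \<longleftrightarrow> (\<forall>w. Good_W \<tau> (X w))"

lemma Good_WW_mult:
  assumes "Good_WW \<tau> X" "Good_WW \<tau> (Y :: ('n::{finite,linorder}, 'd::finite) qu_WW)" shows "Good_WW \<tau> (mult_WW X Y)"
proof -
  have "Good_W \<tau> (act_hat w (Y v))" for w v
    using assms(2) by (simp add: Good_W_def Good_WW_def act_hat_def Good_hat)
  then have "Good_W \<tau> (mult_W (X w) (act_hat w (Y v)))" for w v
    by (rule Good_W_mult[rotated]) (use assms(1) in \<open>simp add: Good_WW_def\<close>)
  then show ?thesis
    unfolding Good_WW_def Good_W_def mult_WW_def cross_mult_def sum_fun_apply by (intro allI Good_sum) simp
qed

lemma Good_WW_add: "Good_WW \<tau> X ==> Good_WW \<tau> Y ==> Good_WW \<tau> (X + Y)"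
  by (simp add: Good_WW_def Good_W_def Good_add)

lemma Good_WW_diff: "Good_WW \<tau> X ==> Good_WW \<tau> Y ==> Good_WW \<tau> (X - Y)"
  by (simp add: Good_WW_def Good_W_def Good_diff)

lemma Good_WW_0 [simp]: "Good_WW \<tau> 0"
  by (simp add: Good_WW_def Good_W_def zero_fun_def)

lemma Good_WW_sum: "(\<And>a. a \<in> A ==> Good_WW \<tau> (f a)) ==> Good_WW \<tau> (sum f A)"
proof (induction A rule: infinite_finite_induct)
  case (insert x F)
  then show ?case unfolding sum.insert[OF insert.hyps] by (intro Good_WW_add) auto
next
  case (infinite A)
  show ?case unfolding sum.infinite[OF infinite.hyps] by (rule Good_WW_0)
next
  case empty
  show ?case unfolding sum.empty by (rule Good_WW_0)
qed

lemma Good_WW_spread: "(\<And>I J. Good \<tau> (A I J)) ==> Good_WW \<tau> (spread w A)"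
  by (simp add: Good_WW_def Good_W_def spread_def delta_def zero_fun_def)

lemma Good_WW_scalar: "Good \<tau> a ==> Good_WW \<tau> (scalar_WW a)"
  unfolding scalar_WW_spread by (rule Good_WW_spread) (simp add: scal_mat_def)

text \<open>
  Everything in sight is built from momenta, functions of $\lambda$ and R-matrices by sums and
  products.
\<close>

lemma Good_WW_subst_dunkl:
  assumes \<tau>: "Im \<tau> > 0"
  shows "Good_WW \<tau> (subst_dunkl \<tau> g f :: ('n::{finite,linorder}, 'd::{finite,linorder}) qu_WW)"
proof -
  have d: "Good_WW \<tau> (dunkl \<tau> g i :: ('n, 'd) qu_WW)" for i
    unfolding dunkl_PP_TT PP_def TT_def
  proof (intro Good_WW_diff Good_WW_sum Good_WW_spread)
    fix I J :: "'n => 'd"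
    show "Good \<tau> (scal_mat (mom i) I J)" by (simp add: scal_mat_def)
    fix j assume "j \<in> UNIV - {i}"
    then have "i \<noteq> j" by auto
    then show "Good \<tau> (cM (\<lambda>I J. mconst g * RR \<tau> i j i j I J) I J)"
      unfolding cM_def by (intro Good_coef goodf_const good_mult good_mconst good_RR[OF \<tau>])
  qed
  have m: "Good_WW \<tau> (dunkl_monom \<tau> g \<alpha> :: ('n, 'd) qu_WW)" for \<alpha>
  proof (induction \<alpha> rule: exponent_induct)
    case zero
    show ?case unfolding dunkl_monom_0[OF \<tau>] by (intro Good_WW_scalar Good_coef) simp
  next
    case (add \<alpha> i)
    then show ?case unfolding dunkl_monom_add[OF \<tau>] by (intro Good_WW_mult d)
  qed
  show ?thesis
    unfolding subst_dunkl_alt[OF \<tau>] lam_WW_def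
    by (intro Good_WW_sum Good_WW_mult Good_WW_scalar Good_coef goodf_const good_Inr m)
qed

lemma Good_W_Res: "Good_WW \<tau> X ==> Good_W \<tau> (Res_vee X)"
  by (auto simp: Good_W_def Good_WW_def Res_vee_def sum_fun_apply intro!: Good_sum)

section \<open>The star product to first order\<close>

text \<open>
  The formal derivative with respect to the momentum $p_i$.
\<close>

definition dp :: "'n => ('n::finite) qu => 'n qu" where
  "dp i a = Abs_poly_mapping (\<lambda>\<beta>. of_nat (lk \<beta> i + 1) * lk a (\<beta> + sg i 1))"

lemma lookup_dp [simp]: "lk (dp i a) \<beta> = of_nat (lk \<beta> i + 1) * lk a (\<beta> + sg i 1)"
proof -
  have "finite {\<beta>. of_nat (lk \<beta> i + 1) * lk a (\<beta> + sg i 1) \<noteq> 0}"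
  proof (rule finite_subset)
    show "{\<beta>. of_nat (lk \<beta> i + 1) * lk a (\<beta> + sg i 1) \<noteq> 0} \<subseteq> (\<lambda>\<beta>. \<beta> + sg i 1) -` Poly_Mapping.keys a"
      by (auto simp: in_keys_iff)
    show "finite ((\<lambda>\<beta>. \<beta> + sg i 1) -` Poly_Mapping.keys a)"
      by (rule finite_vimageI) (auto intro: injI)
  qed
  from Abs_poly_mapping_inverse[OF CollectI, OF this] show ?thesis by (simp add: dp_def)
qed

lemma dp_add: "dp i (a + b) = dp i a + dp i b"
  by (rule poly_mapping_eqI) (simp add: lookup_add algebra_simps)

lemma dp_0 [simp]: "dp i 0 = 0" by (rule poly_mapping_eqI) simp

lemma sg_mom: "sg (\<alpha> + sg i 1) c = sg \<alpha> (c :: 'c::comm_ring_1) * mom i"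
  by (simp add: mom_def mult_single)

lemma dp_single_0: "dp i (sg 0 c) = 0"
proof (rule poly_mapping_eqI)
  fix \<beta> :: "'a \<Rightarrow>\<^sub>0 nat"
  have "lk (\<beta> + sg i 1) i \<noteq> lk 0 i" by (simp add: lookup_add)
  then have "\<beta> + sg i 1 \<noteq> 0" by metis
  then show "lk (dp i (sg 0 c)) \<beta> = lk 0 \<beta>" by (simp add: lookup_single when_def)
qed

lemma dp_mom: "dp j (sg (\<alpha> + sg i 1) c) = mom i * dp j (sg \<alpha> c) + (if i = j then sg \<alpha> c else 0)"
proof -
  have s: "dp j (sg \<gamma> c) = (if lk \<gamma> j = 0 then 0 else sg (\<gamma> - sg j 1) (of_nat (lk \<gamma> j) * c))" for \<gamma>
  proof (rule poly_mapping_eqI)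
    fix \<beta>
    show "lk (dp j (sg \<gamma> c)) \<beta> = lk (if lk \<gamma> j = 0 then 0 else sg (\<gamma> - sg j 1) (of_nat (lk \<gamma> j) * c)) \<beta>"
    proof (cases "\<gamma> = \<beta> + sg j 1")
      case True
      then show ?thesis by (simp add: lookup_add)
    next
      case False
      have "\<gamma> - sg j 1 \<noteq> \<beta>" if "lk \<gamma> j \<noteq> 0"
      proof
        assume e: "\<gamma> - sg j 1 = \<beta>"
        have "\<gamma> = \<beta> + sg j 1"
        proof (rule poly_mapping_eqI)
          fix k show "lk \<gamma> k = lk (\<beta> + sg j 1) k"
            unfolding e[symmetric] using that by (auto simp: lookup_add lookup_minus lookup_single when_def)
        qed
        then show False using False by simp
      qed
      then show ?thesis using False by (auto simp: lookup_single when_def)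
    qed
  qed
  show ?thesis
  proof (cases "i = j")
    case True
    have "\<alpha> + sg j 1 - sg j 1 = \<alpha>" by simp
    moreover have "mom j * sg (\<alpha> - sg j 1) d = sg \<alpha> d" if "lk \<alpha> j \<noteq> 0" for d :: "('a + 'a) merfun fps"
    proof -
      have "\<alpha> - sg j 1 + sg j 1 = \<alpha>"
        using that by (intro poly_mapping_eqI) (auto simp: lookup_add lookup_minus lookup_single when_def)
      then show ?thesis using sg_mom[of "\<alpha> - sg j 1" j d] by (simp add: mult.commute)
    qed
    ultimately show ?thesis
      unfolding s using True by (auto simp: lookup_add single_add[symmetric] algebra_simps)
  next
    case False
    have "\<alpha> + sg i 1 - sg j 1 = (\<alpha> - sg j 1) + sg i 1"
      using False by (intro poly_mapping_eqI) (auto simp: lookup_add lookup_minus lookup_single when_def)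
    then show ?thesis
      unfolding s using False by (simp add: lookup_add lookup_single sg_mom[unfolded One_nat_def] mult.commute)
  qed
qed

text \<open>
  The star product modulo $\hbar^2$: the commutative product and the part of the Poisson bracket
  that differentiates momenta on the left. The remainder is divisible by $\hbar^2$.
\<close>

lemma star_first_order:
  "\<exists>r. star a b = a * b + coef fps_X * (\<Sum>i\<in>UNIV. dp i a * Dq i b) + coef (fps_X ^ 2) * r"
proof (induction a arbitrary: b rule: star_induct)
  case (plus a a')
  obtain r where r: "star a b = a * b + coef fps_X * (\<Sum>i\<in>UNIV. dp i a * Dq i b) + coef (fps_X ^ 2) * r"
    using plus.IH(1) by blast
  obtain r' where r': "star a' b = a' * b + coef fps_X * (\<Sum>i\<in>UNIV. dp i a' * Dq i b) + coef (fps_X ^ 2) * r'"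
    using plus.IH(2) by blast
  show ?case
    by (rule exI[of _ "r + r'"]) (simp add: star_add_left r r' dp_add algebra_simps sum.distrib)
next
  case zero
  show ?case by (rule exI[of _ 0]) simp
next
  case (scalar c)
  show ?case by (rule exI[of _ 0]) (simp add: star_single_0 dp_single_0, simp add: coef_def)
next
  case (mom \<alpha> i c)
  obtain r where r: "star (sg \<alpha> c) (pq i b) = sg \<alpha> c * pq i b + coef fps_X * (\<Sum>j\<in>UNIV. dp j (sg \<alpha> c) * Dq j (pq i b)) + coef (fps_X ^ 2) * r"
    using mom[of c "pq i b"] by blast
  have "(\<Sum>j\<in>UNIV. dp j (sg (\<alpha> + sg i 1) c) * Dq j b) = (\<Sum>j\<in>UNIV. mom i * (dp j (sg \<alpha> c) * Dq j b)) + (\<Sum>j\<in>UNIV. if i = j then sg \<alpha> c * Dq j b else 0)"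
    unfolding dp_mom sum.distrib[symmetric] by (rule sum.cong) (simp_all add: algebra_simps)
  also have "\<dots> = mom i * (\<Sum>j\<in>UNIV. dp j (sg \<alpha> c) * Dq j b) + sg \<alpha> c * Dq i b"
    by (simp add: sum_distrib_left)
  finally have 1: "(\<Sum>j\<in>UNIV. dp j (sg (\<alpha> + sg i 1) c) * Dq j b) = mom i * (\<Sum>j\<in>UNIV. dp j (sg \<alpha> c) * Dq j b) + sg \<alpha> c * Dq i b" .
  have 2: "(\<Sum>j\<in>UNIV. dp j (sg \<alpha> c) * Dq j (pq i b)) = mom i * (\<Sum>j\<in>UNIV. dp j (sg \<alpha> c) * Dq j b) + coef fps_X * (\<Sum>j\<in>UNIV. dp j (sg \<alpha> c) * Dq i (Dq j b))"
    unfolding Dq_pq unfolding pq_def by (simp add: algebra_simps sum.distrib sum_distrib_left)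
  show ?case
    unfolding star_single_add r 1 2 unfolding sg_mom
    by (rule exI[of _ "r + (\<Sum>j\<in>UNIV. dp j (sg \<alpha> c) * Dq i (Dq j b))"])
      (simp add: pq_def power2_eq_square coef_mult algebra_simps)
qed

text \<open>
  The coefficient of $\hbar^k p^\beta$.
\<close>

abbreviation "cc k \<beta> q \<equiv> fps_nth (lk q \<beta>) k"

lemma lookup_coef_mult: "lk (coef c * q) \<beta> = c * lk q (\<beta> :: 'n \<Rightarrow>\<^sub>0 nat)"
proof (induction q rule: poly_mapping_additive_induct)
  case (single k d)
  show ?case by (simp add: coef_def mult_single lookup_single when_def)
qed (simp_all add: lookup_add algebra_simps)

lemma lookup_mom_mult:
  "lk (mom i * q) \<beta> = (if lk \<beta> i = 0 then 0 else lk q (\<beta> - sg i 1) :: 'c::comm_ring_1)"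
proof (induction q rule: poly_mapping_additive_induct)
  case (single k d)
  have "(k + sg i 1 = \<beta>) = (lk \<beta> i \<noteq> 0 \<and> k = \<beta> - sg i 1)"
  proof
    assume "k + sg i 1 = \<beta>"
    then show "lk \<beta> i \<noteq> 0 \<and> k = \<beta> - sg i 1" by (auto simp: lookup_add)
  next
    assume a: "lk \<beta> i \<noteq> 0 \<and> k = \<beta> - sg i 1"
    show "k + sg i 1 = \<beta>"
      using a by (intro poly_mapping_eqI) (auto simp: lookup_add lookup_minus lookup_single when_def)
  qed
  then show ?case by (auto simp: mom_def mult_single lookup_single when_def add.commute)
qed (simp_all add: lookup_add distrib_left)

lemma lookup_mult_0: "lk (a * b) 0 = lk a 0 * (lk b (0 :: 'n::finite \<Rightarrow>\<^sub>0 nat) :: 'c::comm_ring_1)"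
proof (induction a rule: poly_mapping_additive_induct)
  case (single k c)
  show ?case
  proof (induction b rule: poly_mapping_additive_induct)
    case (single l d)
    have "(k + l = 0) = (k = 0 \<and> l = 0)"
    proof
      assume e: "k + l = 0"
      have "lk k i = 0 \<and> lk l i = 0" for i using arg_cong[OF e, of "\<lambda>m. lk m i"] by (simp add: lookup_add)
      then show "k = 0 \<and> l = 0" by (auto intro: poly_mapping_eqI)
    qed simp
    then show ?case by (auto simp: mult_single lookup_single when_def)
  qed (simp_all add: lookup_add algebra_simps)
qed (simp_all add: lookup_add algebra_simps)

lemma star_order_0: "cc 0 \<beta> (star a b) = cc 0 \<beta> (a * b)"
proof -
  obtain r where r: "star a b = a * b + coef fps_X * (\<Sum>i\<in>UNIV. dp i a * Dq i b) + coef (fps_X ^ 2) * r"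
    using star_first_order by blast
  show ?thesis unfolding r by (simp add: lookup_add lookup_coef_mult)
qed

lemma star_order_1:
  "cc 1 \<beta> (star a b) = cc 1 \<beta> (a * b) + (\<Sum>i\<in>UNIV. cc 0 \<beta> (dp i a * Dq i b))"
proof -
  obtain r where r: "star a b = a * b + coef fps_X * (\<Sum>i\<in>UNIV. dp i a * Dq i b) + coef (fps_X ^ 2) * r"
    using star_first_order by blast
  have "lk (sum f A) \<beta> = (\<Sum>i\<in>A. lk (f i) \<beta>)" for f :: "'a => 'a qu" and A
    by (induction A rule: infinite_finite_induct) (simp_all add: lookup_add)
  then show ?thesis unfolding r
    by (simp add: lookup_add lookup_coef_mult fps_sum_nth power2_eq_square mult.assoc)
qed

lemma star_zero_0: "cc 0 0 (star a b) = cc 0 0 a * cc 0 0 b"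
  by (simp add: star_order_0 lookup_mult_0)

text \<open>
  At $p=0$ only the terms linear in the momenta contribute to the derivative with respect to
  $p_i$.
\<close>

lemma star_zero_1:
  "cc 1 0 (star a b) = cc 0 0 a * cc 1 0 b + cc 1 0 a * cc 0 0 b
     + (\<Sum>i\<in>UNIV. cc 0 (sg i 1) a * pderiv_mer (Inl i) (cc 0 0 b))"
  by (simp add: star_order_1[unfolded One_nat_def] lookup_mult_0 fps_mult_nth Df_def sum.atLeast0_atMost_Suc)

section \<open>Regularity from regularity of iterated derivatives\<close>

lemma scaleR_smult: "s *\<^sub>R v = of_real s *s (v :: complex^'k)"
  unfolding vec_eq_iff vector_scaleR_component vector_smult_component by (simp add: scaleR_conv_of_real)

text \<open>
  Differentiation under the integral sign; the derivative of \<open>c\<close> is continuous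
  because directional derivatives are holomorphic.
\<close>

lemma holo_on_integral:
  fixes c :: "complex^'k::finite => complex"
  assumes c: "holo_on c T" and S: "open S" "convex S"
    and sub: "\<And>x s. x \<in> S ==> s \<in> {0..1} ==> x + s *\<^sub>R v \<in> T"
  shows "holo_on (\<lambda>x. integral {0..1} (\<lambda>s. c (x + s *\<^sub>R v))) S"
proof -
  define fx where "fx x t = Blinfun (\<lambda>h. ddir h c (x + t *\<^sub>R v))" for x and t :: real
  have fx: "blinfun_apply (fx x t) h = ddir h c (x + t *\<^sub>R v)" if "x \<in> S" "t \<in> {0..1}" for x t h
  proof -
    have "bounded_linear (\<lambda>h. ddir h c (x + t *\<^sub>R v))"
      by (rule has_derivative_bounded_linear[OF holo_on_has_derivative(1)[OF c sub[OF that]]])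
    then show ?thesis by (simp add: fx_def bounded_linear_Blinfun_apply)
  qed
  have line: "continuous_on {0..1} (\<lambda>t. f (x + t *\<^sub>R v))" if "x \<in> S" "holo_on f T" for x and f :: "complex^'k => complex"
    by (rule continuous_on_compose2[OF holo_on_continuous[OF that(2)]]) (use sub that in \<open>auto intro!: continuous_intros\<close>)
  have cont: "continuous_on (S \<times> cbox 0 1) (\<lambda>(x, t). fx x t)"
  proof (rule continuous_on_blinfun_componentwise)
    fix i :: "complex^'k" assume "i \<in> Basis"
    have "continuous_on (S \<times> cbox 0 1) (\<lambda>z. ddir i c (fst z + snd z *\<^sub>R v))"
      by (rule continuous_on_compose2[OF holo_on_continuous[OF holo_on_ddir[OF c, of i]]])
        (use sub in \<open>auto intro!: continuous_intros\<close>)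
    then show "continuous_on (S \<times> cbox 0 1) (\<lambda>z. blinfun_apply (case z of (x, t) => fx x t) i)"
      by (rule continuous_on_eq) (auto simp: fx)
  qed
  show ?thesis unfolding holo_on_def
  proof (intro conjI ballI)
    fix x assume x: "x \<in> S"
    have "((\<lambda>x. integral (cbox 0 1) (\<lambda>s. c (x + s *\<^sub>R v))) has_derivative blinfun_apply (integral (cbox 0 1) (fx x))) (at x within S)"
    proof (rule leibniz_rule[OF _ _ cont x S(2)])
      fix y and t :: real assume y: "y \<in> S" "t \<in> cbox 0 1"
      then have t: "t \<in> {0..1}" by simp
      have "((\<lambda>y. y + t *\<^sub>R v) has_derivative (\<lambda>h. h)) (at y)" by (auto intro!: derivative_eq_intros)
      from has_derivative_compose[OF this holo_on_has_derivative(1)[OF c sub[OF y(1) t]]]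
      have "((\<lambda>y. c (y + t *\<^sub>R v)) has_derivative (\<lambda>h. ddir h c (y + t *\<^sub>R v))) (at y)" .
      moreover have "blinfun_apply (fx y t) = (\<lambda>h. ddir h c (y + t *\<^sub>R v))" using fx[OF y(1) t] by auto
      ultimately show "((\<lambda>y. c (y + t *\<^sub>R v)) has_derivative blinfun_apply (fx y t)) (at y within S)"
        by (simp add: has_derivative_at_withinI)
    next
      fix y assume "y \<in> S"
      then show "(\<lambda>s. c (y + s *\<^sub>R v)) integrable_on cbox 0 1"
        using line[OF _ c] by (intro integrable_continuous) simp
    qed
    then have d: "((\<lambda>x. integral {0..1} (\<lambda>s. c (x + s *\<^sub>R v))) has_derivative blinfun_apply (integral {0..1} (fx x))) (at x)"
      using at_within_open[OF x S(1)] by simp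
    have i: "fx x integrable_on {0..1}"
    proof -
      have "continuous_on {0..1} (\<lambda>t. (\<lambda>(x, t). fx x t) (x, t))"
        by (rule continuous_on_compose2[OF cont]) (use x in \<open>auto intro!: continuous_intros\<close>)
      then show ?thesis by (simp add: integrable_continuous_interval)
    qed
    have e: "blinfun_apply (integral {0..1} (fx x)) h = integral {0..1} (\<lambda>t. ddir h c (x + t *\<^sub>R v))" for h
    proof -
      have "blinfun_apply (integral {0..1} (fx x)) h = integral {0..1} ((\<lambda>L. blinfun_apply L h) \<circ> fx x)"
        by (rule integral_linear[OF i blinfun.bounded_linear_left, symmetric])
      also have "\<dots> = integral {0..1} (\<lambda>t. ddir h c (x + t *\<^sub>R v))"
        by (rule integral_cong) (use fx x in auto)
      finally show ?thesis .
    qed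
    have "blinfun_apply (integral {0..1} (fx x)) (k *s h) = k * blinfun_apply (integral {0..1} (fx x)) h" for k h
    proof -
      have "integral {0..1} (\<lambda>t. ddir (k *s h) c (x + t *\<^sub>R v)) = integral {0..1} (\<lambda>t. k * ddir h c (x + t *\<^sub>R v))"
        by (rule integral_cong) (use holo_on_has_derivative(2)[OF c sub[OF x]] in auto)
      then show ?thesis unfolding e by simp
    qed
    then show "\<exists>D. ((\<lambda>x. integral {0..1} (\<lambda>s. c (x + s *\<^sub>R v))) has_derivative D) (at x) \<and> (\<forall>k h. D (k *s h) = k * D h)"
      using d by blast
  qed (rule S(1))
qed

lemma regular_glue:
  assumes T: "open T" and r: "\<And>x. x \<in> T ==> \<exists>c. regular_value F x c"
  shows "\<exists>c. holo_on c T \<and> (\<forall>x\<in>T. regular_value F x (c x))"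
proof -
  define c where "c x = (THE c. regular_value F x c)" for x
  have c: "c x = d" if "regular_value F x d" for x d
    unfolding c_def using that regular_value_unique by (intro the_equality) auto
  have "holo_on c T"
  proof (rule holo_on_local[OF _ T])
    fix x assume x: "x \<in> T"
    obtain d where "regular_value F x d" using r[OF x] by blast
    then obtain N a where N: "x \<in> N" "holo_on a N" "nowhere_dense {v\<in>N. rep_mer F v \<noteq> a v}"
      by (auto simp: regular_value_def)
    have "c y = a y" if "y \<in> N" for y by (rule c[OF regular_valueI[OF that N(2,3) refl]])
    then have "holo_on c N" by (intro holo_on_cong[OF N(2)]) auto
    then show "\<exists>M. x \<in> M \<and> holo_on c M" using N(1) by blast
  qed
  moreover have "regular_value F x (c x)" if "x \<in> T" for x using r[OF that] c by auto
  ultimately show ?thesis by blast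
qed

text \<open>
  Along the segment from $y$, where $G$ is holomorphic, to $z$ the function is recovered from
  its derivative: near $z$ it should be $G(x-v)+\int_0^1 c(x-v+sv)\,ds$ with $v=z-y$. This is a
  holomorphic function; that it agrees with the quotient $A/B$ follows on each complex line in
  the direction $v$ from the identity theorem, applied to $A - B\,(\gamma+P-P(0))$ with a
  primitive $P$ of $c$, which avoids all zeros of $B$ on the way.
\<close>

lemma regular_from_derivative:
  fixes G :: "('k::finite) merfun"
  assumes T: "open T" "convex T" and G: "rat G T A B" and y: "y \<in> T" "B y \<noteq> 0" and z: "z \<in> T"
    and D: "\<And>x. x \<in> T ==> \<exists>c. regular_value (dmer (z - y) G) x c"
  shows "\<exists>c. regular_value G z c"
proof -
  define v where "v = z - y"
  have hA: "holo_on A T" and hB: "holo_on B T" and B0: "interior {x\<in>T. B x = 0} = {}"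
    using G by (auto simp: rat_def)
  obtain c where hc: "holo_on c T" and c: "\<forall>x\<in>T. regular_value (dmer v G) x (c x)"
    using regular_glue[OF T(1) D] v_def by blast
  have cAB: "c x * (B x * B x) = ddir v A x * B x - A x * ddir v B x" if "x \<in> T" "B x \<noteq> 0" for x
  proof -
    have "c x = (ddir v A x * B x - A x * ddir v B x) / (B x * B x)"
      by (rule regular_value_unique[OF bspec[OF c that(1)] regular_value_rat[OF rat_dmer[OF G]]]) (use that in auto)
    then show ?thesis using that by (simp add: field_simps)
  qed
  have oB: "open {x\<in>T. B x \<noteq> 0}" by (rule holo_on_open_nonzero[OF hB])
  obtain d1 where d1: "d1 > 0" "ball z d1 \<subseteq> T" using T(1) z open_contains_ball by blast
  obtain d2 where d2: "d2 > 0" "ball y d2 \<subseteq> {x\<in>T. B x \<noteq> 0}" using oB y open_contains_ball by blast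
  define S where "S = ball z (min d1 d2)"
  have S: "open S" "convex S" "z \<in> S" "S \<subseteq> T" using d1 d2 by (auto simp: S_def)
  have Sv: "x - v \<in> T" "B (x - v) \<noteq> 0" if "x \<in> S" for x
  proof -
    have "dist y (x - v) = dist z x" unfolding v_def dist_norm by (simp add: algebra_simps)
    then have "x - v \<in> ball y d2" using that by (simp add: S_def)
    then show "x - v \<in> T" "B (x - v) \<noteq> 0" using d2 by auto
  qed
  have seg: "x - v + s *\<^sub>R v \<in> T" if "x \<in> S" "s \<in> {0..1}" for x s
  proof -
    have "(1 - s) *\<^sub>R (x - v) + s *\<^sub>R x \<in> T"
      by (rule convexD[OF T(2) Sv(1)[OF that(1)]]) (use that S(4) in auto)
    then show ?thesis by (simp add: algebra_simps)
  qed
  define C where "C x = integral {0..1} (\<lambda>s. c (x - v + s *\<^sub>R v))" for x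
  \<comment> \<open>the candidate agrees with $A/B$; the denominator is cleared because it may vanish near $z$\<close>
  have key: "A x = B x * (A (x - v) / B (x - v) + C x)" if x: "x \<in> S" for x
  proof -
    let ?l = "\<lambda>t. (x - v) + t *s v"
    define \<Omega> where "\<Omega> = {t. ?l t \<in> T}"
    have o: "open \<Omega>" unfolding \<Omega>_def by (rule open_line_preimage[OF T(1)])
    have cv: "convex \<Omega>" unfolding convex_def
    proof (intro ballI allI impI)
      fix s t and a b :: real assume st: "s \<in> \<Omega>" "t \<in> \<Omega>" "0 \<le> a" "0 \<le> b" "a + b = 1"
      have "a *\<^sub>R ?l s + b *\<^sub>R ?l t \<in> T" using st by (intro convexD[OF T(2)]) (auto simp: \<Omega>_def)
      moreover have "a *\<^sub>R ?l s + b *\<^sub>R ?l t = (a + b) *\<^sub>R (x - v) + (of_real a * s + of_real b * t) *s v"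
        unfolding scaleR_smult by (simp add: vec_eq_iff algebra_simps)
      ultimately show "a *\<^sub>R s + b *\<^sub>R t \<in> \<Omega>" using st(5) by (simp add: \<Omega>_def scaleR_conv_of_real)
    qed
    have O01: "complex_of_real s \<in> \<Omega>" if "s \<in> {0..1}" for s
      using seg[OF x that] by (simp add: \<Omega>_def scaleR_smult)
    have "(\<lambda>t. c (?l t)) holomorphic_on \<Omega>" by (rule holo_on_along_line_holomorphic[OF hc]) (simp add: \<Omega>_def)
    then obtain P where P: "\<And>t. t \<in> \<Omega> ==> (P has_field_derivative c (?l t)) (at t within \<Omega>)"
      using holomorphic_convex_primitive'[OF cv o] by blast
    then have P: "(P has_field_derivative c (?l t)) (at t)" if "t \<in> \<Omega>" for t
      using at_within_open[OF that o] that by metis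
    have hP: "P holomorphic_on \<Omega>"
      unfolding holomorphic_on_open[OF o] using P by blast
    define \<gamma> where "\<gamma> = A (x - v) / B (x - v)"
    define h where "h t = A (?l t) - B (?l t) * (\<gamma> + (P t - P 0))" for t
    have hh: "h holomorphic_on \<Omega>" unfolding h_def[abs_def]
      by (intro holomorphic_intros hP holo_on_along_line_holomorphic[OF hA] holo_on_along_line_holomorphic[OF hB])
        (simp_all add: \<Omega>_def)
    let ?U = "{t. ?l t \<in> {x\<in>T. B x \<noteq> 0}}"
    have oU: "open ?U" by (rule open_line_preimage[OF oB])
    have "0 \<in> ?U" using Sv[OF x] by simp
    then obtain \<rho> where \<rho>: "\<rho> > 0" "ball 0 \<rho> \<subseteq> ?U" using oU open_contains_ball by blast
    have "\<exists>k. \<forall>t\<in>ball 0 \<rho>. A (?l t) / B (?l t) - P t = k"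
    proof (rule has_field_derivative_zero_constant[OF convex_ball])
      fix t assume "t \<in> ball (0 :: complex) \<rho>"
      then have t: "?l t \<in> T" "B (?l t) \<noteq> 0" "t \<in> \<Omega>" using \<rho> by (auto simp: \<Omega>_def)
      have d: "((\<lambda>t. A (?l t) / B (?l t) - P t) has_field_derivative
         (ddir v A (?l t) * B (?l t) - A (?l t) * ddir v B (?l t)) / (B (?l t) * B (?l t)) - c (?l t)) (at t)"
        by (intro DERIV_diff DERIV_divide holo_on_along_line[OF hA t(1)] holo_on_along_line[OF hB t(1)] P t)
      have e: "(ddir v A (?l t) * B (?l t) - A (?l t) * ddir v B (?l t)) / (B (?l t) * B (?l t)) - c (?l t) = 0"
        using cAB[OF t(1,2)] t(2) by (simp add: field_simps)
      show "((\<lambda>t. A (?l t) / B (?l t) - P t) has_field_derivative 0) (at t within ball 0 \<rho>)"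
        by (rule has_field_derivative_at_within, rule d[unfolded e])
    qed
    then obtain k where k: "\<And>t. t \<in> ball 0 \<rho> ==> A (?l t) / B (?l t) - P t = k" by blast
    have k0: "\<gamma> - P 0 = k" using k[of 0] \<rho>(1) by (simp add: \<gamma>_def)
    have h0: "h t = 0" if t: "t \<in> ball 0 \<rho>" for t
    proof -
      have "A (?l t) / B (?l t) = \<gamma> + (P t - P 0)" using k[OF t] k0 by (simp add: algebra_simps)
      moreover have "B (?l t) \<noteq> 0" using \<rho>(2) t by auto
      ultimately show ?thesis by (simp add: h_def field_simps)
    qed
    have "h 1 = 0"
    proof (rule analytic_continuation[OF hh o convex_connected[OF cv], where U = "ball 0 \<rho>" and \<xi> = 0])
      show "ball 0 \<rho> \<subseteq> \<Omega>" using \<rho>(2) by (auto simp: \<Omega>_def)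
      show "(0::complex) \<in> \<Omega>" using O01[of 0] by simp
      show "(1::complex) \<in> \<Omega>" using O01[of 1] by simp
      show "(0::complex) islimpt ball 0 \<rho>" using \<rho>(1) by (simp add: islimpt_ball)
    qed (use h0 in auto)
    moreover have "C x = P 1 - P 0"
    proof -
      have "((\<lambda>s. P (of_real s)) has_vector_derivative c (x - v + s *\<^sub>R v)) (at s within {0..1})" if "s \<in> {0..1}" for s
        using has_vector_derivative_real_field[OF P[OF O01[OF that]]] by (simp add: scaleR_smult)
      then have "((\<lambda>s. c (x - v + s *\<^sub>R v)) has_integral (P (of_real 1) - P (of_real 0))) {0..1}"
        by (intro fundamental_theorem_of_calculus) auto
      then show ?thesis unfolding C_def by (simp add: integral_unique)
    qed
    ultimately show ?thesis by (simp add: h_def \<gamma>_def)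
  qed
  have hC: "holo_on C S"
  proof -
    let ?S = "(\<lambda>x. x - v) ` S"
    have "open ?S" using open_translation[OF S(1), of "- v"] by (simp add: add.commute)
    moreover have "convex ?S" using convex_translation[OF S(2), of "- v"] by (simp add: add.commute)
    ultimately have "holo_on (\<lambda>x. integral {0..1} (\<lambda>s. c (x + s *\<^sub>R v))) ?S"
      by (rule holo_on_integral[OF hc]) (use seg in auto)
    then have "holo_on (\<lambda>x. integral {0..1} (\<lambda>s. c (x + - v + s *\<^sub>R v))) S"
      by (rule holo_on_translate[OF _ S(1)]) auto
    then show ?thesis by (simp add: C_def[abs_def])
  qed
  have hAv: "holo_on (\<lambda>x. A (x - v)) S" using holo_on_translate[OF hA S(1), of "- v"] Sv by simp
  have hBv: "holo_on (\<lambda>x. B (x - v)) S" using holo_on_translate[OF hB S(1), of "- v"] Sv by simp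
  show ?thesis
  proof (rule exI, rule regular_valueI[OF S(3)])
    show "holo_on (\<lambda>x. A (x - v) / B (x - v) + C x) S"
      by (intro holo_on_add holo_on_divide hAv hBv hC) (rule Sv(2))
    have "nowhere_dense ({x\<in>T. B x \<noteq> 0 \<and> rep_mer G x \<noteq> A x / B x} \<union> {x\<in>T. B x = 0})"
      using G nowhere_dense_zero_set[OF hB B0] by (intro nowhere_dense_Un) (simp_all add: rat_def)
    then show "nowhere_dense {x\<in>S. rep_mer G x \<noteq> A (x - v) / B (x - v) + C x}"
      by (rule nowhere_dense_subset) (use key S(4) in auto)
  qed (rule refl)
qed

lemma rat_iterate:
  assumes "rat F N a b"
  shows "\<exists>a' b'. rat ((dmer v ^^ k) F) N a' b' \<and> (\<forall>x\<in>N. b x \<noteq> 0 \<longrightarrow> b' x \<noteq> 0)"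
proof (induction k)
  case 0
  then show ?case using assms by auto
next
  case (Suc k)
  then obtain a' b' where *: "rat ((dmer v ^^ k) F) N a' b'" "\<forall>x\<in>N. b x \<noteq> 0 \<longrightarrow> b' x \<noteq> 0" by blast
  show ?case
    by (intro exI[of _ "\<lambda>u. ddir v a' u * b' u - a' u * ddir v b' u"] exI[of _ "\<lambda>u. b' u * b' u"])
      (use rat_dmer[OF *(1), of v] *(2) in simp)
qed

text \<open>
  The denominator of a local presentation is nonzero at some nearby point $x_1$, hence on a ball
  around it. Translating this ball along $v=x_0-x_1$ sweeps out a convex tube that contains
  $x_0$, and on it the previous lemma removes one derivative after another.
\<close>

lemma regular_from_iterated_derivatives:
  fixes F :: "('k::finite) merfun"
  assumes U: "open U" "x0 \<in> U"
    and D: "\<And>v. \<exists>M. \<forall>x\<in>U. \<exists>c. regular_value ((dmer v ^^ M) F) x c"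
  shows "\<exists>c. regular_value F x0 c"
proof -
  obtain N a b where N: "x0 \<in> N" "rat F N a b" using rat_exists[of x0 F] by blast
  have "open (N \<inter> U)" using N U holo_on_open by (auto simp: rat_def)
  then obtain r where r: "r > 0" "ball x0 r \<subseteq> N \<inter> U" using N(1) U(2) open_contains_ball by blast
  have R: "rat F (ball x0 r) a b" using rat_mono[OF N(2) open_ball] r by blast
  obtain x1 where x1: "x1 \<in> ball x0 r" "b x1 \<noteq> 0"
  proof -
    have "\<not> ball x0 r \<subseteq> {x\<in>ball x0 r. b x = 0}"
    proof
      assume "ball x0 r \<subseteq> {x\<in>ball x0 r. b x = 0}"
      from interior_maximal[OF this open_ball] have "ball x0 r \<subseteq> {}" using R by (simp add: rat_def)
      then show False using r(1) by simp
    qed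
    then show ?thesis using that by blast
  qed
  have "holo_on b (ball x0 r)" using R by (simp add: rat_def)
  from holo_on_open_nonzero[OF this] have "open {x\<in>ball x0 r. b x \<noteq> 0}" .
  then obtain e where e: "e > 0" "ball x1 e \<subseteq> {x\<in>ball x0 r. b x \<noteq> 0}" using x1 open_contains_ball by blast
  define \<epsilon> where "\<epsilon> = min e (r - dist x0 x1)"
  have \<epsilon>: "\<epsilon> > 0" "\<epsilon> \<le> e" "\<epsilon> \<le> r - dist x0 x1" using e(1) x1(1) by (auto simp: \<epsilon>_def)
  define v where "v = x0 - x1"
  \<comment> \<open>the tube swept out by the ball around $x_1$\<close>
  define T where "T = (\<Union>x\<in>ball x1 \<epsilon>. \<Union>y\<in>(\<lambda>s. s *\<^sub>R v) ` {0..1}. {x + y})"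
  have oT: "open T" unfolding T_def by (rule open_sums) simp
  have cT: "convex T" unfolding T_def
    by (intro convex_sums convex_ball convex_linear_image) (auto intro!: linearI simp: algebra_simps)
  have TI: "y + s *\<^sub>R v \<in> T" if "y \<in> ball x1 \<epsilon>" "s \<in> {0..1}" for y s
    using that unfolding T_def by blast
  have TE: "\<exists>y s. y \<in> ball x1 \<epsilon> \<and> s \<in> {0..1} \<and> z = y + s *\<^sub>R v" if "z \<in> T" for z
    using that unfolding T_def by blast
  have Tsub: "T \<subseteq> ball x0 r"
  proof
    fix z assume "z \<in> T"
    then obtain y s where ys: "y \<in> ball x1 \<epsilon>" "s \<in> {0..1}" "z = y + s *\<^sub>R v" using TE by blast
    have "x0 - z = (x1 - y) + (1 - s) *\<^sub>R (x0 - x1)" by (simp add: ys(3) v_def algebra_simps)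
    then have "dist x0 z \<le> dist x1 y + norm ((1 - s) *\<^sub>R (x0 - x1))"
      unfolding dist_norm by (metis norm_triangle_ineq)
    also have "norm ((1 - s) *\<^sub>R (x0 - x1)) \<le> dist x0 x1"
      using ys(2) by (simp add: dist_norm mult_left_le_one_le)
    finally show "z \<in> ball x0 r" using ys(1) \<epsilon>(3) by simp
  qed
  have RT: "rat F T a b" by (rule rat_mono[OF R oT Tsub])
  obtain M where M: "\<forall>x\<in>U. \<exists>c. regular_value ((dmer v ^^ M) F) x c" using D by blast
  have "\<forall>z\<in>T. \<exists>c. regular_value ((dmer v ^^ (M - k)) F) z c" for k
  proof (induction k)
    case 0
    have "T \<subseteq> U" using Tsub r by blast
    then show ?case using M by auto
  next
    case (Suc k)
    show ?case
    proof (cases "k < M")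
      case False
      then show ?thesis using Suc by simp
    next
      case True
      define m where "m = M - Suc k"
      have m: "M - k = Suc m" using True by (simp add: m_def)
      obtain a' b' where ab: "rat ((dmer v ^^ m) F) T a' b'" "\<forall>x\<in>T. b x \<noteq> 0 \<longrightarrow> b' x \<noteq> 0"
        using rat_iterate[OF RT] by blast
      show ?thesis unfolding m_def[symmetric]
      proof
        fix z assume z: "z \<in> T"
        then obtain y s where ys: "y \<in> ball x1 \<epsilon>" "s \<in> {0..1}" "z = y + s *\<^sub>R v" using TE by blast
        have yT: "y \<in> T" using TI[OF ys(1), of 0] by simp
        have "y \<in> ball x1 e" using ys(1) \<epsilon>(2) by simp
        then have "b y \<noteq> 0" using e(2) by blast
        then have b': "b' y \<noteq> 0" using ab(2) yT by blast
        show "\<exists>c. regular_value ((dmer v ^^ m) F) z c"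
        proof (rule regular_from_derivative[OF oT cT ab(1) yT b' z])
          fix x assume "x \<in> T"
          then obtain c where c: "regular_value (dmer v ((dmer v ^^ m) F)) x c" using Suc m by auto
          have "z - y = of_real s *s v" by (simp add: ys(3) scaleR_smult)
          then have "dmer (z - y) ((dmer v ^^ m) F) = mconst (of_real s) * dmer v ((dmer v ^^ m) F)"
            by (simp add: dmer_scale_dir)
          then show "\<exists>c. regular_value (dmer (z - y) ((dmer v ^^ m) F)) x c"
            using regular_value_arith(2)[OF regular_value_mconst c] by auto
        qed
      qed
    qed
  qed
  from this[of M] have "\<forall>z\<in>T. \<exists>c. regular_value F z c" by simp
  moreover have "x0 \<in> T" using TI[of x1 1] \<epsilon>(1) by (simp add: v_def)
  ultimately show ?thesis by blast
qed

section \<open>The first quantum correction of a Calogero--Moser Hamiltonian\<close>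

subsection \<open>Iterated derivatives\<close>

lemma dmer_diff: "dmer v (F - G) = dmer v F - dmer v G"
  using dmer_add[of v "F - G" G] by simp

lemma iter_sum: "(dmer v ^^ k) (sum f A) = (\<Sum>a\<in>A. (dmer v ^^ k) (f a))"
  by (induction k) (simp_all add: dmer_sum)

lemma iter_add: "(dmer v ^^ k) (F + G) = (dmer v ^^ k) F + (dmer v ^^ k) G"
  by (induction k) (simp_all add: dmer_add)

lemma iter_diff: "(dmer v ^^ k) (F - G) = (dmer v ^^ k) F - (dmer v ^^ k) G"
  by (induction k) (simp_all add: dmer_diff)

lemma iter_commute: "(dmer v ^^ k) (dmer w F) = dmer w ((dmer v ^^ k) F)"
  by (induction k) (simp_all add: dmer_commute[of v w])

lemma good_iter: "good \<tau> F ==> good \<tau> ((dmer v ^^ k) F)"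
  by (induction k) (simp_all add: good_dmer)

text \<open>
  In the binomial expansion of $(D_v+D_w)^{a+b}$ each term contains $D_v^a$ or $D_w^b$; the
  induction removes one derivative at a time instead.
\<close>

lemma good_iter_add_dir:
  assumes "good \<tau> ((dmer v ^^ a) F)" "good \<tau> ((dmer w ^^ b) F)"
  shows "good \<tau> ((dmer (v + w) ^^ (a + b)) F)"
  using assms
proof (induction "a + b" arbitrary: a b F)
  case 0
  then show ?case by simp
next
  case (Suc n)
  show ?case
  proof (cases "a = 0 \<or> b = 0")
    case True
    then have "good \<tau> F" using Suc.prems by auto
    then show ?thesis by (rule good_iter)
  next
    case False
    then obtain a' b' where ab: "a = Suc a'" "b = Suc b'" by (metis not0_implies_Suc)
    have "(dmer (v + w) ^^ (a + b)) F = (dmer (v + w) ^^ n) (dmer v F) + (dmer (v + w) ^^ n) (dmer w F)"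
      unfolding Suc.hyps(2)[symmetric] by (simp add: funpow_swap1 iter_add[symmetric] dmer_add_dir[symmetric])
    moreover have "good \<tau> ((dmer (v + w) ^^ (a' + b)) (dmer v F))"
    proof (rule Suc.hyps(1))
      show "n = a' + b" using Suc.hyps(2) ab by simp
      show "good \<tau> ((dmer v ^^ a') (dmer v F))" using Suc.prems(1) ab by (simp add: funpow_swap1)
      show "good \<tau> ((dmer w ^^ b) (dmer v F))" unfolding iter_commute by (rule good_dmer[OF Suc.prems(2)])
    qed
    moreover have "good \<tau> ((dmer (v + w) ^^ (a + b')) (dmer w F))"
    proof (rule Suc.hyps(1))
      show "n = a + b'" using Suc.hyps(2) ab by simp
      show "good \<tau> ((dmer w ^^ b') (dmer w F))" using Suc.prems(2) ab by (simp add: funpow_swap1)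
      show "good \<tau> ((dmer v ^^ a) (dmer w F))" unfolding iter_commute by (rule good_dmer[OF Suc.prems(1)])
    qed
    moreover have "a' + b = n" "a + b' = n" using Suc.hyps(2) ab by simp_all
    ultimately show ?thesis by (simp add: good_add)
  qed
qed

lemma iter_scale: "(dmer (c *s v) ^^ k) F = mconst (c ^ k) * (dmer v ^^ k) F"
  by (induction k) (simp_all add: dmer_scale_dir dmer_mult dmer_const mconst_mult mult.assoc)

text \<open>
  A function annihilated modulo good functions by powers of all coordinate derivatives is so
  annihilated in every direction, and then the integration argument applies.
\<close>

lemma good_from_iterated:
  fixes f :: "('n::finite) merfun"
  assumes \<tau>: "Im \<tau> > 0" and k: "\<And>i. \<exists>k. good \<tau> ((dmer (axis (Inl i) 1) ^^ k) (reindex Inl f))"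
  shows "good \<tau> (reindex Inl f)"
proof -
  have sum: "\<exists>k. good \<tau> ((dmer (\<Sum>i\<in>A. (v $ i) *s axis (Inl i) 1) ^^ k) (reindex Inl f))" for v :: "complex^'n" and A
  proof (induction A rule: infinite_finite_induct)
    case (insert i A)
    obtain a where a: "good \<tau> ((dmer (axis (Inl i) 1) ^^ a) (reindex Inl f))" using k by blast
    have "good \<tau> ((dmer ((v $ i) *s axis (Inl i) 1) ^^ a) (reindex Inl f))"
      unfolding iter_scale by (intro good_mult good_mconst a)
    moreover obtain b where "good \<tau> ((dmer (\<Sum>i\<in>A. (v $ i) *s axis (Inl i) 1) ^^ b) (reindex Inl f))" using insert.IH by blast
    ultimately show ?case unfolding sum.insert[OF insert.hyps] using good_iter_add_dir by blast
  qed (auto intro!: exI[of _ 1])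
  have j: "(\<Sum>i\<in>UNIV. (v $ i) *s axis (Inl i) 1) = join v 0" for v :: "complex^'n"
    by (simp add: vec_eq_iff join_def axis_def if_distrib sum.delta split: sum.split cong: if_cong)
  have c: "coords Inl (join v 0) = v" for v :: "complex^'n" by (simp add: vec_eq_iff)
  have it: "(dmer (join v 0) ^^ k) (reindex Inl f) = reindex Inl ((dmer v ^^ k) f)" for v :: "complex^'n" and k
    by (induction k) (simp_all add: dmer_reindex c)
  show ?thesis
  proof (rule good_InlI)
    fix x :: "complex^'n" assume x: "x \<in> Dset \<tau>"
    show "\<exists>c. regular_value f x c"
    proof (rule regular_from_iterated_derivatives[OF open_Dset[OF \<tau>] x])
      fix v :: "complex^'n"
      obtain k where "good \<tau> (reindex Inl ((dmer v ^^ k) f))" using sum[where A = UNIV and v = v] unfolding j it by blast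
      then show "\<exists>M. \<forall>x\<in>Dset \<tau>. \<exists>c. regular_value ((dmer v ^^ M) f) x c" using good_InlD by blast
    qed
  qed
qed

subsection \<open>Splitting off the classical part\<close>

definition trunc :: "('n::finite) qu => 'n qu" where
  "trunc q = Poly_Mapping.map (\<lambda>c. fps_const (fps_nth c 0)) q"

definition shift :: "('n::finite) qu => 'n qu" where
  "shift q = Poly_Mapping.map (fps_shift 1) q"

lemma lookup_trunc [simp]: "lk (trunc q) \<beta> = fps_const (fps_nth (lk q \<beta>) 0)"
  by (simp add: trunc_def lookup_map_zero)

lemma lookup_shift [simp]: "lk (shift q) \<beta> = fps_shift 1 (lk q \<beta>)"
  by (simp add: shift_def lookup_map_zero)

lemma trunc_shift: "q = trunc q + coef fps_X * shift q"
proof (rule poly_mapping_eqI)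
  fix \<beta>
  have "c = fps_const (fps_nth c 0) + fps_X * fps_shift 1 c" for c :: "('a + 'a) merfun fps"
    by (rule fps_ext) auto
  then show "lk q \<beta> = lk (trunc q + coef fps_X * shift q) \<beta>" by (simp add: lookup_add lookup_coef_mult)
qed

lemma star_X_right: "star a (coef fps_X * b) = coef fps_X * star a b"
proof -
  have "Dq j (coef fps_X :: 'a qu) = 0" for j by (simp add: Dq_coef)
  then have c: "star a (coef fps_X) = star (coef fps_X) a"
    by (simp add: star_const_right star_coef mult.commute)
  have "star a (coef fps_X * b) = star (star a (coef fps_X)) b" by (simp only: star_assoc star_coef)
  also have "\<dots> = coef fps_X * star a b" unfolding c by (simp only: star_coef star_coef_mult)
  finally show ?thesis .
qed

text \<open>
  Regularity of the classical limit only.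
\<close>

definition good_cl :: "complex => ('n::finite) qu => bool" where
  "good_cl \<tau> q \<longleftrightarrow> (\<forall>\<beta>. good \<tau> (cc 0 \<beta> q))"

lemma good_cl_trunc: "good_cl \<tau> q ==> Good \<tau> (trunc q)"
  by (simp add: good_cl_def Good_def goodf_const)

lemma good_cl_add: "good_cl \<tau> a ==> good_cl \<tau> b ==> good_cl \<tau> (a + b)"
  by (simp add: good_cl_def lookup_add good_add)

text \<open>
  Modulo $\hbar$ the star product depends on the classical parts only.
\<close>

lemma good_cl_star:
  assumes "good_cl \<tau> a" "good_cl \<tau> b" shows "good_cl \<tau> (star a b)"
proof -
  have "star a b = star (trunc a) (trunc b) + coef fps_X * (star (trunc a) (shift b) + star (shift a) b)"
    by (subst trunc_shift[of a], simp only: star_add_left star_coef_mult, subst (1) trunc_shift[of b],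
        simp only: star_add_right star_X_right distrib_left add.assoc)
  then have "cc 0 \<beta> (star a b) = cc 0 \<beta> (star (trunc a) (trunc b))" for \<beta>
    by (simp add: lookup_add lookup_coef_mult)
  moreover have "Good \<tau> (star (trunc a) (trunc b))" by (intro Good_star good_cl_trunc assms)
  ultimately show ?thesis by (simp add: good_cl_def Good_def goodf_def)
qed

subsection \<open>The classical Hamiltonians\<close>

text \<open>
  The function attached to one pair of a matching.
\<close>

definition wpm :: "complex => complex => 'n::finite \<times> 'n => 'n merfun" where
  "wpm \<tau> g p = abs_mer (\<lambda>x. g\<^sup>2 * wp (x $ fst p - x $ snd p) \<tau>)"

definition chi :: "'n set => ('n \<Rightarrow>\<^sub>0 nat)" where "chi K = (\<Sum>k\<in>K. sg k 1)"

lemma prod_mom: "(\<Prod>k\<in>K. mom k) = sg (chi K) (1 :: 'c::comm_ring_1)"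
  by (induction K rule: infinite_finite_induct) (simp_all add: chi_def mom_def mult_single)

lemma prod_coef: "(\<Prod>p\<in>M. coef (c p)) = coef (\<Prod>p\<in>M. c p :: 'c::comm_ring_1)"
  by (induction M rule: infinite_finite_induct) (simp_all add: coef_mult)

lemma eCM_h_single: "eCM_h \<tau> g r = (\<Sum>(M, K)\<in>matchings r. sg (chi K) (\<Prod>p\<in>M. wpm \<tau> g p))"
  unfolding eCM_h_def
proof (rule sum.cong[OF refl], clarify)
  fix M K
  have e: "(\<Prod>(i, j)\<in>M. coef (abs_mer (\<lambda>x. g\<^sup>2 * wp (x $ i - x $ j) \<tau>))) = (\<Prod>p\<in>M. coef (wpm \<tau> g p))"
    by (rule prod.cong) (auto simp: wpm_def)
  show "(\<Prod>(i, j)\<in>M. coef (abs_mer (\<lambda>x. g\<^sup>2 * wp (x $ i - x $ j) \<tau>))) * (\<Prod>k\<in>K. mom k) = sg (chi K) (\<Prod>p\<in>M. wpm \<tau> g p)"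
    unfolding e prod_coef prod_mom by (simp add: coef_def mult_single)
qed

lemma lookup_sum: "lk (sum f A) \<beta> = (\<Sum>a\<in>A. lk (f a) \<beta>)"
  by (induction A rule: infinite_finite_induct) (simp_all add: lookup_add)

lemma lookup_eCM_h:
  "lk (eCM_h \<tau> g r) \<beta> = (\<Sum>(M, K)\<in>matchings r. if chi K = \<beta> then \<Prod>p\<in>M. wpm \<tau> g p else 0)"
  unfolding eCM_h_single lookup_sum by (rule sum.cong) (auto simp: lookup_single when_def)

lemma regular_value_sum:
  "(\<And>a. a \<in> A ==> regular_value (f a) x (c a)) ==> regular_value (sum f A) x (sum c A)"
proof (induction A rule: infinite_finite_induct)
  case (insert a A)
  show ?case unfolding sum.insert[OF insert.hyps]
    by (intro regular_value_arith(1) insert.IH insert.prems) auto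
qed (use regular_value_mconst[of 0] in auto)

lemma regular_value_prod:
  "(\<And>a. a \<in> A ==> regular_value (f a) x (c a)) ==> regular_value (prod f A) x (prod c A)"
proof (induction A rule: infinite_finite_induct)
  case (insert a A)
  show ?case unfolding prod.insert[OF insert.hyps]
    by (intro regular_value_arith(2) insert.IH insert.prems) auto
qed (use regular_value_mconst[of 1] in auto)

lemma matchings_less: "(M, K) \<in> matchings r ==> p \<in> M ==> fst p < snd p"
  by (auto simp: matchings_def)

lemma mero_wpm:
  assumes \<tau>: "Im \<tau> > 0" and p: "fst p \<noteq> snd p"
  shows "mero (\<lambda>x :: complex^'n::finite. g\<^sup>2 * wp (x $ fst p - x $ snd p) \<tau>)"
  by (intro mero_mult mero_const mero_wp[OF \<tau> p])

lemma regular_wpm: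
  assumes \<tau>: "Im \<tau> > 0" and p: "fst p \<noteq> snd p" and x: "x \<in> Dset \<tau>"
  shows "regular_value (wpm \<tau> g p) x (g\<^sup>2 * wp (x $ fst p - x $ snd p) \<tau>)"
proof -
  have "x $ fst p - x $ snd p \<notin> Lat \<tau>" using x p by (simp add: Dset_def)
  from holo_at_wp[OF \<tau> this] obtain N where N: "x \<in> N" "holo_on (\<lambda>x. wp (x $ fst p - x $ snd p) \<tau>) N"
    by (auto simp: holo_at_def)
  have "holo_on (\<lambda>x. g\<^sup>2 * wp (x $ fst p - x $ snd p) \<tau>) N"
    by (intro holo_on_mult holo_on_const N(2) holo_on_open[OF N(2)])
  then have "holo_at (\<lambda>x. g\<^sup>2 * wp (x $ fst p - x $ snd p) \<tau>) x" using N(1) by (auto simp: holo_at_def)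
  from regular_value_abs[OF mero_wpm[OF \<tau> p] this] show ?thesis by (simp add: wpm_def)
qed

text \<open>
  The value at a regular point of the coefficient of $p^\beta$ in the classical Hamiltonian.
\<close>

definition Fh :: "complex => complex => nat => ('n::{finite,linorder} \<Rightarrow>\<^sub>0 nat) => complex^('n::{finite,linorder}) => complex" where
  "Fh \<tau> g r \<beta> x = (\<Sum>(M, K)\<in>matchings r. if chi K = \<beta> then \<Prod>p\<in>M. g\<^sup>2 * wp (x $ fst p - x $ snd p) \<tau> else 0)"

lemma regular_Fh:
  assumes \<tau>: "Im \<tau> > 0" and x: "x \<in> Dset \<tau>" shows "regular_value (lk (eCM_h \<tau> g r) \<beta>) x (Fh \<tau> g r \<beta> (x :: complex^('n::{finite,linorder})))"
  unfolding lookup_eCM_h Fh_def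
proof (rule regular_value_sum, clarify)
  fix M :: "('n \<times> 'n) set" and K assume mk: "(M, K) \<in> matchings r"
  have p: "regular_value (\<Prod>p\<in>M. wpm \<tau> g p) x (\<Prod>p\<in>M. g\<^sup>2 * wp (x $ fst p - x $ snd p) \<tau>)"
  proof (rule regular_value_prod)
    fix p assume "p \<in> M"
    then have "fst p \<noteq> snd p" using matchings_less[OF mk] by fastforce
    then show "regular_value (wpm \<tau> g p) x (g\<^sup>2 * wp (x $ fst p - x $ snd p) \<tau>)" by (rule regular_wpm[OF \<tau> _ x])
  qed
  have z: "regular_value 0 x 0" using regular_value_mconst[of 0 x] by simp
  show "regular_value (if chi K = \<beta> then \<Prod>p\<in>M. wpm \<tau> g p else 0) x
      (if chi K = \<beta> then \<Prod>p\<in>M. g\<^sup>2 * wp (x $ fst p - x $ snd p) \<tau> else 0)"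
    using p z by simp
qed

lemma good_eCM_h:
  assumes \<tau>: "Im \<tau> > 0" shows "good \<tau> (reindex Inl (lk (eCM_h \<tau> g r :: ('n::{finite,linorder}) cl) \<beta>))"
  by (rule good_InlI, rule exI, rule regular_Fh[OF \<tau>])

subsection \<open>The algebra of scalar Hamiltonians\<close>

definition lam_free :: "('n::finite) qu => bool" where
  "lam_free q \<longleftrightarrow> (\<forall>\<beta> k. fps_nth (lk q \<beta>) k \<in> range (reindex Inl))"

definition lamf :: "('n::finite + 'n) merfun fps => bool" where
  "lamf c \<longleftrightarrow> (\<forall>k. fps_nth c k \<in> range (reindex Inl))"

lemma inj_Inl': "inj (Inl :: 'n => 'n + 'n)" by simp

lemma Inl_add: "F \<in> range (reindex (Inl :: 'n::finite => 'n + 'n)) ==> G \<in> range (reindex Inl) ==> F + G \<in> range (reindex (Inl :: 'n => 'n + 'n))"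
  using reindex_add[OF inj_Inl'] by (metis (no_types, lifting) rangeE rangeI)

lemma Inl_mult: "F \<in> range (reindex (Inl :: 'n::finite => 'n + 'n)) ==> G \<in> range (reindex Inl) ==> F * G \<in> range (reindex (Inl :: 'n => 'n + 'n))"
  using reindex_mult[OF inj_Inl'] by (metis (no_types, lifting) rangeE rangeI)

lemma Inl_mconst [simp]: "mconst c \<in> range (reindex (Inl :: 'n::finite => 'n + 'n))"
  using reindex_mconst[OF inj_Inl', of c] by (metis rangeI)

lemma Inl_0 [simp]: "0 \<in> range (reindex (Inl :: 'n::finite => 'n + 'n))"
  and Inl_1 [simp]: "1 \<in> range (reindex (Inl :: 'n::finite => 'n + 'n))"
  using Inl_mconst[of 0] Inl_mconst[of 1] by simp_all

lemma Inl_sum: "(\<And>a. a \<in> A ==> f a \<in> range (reindex (Inl :: 'n::finite => 'n + 'n))) ==> sum f A \<in> range (reindex (Inl :: 'n => 'n + 'n))"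
proof (induction A rule: infinite_finite_induct)
  case (insert a A)
  show ?case unfolding sum.insert[OF insert.hyps] by (intro Inl_add insert.IH insert.prems) auto
qed simp_all

lemma lamf_add: "lamf c ==> lamf d ==> lamf (c + d)"
  by (simp add: lamf_def Inl_add)

lemma lamf_mult: "lamf c ==> lamf d ==> lamf (c * d)"
  unfolding lamf_def fps_mult_nth by (intro allI Inl_sum Inl_mult) simp_all

lemma lamf_0 [simp]: "lamf 0" and lamf_1 [simp]: "lamf 1" and lamf_X [simp]: "lamf fps_X"
  by (simp_all add: lamf_def fps_X_def)

lemma lamf_power: "lamf c ==> lamf (c ^ k)"
  by (induction k) (auto intro: lamf_mult)

lemma lamf_of_nat: "lamf (of_nat k)"
  by (induction k) (auto intro: lamf_add)

lemma Inl_dmer: "F \<in> range (reindex (Inl :: 'n::finite => 'n + 'n)) ==> dmer v F \<in> range (reindex (Inl :: 'n => 'n + 'n))"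
  by (auto simp: dmer_reindex)

lemma lamf_pderivs_x: "lamf c ==> lamf (fps_coeffwise (pderivs_x \<gamma>) c)"
proof (induction \<gamma> arbitrary: c rule: exponent_induct)
  case zero
  then show ?case by (simp only: pderivs_x_0)
next
  case (add \<gamma> i)
  have "lamf (Df i c)" using add.prems by (simp add: lamf_def Df_def pderiv_mer_dmer Inl_dmer)
  then show ?case unfolding pderivs_x_add by (rule add.IH)
qed

lemma lam_free_lamf: "lam_free q \<longleftrightarrow> (\<forall>\<beta>. lamf (lk q \<beta>))"
  by (simp add: lam_free_def lamf_def)

lemma lam_free_add: "lam_free a ==> lam_free b ==> lam_free (a + b)"
  by (simp add: lam_free_lamf lookup_add lamf_add)

lemma lam_free_single: "lamf c ==> lam_free (sg \<alpha> c)"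
  by (simp add: lam_free_lamf lookup_single when_def)

lemma lam_free_sum: "(\<And>a. a \<in> A ==> lam_free (f a)) ==> lam_free (sum f A)"
proof (induction A rule: infinite_finite_induct)
  case (insert a A)
  show ?case unfolding sum.insert[OF insert.hyps] by (intro lam_free_add insert.IH insert.prems) auto
qed (simp_all add: lam_free_def)

lemma lam_free_star:
  assumes "lam_free a" "lam_free b" shows "lam_free (star a b)"
  unfolding star_def
  by (intro lam_free_sum lam_free_single lamf_mult lamf_of_nat lamf_power lamf_X lamf_pderivs_x)
    (use assms in \<open>simp_all add: lam_free_lamf\<close>)

lemma lam_free_A_hbar: "q \<in> A_hbar ==> lam_free q"
  unfolding A_hbar_def A_hbar_over_def
proof (induction rule: alg_gen.induct)
  case (gen a)
  then show ?case
    by (auto simp: coef_def mom_def lamf_def intro!: lam_free_single)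
qed (auto intro: lam_free_add lam_free_star)

lemma lam_free_vee: "lam_free q ==> act_vee_qu w q = (q :: ('n::{finite,linorder}) qu)"
proof (rule poly_mapping_eqI, rule fps_ext)
  fix \<beta> k assume q: "lam_free q"
  obtain F where F: "fps_nth (lk q \<beta>) k = reindex Inl F" using q by (auto simp: lam_free_def)
  have k1: "Poly_Mapping.map_key (Perm.apply 1) \<beta> = \<beta>"
    by (rule poly_mapping_eqI) (simp add: map_key.rep_eq)
  then have k2: "Poly_Mapping.map_key id \<beta> = \<beta>" by simp
  have "reindex (map_sum id (Perm.apply w)) (reindex Inl F) = reindex Inl F"
    by (simp add: reindex_comp inj_map_sum inj_perm comp_def)
  then show "fps_nth (lk (act_vee_qu w q) \<beta>) k = fps_nth (lk q \<beta>) k"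
    unfolding act_vee_qu_qact by (simp add: qaction.lookup_qact[OF qaction_vee] k2 F)
qed

text \<open>
  Commuting with the generators is enough.
\<close>

lemma alg_gen_commute:
  assumes "\<And>a. a \<in> G ==> star a b = star b a" "H \<in> alg_gen star G"
  shows "star H b = star b H"
  using assms(2)
proof (induction rule: alg_gen.induct)
  case (mul x y)
  then show ?case by (metis star_assoc)
qed (simp_all add: assms(1) star_add_left star_add_right)

context
  fixes \<tau> g :: complex and Ht :: "nat => ('n::{finite,linorder}) qu"
  assumes \<tau>: "Im \<tau> > 0" and Ht: "eCM_quantum_lifts \<tau> g Ht"
begin

lemma star_mconst: "star (coef (fps_const (mconst c))) b = star b (coef (fps_const (mconst c :: ('n + 'n) merfun)))"
proof -
  have "Dq j (coef (fps_const (mconst c :: ('n + 'n) merfun))) = 0" for j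
    by (simp add: Dq_coef Df_def fps_coeffwise_const pderiv_mer_dmer dmer_const)
  then show ?thesis by (simp add: star_const_right star_coef mult.commute)
qed

lemma hamiltonian_commute_Ht:
  assumes "H \<in> scalar_eCM_hamiltonians Ht" "r \<in> {1..CARD('n)}" shows "star H (Ht r) = star (Ht r) H"
  using assms(1) unfolding scalar_eCM_hamiltonians_def
  by (rule alg_gen_commute[rotated]) (use Ht assms(2) star_mconst in \<open>auto simp: eCM_quantum_lifts_def\<close>)

lemma hamiltonian_commute:
  assumes "H \<in> scalar_eCM_hamiltonians Ht" "H' \<in> scalar_eCM_hamiltonians Ht" shows "star H H' = star H' H"
  using assms(1) unfolding scalar_eCM_hamiltonians_def
proof (rule alg_gen_commute[rotated])
  fix a assume "a \<in> range (\<lambda>c. coef (fps_const (mconst c))) \<union> Ht ` {1..CARD('n)}"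
  then show "star a H' = star H' a" using star_mconst hamiltonian_commute_Ht[OF assms(2)] by auto
qed

lemma hamiltonian_lam_free: "H \<in> scalar_eCM_hamiltonians Ht ==> lam_free H"
  unfolding scalar_eCM_hamiltonians_def
proof (induction rule: alg_gen.induct)
  case (gen a)
  then show ?case
  proof
    assume "a \<in> range (\<lambda>c. coef (fps_const (mconst c)))"
    then show ?thesis by (auto simp: coef_def lamf_def intro!: lam_free_single)
  next
    assume "a \<in> Ht ` {1..CARD('n)}"
    then show ?thesis using Ht lam_free_A_hbar by (auto simp: eCM_quantum_lifts_def)
  qed
qed (auto intro: lam_free_add lam_free_star)

lemma classical_Ht:
  assumes "r \<in> {1..CARD('n)}" shows "cc 0 \<beta> (Ht r) = reindex Inl (lk (eCM_h \<tau> g r) \<beta>)"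
proof -
  have "eta0 (Ht r) = cl_emb (eCM_h \<tau> g r)" using Ht assms by (simp add: eCM_quantum_lifts_def)
  then have "lk (eta0 (Ht r)) \<beta> = lk (cl_emb (eCM_h \<tau> g r)) \<beta>" by simp
  then show ?thesis by (simp add: eta0_def cl_emb_def lookup_map_zero reindex_0[OF inj_Inl'])
qed

lemma hamiltonian_good_cl: "H \<in> scalar_eCM_hamiltonians Ht ==> good_cl \<tau> H"
  unfolding scalar_eCM_hamiltonians_def
proof (induction rule: alg_gen.induct)
  case (gen a)
  then show ?case
  proof
    assume "a \<in> range (\<lambda>c. coef (fps_const (mconst c)))"
    then show ?thesis by (auto simp: good_cl_def coef_def lookup_single when_def)
  next
    assume "a \<in> Ht ` {1..CARD('n)}"
    then show ?thesis using classical_Ht good_eCM_h[OF \<tau>] by (auto simp: good_cl_def)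
  qed
qed (auto intro: good_cl_add good_cl_star)

text \<open>
  The potential $2g(g-\hbar)\sum_{i<j}\wp(x_i-x_j)$ as a power series in $\hbar$.
\<close>

definition Vpot :: "('n + 'n) merfun fps" where
  "Vpot = (\<Sum>(i, j)\<in>{(i, j). i < j}. fps_const (abs_mer (\<lambda>u. 2 * g * wp (u $ Inl i - u $ Inl j) \<tau>)) * (fps_const (mconst g) - fps_X))"

lemma coef_sum: "coef (sum f A) = (\<Sum>a\<in>A. coef (f a :: 'c::comm_ring_1))"
  by (induction A rule: infinite_finite_induct) (simp_all add: coef_add)

lemma goodf_Vpot: "goodf \<tau> Vpot"
proof -
  have s: "goodf \<tau> (sum f A)" if "\<And>a. a \<in> A ==> goodf \<tau> (f a)" for f :: "'n \<times> 'n => ('n + 'n) merfun fps" and A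
    using that by (induction A rule: infinite_finite_induct) (auto intro: goodf_add)
  have "goodf \<tau> (fps_const (mconst g) - fps_X)" by (simp add: goodf_def good_diff fps_X_def)
  then show ?thesis unfolding Vpot_def
    by (intro s) (auto intro!: goodf_mult goodf_const good_wp[OF \<tau>])
qed

text \<open>
  The operator $\widetilde H_1^2-2\widetilde H_2$: the Laplacian minus a multiple of the sum of
  Weierstrass potentials.
\<close>

definition Kop :: "'n qu" where
  "Kop = (\<Sum>i\<in>UNIV. star (mom i) (mom i)) - coef Vpot"

lemma Kop_Ht: "2 \<le> CARD('n) ==> Kop = star (Ht 1) (Ht 1) - (Ht 2 + Ht 2)"
proof -
  assume n: "2 \<le> CARD('n)"
  then have e: "star (Ht 1) (Ht 1) - (Ht 2 + Ht 2) = (\<Sum>i\<in>UNIV. star (mom i) (mom i)) - (\<Sum>(i, j)\<in>{(i, j). i < j}.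
      coef (fps_const (abs_mer (\<lambda>u. 2 * g * wp (u $ Inl i - u $ Inl j) \<tau>)) * (fps_const (mconst g) - fps_X)))"
    using Ht unfolding eCM_quantum_lifts_def by blast
  show ?thesis unfolding e Kop_def Vpot_def coef_sum by (simp only: case_prod_unfold)
qed

lemma Good_Kop: "Good \<tau> Kop"
  unfolding Kop_def by (intro Good_diff Good_sum Good_star Good_mom Good_coef goodf_Vpot)

lemma star_sum_left: "star (sum f A) b = (\<Sum>a\<in>A. star (f a) b)"
  by (induction A rule: infinite_finite_induct) (simp_all add: star_add_left)

lemma star_sum_right: "star b (sum f A) = (\<Sum>a\<in>A. star b (f a))"
  by (induction A rule: infinite_finite_induct) (simp_all add: star_add_right)

text \<open>
  To first order in $\hbar$ this is the Poisson bracket with $\sum_i p_i^2 - V$.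
\<close>

lemma Kop_commutator:
  "cc 1 \<beta> (star Kop b - star b Kop) =
     (\<Sum>i\<in>UNIV. if lk \<beta> i = 0 then 0 else 2 * pderiv_mer (Inl i) (cc 0 (\<beta> - sg i 1) b))
     + (\<Sum>i\<in>UNIV. of_nat (lk \<beta> i + 1) * cc 0 (\<beta> + sg i 1) b * pderiv_mer (Inl i) (fps_nth Vpot 0))"
proof -
  have mm: "star (star (mom i) (mom i)) b - star b (star (mom i) (mom i))
     = coef fps_X * (2 * (mom i * Dq i b) + coef fps_X * Dq i (Dq i b))" for i
  proof -
    have 1: "star (mom i) (mom i) = (mom i * mom i :: 'n qu)" by (simp add: star_mom pq_def)
    have "star b (mom i * mom i) = b * (mom i * mom i)" by (rule star_const_right) (simp add: Dq_mult)
    moreover have "star (star (mom i) (mom i)) b = pq i (pq i b)" unfolding star_assoc by (simp only: star_mom)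
    ultimately show ?thesis unfolding 1 pq_def
      by (simp add: Dq_add Dq_mult Dq_coef algebra_simps)
  qed
  have 1: "cc 1 \<beta> (star (star (mom i) (mom i)) b - star b (star (mom i) (mom i))) =
      (if lk \<beta> i = 0 then 0 else 2 * pderiv_mer (Inl i) (cc 0 (\<beta> - sg i 1) b))" for i
  proof -
    have e: "cc 1 \<beta> (coef fps_X * (A + coef fps_X * B)) = cc 0 \<beta> A" for A B :: "'n qu"
      by (simp add: lookup_coef_mult lookup_add)
    have l: "lk (2 * (mom i * Dq i b)) \<beta> = lk (mom i * Dq i b) \<beta> + lk (mom i * Dq i b) \<beta>"
      by (simp only: mult_2 lookup_add)
    show ?thesis unfolding mm e l
      by (cases "lk \<beta> i = 0") (simp_all add: lookup_mom_mult Df_def)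
  qed
  have 2: "cc 1 \<beta> (star b (coef Vpot)) - cc 1 \<beta> (star (coef Vpot) b) =
     (\<Sum>i\<in>UNIV. of_nat (lk \<beta> i + 1) * cc 0 (\<beta> + sg i 1) b * pderiv_mer (Inl i) (fps_nth Vpot 0))"
  proof -
    have "cc 0 \<beta> (dp i b * Dq i (coef Vpot)) = of_nat (lk \<beta> i + 1) * cc 0 (\<beta> + sg i 1) b * pderiv_mer (Inl i) (fps_nth Vpot 0)" for i
    proof -
      have "lk (dp i b * Dq i (coef Vpot)) \<beta> = Df i Vpot * (of_nat (lk \<beta> i + 1) * lk b (\<beta> + sg i 1))"
        unfolding Dq_coef mult.commute[of "dp i b"] lookup_coef_mult lookup_dp ..
      moreover have "fps_nth (of_nat m :: ('n + 'n) merfun fps) 0 = of_nat m" for m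
        by (induction m) simp_all
      ultimately show ?thesis by (simp add: Df_def mult_ac)
    qed
    then show ?thesis unfolding star_order_1 star_coef by (simp add: mult.commute)
  qed
  have "star Kop b - star b Kop = (\<Sum>i\<in>UNIV. star (star (mom i) (mom i)) b - star b (star (mom i) (mom i)))
     + (star b (coef Vpot) - star (coef Vpot) b)"
    unfolding Kop_def star_diff_left star_diff_right star_sum_left star_sum_right sum_subtractf by simp
  then show ?thesis unfolding 1[symmetric] 2[symmetric]
    by (simp only: lookup_add lookup_minus lookup_sum fps_add_nth fps_sub_nth fps_sum_nth)
qed

end

definition deg :: "('n::finite \<Rightarrow>\<^sub>0 nat) => nat" where "deg \<alpha> = (\<Sum>i\<in>UNIV. lk \<alpha> i)"

lemma deg_add: "deg (\<alpha> + \<beta>) = deg \<alpha> + deg \<beta>" by (simp add: deg_def lookup_add sum.distrib)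

lemma deg_single: "deg (sg i m) = m"
proof -
  have "lk (sg i m) = (\<lambda>j. if j = i then m else 0)" by (auto simp: lookup_single when_def fun_eq_iff)
  then show ?thesis by (simp add: deg_def)
qed

text \<open>
  The commutation relations constrain the first quantum correction $h_\alpha$ (the coefficients
  of $\hbar p^\alpha$). Since $H$ commutes with \<open>Kop\<close> and its classical part is
  regular, $\sum_i 2\,\partial_i h_{\beta-e_i} + \sum_i(\beta_i+1)\,h_{\beta+e_i}\,\partial_i V$
  is regular for every $\beta$. By downward induction on the degree the second sum is regular,
  so $\sum_i\partial_i h_{\beta-e_i}$ is. These are the equations of a Killing tensor: pushing
  indices towards $i$ shows that $\partial_i^{m+1-\alpha_i}h_\alpha$ is regular for
  $|\alpha|=m$, and a function with regular iterated derivatives in all directions is regular.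
\<close>

lemma hamiltonian_good_1:
  fixes Ht :: "nat => ('n::{finite,linorder}) qu"
  assumes \<tau>: "Im \<tau> > 0" and Ht: "eCM_quantum_lifts \<tau> g Ht" and n: "2 \<le> CARD('n)"
    and H: "H \<in> scalar_eCM_hamiltonians Ht"
  shows "good \<tau> (cc 1 \<alpha> H)"
proof -
  let ?K = "Kop \<tau> g :: 'n qu"
  let ?D = "\<lambda>i :: 'n. dmer (axis (Inl i) (1 :: complex))"
  let ?V = "fps_nth (Vpot \<tau> g) 0 :: ('n + 'n) merfun"
  define h where "h \<alpha> = cc 1 \<alpha> H" for \<alpha>
  have r: "1 \<in> {1..CARD('n)}" "2 \<in> {1..CARD('n)}" using n by auto
  have comm: "star ?K H = star H ?K"
    unfolding Kop_Ht[OF \<tau> Ht n] star_diff_left star_diff_right star_add_left star_add_right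
    using hamiltonian_commute_Ht[OF \<tau> Ht H r(1)] hamiltonian_commute_Ht[OF \<tau> Ht H r(2)]
    by (metis star_assoc)
  let ?E0 = "star ?K (trunc H) - star (trunc H) ?K"
  let ?E1 = "star ?K (shift H) - star (shift H) ?K"
  have "?E0 + coef fps_X * ?E1 = star ?K (trunc H + coef fps_X * shift H) - star (trunc H + coef fps_X * shift H) ?K"
    by (simp add: star_add_left star_add_right star_X_right star_coef_mult algebra_simps)
  also have "\<dots> = 0" using comm by (simp add: trunc_shift[symmetric])
  finally have E: "?E0 + coef fps_X * ?E1 = 0" .
  have gE0: "Good \<tau> ?E0"
    by (intro Good_diff Good_star Good_Kop[OF \<tau> Ht] good_cl_trunc hamiltonian_good_cl[OF \<tau> Ht H])
  have gE1: "good \<tau> (cc 1 \<beta> ?E1)" for \<beta>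
  proof -
    have "cc 2 \<beta> (?E0 + coef fps_X * ?E1) = 0" unfolding E by simp
    then have "cc 2 \<beta> ?E0 + cc 1 \<beta> ?E1 = 0" by (simp add: lookup_add lookup_coef_mult)
    then have "cc 1 \<beta> ?E1 = - cc 2 \<beta> ?E0" by (metis add.commute add_eq_0_iff)
    then show ?thesis using gE0 by (simp add: Good_def goodf_def good_uminus)
  qed
  have h0: "cc 0 \<alpha> (shift H) = h \<alpha>" for \<alpha> by (simp add: h_def)
  have gV: "good \<tau> (?D i ?V)" for i
    using goodf_Vpot[OF \<tau> Ht] by (simp add: goodf_def good_dmer)
  have S: "good \<tau> (\<Sum>i\<in>UNIV. if lk \<beta> i = 0 then 0 else ?D i (h (\<beta> - sg i 1)))"
    if up: "\<And>i. good \<tau> (h (\<beta> + sg i 1))" for \<beta>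
  proof -
    let ?S = "\<Sum>i\<in>UNIV. if lk \<beta> i = 0 then 0 else ?D i (h (\<beta> - sg i 1))"
    let ?S2 = "\<Sum>i\<in>UNIV. of_nat (lk \<beta> i + 1) * h (\<beta> + sg i 1) * ?D i ?V"
    have on: "good \<tau> (of_nat m)" for m by (induction m) (auto intro: good_add)
    have "cc 1 \<beta> ?E1 = (\<Sum>i\<in>UNIV. if lk \<beta> i = 0 then 0 else 2 * ?D i (h (\<beta> - sg i 1))) + ?S2"
      unfolding Kop_commutator[OF \<tau> Ht] h0 pderiv_mer_dmer ..
    also have "(\<Sum>i\<in>UNIV. if lk \<beta> i = 0 then 0 else 2 * ?D i (h (\<beta> - sg i 1))) = 2 * ?S"
      unfolding sum_distrib_left by (rule sum.cong) auto
    finally have e2: "2 * ?S = cc 1 \<beta> ?E1 - ?S2" by (simp only: add_diff_cancel_right')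
    have gS2: "good \<tau> ?S2" by (intro good_sum good_mult on up gV)
    have "good \<tau> (2 * ?S)" unfolding e2 by (rule good_diff[OF gE1 gS2])
    then have "good \<tau> (mconst (1/2) * (2 * ?S))" by (rule good_mult[OF good_mconst])
    moreover have "mconst (1/2) * (2 * F) = F" for F :: "('n + 'n) merfun"
    proof -
      have "mconst (1 + 1) = (mconst 1 + mconst 1 :: ('n + 'n) merfun)" by (rule mconst_add)
      then have 2: "(2 :: ('n + 'n) merfun) = mconst 2" by (simp add: mconst_1)
      have "mconst (1/2 * 2) = (mconst (1/2) * mconst 2 :: ('n + 'n) merfun)" by (rule mconst_mult)
      then have "mconst (1/2) * 2 = (1 :: ('n + 'n) merfun)" unfolding 2 by (simp add: mconst_1)
      then show ?thesis by (simp only: mult.assoc[symmetric] mult_1_left)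
    qed
    ultimately show ?thesis by simp
  qed
  \<comment> \<open>$H$ has finite degree in the momenta; the downward induction starts above it\<close>
  obtain N where N: "\<And>\<alpha>. deg \<alpha> \<ge> N ==> h \<alpha> = 0"
  proof
    fix \<alpha> :: "'n \<Rightarrow>\<^sub>0 nat" assume a: "deg \<alpha> \<ge> Suc (Max (insert 0 (deg ` Poly_Mapping.keys H)))"
    have "\<alpha> \<notin> Poly_Mapping.keys H"
    proof
      assume "\<alpha> \<in> Poly_Mapping.keys H"
      then have "deg \<alpha> \<le> Max (insert 0 (deg ` Poly_Mapping.keys H))" by (intro Max_ge) auto
      then show False using a by simp
    qed
    then show "h \<alpha> = 0" by (simp add: h_def in_keys_iff)
  qed
  have "\<forall>\<alpha>. deg \<alpha> + m \<ge> N \<longrightarrow> good \<tau> (h \<alpha>)" for m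
  proof (induction m)
    case 0
    then show ?case using N by simp
  next
    case (Suc m)
    show ?case
    proof (intro allI impI)
      fix \<alpha>0 :: "'n \<Rightarrow>\<^sub>0 nat" assume N': "deg \<alpha>0 + Suc m \<ge> N"
      define d where "d = deg \<alpha>0"
      \<comment> \<open>$k$ is the number of momenta in $p^\alpha$ that differ from $p_i$\<close>
      have kill: "good \<tau> ((?D i ^^ Suc k) (h \<alpha>))" if "deg \<alpha> = d" "lk \<alpha> i + k = d" for i :: 'n and k \<alpha>
        using that
      proof (induction k arbitrary: \<alpha> rule: less_induct)
        case (less k)
        define \<beta> where "\<beta> = \<alpha> + sg i 1"
        have "good \<tau> (h (\<beta> + sg j 1))" for j
          using Suc N' less.prems(1) by (simp add: \<beta>_def deg_add deg_single d_def)
        from S[OF this] have gS: "good \<tau> (\<Sum>j\<in>UNIV. if lk \<beta> j = 0 then 0 else ?D j (h (\<beta> - sg j 1)))" .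
        have "(\<Sum>j\<in>UNIV. if lk \<beta> j = 0 then 0 else ?D j (h (\<beta> - sg j 1))) =
            ?D i (h \<alpha>) + (\<Sum>j\<in>UNIV - {i}. if lk \<beta> j = 0 then 0 else ?D j (h (\<beta> - sg j 1)))"
          by (subst sum.remove[of _ i]) (simp_all add: \<beta>_def lookup_add)
        then have e: "?D i (h \<alpha>) = (\<Sum>j\<in>UNIV. if lk \<beta> j = 0 then 0 else ?D j (h (\<beta> - sg j 1)))
            - (\<Sum>j\<in>UNIV - {i}. if lk \<beta> j = 0 then 0 else ?D j (h (\<beta> - sg j 1)))" by simp
        have "good \<tau> ((?D i ^^ k) (if lk \<beta> j = 0 then 0 else ?D j (h (\<beta> - sg j 1))))" if j: "j \<in> UNIV - {i}" for j
        proof (cases "lk \<beta> j = 0")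
          case True
          then show ?thesis by (simp add: good_iter)
        next
          case False
          have ji: "j \<noteq> i" using j by simp
          have aj: "lk \<alpha> j \<noteq> 0" using False ji by (simp add: \<beta>_def lookup_add lookup_single)
          have "lk \<alpha> i + lk \<alpha> j \<le> deg \<alpha>"
            unfolding deg_def using sum_mono2[of UNIV "{i, j}" "lk \<alpha>"] ji by simp
          then have k: "k > 0" using aj less.prems by linarith
          have b: "\<beta> - sg j 1 + sg j 1 = \<beta>"
            using False by (intro poly_mapping_eqI) (auto simp: lookup_add lookup_minus lookup_single when_def)
          have "good \<tau> ((?D i ^^ Suc (k - 1)) (h (\<beta> - sg j 1)))"
          proof (rule less.IH)
            show "k - 1 < k" using k by simp
            show "deg (\<beta> - sg j 1) = d"
              using arg_cong[OF b, of deg] less.prems(1) by (simp add: deg_add deg_single \<beta>_def)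
            show "lk (\<beta> - sg j 1) i + (k - 1) = d"
              using less.prems(2) k ji by (simp add: \<beta>_def lookup_minus lookup_add lookup_single)
          qed
          then have "good \<tau> (?D j ((?D i ^^ k) (h (\<beta> - sg j 1))))" using k by (intro good_dmer) simp
          then show ?thesis using False by (simp add: iter_commute)
        qed
        then have "good \<tau> ((?D i ^^ k) (\<Sum>j\<in>UNIV - {i}. if lk \<beta> j = 0 then 0 else ?D j (h (\<beta> - sg j 1))))"
          unfolding iter_sum by (rule good_sum)
        from good_diff[OF good_iter[OF gS] this]
        have "good \<tau> ((?D i ^^ k) (?D i (h \<alpha>)))" unfolding e iter_diff .
        then show ?case unfolding funpow_Suc_right comp_apply .
      qed
      obtain f where f: "h \<alpha>0 = reindex Inl f"
        using hamiltonian_lam_free[OF \<tau> Ht H] by (auto simp: lam_free_def h_def)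
      show "good \<tau> (h \<alpha>0)" unfolding f
      proof (rule good_from_iterated[OF \<tau>])
        fix i
        have "lk \<alpha>0 i \<le> d" unfolding d_def deg_def by (rule member_le_sum) auto
        then have "good \<tau> ((?D i ^^ Suc (d - lk \<alpha>0 i)) (h \<alpha>0))" by (intro kill) (simp_all add: d_def)
        then show "\<exists>k. good \<tau> ((?D i ^^ k) (reindex Inl f))" unfolding f[symmetric] by (rule exI)
      qed
    qed
  qed
  from this[of N] show ?thesis by (simp add: h_def)
qed

section \<open>Evaluation at the equilibrium point\<close>

lemma surj_coords': "inj (\<sigma> :: 'k::finite => 'l::finite) ==> \<exists>u. coords \<sigma> u = x"
  by (rule exI[of _ "\<chi> l. x $ (inv \<sigma> l)"]) (simp add: vec_eq_iff)

text \<open>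
  The projection is open, so closures pull back to closures.
\<close>

lemma nowhere_dense_coords_imp:
  assumes s: "inj (\<sigma> :: 'k::finite => 'l::finite)" and S: "nowhere_dense (coords \<sigma> -` S)"
  shows "nowhere_dense S"
  unfolding nowhere_dense_def
proof (rule ccontr)
  assume "interior (closure S) \<noteq> {}"
  then obtain x where x: "x \<in> interior (closure S)" by blast
  have "coords \<sigma> -` interior (closure S) \<subseteq> closure (coords \<sigma> -` S)"
  proof
    fix u assume u: "u \<in> coords \<sigma> -` interior (closure S)"
    then have u': "coords \<sigma> u \<in> closure S" using interior_subset[of "closure S"] by blast
    show "u \<in> closure (coords \<sigma> -` S)" unfolding closure_iff_nhds_not_empty
    proof (intro allI impI)
      fix N W assume N: "W \<subseteq> N" "open W" "u \<in> W"
      have "open (coords \<sigma> ` W)" by (rule open_coords_image[OF s N(2)])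
      moreover have "coords \<sigma> u \<in> coords \<sigma> ` W" using N(3) by blast
      ultimately have "S \<inter> coords \<sigma> ` W \<noteq> {}" using u' unfolding closure_iff_nhds_not_empty by blast
      then show "coords \<sigma> -` S \<inter> N \<noteq> {}" using N(1) by blast
    qed
  qed
  from interior_maximal[OF this open_coords_vimage[OF open_interior]]
  have "coords \<sigma> -` interior (closure S) = {}" using S by (simp add: nowhere_dense_def)
  moreover obtain u where "coords \<sigma> u = x" using surj_coords'[OF s] by blast
  ultimately show False using x by blast
qed

lemma reindex_inject:
  assumes s: "inj (\<sigma> :: 'k::finite => 'l::finite)" and e: "reindex \<sigma> F = reindex \<sigma> G" shows "F = G"
proof -
  have r: "nowhere_dense {u. rep_mer (reindex \<sigma> F) u \<noteq> rep_mer F (coords \<sigma> u)}" for F :: "'k merfun"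
    using rep_abs_mer[OF mero_coords[OF s mero_rep[of F]]] reindex_abs[OF s mero_rep[of F]] by (simp add: abs_rep_mer)
  have "nowhere_dense (coords \<sigma> -` {x. rep_mer F x \<noteq> rep_mer G x})"
    by (rule nowhere_dense_subset[OF nowhere_dense_Un[OF r[of F] r[of G]]]) (auto simp: e)
  then have nd: "nowhere_dense {x. rep_mer F x \<noteq> rep_mer G x}" by (rule nowhere_dense_coords_imp[OF s])
  have "abs_mer (rep_mer F) = abs_mer (rep_mer G)"
    by (rule abs_mer_eqI[OF mero_rep mero_rep nd]) simp
  then show ?thesis by (simp only: abs_rep_mer)
qed

lemma regular_value_reindex:
  assumes s: "inj (\<sigma> :: 'k::finite => 'l::finite)" and F: "regular_value F (coords \<sigma> u) c"
  shows "regular_value (reindex \<sigma> F) u c"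
proof -
  obtain N a where N: "coords \<sigma> u \<in> N" "holo_on a N" "nowhere_dense {v\<in>N. rep_mer F v \<noteq> a v}" "a (coords \<sigma> u) = c"
    using F by (auto simp: regular_value_def)
  then have "rat F N a (\<lambda>_. 1)" using holo_on_open by (auto simp: rat_def intro: holo_on_const)
  from regular_value_rat[OF rat_reindex[OF s this], of u] show ?thesis using N by simp
qed

text \<open>
  At $p=0$ only the term without momenta remains.
\<close>

lemma classical_value_0:
  "classical_value x 0 a = (\<lambda>w I J. restrict_x x (cc 0 0 (a w I J :: ('n::finite) qu)))"
proof (intro ext)
  fix w I J
  let ?q = "eta0 (a w I J)"
  have l: "lk ?q \<alpha> = cc 0 \<alpha> (a w I J)" for \<alpha> by (simp add: eta0_def lookup_map_zero)
  have p: "(\<Prod>i\<in>UNIV. ((0 :: complex^'n) $ i) ^ lk \<alpha> i) = (if \<alpha> = 0 then 1 else 0)" for \<alpha>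
  proof (cases "\<alpha> = 0")
    case False
    then obtain i where "lk \<alpha> i \<noteq> 0" by (metis lookup_zero poly_mapping_eqI)
    then show ?thesis using False by (auto intro!: prod_zero bexI[of _ i])
  qed simp
  have z: "restrict_x x 0 = (0 :: 'n merfun)" using restrict_mconst[of x 0] by simp
  have "eval_cl2 x 0 ?q = (\<Sum>\<alpha>\<in>Poly_Mapping.keys ?q. if \<alpha> = 0 then restrict_x x (lk ?q 0) else 0)"
    unfolding eval_cl2_def p by (rule sum.cong) auto
  also have "\<dots> = restrict_x x (lk ?q 0)"
    by (simp add: z in_keys_iff)
  finally show "classical_value x 0 a w I J = restrict_x x (cc 0 0 (a w I J))"
    by (simp add: classical_value_def l)
qed

context
  fixes \<tau> :: complex
  assumes \<tau>: "Im \<tau> > 0"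
begin

abbreviation RS :: "('n::{finite,linorder} + 'n) merfun => 'n merfun" where "RS \<equiv> restrict_x x_star"

lemma good_slice: "good \<tau> F ==> slice_ok (x_star :: complex^('n::{finite,linorder})) l F"
  using x_star_Dset[OF \<tau>] by (auto simp: good_def)

lemma RS_add: "good \<tau> F ==> good \<tau> G ==> RS (F + G) = RS F + RS G"
  and RS_mult: "good \<tau> F ==> good \<tau> G ==> RS (F * G) = RS F * RS G"
  by (rule restrict_arith; rule good_slice; assumption)+

lemma RS_0: "RS 0 = 0"
  using restrict_mconst[of x_star 0] by simp

lemma RS_diff: "good \<tau> F ==> good \<tau> G ==> RS (F - G) = RS F - RS G"
proof -
  assume F: "good \<tau> F" and G: "good \<tau> G"
  from RS_add[OF good_diff[OF F G] G] show ?thesis by simp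
qed

lemma RS_sum: "(\<And>a. a \<in> A ==> good \<tau> (f a)) ==> RS (sum f A) = (\<Sum>a\<in>A. RS (f a))"
proof (induction A rule: infinite_finite_induct)
  case (insert a A)
  have "good \<tau> (sum f A)" by (rule good_sum) (use insert.prems in auto)
  then show ?case unfolding sum.insert[OF insert.hyps] using insert by (simp add: RS_add)
qed (simp_all add: RS_0)

lemma RS_vee: "good \<tau> F ==> RS (reindex (map_sum id (Perm.apply w)) F) = reindex (Perm.apply w) (RS F)"
  by (rule restrict_vee[OF good_slice inj_perm])

subsection \<open>Multiplicativity\<close>

lemma cc_vee: "cc k \<beta> (act_vee_qu w q) = reindex (map_sum id (Perm.apply w)) (cc k \<beta> (q :: ('n::{finite,linorder}) qu))"
proof -
  have "Poly_Mapping.map_key (Perm.apply 1) \<beta> = \<beta>"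
    by (rule poly_mapping_eqI) (simp add: map_key.rep_eq)
  then have "Poly_Mapping.map_key id \<beta> = \<beta>" by simp
  then show ?thesis unfolding act_vee_qu_qact by (simp add: qaction.lookup_qact[OF qaction_vee])
qed

definition reg :: "('n::{finite,linorder}, 'd::finite) qu_W => bool" where
  "reg a \<longleftrightarrow> (\<forall>w I J. good_cl \<tau> (a w I J))"

lemma cc_mult_W:
  "cc k 0 (mult_W a b v I J) = (\<Sum>w\<in>UNIV. \<Sum>K\<in>UNIV. cc k 0 (star (a w I K) (act_vee_qu w (b (inverse w * v) K J))))"
  unfolding mult_W_def cross_mult_def sum_fun_apply umat_mult_def act_vee_def lookup_sum fps_sum_nth ..

lemma reg_mult:
  assumes "reg a" "reg b" shows "good \<tau> (cc 0 0 (mult_W a b v I J))"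
proof -
  have g: "good \<tau> (cc 0 0 (a w I K))" "good \<tau> (cc 0 0 (b w I K))" for w I K
    using assms by (auto simp: reg_def good_cl_def)
  show ?thesis unfolding cc_mult_W star_zero_0 cc_vee by (intro good_sum good_mult good_vee g)
qed

text \<open>
  Taking the classical limit, putting $p=0$ and restricting to $x^*$ is multiplicative on
  elements whose coefficients restrict.
\<close>

lemma classical_value_mult:
  assumes a: "reg a" and b: "reg (b :: ('n::{finite,linorder}, 'd::finite) qu_W)"
  shows "spin_mult (classical_value x_star 0 a) (classical_value x_star 0 b) = classical_value x_star 0 (mult_W a b)"
proof (intro ext)
  fix v I J
  have g: "good \<tau> (cc 0 0 (a w I K))" "good \<tau> (cc 0 0 (b w I K))" for w I K
    using a b by (auto simp: reg_def good_cl_def)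
  have "classical_value x_star 0 (mult_W a b) v I J =
      (\<Sum>w\<in>UNIV. \<Sum>K\<in>UNIV. RS (cc 0 0 (a w I K) * reindex (map_sum id (Perm.apply w)) (cc 0 0 (b (inverse w * v) K J))))"
    unfolding classical_value_0 cc_mult_W star_zero_0 cc_vee
    by (simp add: RS_sum good_sum good_mult good_vee g)
  also have "\<dots> = (\<Sum>w\<in>UNIV. \<Sum>K\<in>UNIV. RS (cc 0 0 (a w I K)) * reindex (Perm.apply w) (RS (cc 0 0 (b (inverse w * v) K J))))"
    by (simp only: RS_mult[OF g(1) good_vee[OF g(2)]] RS_vee[OF g(2)])
  also have "\<dots> = spin_mult (classical_value x_star 0 a) (classical_value x_star 0 b) v I J"
    unfolding spin_mult_def cross_mult_def sum_fun_apply umat_mult_def classical_value_0 ..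
  finally show "spin_mult (classical_value x_star 0 a) (classical_value x_star 0 b) v I J = classical_value x_star 0 (mult_W a b) v I J" ..
qed

lemma reg_defined: "reg a ==> classical_value_defined x_star a"
  unfolding classical_value_defined_def regular_along_def
proof (intro allI)
  fix w I J \<alpha> assume "reg a"
  then have "good \<tau> (lk (eta0 (a w I J)) \<alpha>)" by (simp add: reg_def good_cl_def eta0_def lookup_map_zero)
  then show "nowhere_dense {l. \<nexists>c. regular_value (lk (eta0 (a w I J)) \<alpha>) (join x_star l) c}"
    by (rule slice_val_props(2)[OF good_slice])
qed

subsection \<open>The Poisson bracket with a Hamiltonian vanishes at the equilibrium\<close>

text \<open>
  The point $(x^*,0)$ is an equilibrium up to translation: the Hamiltonian vector field of the
  classical part is a multiple of $\sum_i\partial/\partial x_i$ there.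
\<close>

definition equilibrium :: "('n::{finite,linorder}) qu => bool" where
  "equilibrium H \<longleftrightarrow> (\<exists>c. RS (cc 0 0 H) = mconst c) \<and> (\<exists>c. \<forall>i. RS (cc 0 (sg i 1) H) = mconst c)
     \<and> (\<forall>i. RS (pderiv_mer (Inl i) (cc 0 0 H)) = 0)"

lemma good_pderiv: "good \<tau> F ==> good \<tau> (pderiv_mer i F)"
  by (simp add: pderiv_mer_dmer good_dmer)

text \<open>
  The bracket with $H$ at the equilibrium differentiates $a$ along $\sum_i\partial/\partial x_i$
  only, and $a$ is invariant under translations.
\<close>

lemma bracket_vanishes:
  assumes H: "equilibrium H" "good_cl \<tau> H" and a: "good_cl \<tau> a" "(\<Sum>i\<in>UNIV. pderiv_mer (Inl i) (cc 0 0 a)) = 0"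
  shows "cc 1 0 (star H a - star a H) = (\<Sum>i\<in>UNIV. cc 0 (sg i 1) H * pderiv_mer (Inl i) (cc 0 0 a) - cc 0 (sg i 1) a * pderiv_mer (Inl i) (cc 0 0 H))"
    "RS (cc 1 0 (star H (a :: ('n::{finite,linorder}) qu) - star a H)) = 0"
proof -
  show 1: "cc 1 0 (star H a - star a H) = (\<Sum>i\<in>UNIV. cc 0 (sg i 1) H * pderiv_mer (Inl i) (cc 0 0 a) - cc 0 (sg i 1) a * pderiv_mer (Inl i) (cc 0 0 H))"
    unfolding lookup_minus fps_sub_nth star_zero_1 sum_subtractf by (simp add: algebra_simps)
  obtain c where c: "\<And>i. RS (cc 0 (sg i 1) H) = mconst c" using H(1) unfolding equilibrium_def by blast
  have d: "RS (pderiv_mer (Inl i) (cc 0 0 H)) = 0" for i using H(1) by (simp add: equilibrium_def)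
  have g: "good \<tau> (cc 0 \<beta> H)" "good \<tau> (cc 0 \<beta> a)" for \<beta> using H(2) a(1) by (simp_all add: good_cl_def)
  have "RS (cc 1 0 (star H a - star a H)) = (\<Sum>i\<in>UNIV. mconst c * RS (pderiv_mer (Inl i) (cc 0 0 a)))"
  proof -
    have "RS (cc 0 (sg i 1) H * pderiv_mer (Inl i) (cc 0 0 a) - cc 0 (sg i 1) a * pderiv_mer (Inl i) (cc 0 0 H))
        = mconst c * RS (pderiv_mer (Inl i) (cc 0 0 a))" for i
      unfolding RS_diff[OF good_mult[OF g(1) good_pderiv[OF g(2)]] good_mult[OF g(2) good_pderiv[OF g(1)]]]
        RS_mult[OF g(1) good_pderiv[OF g(2)]] RS_mult[OF g(2) good_pderiv[OF g(1)]] c d by simp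
    then show ?thesis unfolding 1
      by (subst RS_sum) (simp_all only: good_diff[OF good_mult[OF g(1) good_pderiv[OF g(2)]] good_mult[OF g(2) good_pderiv[OF g(1)]]])
  qed
  also have "\<dots> = mconst c * RS (\<Sum>i\<in>UNIV. pderiv_mer (Inl i) (cc 0 0 a))"
    unfolding sum_distrib_left[symmetric] using RS_sum[of UNIV "\<lambda>i. pderiv_mer (Inl i) (cc 0 0 a)"] good_pderiv[OF g(2)] by simp
  also have "\<dots> = 0" unfolding a(2) RS_0 by simp
  finally show "RS (cc 1 0 (star H a - star a H)) = 0" .
qed

lemma lookup_mult_single:
  "lk (a * b) (sg i (1::nat)) = lk a (sg i 1) * lk b 0 + lk a 0 * (lk b (sg (i :: 'n::finite) 1) :: 'c::comm_ring_1)"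
proof (induction a rule: poly_mapping_additive_induct)
  case (single k c)
  show ?case
  proof (induction b rule: poly_mapping_additive_induct)
    case (single l d)
    have e: "(k + l = sg i (1::nat)) = (k = sg i 1 \<and> l = 0 \<or> k = 0 \<and> l = sg i 1)"
    proof
      assume e: "k + l = sg i 1"
      have j: "lk k j + lk l j = (if j = i then 1 else 0)" for j
        using arg_cong[OF e, of "\<lambda>m. lk m j"] by (simp add: lookup_add lookup_single when_def)
      have z: "lk k j = 0 \<and> lk l j = 0" if "j \<noteq> i" for j using j[of j] that by simp
      have "lk k i = 1 \<and> lk l i = 0 \<or> lk k i = 0 \<and> lk l i = 1" using j[of i] by simp arith
      then show "k = sg i 1 \<and> l = 0 \<or> k = 0 \<and> l = sg i 1"
      proof
        assume "lk k i = 1 \<and> lk l i = 0"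
        then have "k = sg i 1" "l = 0" using z by (auto intro!: poly_mapping_eqI simp: lookup_single when_def; metis)+
        then show ?thesis by simp
      next
        assume "lk k i = 0 \<and> lk l i = 1"
        then have "l = sg i 1" "k = 0" using z by (auto intro!: poly_mapping_eqI simp: lookup_single when_def; metis)+
        then show ?thesis by simp
      qed
    qed auto
    have n: "sg i (1::nat) \<noteq> 0" by (metis lookup_single_eq lookup_zero zero_neq_one)
    have "lk (sg k c * sg l d) (sg i 1) = (if k + l = sg i 1 then c * d else 0)"
      by (simp add: mult_single lookup_single when_def)
    also have "\<dots> = lk (sg k c) (sg i 1) * lk (sg l d) 0 + lk (sg k c) 0 * lk (sg l d) (sg i 1)"
      unfolding e using n by (cases "k = 0"; cases "l = 0") (simp_all only: lookup_single when_def, simp_all)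
    finally show ?case .
  qed (simp_all add: lookup_add algebra_simps)
qed (simp_all add: lookup_add algebra_simps)

lemma equilibrium_add:
  assumes "equilibrium a" "equilibrium b" "good_cl \<tau> a" "good_cl \<tau> (b :: ('n::{finite,linorder}) qu)"
  shows "equilibrium (a + b)"
proof -
  have g: "good \<tau> (cc 0 \<beta> a)" "good \<tau> (cc 0 \<beta> b)" for \<beta> using assms(3,4) by (simp_all add: good_cl_def)
  have "pderiv_mer i (F + G) = pderiv_mer i F + pderiv_mer i G" for i and F G :: "('n + 'n) merfun"
    by (simp add: pderiv_mer_dmer dmer_add)
  then show ?thesis using assms(1,2) unfolding equilibrium_def lookup_add fps_add_nth
    by (auto simp: RS_add g good_pderiv mconst_add[symmetric])
qed

lemma equilibrium_star:
  assumes a: "equilibrium a" and b: "equilibrium b" and "good_cl \<tau> a" "good_cl \<tau> (b :: ('n::{finite,linorder}) qu)"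
  shows "equilibrium (star a b)"
proof -
  have g: "good \<tau> (cc 0 \<beta> a)" "good \<tau> (cc 0 \<beta> b)" for \<beta> using assms(3,4) by (simp_all add: good_cl_def)
  obtain a0 a1 where a': "RS (cc 0 0 a) = mconst a0" "\<And>i. RS (cc 0 (sg i 1) a) = mconst a1" "\<And>i. RS (pderiv_mer (Inl i) (cc 0 0 a)) = 0"
    using a unfolding equilibrium_def by blast
  obtain b0 b1 where b': "RS (cc 0 0 b) = mconst b0" "\<And>i. RS (cc 0 (sg i 1) b) = mconst b1" "\<And>i. RS (pderiv_mer (Inl i) (cc 0 0 b)) = 0"
    using b unfolding equilibrium_def by blast
  have 0: "RS (cc 0 0 (star a b)) = mconst (a0 * b0)"
    unfolding star_zero_0 RS_mult[OF g] a' b' mconst_mult ..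
  have 1: "RS (cc 0 (sg i 1) (star a b)) = mconst (a1 * b0 + a0 * b1)" for i
    unfolding star_order_0 lookup_mult_single fps_add_nth fps_mult_nth_0
    unfolding RS_add[OF good_mult[OF g] good_mult[OF g]] RS_mult[OF g] a' b' mconst_mult mconst_add ..
  have p: "pderiv_mer i (F * G) = F * pderiv_mer i G + pderiv_mer i F * G" for i and F G :: "('n + 'n) merfun"
    by (simp add: pderiv_mer_dmer dmer_mult)
  have 2: "RS (pderiv_mer (Inl i) (cc 0 0 (star a b))) = 0" for i
    unfolding star_zero_0 p RS_add[OF good_mult[OF g(1) good_pderiv[OF g(2)]] good_mult[OF good_pderiv[OF g(1)] g(2)]]
      RS_mult[OF g(1) good_pderiv[OF g(2)]] RS_mult[OF good_pderiv[OF g(1)] g(2)] a' b' by simp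
  show ?thesis unfolding equilibrium_def using 0 1 2 by blast
qed

end

section \<open>Symmetry of the equilibrium point\<close>

lemma Fh_cong:
  fixes x y :: "complex^('n::{finite,linorder})"
  assumes "\<And>i j. wp (x $ i - x $ j) \<tau> = wp (y $ i - y $ j) \<tau>"
  shows "Fh \<tau> g r \<beta> x = Fh \<tau> g r \<beta> y"
  unfolding Fh_def assms ..

lemma perm_of_inj:
  assumes "inj (f :: 'n::finite => 'n)" shows "\<exists>w. Perm.apply w = f"
proof -
  have "bij f" using assms finite_UNIV_inj_surj[of f] by (simp add: bij_def)
  then have "Perm.apply (Perm f) = f" by (intro Perm_inverse) simp
  then show ?thesis by blast
qed

text \<open>
  Rotations and reflections of the regular $n$-gon formed by the $x_i^*$ on the circle
  $\mathbb{R}/\mathbb{Z}$.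
\<close>

lemma dihedral_perm:
  assumes s: "s = 1 \<or> s = - 1"
  shows "\<exists>w. \<forall>i :: 'n::{finite,linorder}. int CARD('n) dvd ip (w \<langle>$\<rangle> i) - (a + s * ip i)"
proof -
  have "\<forall>i :: 'n. \<exists>x :: 'n. int CARD('n) dvd ip x - (a + s * ip i)" using pos_residue_exists by blast
  from choice[OF this] obtain f :: "'n => 'n" where f: "\<And>i :: 'n. int CARD('n) dvd ip (f i) - (a + s * ip i)" by blast
  have "inj f"
  proof (rule injI)
    fix i j assume e: "f i = f j"
    have "int CARD('n) dvd (ip (f i) - (a + s * ip i)) - (ip (f j) - (a + s * ip j))" by (rule dvd_diff[OF f f])
    then have "int CARD('n) dvd s * (ip j - ip i)" unfolding e by (simp add: algebra_simps)
    then have "int CARD('n) dvd ip j - ip i" using s by (auto simp: dvd_diff_commute)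
    then show "i = j" by (rule pos_residue_unique[symmetric])
  qed
  then obtain w where "Perm.apply w = f" using perm_of_inj by blast
  then show ?thesis using f by blast
qed

lemma x_star_dihedral:
  assumes "int CARD('n) dvd ip (j :: 'n::{finite,linorder}) - (a + s * ip i)"
  shows "\<exists>m. (x_star :: complex^('n::{finite,linorder})) $ j
    = of_int a / of_nat CARD('n) + of_int s * (x_star :: complex^('n::{finite,linorder})) $ i + of_int m"
proof -
  obtain m where m: "ip j = a + s * ip i + int CARD('n) * m" using assms by (auto simp: dvd_def algebra_simps)
  have "of_nat (pos j) = (of_int (ip j) :: complex)" by simp
  also have "\<dots> = of_int a + of_int s * of_nat (pos i) + of_nat CARD('n) * of_int m" unfolding m by simp
  finally show ?thesis by (intro exI[of _ m]) (simp add: x_star_def field_simps)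
qed

context
  fixes \<tau> g :: complex and Ht :: "nat => ('n::{finite,linorder}) qu"
  assumes \<tau>: "Im \<tau> > 0" and Ht: "eCM_quantum_lifts \<tau> g Ht"
begin

text \<open>
  Invariance of the classical Hamiltonians is read off from that of their quantum lifts, because
  functions of $x$ embed into functions of $(x,\lambda)$.
\<close>

lemma eCM_h_invariant:
  assumes r: "r \<in> {1..CARD('n)}" shows "act_cl w (eCM_h \<tau> g r) = (eCM_h \<tau> g r :: 'n cl)"
proof (rule poly_mapping_eqI)
  fix \<beta> :: "'n \<Rightarrow>\<^sub>0 nat"
  let ?h = "eCM_h \<tau> g r :: 'n cl" and ?\<gamma> = "Poly_Mapping.map_key (Perm.apply w) \<beta>"
  have i: "inj (map_sum (Perm.apply w) (id :: 'n => 'n))" by (intro inj_map_sum inj_perm inj_on_id)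
  have "reindex (Inl :: 'n => 'n + 'n) (lk (act_cl w ?h) \<beta>) = reindex (Inl \<circ> Perm.apply w) (lk ?h ?\<gamma>)"
    unfolding lookup_act_cl[OF \<tau>] by (rule reindex_comp[OF inj_perm inj_Inl'])
  also have "Inl \<circ> Perm.apply w = map_sum (Perm.apply w) id \<circ> Inl" by (simp add: fun_eq_iff)
  also have "reindex (map_sum (Perm.apply w) id \<circ> Inl) (lk ?h ?\<gamma>) = reindex (map_sum (Perm.apply w) id) (cc 0 ?\<gamma> (Ht r))"
    unfolding classical_Ht[OF \<tau> Ht r] by (rule reindex_comp[OF inj_Inl' i, symmetric])
  also have "\<dots> = cc 0 \<beta> (act_hat_qu w (Ht r))"
    unfolding act_hat_qu_qact by (simp add: qaction.lookup_qact[OF qaction_hat])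
  also have "act_hat_qu w (Ht r) = Ht r" using Ht r by (simp add: eCM_quantum_lifts_def)
  also have "cc 0 \<beta> (Ht r) = reindex Inl (lk ?h \<beta>)" by (rule classical_Ht[OF \<tau> Ht r])
  finally show "lk (act_cl w ?h) \<beta> = lk ?h \<beta>" by (rule reindex_inject[OF inj_Inl'])
qed

lemma Fh_perm:
  assumes r: "r \<in> {1..CARD('n)}" and x: "x \<in> Dset \<tau>"
  shows "Fh \<tau> g r \<beta> x = Fh \<tau> g r (Poly_Mapping.map_key (Perm.apply w) \<beta>) (coords (Perm.apply w) (x :: complex^('n::{finite,linorder})))"
proof (rule regular_value_unique[OF regular_Fh[OF \<tau> x]])
  have e: "lk (eCM_h \<tau> g r :: 'n cl) \<beta> = reindex (Perm.apply w) (lk (eCM_h \<tau> g r) (Poly_Mapping.map_key (Perm.apply w) \<beta>))"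
    using lookup_act_cl[OF \<tau>, of w "eCM_h \<tau> g r :: 'n cl" \<beta>] unfolding eCM_h_invariant[OF r] .
  show "regular_value (lk (eCM_h \<tau> g r) \<beta>) x (Fh \<tau> g r (Poly_Mapping.map_key (Perm.apply w) \<beta>) (coords (Perm.apply w) x))"
    unfolding e by (rule regular_value_reindex[OF inj_perm regular_Fh[OF \<tau> Dset_perm[OF x]]])
qed

text \<open>
  The coefficient of $p_k$ at $x^*$ is independent of $k$ by rotation. The reflection that fixes
  $k$ sends $x^*+te_k$ to $x^*-te_k$ up to periods and translation; hence the part without
  momenta is even in $t$ and its derivative vanishes at $t=0$.
\<close>

lemma equilibrium_Ht:
  assumes r: "r \<in> {1..CARD('n)}" shows "equilibrium (Ht r)"
proof -
  let ?x = "x_star :: complex^('n::{finite,linorder})" and ?h = "eCM_h \<tau> g r :: 'n cl"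
  have xD: "?x \<in> Dset \<tau>" by (rule x_star_Dset[OF \<tau>])
  have c: "restrict_x ?x (cc 0 \<beta> (Ht r)) = mconst (Fh \<tau> g r \<beta> ?x)" for \<beta>
    unfolding classical_Ht[OF \<tau> Ht r] by (rule restrict_Inl[OF regular_Fh[OF \<tau> xD]])
  have rot: "Fh \<tau> g r (sg k 1) ?x = Fh \<tau> g r (sg l 1) ?x" for k l
  proof -
    obtain w where w: "\<And>i :: 'n. int CARD('n) dvd ip (w \<langle>$\<rangle> i) - ((ip k - ip l) + 1 * ip i)"
      using dihedral_perm[of 1 "ip k - ip l"] by blast
    have wl: "w \<langle>$\<rangle> l = k" using w[of l] by (intro pos_residue_unique) simp
    have wi: "(k = w \<langle>$\<rangle> i) = (l = i)" for i
      using inj_eq[OF inj_perm, of w l i] unfolding wl .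
    have m: "Poly_Mapping.map_key (Perm.apply w) (sg k 1) = sg l (1::nat)"
      by (intro poly_mapping_eqI) (simp add: lookup_single when_def wi)
    have "\<forall>i. \<exists>m. ?x $ (w \<langle>$\<rangle> i) = of_int (ip k - ip l) / of_nat CARD('n) + of_int 1 * ?x $ i + of_int m"
      using x_star_dihedral[OF w] by (rule allI)
    from choice[OF this] obtain m where mm: "\<And>i. ?x $ (w \<langle>$\<rangle> i) = of_int (ip k - ip l) / of_nat CARD('n) + of_int 1 * ?x $ i + of_int (m i)"
      by blast
    have "Fh \<tau> g r (sg k 1) ?x = Fh \<tau> g r (sg l 1) (coords (Perm.apply w) ?x)"
      using Fh_perm[OF r xD, of "sg k 1" w] by (simp only: m)
    also have "\<dots> = Fh \<tau> g r (sg l 1) ?x"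
    proof (rule Fh_cong)
      fix i j
      have "coords (Perm.apply w) ?x $ i - coords (Perm.apply w) ?x $ j = (?x $ i - ?x $ j) + of_int (m i - m j)"
        by (simp add: mm)
      then show "wp (coords (Perm.apply w) ?x $ i - coords (Perm.apply w) ?x $ j) \<tau> = wp (?x $ i - ?x $ j) \<tau>"
        by (simp only: wp_plus_int[OF \<tau>])
    qed
    finally show ?thesis .
  qed
  have der: "restrict_x ?x (pderiv_mer (Inl k) (cc 0 0 (Ht r))) = 0" for k :: 'n
  proof -
    let ?v = "axis k 1 :: complex^('n::{finite,linorder})" and ?F = "lk ?h 0"
    obtain N a where N: "?x \<in> N" "holo_on a N" "nowhere_dense {v\<in>N. rep_mer ?F v \<noteq> a v}"
      using regular_Fh[OF \<tau> xD, where r = r and g = g and \<beta> = 0] by (auto simp: regular_value_def)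
    have aF: "a y = Fh \<tau> g r 0 y" if "y \<in> N" "y \<in> Dset \<tau>" for y
      by (rule regular_value_unique[OF regular_valueI[OF that(1) N(2,3) refl] regular_Fh[OF \<tau> that(2)]])
    have R: "rat ?F N a (\<lambda>_. 1)" using N holo_on_open by (auto simp: rat_def intro: holo_on_const)
    have d1: "ddir ?v (\<lambda>_. 1) ?x = 0" by (simp add: ddir_def)
    have reg: "regular_value (dmer ?v ?F) ?x (ddir ?v a ?x)"
      using regular_value_rat[OF rat_dmer[OF R, of ?v] N(1)] by (simp add: d1)
    have even: "Fh \<tau> g r 0 (?x + t *s ?v) = Fh \<tau> g r 0 (?x + t *s (- ?v))" if D: "?x + t *s ?v \<in> Dset \<tau>" for t
    proof -
      obtain w where w: "\<And>i :: 'n. int CARD('n) dvd ip (w \<langle>$\<rangle> i) - (2 * ip k + (- 1) * ip i)"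
        using dihedral_perm[of "- 1" "2 * ip k"] by blast
      have wk: "w \<langle>$\<rangle> k = k" using w[of k] by (intro pos_residue_unique) simp
      have wi: "(w \<langle>$\<rangle> i = k) = (i = k)" for i
        using inj_eq[OF inj_perm, of w i k] unfolding wk .
      have m: "Poly_Mapping.map_key (Perm.apply w) (0 :: 'n \<Rightarrow>\<^sub>0 nat) = 0"
        by (intro poly_mapping_eqI) simp
      have "\<forall>i. \<exists>m. ?x $ (w \<langle>$\<rangle> i) = of_int (2 * ip k) / of_nat CARD('n) + of_int (- 1) * ?x $ i + of_int m"
        using x_star_dihedral[OF w] by (rule allI)
      from choice[OF this] obtain m where mm: "\<And>i. ?x $ (w \<langle>$\<rangle> i) = of_int (2 * ip k) / of_nat CARD('n) + of_int (- 1) * ?x $ i + of_int (m i)"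
        by blast
      let ?y = "?x + t *s ?v" and ?z = "?x + t *s (- ?v)"
      have "Fh \<tau> g r 0 ?y = Fh \<tau> g r 0 (coords (Perm.apply w) ?y)"
        using Fh_perm[OF r D, of 0 w] by (simp only: m)
      also have "\<dots> = Fh \<tau> g r 0 ?z"
      proof (rule Fh_cong)
        fix i j
        have "coords (Perm.apply w) ?y $ i - coords (Perm.apply w) ?y $ j = - (?z $ i - ?z $ j) + of_int (m i - m j)"
          by (simp add: mm axis_def wi)
        then show "wp (coords (Perm.apply w) ?y $ i - coords (Perm.apply w) ?y $ j) \<tau> = wp (?z $ i - ?z $ j) \<tau>"
          by (simp only: wp_plus_int[OF \<tau>] wp_even[OF \<tau>])
      qed
      finally show ?thesis .
    qed
    have dv: "((\<lambda>t. a (?x + t *s v)) has_field_derivative ddir v a ?x) (at 0)" for v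
      using holo_on_along_line[OF N(2), of ?x 0 v] N(1) by simp
    let ?U = "N \<inter> Dset \<tau>"
    have oU: "open ?U" using holo_on_open[OF N(2)] open_Dset[OF \<tau>] by (rule open_Int)
    let ?S = "{t. ?x + t *s ?v \<in> ?U} \<inter> {t. ?x + t *s (- ?v) \<in> ?U}"
    have "((\<lambda>t. a (?x + t *s ?v)) has_field_derivative ddir (- ?v) a ?x) (at 0)"
    proof (rule has_field_derivative_transform_within_open[OF dv])
      show "open ?S" by (intro open_Int open_line_preimage oU)
      show "0 \<in> ?S" using N(1) xD by simp
      show "a (?x + t *s (- ?v)) = a (?x + t *s ?v)" if "t \<in> ?S" for t
        using that aF even by simp
    qed
    then have "ddir (- ?v) a ?x = ddir ?v a ?x" by (rule DERIV_unique[OF _ dv])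
    moreover have "ddir (- ?v) a ?x = - ddir ?v a ?x"
      using holo_on_has_derivative(2)[OF N(2,1), of "- 1" ?v] by simp
    ultimately have "ddir ?v a ?x = 0" by simp
    then have r0: "regular_value (dmer ?v ?F) ?x 0" using reg by simp
    have p: "pderiv_mer (Inl k) (cc 0 0 (Ht r)) = reindex Inl (dmer ?v ?F)"
      unfolding classical_Ht[OF \<tau> Ht r] pderiv_mer_dmer by (simp add: dmer_reindex coords_axis)
    show ?thesis unfolding p using restrict_Inl[OF r0] by simp
  qed
  show ?thesis unfolding equilibrium_def[OF \<tau>]
  proof (intro conjI allI exI)
    show "restrict_x ?x (cc 0 0 (Ht r)) = mconst (Fh \<tau> g r 0 ?x)" by (rule c)
    show "restrict_x ?x (cc 0 (sg k 1) (Ht r)) = mconst (Fh \<tau> g r (sg undefined 1) ?x)" for k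
      unfolding c rot[of k undefined] ..
  qed (rule der)
qed

text \<open>
  By the Leibniz rule the property passes to the generated algebra.
\<close>

lemma equilibrium_hamiltonian: "H \<in> scalar_eCM_hamiltonians Ht ==> equilibrium H \<and> good_cl \<tau> H"
  unfolding scalar_eCM_hamiltonians_def
proof (induction rule: alg_gen.induct)
  case (gen a)
  have g: "good_cl \<tau> a"
    using hamiltonian_good_cl[OF \<tau> Ht, of a] alg_gen.gen[OF gen] unfolding scalar_eCM_hamiltonians_def by blast
  from gen show ?case
  proof
    assume "a \<in> range (\<lambda>c. coef (fps_const (mconst c)))"
    then obtain c where a: "a = coef (fps_const (mconst c))" by blast
    have n: "sg i (1::nat) \<noteq> 0" for i :: 'n by (metis lookup_single_eq lookup_zero zero_neq_one)
    have e: "cc 0 0 a = mconst c" "cc 0 (sg i 1) a = mconst 0" for i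
      unfolding a coef_def using n[of i] by (simp_all add: lookup_single when_def)
    have "equilibrium a"
      unfolding equilibrium_def[OF \<tau>] e restrict_mconst pderiv_mer_dmer dmer_const RS_0[OF \<tau>] by blast
    then show ?thesis using g by blast
  next
    assume "a \<in> Ht ` {1..CARD('n)}"
    then show ?thesis using equilibrium_Ht g by blast
  qed
qed (auto intro: good_cl_add good_cl_star equilibrium_add[OF \<tau>] equilibrium_star[OF \<tau>])

end

section \<open>Commutativity\<close>

lemma lam_free_X: "lam_free (coef fps_X :: ('n::finite) qu)"
  unfolding coef_def by (rule lam_free_single) simp

lemma hbar_W_scalar: "hbar_W A = mult_W (scalar_W (coef fps_X)) (A :: ('n::{finite,linorder}, 'd::finite) qu_W)"
  by (simp add: mult_W_scalar_left hbar_W_def)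

lemma hbar_W_mult:
  "mult_W (hbar_W A) Y = hbar_W (mult_W A (Y :: ('n::{finite,linorder}, 'd::finite) qu_W))"
  "mult_W Y (hbar_W A) = hbar_W (mult_W Y A)"
proof -
  show "mult_W (hbar_W A) Y = hbar_W (mult_W A Y)" unfolding hbar_W_scalar mult_W_assoc ..
  have "star y (coef fps_X) = star (coef fps_X) y" for y :: "'n qu"
    using star_X_right[of y 1] by (simp add: star_coef)
  then have "mult_W Y (scalar_W (coef fps_X)) = mult_W (scalar_W (coef fps_X)) Y"
    unfolding mult_W_scalar_right mult_W_scalar_left lam_free_vee[OF lam_free_X] by simp
  then show "mult_W Y (hbar_W A) = hbar_W (mult_W Y A)"
    unfolding hbar_W_scalar by (simp only: mult_W_assoc[symmetric])
qed

lemma hbar_W_apply: "hbar_W A w I J = coef fps_X * A w I J"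
  by (simp add: hbar_W_def star_coef)

text \<open>
  The total momentum acts as $\hbar\sum_i\partial_i$.
\<close>

lemma translation_commutator:
  "cc 1 0 (star (\<Sum>i\<in>UNIV. mom i) q - star q (\<Sum>i\<in>UNIV. mom i)) = (\<Sum>i\<in>UNIV. pderiv_mer (Inl i) (cc 0 0 (q :: ('n::{finite,linorder}) qu)))"
proof -
  have s: "star (sum f A) b = (\<Sum>a\<in>A. star (f a) b)" for f :: "'n => 'n qu" and A b
    by (induction A rule: infinite_finite_induct) (simp_all add: star_add_left)
  have "Dq j (sum f A) = (\<Sum>a\<in>A. Dq j (f a))" for f :: "'n => 'n qu" and A j
    by (induction A rule: infinite_finite_induct) (simp_all add: Dq_add)
  then have "star q (\<Sum>i\<in>UNIV. mom i) = q * (\<Sum>i\<in>UNIV. mom i)" by (intro star_const_right) simp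
  then have "star (\<Sum>i\<in>UNIV. mom i) q - star q (\<Sum>i\<in>UNIV. mom i) = coef fps_X * (\<Sum>i\<in>UNIV. Dq i q)"
    unfolding s star_mom pq_def by (simp add: sum.distrib sum_distrib_left sum_distrib_right mult.commute)
  then show ?thesis by (simp add: lookup_coef_mult lookup_sum fps_sum_nth Df_def)
qed

context
  fixes \<tau> g :: complex and Ht :: "nat => ('n::{finite,linorder}) qu"
  assumes \<tau>: "Im \<tau> > 0" and Ht: "eCM_quantum_lifts \<tau> g Ht"
begin

text \<open>
  Translation invariance, at $\hbar=0$ and $p=0$.
\<close>

abbreviation trans :: "'n qu => bool" where
  "trans q \<equiv> (\<Sum>i\<in>UNIV. pderiv_mer (Inl i) (cc 0 0 q)) = 0"

lemma lam_free_P: "lam_free (\<Sum>i\<in>UNIV. mom i :: 'n qu)"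
  by (intro lam_free_sum) (simp add: mom_def lam_free_single)

lemma trans_Res:
  assumes "\<And>w. act_cl w f = f"
  shows "star (\<Sum>i\<in>UNIV. mom i) (Res_vee (subst_dunkl \<tau> g f :: ('n, 'd::{finite,linorder}) qu_WW) w I J)
    = star (Res_vee (subst_dunkl \<tau> g f) w I J) (\<Sum>i\<in>UNIV. mom i)"
proof -
  have "mult_W (scalar_W (\<Sum>i\<in>UNIV. mom i)) (Res_vee (subst_dunkl \<tau> g f :: ('n, 'd) qu_WW)) w I J
     = mult_W (Res_vee (subst_dunkl \<tau> g f)) (scalar_W (\<Sum>i\<in>UNIV. mom i)) w I J"
    unfolding Res_subst_translation[OF \<tau> assms] ..
  then show ?thesis unfolding mult_W_scalar_left mult_W_scalar_right lam_free_vee[OF lam_free_P] .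
qed

lemma bracket_RS:
  assumes H: "H \<in> scalar_eCM_hamiltonians Ht" and q: "good_cl \<tau> q" "trans q"
  shows "good \<tau> (cc 1 0 (star H q - star q H))" "restrict_x x_star (cc 1 0 (star H q - star q H)) = 0"
proof -
  have h: "equilibrium H" "good_cl \<tau> H" using equilibrium_hamiltonian[OF \<tau> Ht H] by auto
  show "restrict_x x_star (cc 1 0 (star H q - star q H)) = 0" by (rule bracket_vanishes(2)[OF \<tau> h q])
  show "good \<tau> (cc 1 0 (star H q - star q H))"
    unfolding bracket_vanishes(1)[OF \<tau> h q]
    by (intro good_sum good_diff good_mult good_pderiv[OF \<tau>]) (use h(2) q(1) in \<open>simp_all add: good_cl_def\<close>)
qed

context
  fixes H H' :: "'n qu" and A A' L :: "('n, 'd::{finite,linorder}) qu_W"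
  assumes H: "H \<in> scalar_eCM_hamiltonians Ht" "H' \<in> scalar_eCM_hamiltonians Ht"
    and A: "reg \<tau> A" "\<And>w I J. trans (A w I J)"
    and A': "reg \<tau> A'" "\<And>w I J. trans (A' w I J)"
begin

text \<open>
  In $[H+\hbar A,\,H'+\hbar A']=0$ the commutator $[H,H']$ vanishes. The
  coefficient of $\hbar^2$ expresses the commutator of the classical parts of $A$ and $A'$
  by Poisson brackets with $H$ and $H'$, and these vanish at the equilibrium.
\<close>

lemma classical_commute:
  assumes X: "mult_W (scalar_W H + hbar_W A) (scalar_W H' + hbar_W A') = mult_W (scalar_W H' + hbar_W A') (scalar_W H + hbar_W A)"
  shows "spin_mult (classical_value x_star 0 A) (classical_value x_star 0 A') = spin_mult (classical_value x_star 0 A') (classical_value x_star 0 A)"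
  unfolding classical_value_mult[OF \<tau> A(1) A'(1)] classical_value_mult[OF \<tau> A'(1) A(1)] unfolding classical_value_0
proof (intro ext)
  fix w I J
  let ?a = "A w I J" and ?a' = "A' w I J"
  note lf = lam_free_vee[OF hamiltonian_lam_free[OF \<tau> Ht H(1)]] lam_free_vee[OF hamiltonian_lam_free[OF \<tau> Ht H(2)]]
  have HH: "mult_W (scalar_W H) (scalar_W H' :: ('n, 'd) qu_W) = mult_W (scalar_W H') (scalar_W H)"
  proof (intro ext)
    fix w and I J :: "'n => 'd"
    have "star H (scalar_W H' w I J) = star (scalar_W H' w I J) H"
      using hamiltonian_commute[OF \<tau> Ht H] by (simp add: scalar_W_def delta_def scal_mat_def)
    then show "mult_W (scalar_W H) (scalar_W H') w I J = mult_W (scalar_W H') (scalar_W H) w I J"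
      unfolding mult_W_scalar_left[of H] mult_W_scalar_right[of _ H] lf .
  qed
  have "mult_W (scalar_W H) (hbar_W A') + mult_W (hbar_W A) (scalar_W H') + mult_W (hbar_W A) (hbar_W A')
      = mult_W (scalar_W H') (hbar_W A) + mult_W (hbar_W A') (scalar_W H) + mult_W (hbar_W A') (hbar_W A)"
    using X unfolding mult_W_add HH by (simp only: add.assoc add_left_cancel) (simp only: add.left_commute add_left_cancel)
  then have "(mult_W (scalar_W H) (hbar_W A') + mult_W (hbar_W A) (scalar_W H') + mult_W (hbar_W A) (hbar_W A')) w I J
      = (mult_W (scalar_W H') (hbar_W A) + mult_W (hbar_W A') (scalar_W H) + mult_W (hbar_W A') (hbar_W A)) w I J" by simp
  then have "cc 2 0 (coef fps_X * star H ?a' + coef fps_X * star ?a H' + coef fps_X * (coef fps_X * mult_W A A' w I J))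
      = cc 2 0 (coef fps_X * star H' ?a + coef fps_X * star ?a' H + coef fps_X * (coef fps_X * mult_W A' A w I J))"
    unfolding hbar_W_mult unfolding plus_fun_apply hbar_W_apply mult_W_scalar_left mult_W_scalar_right lf by simp
  then have "cc 1 0 (star H ?a') + cc 1 0 (star ?a H') + cc 0 0 (mult_W A A' w I J)
     = cc 1 0 (star H' ?a) + cc 1 0 (star ?a' H) + cc 0 0 (mult_W A' A w I J)"
    by (simp add: lookup_add lookup_coef_mult)
  then have e: "cc 0 0 (mult_W A A' w I J) = cc 0 0 (mult_W A' A w I J) + cc 1 0 (star H' ?a - star ?a H') - cc 1 0 (star H ?a' - star ?a' H)"
    unfolding lookup_minus fps_sub_nth by (simp add: algebra_simps)
  have q: "good_cl \<tau> ?a" "good_cl \<tau> ?a'" using A A' by (simp_all add: reg_def[OF \<tau>])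
  note b = bracket_RS[OF H(2) q(1) A(2)] bracket_RS[OF H(1) q(2) A'(2)]
  note g = reg_mult[OF \<tau> A'(1) A(1)]
  show "restrict_x x_star (cc 0 0 (mult_W A A' w I J)) = restrict_x x_star (cc 0 0 (mult_W A' A w I J))"
    unfolding e RS_diff[OF \<tau> good_add[OF g b(1)] b(3)] RS_add[OF \<tau> g b(1)] b by simp
qed

text \<open>
  The same with $[H+\hbar A, L]=0$ and the coefficient of $\hbar$.
\<close>

lemma classical_commute_L:
  assumes X: "mult_W (scalar_W H + hbar_W A) A' = mult_W A' (scalar_W H + hbar_W A)"
  shows "spin_mult (classical_value x_star 0 A) (classical_value x_star 0 A') = spin_mult (classical_value x_star 0 A') (classical_value x_star 0 A)"
  unfolding classical_value_mult[OF \<tau> A(1) A'(1)] classical_value_mult[OF \<tau> A'(1) A(1)] unfolding classical_value_0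
proof (intro ext)
  fix w I J
  let ?a' = "A' w I J"
  note lf = lam_free_vee[OF hamiltonian_lam_free[OF \<tau> Ht H(1)]]
  have "(mult_W (scalar_W H) A' + mult_W (hbar_W A) A') w I J = (mult_W A' (scalar_W H) + mult_W A' (hbar_W A)) w I J"
    using X unfolding mult_W_add by simp
  then have "cc 1 0 (star H ?a' + coef fps_X * mult_W A A' w I J) = cc 1 0 (star ?a' H + coef fps_X * mult_W A' A w I J)"
    unfolding hbar_W_mult unfolding plus_fun_apply hbar_W_apply mult_W_scalar_left mult_W_scalar_right lf by simp
  then have "cc 1 0 (star H ?a') + cc 0 0 (mult_W A A' w I J) = cc 1 0 (star ?a' H) + cc 0 0 (mult_W A' A w I J)"
    by (simp add: lookup_add lookup_coef_mult)
  then have e: "cc 0 0 (mult_W A A' w I J) = cc 0 0 (mult_W A' A w I J) - cc 1 0 (star H ?a' - star ?a' H)"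
    unfolding lookup_minus fps_sub_nth by (simp add: algebra_simps)
  have q: "good_cl \<tau> ?a'" using A' by (simp add: reg_def[OF \<tau>])
  note b = bracket_RS[OF H(1) q A'(2)]
  note g = reg_mult[OF \<tau> A'(1) A(1)]
  show "restrict_x x_star (cc 0 0 (mult_W A A' w I J)) = restrict_x x_star (cc 0 0 (mult_W A' A w I J))"
    unfolding e RS_diff[OF \<tau> g b(1)] b by simp
qed

end

end

theorem theorem8p4:
  fixes \<tau> g :: complex
    and Ht H :: "nat \<Rightarrow> ('n::{finite,linorder}) qu"
    and A :: "nat \<Rightarrow> ('n, 'd::{finite,linorder}) qu_W"
    and family :: "('n, 'd) qu_W set"
  assumes "Im \<tau> > 0"
    and "eCM_quantum_lifts \<tau> g Ht"
    and "\<And>r. r \<in> {2..CARD('n)} \<Longrightarrow> H r \<in> scalar_eCM_hamiltonians Ht"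
    and "\<And>r. r \<in> {2..CARD('n)} \<Longrightarrow> A r \<in> A_hbar_End_W"
    and "\<And>r. r \<in> {2..CARD('n)} \<Longrightarrow>
           Res_vee (subst_dunkl \<tau> g (eCM_h \<tau> g r)) = scalar_W (H r) + hbar_W (A r)"
  defines "family \<equiv> A ` {2..CARD('n)} \<union>
             (\<lambda>f. Res_vee (subst_dunkl \<tau> g f)) ` spherical_cherednik g"
  shows "(\<forall>a\<in>family. classical_value_defined x_star a) \<and>
         (\<forall>a\<in>family. \<forall>b\<in>family.
            spin_mult (classical_value x_star 0 a) (classical_value x_star 0 b)
          = spin_mult (classical_value x_star 0 b) (classical_value x_star 0 a))"
proof -
  note \<tau> = assms(1) and Ht = assms(2) and H = assms(3) and XA = assms(5)
  let ?R = "{2..CARD('n)}" and ?P = "\<Sum>i\<in>UNIV. mom i :: 'n qu"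
  let ?X = "\<lambda>f. Res_vee (subst_dunkl \<tau> g f) :: ('n, 'd) qu_W"
  let ?cv = "classical_value x_star 0 :: ('n, 'd) qu_W => _"
  have r1: "r \<in> {1..CARD('n)}" if "r \<in> ?R" for r using that by auto
  have inv: "act_cl w (eCM_h \<tau> g r) = (eCM_h \<tau> g r :: 'n cl)" if "r \<in> ?R" for r w
    by (rule eCM_h_invariant[OF \<tau> Ht r1[OF that]])
  have invf: "act_cl w f = f" if "f \<in> spherical_cherednik g" for w and f :: "'n cl"
    using that by (simp add: spherical_cherednik_def)
  have GX: "Good_W \<tau> (?X f)" for f by (rule Good_W_Res[OF Good_WW_subst_dunkl[OF \<tau>]])
  have regL: "reg \<tau> (?X f)" for f
    using GX[of f] by (simp add: reg_def[OF \<tau>] good_cl_def Good_W_def Good_def goodf_def)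
  have transL: "(\<Sum>i\<in>UNIV. pderiv_mer (Inl i) (cc 0 0 (?X f w I J))) = 0" if "f \<in> spherical_cherednik g" for f w I J
    unfolding translation_commutator[symmetric] trans_Res[OF \<tau> Ht invf[OF that]] by simp
  have XAw: "?X (eCM_h \<tau> g r) w I J = scalar_W (H r) w I J + coef fps_X * A r w I J" if "r \<in> ?R" for r w I J
    unfolding XA[OF that] plus_fun_apply hbar_W_apply ..
  have sc: "scalar_W (H r) w I J = H r \<or> scalar_W (H r) w I J = 0" for r w and I J :: "'n => 'd"
    by (simp add: scalar_W_def delta_def scal_mat_def)
  \<comment> \<open>the classical limit of $A_r$ contains the coefficient of $\hbar$ in $H_r$\<close>
  have regA: "reg \<tau> (A r)" if r: "r \<in> ?R" for r
    unfolding reg_def[OF \<tau>] good_cl_def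
  proof (intro allI)
    fix w and I J :: "'n => 'd" and \<beta>
    have n: "2 \<le> CARD('n)" using r by simp
    have "good \<tau> (cc 1 \<beta> (scalar_W (H r) w I J))"
      using sc[of r w I J] hamiltonian_good_1[OF \<tau> Ht n H[OF r]] by auto
    moreover have "good \<tau> (cc 1 \<beta> (?X (eCM_h \<tau> g r) w I J))"
      using GX[of "eCM_h \<tau> g r"] by (simp add: Good_W_def Good_def goodf_def)
    moreover have "cc 0 \<beta> (A r w I J) = cc 1 \<beta> (?X (eCM_h \<tau> g r) w I J) - cc 1 \<beta> (scalar_W (H r) w I J)"
      unfolding XAw[OF r] by (simp add: lookup_add lookup_coef_mult)
    ultimately show "good \<tau> (cc 0 \<beta> (A r w I J))" by (simp add: good_diff)
  qed
  have transA: "(\<Sum>i\<in>UNIV. pderiv_mer (Inl i) (cc 0 0 (A r w I J))) = 0" if r: "r \<in> ?R" for r w I J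
  proof -
    let ?s = "scalar_W (H r) w I J" and ?a = "A r w I J"
    have "(1::nat) \<in> {1..CARD('n)}" using r by simp
    from hamiltonian_commute_Ht[OF \<tau> Ht H[OF r] this] have "star (H r) ?P = star ?P (H r)"
      using Ht by (simp add: eCM_quantum_lifts_def)
    then have "star ?P ?s = star ?s ?P" using sc[of r w I J] by auto
    moreover have "star ?P (?s + coef fps_X * ?a) = star (?s + coef fps_X * ?a) ?P"
      using trans_Res[OF \<tau> Ht inv[OF r], where 'd = 'd, of w I J] unfolding XAw[OF r] .
    ultimately have "coef fps_X * star ?P ?a = coef fps_X * star ?a ?P"
      by (simp add: star_add_left star_add_right star_X_right star_coef_mult)
    then have "cc 2 0 (coef fps_X * star ?P ?a) = cc 2 0 (coef fps_X * star ?a ?P)" by simp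
    then have "cc 1 0 (star ?P ?a) = cc 1 0 (star ?a ?P)" by (simp add: lookup_coef_mult)
    then show ?thesis unfolding translation_commutator[symmetric] by (simp add: lookup_minus)
  qed
  have AA: "spin_mult (?cv (A r)) (?cv (A s)) = spin_mult (?cv (A s)) (?cv (A r))" if r: "r \<in> ?R" and s: "s \<in> ?R" for r s
    by (rule classical_commute[OF \<tau> Ht H[OF r] H[OF s] regA[OF r] transA[OF r] regA[OF s] transA[OF s]])
      (unfold XA[OF r, symmetric] XA[OF s, symmetric], rule Res_subst_commute[OF \<tau> inv[OF r] inv[OF s]])
  have AL: "spin_mult (?cv (A r)) (?cv (?X f)) = spin_mult (?cv (?X f)) (?cv (A r))"
    if r: "r \<in> ?R" and f: "f \<in> spherical_cherednik g" for r f
    by (rule classical_commute_L[OF \<tau> Ht H[OF r] H[OF r] regA[OF r] transA[OF r] regL transL[OF f]])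
      (unfold XA[OF r, symmetric], rule Res_subst_commute[OF \<tau> inv[OF r] invf[OF f]])
  have LL: "spin_mult (?cv (?X f)) (?cv (?X f')) = spin_mult (?cv (?X f')) (?cv (?X f))"
    if f: "f \<in> spherical_cherednik g" and f': "f' \<in> spherical_cherednik g" for f f'
    unfolding classical_value_mult[OF \<tau> regL regL] Res_subst_commute[OF \<tau> invf[OF f] invf[OF f']] ..
  show ?thesis
  proof (intro conjI ballI)
    fix a assume a: "a \<in> family"
    show "classical_value_defined x_star a"
      using a regA regL reg_defined[OF \<tau>] unfolding family_def by auto
    fix b assume b: "b \<in> family"
    show "spin_mult (?cv a) (?cv b) = spin_mult (?cv b) (?cv a)"
      using a b unfolding family_def by (elim UnE imageE) (simp_all only: AA AL LL)
  qed
qed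

end
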